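(* Let $\Lambda$ be a simple gluing algebra of two finite-dimensional bound quiver algebras $A$ and $B$ over $K$. Then $\Lambda$ is Gorenstein if and only if $A$ and $B$ are Gorenstein. In particular, when these algebras are Gorenstein, $\max\{\operatorname{Gd} A,\operatorname{Gd} B\}\leq \operatorname{Gd}\Lambda\leq \max\{\operatorname{Gd} A,\operatorname{Gd} B,1\}$.
   Context: $K$ is an algebraically closed field; algebras are finite-dimensional $K$-algebras and modules are finitely generated left modules. A bound quiver algebra is $KQ/I$ with $Q$ a finite quiver and $I$ an admissible ideal of $KQ$. Simple gluing algebra: let $A=KQ_A/I_A$ and $B=KQ_B/I_B$ be finite-dimensional bound quiver algebras, $a$ a vertex of $Q_A$ and $b$ a vertex of $Q_B$. Let $Q$ be the quiver obtained from the disjoint union of $Q_A$ and $Q_B$ by identifying $a$ and $b$ to one vertex $v$ (so $Q_A,Q_B$ are subquivers of $Q$), and let $I$ be the ideal of $KQ$ generated by $I_A$ and $I_B$. Assume that $\Lambda=KQ/I$ is finite-dimensional (equivalently, each non-trivial path in $Q_A$ from $a$ to $a$ is in $I_A$, or each non-trivial path in $Q_B$ from $b$ to $b$ is in $I_B$). Then $\Lambda$ is called the simple gluing algebra of $A$ and $B$. An algebra $C$ is Gorenstein if both the left and right regular modules ${}_CC$ and $C_C$ have finite injective dimension; in that case these two injective dimensions coincide, and the common value is denoted $\operatorname{Gd} C$. *)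

theory Defs
  imports
    "HOL-Algebra.Algebra"
    "HOL-Computational_Algebra.Polynomial"
    "HOL-Library.Poly_Mapping"
    "HOL-Library.Extended_Nat"
    "Graph_Theory.Arc_Walk"
begin

section \<open>Path algebras and bound quiver algebras\<close>

text \<open>
  A finite quiver is a \<^locale>\<open>fin_digraph\<close> (loops and parallel arrows allowed). A path is
  a pair of its starting vertex and its list of arrows, so that the trivial path at \<open>v\<close> is
  \<open>(v, [])\<close>.
\<close>

type_synonym ('v, 'e) qpath = "'v \<times> 'e list"

definition quiver_paths :: "('v, 'e) pre_digraph \<Rightarrow> ('v, 'e) qpath set" where
  "quiver_paths Q = {(u, p). \<exists>w. pre_digraph.awalk Q u p w}"

text \<open>
  The product \<open>pq\<close> of two paths is "first \<open>p\<close>, then \<open>q\<close>", and 0 if \<open>p\<close> does not end where \<open>q\<close>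
  starts. The other convention yields the opposite algebra, i.e. the algebra of the opposite
  bound quiver.
\<close>

definition path_mult ::
  "('v, 'e) pre_digraph \<Rightarrow> (('v, 'e) qpath \<Rightarrow>\<^sub>0 'k::field) \<Rightarrow> (('v, 'e) qpath \<Rightarrow>\<^sub>0 'k)
    \<Rightarrow> (('v, 'e) qpath \<Rightarrow>\<^sub>0 'k)" where
  "path_mult Q f g =
     (\<Sum>p\<in>Poly_Mapping.keys f. \<Sum>q\<in>Poly_Mapping.keys g.
        if pre_digraph.awlast Q (fst p) (snd p) = fst q
        then Poly_Mapping.single (fst p, snd p @ snd q)
               (Poly_Mapping.lookup f p * Poly_Mapping.lookup g q)
        else 0)"

definition path_scalar :: "('v, 'e) pre_digraph \<Rightarrow> 'k::field \<Rightarrow> (('v, 'e) qpath \<Rightarrow>\<^sub>0 'k)" where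
  "path_scalar Q c = (\<Sum>v\<in>verts Q. Poly_Mapping.single (v, []) c)"

definition path_algebra :: "('v, 'e) pre_digraph \<Rightarrow> (('v, 'e) qpath \<Rightarrow>\<^sub>0 'k::field) ring" where
  "path_algebra Q =
     \<lparr> carrier = {f. Poly_Mapping.keys f \<subseteq> quiver_paths Q},
       monoid.mult = path_mult Q, monoid.one = path_scalar Q 1, ring.zero = 0, ring.add = (+) \<rparr>"

definition arrow_ideal :: "('v, 'e) pre_digraph \<Rightarrow> (('v, 'e) qpath \<Rightarrow>\<^sub>0 'k::field) set" where
  "arrow_ideal Q =
     Idl\<^bsub>path_algebra Q\<^esub> ((\<lambda>e. Poly_Mapping.single (tail Q e, [e]) 1) ` arcs Q)"

text \<open>Powers are taken with respect to the product of ideals.\<close>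

definition admissible_ideal ::
  "('v, 'e) pre_digraph \<Rightarrow> (('v, 'e) qpath \<Rightarrow>\<^sub>0 'k::field) set \<Rightarrow> bool" where
  "admissible_ideal Q I \<longleftrightarrow>
     ideal I (path_algebra Q) \<and>
     (\<exists>m::nat. m \<ge> 2 \<and> arrow_ideal Q [^]\<^bsub>ideals_set (path_algebra Q)\<^esub> m \<subseteq> I) \<and>
     I \<subseteq> arrow_ideal Q [^]\<^bsub>ideals_set (path_algebra Q)\<^esub> (2::nat)"

definition bound_quiver ::
  "('v, 'e) pre_digraph \<Rightarrow> (('v, 'e) qpath \<Rightarrow>\<^sub>0 'k::field) set \<Rightarrow> bool" where
  "bound_quiver Q I \<longleftrightarrow> fin_digraph Q \<and> admissible_ideal Q I"

abbreviation quiver_algebra ::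
  "('v, 'e) pre_digraph \<Rightarrow> (('v, 'e) qpath \<Rightarrow>\<^sub>0 'k::field) set
    \<Rightarrow> (('v, 'e) qpath \<Rightarrow>\<^sub>0 'k) set ring" where
  "quiver_algebra Q I \<equiv> path_algebra Q Quot I"

text \<open>
  \<open>KQ/I\<close> is finite-dimensional over the image \<open>{c \<cdot> 1 + I | c \<in> K}\<close> of the ground field.
\<close>

definition finite_dim_quiver_algebra ::
  "('v, 'e) pre_digraph \<Rightarrow> (('v, 'e) qpath \<Rightarrow>\<^sub>0 'k::field) set \<Rightarrow> bool" where
  "finite_dim_quiver_algebra Q I \<longleftrightarrow>
     ring.finite_dimension (quiver_algebra Q I)
       (range (\<lambda>c. I +>\<^bsub>path_algebra Q\<^esub> path_scalar Q c))
       (carrier (quiver_algebra Q I))"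


section \<open>Simple gluing\<close>

text \<open>
  In the disjoint union of the two quivers the identified vertex \<open>v\<close> is represented by \<open>Inl a\<close>;
  \<open>glue_right\<close> is the resulting inclusion of the vertices of the second quiver.
\<close>

definition glue_right :: "'v \<Rightarrow> 'w \<Rightarrow> 'w \<Rightarrow> 'v + 'w" where
  "glue_right a b x = (if x = b then Inl a else Inr x)"

definition gluing_quiver ::
  "('v, 'e) pre_digraph \<Rightarrow> 'v \<Rightarrow> ('w, 'f) pre_digraph \<Rightarrow> 'w \<Rightarrow> ('v + 'w, 'e + 'f) pre_digraph"
where
  "gluing_quiver Q\<^sub>A a Q\<^sub>B b =
     \<lparr> verts = Inl ` verts Q\<^sub>A \<union> glue_right a b ` verts Q\<^sub>B,
       arcs = Inl ` arcs Q\<^sub>A \<union> Inr ` arcs Q\<^sub>B,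
       tail = case_sum (Inl \<circ> tail Q\<^sub>A) (glue_right a b \<circ> tail Q\<^sub>B),
       head = case_sum (Inl \<circ> head Q\<^sub>A) (glue_right a b \<circ> head Q\<^sub>B) \<rparr>"

text \<open>The linear map on path algebras induced by a map on vertices and a map on arrows.\<close>

definition path_algebra_map ::
  "('v \<Rightarrow> 'w) \<Rightarrow> ('e \<Rightarrow> 'f) \<Rightarrow> (('v, 'e) qpath \<Rightarrow>\<^sub>0 'k::field) \<Rightarrow> (('w, 'f) qpath \<Rightarrow>\<^sub>0 'k)" where
  "path_algebra_map \<phi> \<psi> f =
     (\<Sum>p\<in>Poly_Mapping.keys f.
        Poly_Mapping.single (\<phi> (fst p), map \<psi> (snd p)) (Poly_Mapping.lookup f p))"

definition gluing_ideal ::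
  "('v, 'e) pre_digraph \<Rightarrow> 'v \<Rightarrow> (('v, 'e) qpath \<Rightarrow>\<^sub>0 'k::field) set
    \<Rightarrow> ('w, 'f) pre_digraph \<Rightarrow> 'w \<Rightarrow> (('w, 'f) qpath \<Rightarrow>\<^sub>0 'k) set
    \<Rightarrow> (('v + 'w, 'e + 'f) qpath \<Rightarrow>\<^sub>0 'k) set"
where
  "gluing_ideal Q\<^sub>A a I\<^sub>A Q\<^sub>B b I\<^sub>B =
     Idl\<^bsub>path_algebra (gluing_quiver Q\<^sub>A a Q\<^sub>B b)\<^esub>
       (path_algebra_map Inl Inl ` I\<^sub>A \<union> path_algebra_map (glue_right a b) Inr ` I\<^sub>B)"


section \<open>Modules over noncommutative rings and injective dimension\<close>

text \<open>
  The locale \<^locale>\<open>module\<close> is restricted to commutative rings; here is the same for left modules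
  over an arbitrary ring. In the record type \<^typ>\<open>('r, 'm) module\<close>, the multiplication and
  the unit of a module are junk.
\<close>

locale left_module = R?: ring R + M?: abelian_group M
  for R :: "('r, 's) ring_scheme" (structure) and M :: "('r, 'm) module" (structure) +
  assumes smult_closed:
      "\<lbrakk> r \<in> carrier R; x \<in> carrier M \<rbrakk> \<Longrightarrow> r \<odot>\<^bsub>M\<^esub> x \<in> carrier M"
    and smult_l_distr:
      "\<lbrakk> r \<in> carrier R; s \<in> carrier R; x \<in> carrier M \<rbrakk>
        \<Longrightarrow> (r \<oplus>\<^bsub>R\<^esub> s) \<odot>\<^bsub>M\<^esub> x = r \<odot>\<^bsub>M\<^esub> x \<oplus>\<^bsub>M\<^esub> s \<odot>\<^bsub>M\<^esub> x"
    and smult_r_distr: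
      "\<lbrakk> r \<in> carrier R; x \<in> carrier M; y \<in> carrier M \<rbrakk>
        \<Longrightarrow> r \<odot>\<^bsub>M\<^esub> (x \<oplus>\<^bsub>M\<^esub> y) = r \<odot>\<^bsub>M\<^esub> x \<oplus>\<^bsub>M\<^esub> r \<odot>\<^bsub>M\<^esub> y"
    and smult_assoc:
      "\<lbrakk> r \<in> carrier R; s \<in> carrier R; x \<in> carrier M \<rbrakk>
        \<Longrightarrow> (r \<otimes>\<^bsub>R\<^esub> s) \<odot>\<^bsub>M\<^esub> x = r \<odot>\<^bsub>M\<^esub> (s \<odot>\<^bsub>M\<^esub> x)"
    and smult_one: "x \<in> carrier M \<Longrightarrow> \<one>\<^bsub>R\<^esub> \<odot>\<^bsub>M\<^esub> x = x"

definition fg_module :: "('r, 's) ring_scheme \<Rightarrow> ('r, 'm) module \<Rightarrow> bool" where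
  "fg_module R M \<longleftrightarrow> left_module R M \<and>
     (\<exists>S. finite S \<and> S \<subseteq> carrier M \<and>
        (\<forall>x\<in>carrier M. \<exists>c. c ` S \<subseteq> carrier R \<and>
           x = (\<Oplus>\<^bsub>M\<^esub>s\<in>S. c s \<odot>\<^bsub>M\<^esub> s)))"

definition mod_hom ::
  "('r, 's) ring_scheme \<Rightarrow> ('r, 'm) module \<Rightarrow> ('r, 'n) module \<Rightarrow> ('m \<Rightarrow> 'n) set" where
  "mod_hom R M N =
     {h. h ` carrier M \<subseteq> carrier N \<and>
         (\<forall>x\<in>carrier M. \<forall>y\<in>carrier M. h (x \<oplus>\<^bsub>M\<^esub> y) = h x \<oplus>\<^bsub>N\<^esub> h y) \<and>
         (\<forall>r\<in>carrier R. \<forall>x\<in>carrier M. h (r \<odot>\<^bsub>M\<^esub> x) = r \<odot>\<^bsub>N\<^esub> h x)}"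

definition mod_kernel :: "('r, 'm) module \<Rightarrow> ('r, 'n) module \<Rightarrow> ('m \<Rightarrow> 'n) \<Rightarrow> 'm set" where
  "mod_kernel M N h = {x \<in> carrier M. h x = \<zero>\<^bsub>N\<^esub>}"

text \<open>
  Every finitely generated left \<open>R\<close>-module is isomorphic to a quotient of some \<open>R\<^sup>n\<close>. With \<open>R\<^sup>n\<close>
  realised as the sequences vanishing from index \<open>n\<close> on, the elements of such a quotient are sets
  of sequences. Hence the modules whose elements have the following type represent all isomorphism
  classes of finitely generated \<open>R\<close>-modules, and quantifying over them loses nothing.
\<close>

type_synonym 'r fg_carrier = "(nat \<Rightarrow> 'r) set"

text \<open>Injective objects of the category of finitely generated left modules.\<close>

definition injective_module :: "('r, 's) ring_scheme \<Rightarrow> ('r, 'm) module \<Rightarrow> bool" where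
  "injective_module R E \<longleftrightarrow> fg_module R E \<and>
     (\<forall>(M :: ('r, 'r fg_carrier) module) (N :: ('r, 'r fg_carrier) module) f g.
        fg_module R M \<and> fg_module R N \<and>
        f \<in> mod_hom R M N \<and> inj_on f (carrier M) \<and> g \<in> mod_hom R M E \<longrightarrow>
        (\<exists>h\<in>mod_hom R N E. \<forall>x\<in>carrier M. h (f x) = g x))"

text \<open>The sequence \<open>0 \<rightarrow> M \<rightarrow> E 0 \<rightarrow> E 1 \<rightarrow> \<dots>\<close>, with maps \<open>\<epsilon>, d 0, d 1, \<dots>\<close>, is exact.\<close>

definition injective_resolution ::
  "('r, 's) ring_scheme \<Rightarrow> ('r, 'm) module \<Rightarrow> (nat \<Rightarrow> ('r, 'r fg_carrier) module)
    \<Rightarrow> ('m \<Rightarrow> 'r fg_carrier) \<Rightarrow> (nat \<Rightarrow> 'r fg_carrier \<Rightarrow> 'r fg_carrier) \<Rightarrow> bool" where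
  "injective_resolution R M E \<epsilon> d \<longleftrightarrow>
     (\<forall>i. injective_module R (E i)) \<and>
     \<epsilon> \<in> mod_hom R M (E 0) \<and> (\<forall>i. d i \<in> mod_hom R (E i) (E (Suc i))) \<and>
     inj_on \<epsilon> (carrier M) \<and>
     \<epsilon> ` carrier M = mod_kernel (E 0) (E 1) (d 0) \<and>
     (\<forall>i. d i ` carrier (E i) = mod_kernel (E (Suc i)) (E (Suc (Suc i))) (d (Suc i)))"

definition inj_dim :: "('r, 's) ring_scheme \<Rightarrow> ('r, 'm) module \<Rightarrow> enat" where
  "inj_dim R M =
     Inf {enat n |n. \<exists>E \<epsilon> d. injective_resolution R M E \<epsilon> d \<and>
                        (\<forall>i>n. carrier (E i) = {\<zero>\<^bsub>E i\<^esub>})}"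

definition regular_module :: "('r, 's) ring_scheme \<Rightarrow> ('r, 'r) module" where
  "regular_module R =
     \<lparr> carrier = carrier R, monoid.mult = monoid.mult R, monoid.one = \<one>\<^bsub>R\<^esub>,
       ring.zero = \<zero>\<^bsub>R\<^esub>, ring.add = ring.add R, module.smult = monoid.mult R \<rparr>"

text \<open>Right modules are left modules over the opposite ring.\<close>

definition opposite_ring :: "('r, 's) ring_scheme \<Rightarrow> ('r, 's) ring_scheme" where
  "opposite_ring R = R\<lparr>monoid.mult := \<lambda>x y. y \<otimes>\<^bsub>R\<^esub> x\<rparr>"

definition left_inj_dim :: "('r, 's) ring_scheme \<Rightarrow> enat" where
  "left_inj_dim R = inj_dim R (regular_module R)"

definition right_inj_dim :: "('r, 's) ring_scheme \<Rightarrow> enat" where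
  "right_inj_dim R = inj_dim (opposite_ring R) (regular_module (opposite_ring R))"

definition Gorenstein :: "('r, 's) ring_scheme \<Rightarrow> bool" where
  "Gorenstein R \<longleftrightarrow> left_inj_dim R < \<infinity> \<and> right_inj_dim R < \<infinity>"

text \<open>
  For a Gorenstein finite-dimensional algebra, \<^const>\<open>left_inj_dim\<close> and \<^const>\<open>right_inj_dim\<close>
  agree; \<open>Gd\<close> is only meaningful in that case.
\<close>

definition Gd :: "('r, 's) ring_scheme \<Rightarrow> enat" where
  "Gd R = left_inj_dim R"

end

theory Submission
  imports Defs
begin

text \<open>
  Over a finite-dimensional algebra with augmentations \<open>\<epsilon>\<^sub>x\<close> at the vertices, a module \<open>M\<close> is injective
  iff every \<open>\<epsilon>\<^sub>x\<close>-derivation into \<open>M\<close> is inner (Baer's criterion, tested on the simple modules). For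
  the gluing \<open>\<Lambda>\<close> of \<open>A\<close> and \<open>B\<close> this criterion decouples: every path ending in the first quiver is
  uniquely a path times its longest final segment there, so derivations of \<open>A\<close> extend to \<open>\<Lambda>\<close>, an
  injective \<open>\<Lambda>\<close>-module restricts to injective modules over \<open>A\<close> and \<open>B\<close>, and conversely these two
  restrictions determine injectivity once the vertex space at the glued vertex is the sum of the
  socle parts of the two halves, a property inherited by cosyzygies. Since the regular module of \<open>\<Lambda>\<close>
  restricts to a module that is a retract of a power of \<open>A\<close> and has \<open>A\<close> as a retract, injective
  dimensions agree up to the first step. The remaining point is that long paths vanish in \<open>\<Lambda>\<close>: if
  there were nonzero loops at the glued vertex in both quivers, the powers of their product would be
  linearly independent, contradicting finite dimensionality.
\<close>

section \<open>Modules and quotients\<close>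

text \<open>The number 1 in the upper bound comes from the socle condition: it is proved for
  injective modules and their quotients, hence for every cosyzygy, but nothing provides it for the
  regular module itself, so the induction starts in dimension 1. Neither Ext groups nor minimal
  resolutions are formed: derivations twisted by an augmentation are 1-cocycles, and two cosyzygies
  are compared, up to an injective summand, by a Schanuel-type argument. Final and initial segments
  of paths serve different purposes for left modules: cutting off the longest final segment extends
  derivations, cutting off the longest initial segment decomposes the restricted regular module.
  Both cuts are therefore part of the data, which makes the data invariant under passage to opposite
  algebras and yields the right-hand dimensions. Tensor products are replaced by families of maps
  indexed by linear functionals, so that only functionals vanishing on the ideal have to be
  controlled. Since resolutions are quantified over one fixed element type, constructions are
  transferred to isomorphic copies in that type.\<close>

definition submodule_set :: "('r, 's) ring_scheme => ('r, 'm) module => 'm set => bool" where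
  "submodule_set R M H \<longleftrightarrow> H \<subseteq> carrier M \<and> \<zero>\<^bsub>M\<^esub> \<in> H \<and>
     (\<forall>x\<in>H. \<forall>y\<in>H. x \<oplus>\<^bsub>M\<^esub> y \<in> H) \<and> (\<forall>r\<in>carrier R. \<forall>x\<in>H. r \<odot>\<^bsub>M\<^esub> x \<in> H)"

lemma submodule_setD:
  assumes "submodule_set R M H"
  shows "x \<in> H ==> x \<in> carrier M" "\<zero>\<^bsub>M\<^esub> \<in> H" "x \<in> H ==> y \<in> H ==> x \<oplus>\<^bsub>M\<^esub> y \<in> H"
    "r \<in> carrier R ==> x \<in> H ==> r \<odot>\<^bsub>M\<^esub> x \<in> H" using assms unfolding submodule_set_def by auto

context left_module
begin

lemma smult_zero_r: "r \<in> carrier R ==> r \<odot>\<^bsub>M\<^esub> \<zero>\<^bsub>M\<^esub> = \<zero>\<^bsub>M\<^esub>"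
  using smult_r_distr[of r "\<zero>\<^bsub>M\<^esub>" "\<zero>\<^bsub>M\<^esub>"] smult_closed[of r "\<zero>\<^bsub>M\<^esub>"]
  by (metis M.add.r_cancel_one M.l_zero M.zero_closed)

lemma smult_zero_l: "x \<in> carrier M ==> \<zero>\<^bsub>R\<^esub> \<odot>\<^bsub>M\<^esub> x = \<zero>\<^bsub>M\<^esub>"
  using smult_l_distr[of "\<zero>\<^bsub>R\<^esub>" "\<zero>\<^bsub>R\<^esub>" x] smult_closed[of "\<zero>\<^bsub>R\<^esub>" x]
  by (metis M.add.r_cancel_one R.l_zero R.zero_closed)

lemma smult_minus_l:
  assumes "r \<in> carrier R" "x \<in> carrier M"
  shows "(\<ominus>\<^bsub>R\<^esub> r) \<odot>\<^bsub>M\<^esub> x = \<ominus>\<^bsub>M\<^esub> (r \<odot>\<^bsub>M\<^esub> x)"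
proof -
  have "(\<ominus>\<^bsub>R\<^esub> r) \<odot>\<^bsub>M\<^esub> x \<oplus>\<^bsub>M\<^esub> r \<odot>\<^bsub>M\<^esub> x = \<zero>\<^bsub>M\<^esub>"
    using smult_l_distr[of "\<ominus>\<^bsub>R\<^esub> r" r x] assms by (simp add: R.l_neg smult_zero_l)
  then show ?thesis using assms smult_closed by (metis M.minus_equality R.a_inv_closed)
qed

lemma smult_minus_r:
  assumes "r \<in> carrier R" "x \<in> carrier M"
  shows "r \<odot>\<^bsub>M\<^esub> (\<ominus>\<^bsub>M\<^esub> x) = \<ominus>\<^bsub>M\<^esub> (r \<odot>\<^bsub>M\<^esub> x)"
proof -
  have "r \<odot>\<^bsub>M\<^esub> (\<ominus>\<^bsub>M\<^esub> x) \<oplus>\<^bsub>M\<^esub> r \<odot>\<^bsub>M\<^esub> x = \<zero>\<^bsub>M\<^esub>"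
    using smult_r_distr[of r "\<ominus>\<^bsub>M\<^esub> x" x] assms by (simp add: M.l_neg smult_zero_r)
  then show ?thesis using assms smult_closed by (metis M.minus_equality M.a_inv_closed)
qed

lemma smult_diff_l:
  "[|r \<in> carrier R; s \<in> carrier R; x \<in> carrier M|] ==> (r \<ominus>\<^bsub>R\<^esub> s) \<odot>\<^bsub>M\<^esub> x = r \<odot>\<^bsub>M\<^esub> x \<ominus>\<^bsub>M\<^esub> s \<odot>\<^bsub>M\<^esub> x"
  by (simp add: R.minus_eq M.minus_eq smult_l_distr smult_minus_l)

lemma smult_diff_r:
  "[|r \<in> carrier R; x \<in> carrier M; y \<in> carrier M|] ==> r \<odot>\<^bsub>M\<^esub> (x \<ominus>\<^bsub>M\<^esub> y) = r \<odot>\<^bsub>M\<^esub> x \<ominus>\<^bsub>M\<^esub> r \<odot>\<^bsub>M\<^esub> y"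
  by (simp add: M.minus_eq smult_r_distr smult_minus_r)

lemma smult_finsum:
  assumes "r \<in> carrier R" "f \<in> S \<rightarrow> carrier M"
  shows "r \<odot>\<^bsub>M\<^esub> (\<Oplus>\<^bsub>M\<^esub>s\<in>S. f s) = (\<Oplus>\<^bsub>M\<^esub>s\<in>S. r \<odot>\<^bsub>M\<^esub> f s)"
proof (cases "finite S")
  case True
  then show ?thesis using assms(2)
  proof (induction S)
    case empty
    then show ?case by (simp add: smult_zero_r assms(1))
  next
    case (insert s S)
    then show ?case using assms(1) by (simp add: smult_closed smult_r_distr Pi_def M.finsum_closed)
  qed
next
  case False
  then show ?thesis by (simp add: M.finsum_infinite smult_zero_r assms(1))
qed

lemma finsum_smult:
  assumes "x \<in> carrier M" "f \<in> S \<rightarrow> carrier R"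
  shows "(\<Oplus>\<^bsub>R\<^esub>s\<in>S. f s) \<odot>\<^bsub>M\<^esub> x = (\<Oplus>\<^bsub>M\<^esub>s\<in>S. f s \<odot>\<^bsub>M\<^esub> x)"
proof (cases "finite S")
  case True
  then show ?thesis using assms(2)
  proof (induction S)
    case empty
    then show ?case by (simp add: smult_zero_l assms(1))
  next
    case (insert s S)
    then show ?case using assms(1) by (simp add: smult_closed smult_l_distr Pi_def R.finsum_closed)
  qed
next
  case False
  then show ?thesis by (simp add: M.finsum_infinite R.finsum_infinite smult_zero_l assms(1))
qed

lemma submodule_minus:
  assumes "submodule_set R M H" "x \<in> H"
  shows "\<ominus>\<^bsub>M\<^esub> x \<in> H" using submodule_setD[OF assms(1)] assms(2) smult_minus_l[of "\<one>\<^bsub>R\<^esub>" x]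
  by (metis R.a_inv_closed R.one_closed smult_one)

lemma submodule_diff:
  "submodule_set R M H ==> x \<in> H ==> y \<in> H ==> x \<ominus>\<^bsub>M\<^esub> y \<in> H"
  by (simp add: M.minus_eq submodule_minus submodule_setD)

lemma submodule_finsum:
  assumes "submodule_set R M H" "f \<in> S \<rightarrow> H"
  shows "(\<Oplus>\<^bsub>M\<^esub>s\<in>S. f s) \<in> H"
proof (cases "finite S")
  case True
  then show ?thesis using assms(2)
  proof (induction S)
    case (insert s S)
    then show ?case using submodule_setD[OF assms(1)] by (simp add: Pi_def)
  qed (simp add: submodule_setD[OF assms(1)])
next
  case False
  then show ?thesis by (simp add: M.finsum_infinite submodule_setD[OF assms(1)])
qed

lemma linear_combinations_submodule:
  assumes "finite S" "S \<subseteq> carrier M"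
  defines "H \<equiv> {x. \<exists>c. c ` S \<subseteq> carrier R \<and> x = (\<Oplus>\<^bsub>M\<^esub>s\<in>S. c s \<odot>\<^bsub>M\<^esub> s)}"
  shows "submodule_set R M H" "S \<subseteq> H"
proof -
  have cl: "c ` S \<subseteq> carrier R ==> (\<lambda>s. c s \<odot>\<^bsub>M\<^esub> s) \<in> S \<rightarrow> carrier M" for c
    using assms(2) by (auto intro!: smult_closed)
  have "H \<subseteq> carrier M" using cl by (auto simp: H_def intro!: M.finsum_closed)
  moreover have "\<zero>\<^bsub>M\<^esub> \<in> H" unfolding H_def by (rule CollectI, rule exI[of _ "\<lambda>_. \<zero>\<^bsub>R\<^esub>"])
       (use assms(2) in "auto simp: smult_zero_l subset_iff intro!: M.add.finprod_one_eqI[symmetric]")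
  moreover have "x \<oplus>\<^bsub>M\<^esub> y \<in> H" if xy: "x \<in> H" "y \<in> H" for x y
  proof -
    from xy obtain c d where cd: "c ` S \<subseteq> carrier R" "d ` S \<subseteq> carrier R"
      "x = (\<Oplus>\<^bsub>M\<^esub>s\<in>S. c s \<odot>\<^bsub>M\<^esub> s)" "y = (\<Oplus>\<^bsub>M\<^esub>s\<in>S. d s \<odot>\<^bsub>M\<^esub> s)"
      unfolding H_def by auto
    have "x \<oplus>\<^bsub>M\<^esub> y = (\<Oplus>\<^bsub>M\<^esub>s\<in>S. (c s \<oplus>\<^bsub>R\<^esub> d s) \<odot>\<^bsub>M\<^esub> s)"
      unfolding cd(3,4) M.finsum_addf[OF cl[OF cd(1)] cl[OF cd(2)], symmetric]
      by (rule M.finsum_cong') (use assms(2) cd(1,2) in "auto simp: smult_l_distr image_subset_iff subset_iff smult_closed")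
    then show ?thesis unfolding H_def using cd(1,2) by (intro CollectI exI[of _ "\<lambda>s. c s \<oplus>\<^bsub>R\<^esub> d s"]) auto
  qed
  moreover have "r \<odot>\<^bsub>M\<^esub> x \<in> H" if xy: "x \<in> H" "r \<in> carrier R" for x r
  proof -
    from xy obtain c where cd: "c ` S \<subseteq> carrier R"
      "x = (\<Oplus>\<^bsub>M\<^esub>s\<in>S. c s \<odot>\<^bsub>M\<^esub> s)" unfolding H_def by auto
    have "r \<odot>\<^bsub>M\<^esub> x = (\<Oplus>\<^bsub>M\<^esub>s\<in>S. (r \<otimes>\<^bsub>R\<^esub> c s) \<odot>\<^bsub>M\<^esub> s)"
      unfolding cd(2) smult_finsum[OF xy(2) cl[OF cd(1)]]
      by (rule M.finsum_cong') (use assms(2) cd(1) xy(2) in "auto simp: smult_assoc image_subset_iff subset_iff intro!: smult_closed")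
    then show ?thesis unfolding H_def using cd(1) xy(2) by (intro CollectI exI[of _ "\<lambda>s. r \<otimes>\<^bsub>R\<^esub> c s"]) auto
  qed
  ultimately show "submodule_set R M H" unfolding submodule_set_def by auto
  show "S \<subseteq> H"
  proof
    fix s assume s: "s \<in> S"
    have "s = (\<Oplus>\<^bsub>M\<^esub>t\<in>S. if s = t then t else \<zero>\<^bsub>M\<^esub>)"
      using M.finsum_singleton[OF s assms(1), of "\<lambda>t. t"] assms(2) by (simp add: Pi_def subset_iff)
    also have "\<dots> = (\<Oplus>\<^bsub>M\<^esub>t\<in>S. (if s = t then \<one>\<^bsub>R\<^esub> else \<zero>\<^bsub>R\<^esub>) \<odot>\<^bsub>M\<^esub> t)"
      by (rule M.finsum_cong') (use assms(2) in "auto simp: smult_one smult_zero_l")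
    finally show "s \<in> H" unfolding H_def
      by (intro CollectI exI[of _ "\<lambda>t. if s = t then \<one>\<^bsub>R\<^esub> else \<zero>\<^bsub>R\<^esub>"]) auto
  qed
qed

text \<open>Submodules pull back along homomorphisms without any bookkeeping of coefficients, so
  finite generation is restated as the absence of a proper submodule containing \<open>S\<close>.
  Later proofs of finite generation take this shape.\<close>

lemma fg_module_iff:
  "fg_module R M \<longleftrightarrow>
    (\<exists>S. finite S \<and> S \<subseteq> carrier M \<and> (\<forall>H. submodule_set R M H \<and> S \<subseteq> H --> H = carrier M))"
proof
  assume "fg_module R M"
  then obtain S where S: "finite S" "S \<subseteq> carrier M"
    "\<forall>x\<in>carrier M. \<exists>c. c ` S \<subseteq> carrier R \<and> x = (\<Oplus>\<^bsub>M\<^esub>s\<in>S. c s \<odot>\<^bsub>M\<^esub> s)"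
    unfolding fg_module_def by blast
  have "H = carrier M" if H: "submodule_set R M H" "S \<subseteq> H" for H
  proof
    show "carrier M \<subseteq> H"
    proof
      fix x assume "x \<in> carrier M"
      then obtain c where c: "c ` S \<subseteq> carrier R" "x = (\<Oplus>\<^bsub>M\<^esub>s\<in>S. c s \<odot>\<^bsub>M\<^esub> s)"
        using S(3) by blast
      show "x \<in> H" unfolding c(2) using c(1) H(2) by (intro submodule_finsum[OF H(1)]) (auto intro!: submodule_setD(4)[OF H(1)])
    qed
  qed (use H in "auto dest: submodule_setD")
  then show "\<exists>S. finite S \<and> S \<subseteq> carrier M \<and> (\<forall>H. submodule_set R M H \<and> S \<subseteq> H --> H = carrier M)"
    using S by blast
next
  assume "\<exists>S. finite S \<and> S \<subseteq> carrier M \<and> (\<forall>H. submodule_set R M H \<and> S \<subseteq> H --> H = carrier M)"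
  then obtain S where S: "finite S" "S \<subseteq> carrier M" "!!H. submodule_set R M H ==> S \<subseteq> H ==> H = carrier M" by blast
  show "fg_module R M" unfolding fg_module_def using S(1,2) S(3)[OF linear_combinations_submodule[OF S(1,2)]] left_module_axioms by blast
qed

end

lemma left_moduleI:
  assumes "ring R" "abelian_group M"
    and "!!r x. [|r \<in> carrier R; x \<in> carrier M|] ==> r \<odot>\<^bsub>M\<^esub> x \<in> carrier M"
    and "!!r s x. [|r \<in> carrier R; s \<in> carrier R; x \<in> carrier M|]
        ==> (r \<oplus>\<^bsub>R\<^esub> s) \<odot>\<^bsub>M\<^esub> x = r \<odot>\<^bsub>M\<^esub> x \<oplus>\<^bsub>M\<^esub> s \<odot>\<^bsub>M\<^esub> x"
    and "!!r x y. [|r \<in> carrier R; x \<in> carrier M; y \<in> carrier M|]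
        ==> r \<odot>\<^bsub>M\<^esub> (x \<oplus>\<^bsub>M\<^esub> y) = r \<odot>\<^bsub>M\<^esub> x \<oplus>\<^bsub>M\<^esub> r \<odot>\<^bsub>M\<^esub> y"
    and "!!r s x. [|r \<in> carrier R; s \<in> carrier R; x \<in> carrier M|]
        ==> (r \<otimes>\<^bsub>R\<^esub> s) \<odot>\<^bsub>M\<^esub> x = r \<odot>\<^bsub>M\<^esub> (s \<odot>\<^bsub>M\<^esub> x)"
    and "!!x. x \<in> carrier M ==> \<one>\<^bsub>R\<^esub> \<odot>\<^bsub>M\<^esub> x = x"
  shows "left_module R M" using assms by (simp add: left_module_def left_module_axioms_def)

lemma mod_homD:
  assumes "h \<in> mod_hom R M N"
  shows "x \<in> carrier M ==> h x \<in> carrier N"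
    "x \<in> carrier M ==> y \<in> carrier M ==> h (x \<oplus>\<^bsub>M\<^esub> y) = h x \<oplus>\<^bsub>N\<^esub> h y"
    "r \<in> carrier R ==> x \<in> carrier M ==> h (r \<odot>\<^bsub>M\<^esub> x) = r \<odot>\<^bsub>N\<^esub> h x"
  using assms unfolding mod_hom_def by auto

lemma mod_homI:
  assumes "!!x. x \<in> carrier M ==> h x \<in> carrier N"
    "!!x y. x \<in> carrier M ==> y \<in> carrier M ==> h (x \<oplus>\<^bsub>M\<^esub> y) = h x \<oplus>\<^bsub>N\<^esub> h y"
    "!!r x. r \<in> carrier R ==> x \<in> carrier M ==> h (r \<odot>\<^bsub>M\<^esub> x) = r \<odot>\<^bsub>N\<^esub> h x"
  shows "h \<in> mod_hom R M N" using assms unfolding mod_hom_def by auto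

lemma mod_hom_zero:
  assumes "h \<in> mod_hom R M N" "left_module R M" "left_module R N"
  shows "h \<zero>\<^bsub>M\<^esub> = \<zero>\<^bsub>N\<^esub>"
proof -
  interpret M: left_module R M by fact
  interpret N: left_module R N by fact
  show ?thesis using mod_homD(3)[OF assms(1), of "\<zero>\<^bsub>R\<^esub>" "\<zero>\<^bsub>M\<^esub>"] mod_homD(1)[OF assms(1), of "\<zero>\<^bsub>M\<^esub>"]
    by (simp add: M.smult_zero_l N.smult_zero_l)
qed

lemma mod_hom_minus:
  assumes "h \<in> mod_hom R M N" "left_module R M" "left_module R N" "x \<in> carrier M"
  shows "h (\<ominus>\<^bsub>M\<^esub> x) = \<ominus>\<^bsub>N\<^esub> h x"
proof -
  interpret M: left_module R M by fact
  interpret N: left_module R N by fact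
  show ?thesis using mod_homD(3)[OF assms(1), of "\<ominus>\<^bsub>R\<^esub> \<one>\<^bsub>R\<^esub>" x] mod_homD(1)[OF assms(1), of x] assms(4)
    by (simp add: M.smult_minus_l N.smult_minus_l M.smult_one N.smult_one)
qed

lemma mod_hom_diff:
  assumes "h \<in> mod_hom R M N" "left_module R M" "left_module R N" "x \<in> carrier M" "y \<in> carrier M"
  shows "h (x \<ominus>\<^bsub>M\<^esub> y) = h x \<ominus>\<^bsub>N\<^esub> h y"
proof -
  interpret M: left_module R M by fact
  interpret N: left_module R N by fact
  show ?thesis using assms mod_homD[OF assms(1)] by (simp add: a_minus_def mod_hom_minus[OF assms(1-3)])
qed

lemma mod_hom_comp:
  "[|f \<in> mod_hom R L M; g \<in> mod_hom R M N|] ==> (\<lambda>x. g (f x)) \<in> mod_hom R L N"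
  by (rule mod_homI) (simp_all add: mod_homD)

lemma mod_hom_id: "(\<lambda>x. x) \<in> mod_hom R M M" unfolding mod_hom_def by auto

lemma mod_hom_add:
  assumes "left_module R N" "f \<in> mod_hom R M N" "g \<in> mod_hom R M N"
  shows "(\<lambda>x. f x \<oplus>\<^bsub>N\<^esub> g x) \<in> mod_hom R M N"
proof -
  interpret N: left_module R N by fact
  show ?thesis by (rule mod_homI)
      (use mod_homD[OF assms(2)] mod_homD[OF assms(3)] in "auto simp: N.smult_r_distr N.M.a_ac")
qed

lemma mod_hom_neg:
  assumes "left_module R N" "f \<in> mod_hom R M N"
  shows "(\<lambda>x. \<ominus>\<^bsub>N\<^esub> f x) \<in> mod_hom R M N"
proof -
  interpret N: left_module R N by fact
  show ?thesis by (rule mod_homI)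
      (use mod_homD[OF assms(2)] in "auto simp: N.smult_minus_r N.M.minus_add")
qed

lemma mod_hom_sub:
  assumes "left_module R N" "f \<in> mod_hom R M N" "g \<in> mod_hom R M N"
  shows "(\<lambda>x. f x \<ominus>\<^bsub>N\<^esub> g x) \<in> mod_hom R M N"
  unfolding a_minus_def by (intro mod_hom_add mod_hom_neg assms)

lemma submodule_image:
  assumes "left_module R M" "left_module R N" "h \<in> mod_hom R M N"
  shows "submodule_set R N (h ` carrier M)"
proof -
  interpret M: left_module R M by fact
  interpret N: left_module R N by fact
  show ?thesis unfolding submodule_set_def
  proof (intro conjI ballI)
    show "h ` carrier M \<subseteq> carrier N" using mod_homD[OF assms(3)] by auto
    show "\<zero>\<^bsub>N\<^esub> \<in> h ` carrier M" using mod_hom_zero[OF assms(3,1,2)] by (metis M.M.zero_closed image_eqI)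
    fix x assume "x \<in> h ` carrier M"
    then obtain x' where x: "x = h x'" "x' \<in> carrier M" by auto
    { fix y assume "y \<in> h ` carrier M"
      then obtain y' where y: "y = h y'" "y' \<in> carrier M" by auto
      show "x \<oplus>\<^bsub>N\<^esub> y \<in> h ` carrier M"
        using mod_homD(2)[OF assms(3) x(2) y(2)] x y by (metis M.M.a_closed image_eqI) }
    { fix r assume "r \<in> carrier R"
      then show "r \<odot>\<^bsub>N\<^esub> x \<in> h ` carrier M"
        using mod_homD(3)[OF assms(3) _ x(2)] x by (metis M.smult_closed image_eqI) }
  qed
qed

lemma mod_hom_inj_onI:
  assumes "left_module R M" "left_module R N" "h \<in> mod_hom R M N"
    and "!!x. x \<in> carrier M ==> h x = \<zero>\<^bsub>N\<^esub> ==> x = \<zero>\<^bsub>M\<^esub>"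
  shows "inj_on h (carrier M)"
proof -
  interpret M: left_module R M by fact
  interpret N: left_module R N by fact
  show ?thesis
  proof (rule inj_onI)
    fix x y assume *: "x \<in> carrier M" "y \<in> carrier M" "h x = h y"
    then have "h (x \<ominus>\<^bsub>M\<^esub> y) = \<zero>\<^bsub>N\<^esub>"
      using mod_hom_diff[OF assms(3,1,2)] mod_homD(1)[OF assms(3)] by (simp add: N.M.minus_eq N.M.r_neg)
    then have "x \<ominus>\<^bsub>M\<^esub> y = \<zero>\<^bsub>M\<^esub>" using assms(4) * by simp
    then show "x = y" using * by (metis M.M.add.inv_solve_right M.M.l_zero M.M.minus_eq M.M.zero_closed)
  qed
qed

section \<open>Finite generation of images, quotients and copies\<close>

lemma fg_module_left: "fg_module R M ==> left_module R M" unfolding fg_module_def by blast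

lemma fg_module_image:
  assumes "fg_module R M" "left_module R N" "h \<in> mod_hom R M N" "h ` carrier M = carrier N"
  shows "fg_module R N"
proof -
  interpret M: left_module R M using assms(1) by (rule fg_module_left)
  interpret N: left_module R N by fact
  obtain S where S: "finite S" "S \<subseteq> carrier M" "!!H. submodule_set R M H ==> S \<subseteq> H ==> H = carrier M"
    using assms(1) M.fg_module_iff by blast
  have "H = carrier N" if H: "submodule_set R N H" "h ` S \<subseteq> H" for H
  proof -
    \<comment> \<open>The preimage of \<open>H\<close> contains the generators of \<open>M\<close>,
      so it is everything.\<close>
    have "submodule_set R M {x \<in> carrier M. h x \<in> H}"
      using submodule_setD[OF H(1)] mod_homD[OF assms(3)] mod_hom_zero[OF assms(3) M.left_module_axioms assms(2)]
      unfolding submodule_set_def by (auto simp: M.smult_closed)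
    then have "{x \<in> carrier M. h x \<in> H} = carrier M" by (rule S(3)) (use S(2) H(2) in "simp add: subset_iff image_subset_iff")
    then have "h ` carrier M \<subseteq> H" by blast
    moreover have "H \<subseteq> carrier N" using H(1) by (simp add: submodule_set_def)
    ultimately show ?thesis using assms(4) by simp
  qed
  then show ?thesis unfolding N.fg_module_iff using S(1,2) assms(4) by (intro exI[of _ "h ` S"]) auto
qed

text \<open>The structure is carried over to the image of an arbitrary function \<open>q\<close>,
  computing with chosen preimages. Leaving \<open>q\<close> free allows a quotient to be built in
  whatever type is wanted, instead of as a set of cosets.\<close>

definition push_module :: "('m => 'n) => ('r, 'm) module => ('r, 'n) module" where
  "push_module q M =
     \<lparr> carrier = q ` carrier M, monoid.mult = undefined, monoid.one = undefined,
       ring.zero = q \<zero>\<^bsub>M\<^esub>,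
       ring.add = (\<lambda>u v. q (inv_into (carrier M) q u \<oplus>\<^bsub>M\<^esub> inv_into (carrier M) q v)),
       module.smult = (\<lambda>r u. q (r \<odot>\<^bsub>M\<^esub> inv_into (carrier M) q u)) \<rparr>"

lemma push_module:
  assumes "left_module R M" and N: "submodule_set R M N"
    and q: "!!x y. x \<in> carrier M ==> y \<in> carrier M ==> q x = q y \<longleftrightarrow> x \<ominus>\<^bsub>M\<^esub> y \<in> N"
  shows "left_module R (push_module q M)" "q \<in> mod_hom R M (push_module q M)"
    "q ` carrier M = carrier (push_module q M)" "mod_kernel M (push_module q M) q = N"
proof -
  interpret M: left_module R M by fact
  let ?i = "inv_into (carrier M) q"
  have i: "?i (q x) \<in> carrier M" "q (?i (q x)) = q x" if "x \<in> carrier M" for x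
    using that by (simp_all add: inv_into_into f_inv_into_f)
  \<comment> \<open>The fibres of \<open>q\<close> are the cosets of \<open>N\<close>, so results do
    not depend on the preimages picked by \<open>inv_into\<close>.\<close>
  have add: "q (x \<oplus>\<^bsub>M\<^esub> y) = q (x' \<oplus>\<^bsub>M\<^esub> y')"
    if "x \<in> carrier M" "y \<in> carrier M" "x' \<in> carrier M" "y' \<in> carrier M" "q x = q x'" "q y = q y'" for x y x' y'
  proof -
    have "x \<ominus>\<^bsub>M\<^esub> x' \<in> N" "y \<ominus>\<^bsub>M\<^esub> y' \<in> N" using that q by auto
    then have "(x \<ominus>\<^bsub>M\<^esub> x') \<oplus>\<^bsub>M\<^esub> (y \<ominus>\<^bsub>M\<^esub> y') \<in> N" using submodule_setD[OF N] by auto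
    moreover have "(x \<ominus>\<^bsub>M\<^esub> x') \<oplus>\<^bsub>M\<^esub> (y \<ominus>\<^bsub>M\<^esub> y') = (x \<oplus>\<^bsub>M\<^esub> y) \<ominus>\<^bsub>M\<^esub> (x' \<oplus>\<^bsub>M\<^esub> y')"
      using that by (simp add: M.M.minus_eq M.M.minus_add M.M.a_ac)
    ultimately show ?thesis using q that by auto
  qed
  have smult: "q (r \<odot>\<^bsub>M\<^esub> x) = q (r \<odot>\<^bsub>M\<^esub> x')"
    if "x \<in> carrier M" "x' \<in> carrier M" "q x = q x'" "r \<in> carrier R" for x x' r
  proof -
    have "x \<ominus>\<^bsub>M\<^esub> x' \<in> N" using that q by auto
    then have "r \<odot>\<^bsub>M\<^esub> (x \<ominus>\<^bsub>M\<^esub> x') \<in> N" using submodule_setD[OF N] that by auto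
    then show ?thesis using q that by (simp add: M.smult_diff_r M.smult_closed)
  qed
  let ?P = "push_module q M"
  have A: "q x \<oplus>\<^bsub>?P\<^esub> q y = q (x \<oplus>\<^bsub>M\<^esub> y)" if "x \<in> carrier M" "y \<in> carrier M" for x y
    using add[of "?i (q x)" "?i (q y)" x y] i that by (simp add: push_module_def)
  have S: "r \<odot>\<^bsub>?P\<^esub> q x = q (r \<odot>\<^bsub>M\<^esub> x)" if "x \<in> carrier M" "r \<in> carrier R" for r x
    using smult[of "?i (q x)" x r] i that by (simp add: push_module_def)
  have Z: "\<zero>\<^bsub>?P\<^esub> = q \<zero>\<^bsub>M\<^esub>" by (simp add: push_module_def)
  have C: "carrier ?P = q ` carrier M" by (simp add: push_module_def)
  have "abelian_group ?P"
  proof (rule abelian_groupI)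
    fix x assume "x \<in> carrier ?P"
    then obtain x' where x': "x = q x'" "x' \<in> carrier M" using C by auto
    show "\<exists>y\<in>carrier ?P. y \<oplus>\<^bsub>?P\<^esub> x = \<zero>\<^bsub>?P\<^esub>"
      using x' by (intro bexI[of _ "q (\<ominus>\<^bsub>M\<^esub> x')"]) (auto simp: A C Z M.M.l_neg)
  qed (auto simp: C Z A M.M.a_ac)
  then show "left_module R ?P" by (intro left_moduleI)
       (auto simp: C A S M.smult_closed M.smult_l_distr M.smult_r_distr M.smult_assoc M.smult_one intro: M.R.ring_axioms)
  show "q \<in> mod_hom R M ?P" by (intro mod_homI) (auto simp: C A S)
  show "q ` carrier M = carrier ?P" using C by simp
  have "x \<ominus>\<^bsub>M\<^esub> \<zero>\<^bsub>M\<^esub> = x" if "x \<in> carrier M" for x using that by (simp add: M.M.minus_eq)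
  then have "q x = q \<zero>\<^bsub>M\<^esub> \<longleftrightarrow> x \<in> N" if "x \<in> carrier M" for x
    using that q[of x "\<zero>\<^bsub>M\<^esub>"] by simp
  then show "mod_kernel M ?P q = N" unfolding mod_kernel_def Z using submodule_setD(1)[OF N] by blast
qed

text \<open>The definitions of injective modules and resolutions only see modules whose elements are
  sets of sequences. A coset is therefore encoded by the set of all coefficient sequences that
  evaluate into it; distinct cosets give distinct sets because every element of \<open>M\<close> has
  at least one such sequence.\<close>

lemma fg_quotient_exists:
  fixes R :: "('r, 's) ring_scheme" and M :: "('r, 'm) module"
  assumes "fg_module R M" "submodule_set R M N"
  obtains C :: "('r, 'r fg_carrier) module" and q where
    "fg_module R C" "q \<in> mod_hom R M C" "q ` carrier M = carrier C" "mod_kernel M C q = N"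
proof -
  interpret M: left_module R M using assms(1) by (rule fg_module_left)
  obtain S where S: "finite S" "S \<subseteq> carrier M"
    "\<forall>x\<in>carrier M. \<exists>c. c ` S \<subseteq> carrier R \<and> x = (\<Oplus>\<^bsub>M\<^esub>s\<in>S. c s \<odot>\<^bsub>M\<^esub> s)"
    using assms(1) unfolding fg_module_def by blast
  obtain g :: "'m => nat" where g: "inj_on g S" using S(1) by (meson finite_imp_inj_to_nat_seg)
  define ev where "ev c = (\<Oplus>\<^bsub>M\<^esub>s\<in>S. c (g s) \<odot>\<^bsub>M\<^esub> s)" for c
  \<comment> \<open>Entries at indices outside the image of \<open>g\<close> are left unconstrained;
    they do not affect \<open>ev\<close>.\<close>
  define q where "q x = {c. (\<forall>s\<in>S. c (g s) \<in> carrier R) \<and> x \<ominus>\<^bsub>M\<^esub> ev c \<in> N}" for x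
  have ev: "ev c \<in> carrier M" if "\<forall>s\<in>S. c (g s) \<in> carrier R" for c
    unfolding ev_def using that S(2) by (intro M.M.finsum_closed) (auto intro!: M.smult_closed)
  have ex: "\<exists>c. (\<forall>s\<in>S. c (g s) \<in> carrier R) \<and> x = ev c" if xM: "x \<in> carrier M" for x
  proof -
    obtain c where c: "c ` S \<subseteq> carrier R" "x = (\<Oplus>\<^bsub>M\<^esub>s\<in>S. c s \<odot>\<^bsub>M\<^esub> s)" using bspec[OF S(3) xM] by blast
    have "x = (\<Oplus>\<^bsub>M\<^esub>s\<in>S. (c \<circ> inv_into S g) (g s) \<odot>\<^bsub>M\<^esub> s)"
      unfolding c(2) using S(2) c(1) g by (intro M.M.finsum_cong') (simp_all add: M.smult_closed image_subset_iff subset_iff)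
    then show ?thesis using c(1) g by (intro exI[of _ "c \<circ> inv_into S g"]) (simp add: ev_def image_subset_iff)
  qed
  have qq: "q x = q y \<longleftrightarrow> x \<ominus>\<^bsub>M\<^esub> y \<in> N" if xy: "x \<in> carrier M" "y \<in> carrier M" for x y
  proof
    assume eq: "q x = q y"
    obtain c where c: "\<forall>s\<in>S. c (g s) \<in> carrier R" "x = ev c" using ex[OF xy(1)] by blast
    have "c \<in> q x" using c xy submodule_setD(2)[OF assms(2)] by (simp add: q_def M.M.minus_eq M.M.r_neg)
    then have "y \<ominus>\<^bsub>M\<^esub> x \<in> N" using eq c by (auto simp: q_def)
    then have "\<ominus>\<^bsub>M\<^esub> (y \<ominus>\<^bsub>M\<^esub> x) \<in> N" using M.submodule_minus[OF assms(2)] by blast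
    then show "x \<ominus>\<^bsub>M\<^esub> y \<in> N" using xy by (simp add: M.M.minus_eq M.M.minus_add M.M.a_ac)
  next
    assume d: "x \<ominus>\<^bsub>M\<^esub> y \<in> N"
    have "x \<ominus>\<^bsub>M\<^esub> z \<in> N \<longleftrightarrow> y \<ominus>\<^bsub>M\<^esub> z \<in> N" if z: "z \<in> carrier M" for z
    proof -
      have e1: "(x \<ominus>\<^bsub>M\<^esub> y) \<oplus>\<^bsub>M\<^esub> (y \<ominus>\<^bsub>M\<^esub> z) = x \<ominus>\<^bsub>M\<^esub> z"
        using xy z by (simp add: M.M.minus_eq M.M.a_assoc M.M.l_neg M.M.r_neg1 M.M.r_neg2)
      have e2: "(x \<ominus>\<^bsub>M\<^esub> z) \<ominus>\<^bsub>M\<^esub> (x \<ominus>\<^bsub>M\<^esub> y) = y \<ominus>\<^bsub>M\<^esub> z"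
        using xy z by (simp add: M.M.minus_eq M.M.minus_add M.M.a_ac M.M.r_neg1 M.M.r_neg2)
      show ?thesis using e1 e2 d submodule_setD(3)[OF assms(2)] M.submodule_diff[OF assms(2)] by metis
    qed
    then show "q x = q y" using ev by (auto simp: q_def)
  qed
  note P = push_module[OF M.left_module_axioms assms(2) qq]
  show ?thesis by (rule that[OF fg_module_image[OF assms(1) P(1-3)] P(2-4)])
qed

text \<open>Division by the zero submodule. The mutually inverse maps are the means of moving
  products, coinduced modules and restrictions back into the type \<open>fg_carrier\<close>.\<close>

lemma fg_copy_exists:
  fixes R :: "('r, 's) ring_scheme" and M :: "('r, 'm) module"
  assumes "fg_module R M"
  obtains C :: "('r, 'r fg_carrier) module" and q p where
    "fg_module R C" "q \<in> mod_hom R M C" "p \<in> mod_hom R C M"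
    "!!x. x \<in> carrier M ==> p (q x) = x" "!!y. y \<in> carrier C ==> q (p y) = y"
proof -
  interpret M: left_module R M using assms(1) by (rule fg_module_left)
  have z: "submodule_set R M {\<zero>\<^bsub>M\<^esub>}" by (auto simp: submodule_set_def M.smult_zero_r)
  obtain C :: "('r, 'r fg_carrier) module" and q where C:
    "fg_module R C" "q \<in> mod_hom R M C" "q ` carrier M = carrier C" "mod_kernel M C q = {\<zero>\<^bsub>M\<^esub>}"
    by (rule fg_quotient_exists[OF assms z])
  interpret C: left_module R C using C(1) by (rule fg_module_left)
  have inj: "inj_on q (carrier M)" by (rule mod_hom_inj_onI[OF M.left_module_axioms C.left_module_axioms C(2)])
       (use C(4) in "auto simp: mod_kernel_def")
  let ?p = "inv_into (carrier M) q"
  have pq: "?p (q x) = x" if "x \<in> carrier M" for x using that inj by simp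
  have qp: "q (?p y) = y" if "y \<in> carrier C" for y using that C(3) by (simp add: f_inv_into_f)
  have "?p \<in> mod_hom R C M" unfolding mod_hom_def C(3)[symmetric]
    using inj pq mod_homD(2,3)[OF C(2), symmetric] by (auto simp: M.smult_closed)
  then show ?thesis using that[OF C(1,2)] pq qp by blast
qed

section \<open>Injective modules and injective dimension\<close>

definition prod_module :: "('r, 'm) module => ('r, 'n) module => ('r, 'm \<times> 'n) module" where
  "prod_module M N =
     \<lparr> carrier = carrier M \<times> carrier N, monoid.mult = undefined, monoid.one = undefined,
       ring.zero = (\<zero>\<^bsub>M\<^esub>, \<zero>\<^bsub>N\<^esub>),
       ring.add = (\<lambda>u v. (fst u \<oplus>\<^bsub>M\<^esub> fst v, snd u \<oplus>\<^bsub>N\<^esub> snd v)),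
       module.smult = (\<lambda>r u. (r \<odot>\<^bsub>M\<^esub> fst u, r \<odot>\<^bsub>N\<^esub> snd u)) \<rparr>"

lemma prod_module_simps [simp]:
  "carrier (prod_module M N) = carrier M \<times> carrier N"
  "\<zero>\<^bsub>prod_module M N\<^esub> = (\<zero>\<^bsub>M\<^esub>, \<zero>\<^bsub>N\<^esub>)"
  "u \<oplus>\<^bsub>prod_module M N\<^esub> v = (fst u \<oplus>\<^bsub>M\<^esub> fst v, snd u \<oplus>\<^bsub>N\<^esub> snd v)"
  "r \<odot>\<^bsub>prod_module M N\<^esub> u = (r \<odot>\<^bsub>M\<^esub> fst u, r \<odot>\<^bsub>N\<^esub> snd u)"
  by (simp_all add: prod_module_def)

lemma left_module_prod:
  assumes "left_module R M" "left_module R N"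
  shows "left_module R (prod_module M N)"
proof -
  interpret M: left_module R M by fact
  interpret N: left_module R N by fact
  have "abelian_group (prod_module M N)"
  proof (rule abelian_groupI)
    fix x assume "x \<in> carrier (prod_module M N)"
    then show "\<exists>y\<in>carrier (prod_module M N). y \<oplus>\<^bsub>prod_module M N\<^esub> x = \<zero>\<^bsub>prod_module M N\<^esub>"
      by (intro bexI[of _ "(\<ominus>\<^bsub>M\<^esub> fst x, \<ominus>\<^bsub>N\<^esub> snd x)"]) (auto simp: M.M.l_neg N.M.l_neg)
  qed (auto simp: M.M.a_ac N.M.a_ac)
  then show ?thesis by (rule left_moduleI[OF M.ring_axioms])
       (auto simp: M.smult_closed N.smult_closed M.smult_l_distr N.smult_l_distr M.smult_r_distr
         N.smult_r_distr M.smult_assoc N.smult_assoc M.smult_one N.smult_one)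
qed

lemma mod_hom_fst: "fst \<in> mod_hom R (prod_module M N) M"
  and mod_hom_snd: "snd \<in> mod_hom R (prod_module M N) N" by (auto intro!: mod_homI)

lemma mod_hom_pair:
  "f \<in> mod_hom R L M ==> g \<in> mod_hom R L N ==> (\<lambda>x. (f x, g x)) \<in> mod_hom R L (prod_module M N)"
  by (rule mod_homI) (auto simp: mod_homD)

lemma fg_module_prod:
  assumes "fg_module R M" "fg_module R N"
  shows "fg_module R (prod_module M N)"
proof -
  interpret M: left_module R M using assms(1) by (rule fg_module_left)
  interpret N: left_module R N using assms(2) by (rule fg_module_left)
  interpret P: left_module R "prod_module M N" by (rule left_module_prod) (rule M.left_module_axioms N.left_module_axioms)+
  obtain S where S: "finite S" "S \<subseteq> carrier M" "!!H. submodule_set R M H ==> S \<subseteq> H ==> H = carrier M"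
    using assms(1) M.fg_module_iff by blast
  obtain T where T: "finite T" "T \<subseteq> carrier N" "!!H. submodule_set R N H ==> T \<subseteq> H ==> H = carrier N"
    using assms(2) N.fg_module_iff by blast
  let ?S = "(\<lambda>s. (s, \<zero>\<^bsub>N\<^esub>)) ` S \<union> (\<lambda>t. (\<zero>\<^bsub>M\<^esub>, t)) ` T"
  have "H = carrier (prod_module M N)" if H: "submodule_set R (prod_module M N) H" "?S \<subseteq> H" for H
  proof -
    note HD = submodule_setD[OF H(1)]
    have "submodule_set R M {x \<in> carrier M. (x, \<zero>\<^bsub>N\<^esub>) \<in> H}"
      using HD(2) HD(3)[of "(_, \<zero>\<^bsub>N\<^esub>)" "(_, \<zero>\<^bsub>N\<^esub>)"] HD(4)[of _ "(_, \<zero>\<^bsub>N\<^esub>)"]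
      by (auto simp: submodule_set_def M.smult_closed N.smult_zero_r)
    then have 1: "{x \<in> carrier M. (x, \<zero>\<^bsub>N\<^esub>) \<in> H} = carrier M" by (rule S(3)) (use S(2) H(2) in auto)
    have "submodule_set R N {x \<in> carrier N. (\<zero>\<^bsub>M\<^esub>, x) \<in> H}"
      using HD(2) HD(3)[of "(\<zero>\<^bsub>M\<^esub>, _)" "(\<zero>\<^bsub>M\<^esub>, _)"] HD(4)[of _ "(\<zero>\<^bsub>M\<^esub>, _)"]
      by (auto simp: submodule_set_def N.smult_closed M.smult_zero_r)
    then have 2: "{x \<in> carrier N. (\<zero>\<^bsub>M\<^esub>, x) \<in> H} = carrier N" by (rule T(3)) (use T(2) H(2) in auto)
    have "(x, y) \<in> H" if "x \<in> carrier M" "y \<in> carrier N" for x y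
    proof -
      have "(x, \<zero>\<^bsub>N\<^esub>) \<in> H" "(\<zero>\<^bsub>M\<^esub>, y) \<in> H" using that 1 2 by blast+
      from HD(3)[OF this] show ?thesis using that by simp
    qed
    then show ?thesis using HD(1) by auto
  qed
  then show ?thesis unfolding P.fg_module_iff using S(1,2) T(1,2) by (intro exI[of _ ?S]) auto
qed

lemma left_module_submodule:
  assumes "left_module R M" "submodule_set R M H"
  shows "left_module R (M\<lparr>carrier := H\<rparr>)"
proof -
  interpret M: left_module R M by fact
  note HD = submodule_setD[OF assms(2)]
  have "abelian_group (M\<lparr>carrier := H\<rparr>)"
  proof (rule abelian_groupI)
    fix x assume "x \<in> carrier (M\<lparr>carrier := H\<rparr>)"
    then show "\<exists>y\<in>carrier (M\<lparr>carrier := H\<rparr>). y \<oplus>\<^bsub>M\<lparr>carrier := H\<rparr>\<^esub> x = \<zero>\<^bsub>M\<lparr>carrier := H\<rparr>\<^esub>"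
      using HD(1) M.submodule_minus[OF assms(2)] by (intro bexI[of _ "\<ominus>\<^bsub>M\<^esub> x"]) (auto simp: M.M.l_neg)
  qed (use HD in "auto simp: M.M.a_ac")
  then show ?thesis by (rule left_moduleI[OF M.ring_axioms])
       (use HD in "auto simp: M.smult_l_distr M.smult_r_distr M.smult_assoc M.smult_one")
qed

lemma mod_hom_factor:
  assumes "left_module R M" "left_module R C" "left_module R Y"
    and p: "p \<in> mod_hom R M C" "p ` carrier M = carrier C" and f: "f \<in> mod_hom R M Y"
    and ker: "!!x. x \<in> carrier M ==> p x = \<zero>\<^bsub>C\<^esub> ==> f x = \<zero>\<^bsub>Y\<^esub>"
  obtains g where "g \<in> mod_hom R C Y" "!!x. x \<in> carrier M ==> g (p x) = f x"
proof -
  interpret M: left_module R M by fact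
  interpret C: left_module R C by fact
  interpret Y: left_module R Y by fact
  define g where "g c = f (inv_into (carrier M) p c)" for c
  have g: "g (p x) = f x" if x: "x \<in> carrier M" for x
  proof -
    let ?y = "inv_into (carrier M) p (p x)"
    have y: "?y \<in> carrier M" "p ?y = p x" using x by (simp_all add: inv_into_into f_inv_into_f)
    have "p (?y \<ominus>\<^bsub>M\<^esub> x) = \<zero>\<^bsub>C\<^esub>"
      using mod_hom_diff[OF p(1) assms(1,2) y(1) x] y(2) mod_homD(1)[OF p(1) x] by (simp add: C.M.minus_eq C.M.r_neg)
    then have "f (?y \<ominus>\<^bsub>M\<^esub> x) = \<zero>\<^bsub>Y\<^esub>" using ker y(1) x by simp
    then have "f ?y \<ominus>\<^bsub>Y\<^esub> f x = \<zero>\<^bsub>Y\<^esub>" using mod_hom_diff[OF f assms(1,3) y(1) x] by simp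
    then show ?thesis unfolding g_def using mod_homD(1)[OF f] x y(1)
      by (metis Y.M.add.inv_solve_right Y.M.l_zero Y.M.minus_eq Y.M.zero_closed)
  qed
  have "g \<in> mod_hom R C Y" unfolding mod_hom_def p(2)[symmetric]
    using mod_homD[OF f] mod_homD(2,3)[OF p(1), symmetric] by (auto simp: g M.smult_closed)
  then show ?thesis using g that by blast
qed

lemma injective_moduleD: "injective_module R E ==> fg_module R E" unfolding injective_module_def by blast

text \<open>\<open>injective_module\<close> tests extension only against modules of type
  \<open>fg_carrier\<close>. Conjugating with isomorphic copies of \<open>M\<close> and
  \<open>N\<close> removes this restriction on types.\<close>

lemma injective_module_extend:
  fixes R :: "('r, 's) ring_scheme"
  assumes "injective_module R E" "fg_module R M" "fg_module R N"
    and f: "f \<in> mod_hom R M N" "inj_on f (carrier M)" and g: "g \<in> mod_hom R M E"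
  obtains h where "h \<in> mod_hom R N E" "!!x. x \<in> carrier M ==> h (f x) = g x"
proof -
  obtain M' :: "('r, 'r fg_carrier) module" and q p where M': "fg_module R M'" "q \<in> mod_hom R M M'"
    "p \<in> mod_hom R M' M" "!!x. x \<in> carrier M ==> p (q x) = x" "!!y. y \<in> carrier M' ==> q (p y) = y"
    using fg_copy_exists[OF assms(2)] by metis
  obtain N' :: "('r, 'r fg_carrier) module" and q' p' where N': "fg_module R N'" "q' \<in> mod_hom R N N'"
    "p' \<in> mod_hom R N' N" "!!x. x \<in> carrier N ==> p' (q' x) = x" "!!y. y \<in> carrier N' ==> q' (p' y) = y"
    using fg_copy_exists[OF assms(3)] by metis
  have f': "(\<lambda>x. q' (f (p x))) \<in> mod_hom R M' N'" by (rule mod_hom_comp[OF mod_hom_comp[OF M'(3) f(1)] N'(2)])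
  have inj: "inj_on (\<lambda>x. q' (f (p x))) (carrier M')" by (rule inj_onI) (metis M'(3,5) N'(4) f mod_homD(1) inj_onD)
  have g': "(\<lambda>x. g (p x)) \<in> mod_hom R M' E" by (rule mod_hom_comp[OF M'(3) g])
  obtain h where h: "h \<in> mod_hom R N' E" "\<forall>x\<in>carrier M'. h (q' (f (p x))) = g (p x)"
    using assms(1) M'(1) N'(1) f' inj g' unfolding injective_module_def by blast
  have "h (q' (f x)) = g x" if "x \<in> carrier M" for x using h(2) M'(4)[OF that] mod_homD(1)[OF M'(2) that] by force
  then show ?thesis using that[OF mod_hom_comp[OF N'(2) h(1)]] by blast
qed

lemma injective_module_retract:
  assumes "injective_module R E" "fg_module R Y"
    and i: "i \<in> mod_hom R Y E" and p: "p \<in> mod_hom R E Y" and pi: "!!x. x \<in> carrier Y ==> p (i x) = x"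
  shows "injective_module R Y" unfolding injective_module_def
proof (intro conjI allI impI assms(2); elim conjE)
  fix M N :: "('a, 'a fg_carrier) module" and f g
  assume *: "fg_module R M" "fg_module R N" "f \<in> mod_hom R M N" "inj_on f (carrier M)" "g \<in> mod_hom R M Y"
  obtain h where h: "h \<in> mod_hom R N E" "!!x. x \<in> carrier M ==> h (f x) = i (g x)"
    using injective_module_extend[OF assms(1) *(1-4) mod_hom_comp[OF *(5) i]] by blast
  show "\<exists>h\<in>mod_hom R N Y. \<forall>x\<in>carrier M. h (f x) = g x"
    by (rule bexI[OF _ mod_hom_comp[OF h(1) p]]) (simp add: h(2) pi mod_homD(1)[OF *(5)])
qed

lemma injective_module_prod:
  assumes "injective_module R E" "injective_module R F"
  shows "injective_module R (prod_module E F)" unfolding injective_module_def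
proof (intro conjI allI impI fg_module_prod injective_moduleD[OF assms(1)] injective_moduleD[OF assms(2)]; elim conjE)
  fix M N :: "('a, 'a fg_carrier) module" and f g
  assume *: "fg_module R M" "fg_module R N" "f \<in> mod_hom R M N" "inj_on f (carrier M)"
    "g \<in> mod_hom R M (prod_module E F)"
  obtain h where h: "h \<in> mod_hom R N E" "!!x. x \<in> carrier M ==> h (f x) = fst (g x)"
    using injective_module_extend[OF assms(1) *(1-4) mod_hom_comp[OF *(5) mod_hom_fst]] by blast
  obtain k where k: "k \<in> mod_hom R N F" "!!x. x \<in> carrier M ==> k (f x) = snd (g x)"
    using injective_module_extend[OF assms(2) *(1-4) mod_hom_comp[OF *(5) mod_hom_snd]] by blast
  show "\<exists>h\<in>mod_hom R N (prod_module E F). \<forall>x\<in>carrier M. h (f x) = g x"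
    by (rule bexI[OF _ mod_hom_pair[OF h(1) k(1)]]) (simp add: h k)
qed

section \<open>Resolutions and dimension shifting\<close>

definition short_exact ::
  "('r, 's) ring_scheme => ('r, 'l) module => ('r, 'm) module => ('r, 'n) module
    => ('l => 'm) => ('m => 'n) => bool" where
  "short_exact R L M N i p \<longleftrightarrow> i \<in> mod_hom R L M \<and> inj_on i (carrier L) \<and> p \<in> mod_hom R M N \<and>
     p ` carrier M = carrier N \<and> i ` carrier L = mod_kernel M N p"

text \<open>Inductions on the length of a resolution need the bound as a predicate;
  \<open>inj_dim_le_iff\<close> relates it to the infimum in \<open>inj_dim\<close>.\<close>

definition inj_dim_at_most :: "('r, 's) ring_scheme => nat => ('r, 'm) module => bool" where
  "inj_dim_at_most R n M \<longleftrightarrow>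
     (\<exists>E \<epsilon> d. injective_resolution R M E \<epsilon> d \<and> (\<forall>i>n. carrier (E i) = {\<zero>\<^bsub>E i\<^esub>}))"

lemma inj_dim_at_most_mono: "inj_dim_at_most R m M ==> m \<le> n ==> inj_dim_at_most R n M"
  unfolding inj_dim_at_most_def by (meson le_less_trans)

lemma inj_dim_le_iff: "inj_dim R M \<le> enat n \<longleftrightarrow> inj_dim_at_most R n M"
proof -
  let ?S = "{enat n |n. inj_dim_at_most R n M}"
  have eq: "inj_dim R M = Inf ?S" unfolding inj_dim_def inj_dim_at_most_def ..
  show ?thesis
  proof
    assume le: "inj_dim R M \<le> enat n"
    then have "?S \<noteq> {}" unfolding eq by (auto simp: Inf_enat_def split: if_splits)
    \<comment> \<open>The extended naturals are well-ordered, so the infimum of a nonempty set is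
      attained.\<close>
    then have "Inf ?S \<in> ?S" by (metis (lifting) Inf_enat_def LeastI ex_in_conv)
    then obtain m where "inj_dim_at_most R m M" "Inf ?S = enat m" by auto
    then show "inj_dim_at_most R n M" using le inj_dim_at_most_mono[of R m M n] unfolding eq by simp
  qed (auto simp: eq intro!: Inf_lower)
qed

lemma inj_dim_at_most_iso:
  assumes "inj_dim_at_most R n M" "f \<in> mod_hom R L M" "bij_betw f (carrier L) (carrier M)"
  shows "inj_dim_at_most R n L"
proof -
  obtain E \<epsilon> d where *: "injective_resolution R M E \<epsilon> d" "\<forall>i>n. carrier (E i) = {\<zero>\<^bsub>E i\<^esub>}"
    using assms(1) unfolding inj_dim_at_most_def by blast
  have fi: "f ` carrier L = carrier M" "inj_on f (carrier L)" using assms(3) by (auto simp: bij_betw_def)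
  have "injective_resolution R L E (\<lambda>x. \<epsilon> (f x)) d"
    using *(1) mod_hom_comp[OF assms(2)] comp_inj_on[OF fi(2), of \<epsilon>] unfolding injective_resolution_def
    by (auto simp: fi(1) image_image[of \<epsilon> f, symmetric] comp_def)
  then show ?thesis using *(2) unfolding inj_dim_at_most_def by blast
qed

lemma inj_dim_at_most_0_iff:
  fixes R :: "('r, 's) ring_scheme"
  assumes "fg_module R M"
  shows "inj_dim_at_most R 0 M \<longleftrightarrow> injective_module R M"
proof
  assume "inj_dim_at_most R 0 M"
  then obtain E \<epsilon> d where *: "injective_resolution R M E \<epsilon> d" "\<forall>i>0. carrier (E i) = {\<zero>\<^bsub>E i\<^esub>}"
    unfolding inj_dim_at_most_def by blast
  have e: "injective_module R (E 0)" "\<epsilon> \<in> mod_hom R M (E 0)" "d 0 \<in> mod_hom R (E 0) (E 1)" "inj_on \<epsilon> (carrier M)"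
    "\<epsilon> ` carrier M = mod_kernel (E 0) (E 1) (d 0)" using *(1) unfolding injective_resolution_def by auto
  \<comment> \<open>\<open>E 1\<close> is zero, so the kernel of \<open>d 0\<close> is all of
    \<open>E 0\<close> and \<open>\<epsilon>\<close> is an isomorphism.\<close>
  have im: "\<epsilon> ` carrier M = carrier (E 0)" unfolding e(5) mod_kernel_def using mod_homD(1)[OF e(3)] *(2) by auto
  interpret M: left_module R M using assms by (rule fg_module_left)
  let ?p = "inv_into (carrier M) \<epsilon>"
  have p: "?p (\<epsilon> x) = x" if "x \<in> carrier M" for x using that e(4) by simp
  have "?p \<in> mod_hom R (E 0) M" unfolding mod_hom_def im[symmetric]
    using p mod_homD(2,3)[OF e(2), symmetric] by (auto simp: M.smult_closed)
  then show "injective_module R M" by (rule injective_module_retract[OF e(1) assms e(2)]) (rule p)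
next
  assume inj: "injective_module R M"
  interpret M: left_module R M using assms by (rule fg_module_left)
  obtain C :: "('r, 'r fg_carrier) module" and q p where C: "fg_module R C" "q \<in> mod_hom R M C"
    "p \<in> mod_hom R C M" "!!x. x \<in> carrier M ==> p (q x) = x" "!!y. y \<in> carrier C ==> q (p y) = y"
    using fg_copy_exists[OF assms] by metis
  interpret C: left_module R C using C(1) by (rule fg_module_left)
  have sub: "submodule_set R C {\<zero>\<^bsub>C\<^esub>}" by (simp add: submodule_set_def C.smult_zero_r)
  \<comment> \<open>The zero module is carved out of \<open>C\<close>, so that all terms share one
    type and one zero element; a single constant function then serves as every differential.\<close>
  define Z where "Z = C\<lparr>carrier := {\<zero>\<^bsub>C\<^esub>}\<rparr>"
  interpret Z: left_module R Z unfolding Z_def by (rule left_module_submodule[OF C.left_module_axioms sub])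
  have zC: "(\<lambda>_. \<zero>\<^bsub>C\<^esub>) \<in> mod_hom R N Z" for N :: "('r, 'r fg_carrier) module"
    by (rule mod_homI) (auto simp: Z_def C.smult_zero_r)
  have fgZ: "fg_module R Z" by (rule fg_module_image[OF C(1) Z.left_module_axioms zC]) (use C.M.zero_closed in "force simp: Z_def")
  have injC: "injective_module R C" by (rule injective_module_retract[OF inj C(1) C(3,2)]) (rule C(5))
  have incl: "(\<lambda>x. x) \<in> mod_hom R Z C" by (rule mod_homI) (auto simp: Z_def)
  have injZ: "injective_module R Z" by (rule injective_module_retract[OF injC fgZ incl zC]) (simp add: Z_def)
  have "injective_resolution R M (\<lambda>i. if i = 0 then C else Z) q (\<lambda>_ _. \<zero>\<^bsub>C\<^esub>)"
    unfolding injective_resolution_def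
  proof (intro conjI allI)
    show "inj_on q (carrier M)" by (rule inj_onI) (metis C(4))
    show "q ` carrier M = mod_kernel (if (0::nat) = 0 then C else Z) (if (1::nat) = 0 then C else Z) (\<lambda>_. \<zero>\<^bsub>C\<^esub>)"
      using mod_homD(1)[OF C(2)] mod_homD(1)[OF C(3)] C(5) by (auto simp: mod_kernel_def Z_def image_iff) (metis C(5))
    show "(\<lambda>_. \<zero>\<^bsub>C\<^esub>) ` carrier (if i = 0 then C else Z) =
      mod_kernel (if Suc i = 0 then C else Z) (if Suc (Suc i) = 0 then C else Z) (\<lambda>_. \<zero>\<^bsub>C\<^esub>)" for i
      using C.M.zero_closed by (auto simp: mod_kernel_def Z_def)
  qed (use injC injZ C(2) zC in auto)
  moreover have "\<forall>i::nat>0. carrier (if i = 0 then C else Z) = {\<zero>\<^bsub>if i = 0 then C else Z\<^esub>}" by (simp add: Z_def)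
  ultimately show "inj_dim_at_most R 0 M" unfolding inj_dim_at_most_def by (metis (no_types, lifting))
qed

text \<open>Cut the resolution after \<open>E 0\<close>: the image of \<open>d 0\<close> inside
  \<open>E 1\<close> is the cosyzygy, and the shifted sequence resolves it.\<close>

lemma inj_dim_at_most_SucD:
  fixes R :: "('r, 's) ring_scheme"
  assumes "inj_dim_at_most R (Suc n) M"
  obtains E C :: "('r, 'r fg_carrier) module" and i p where "injective_module R E" "fg_module R C"
    "short_exact R M E C i p" "inj_dim_at_most R n C"
proof -
  obtain E \<epsilon> d where *: "injective_resolution R M E \<epsilon> d" "!!i. i>Suc n ==> carrier (E i) = {\<zero>\<^bsub>E i\<^esub>}"
    using assms unfolding inj_dim_at_most_def by blast
  have e: "!!i. injective_module R (E i)" "\<epsilon> \<in> mod_hom R M (E 0)" "!!i. d i \<in> mod_hom R (E i) (E (Suc i))"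
    "inj_on \<epsilon> (carrier M)" "\<epsilon> ` carrier M = mod_kernel (E 0) (E 1) (d 0)"
    "!!i. d i ` carrier (E i) = mod_kernel (E (Suc i)) (E (Suc (Suc i))) (d (Suc i))" using *(1) unfolding injective_resolution_def by auto
  interpret E0: left_module R "E 0" using injective_moduleD[OF e(1)] by (rule fg_module_left)
  interpret E1: left_module R "E 1" using injective_moduleD[OF e(1)] by (rule fg_module_left)
  have d0: "d 0 \<in> mod_hom R (E 0) (E 1)" using e(3)[of 0] by simp
  define C where "C = (E 1)\<lparr>carrier := d 0 ` carrier (E 0)\<rparr>"
  have C: "left_module R C" unfolding C_def
    by (rule left_module_submodule[OF E1.left_module_axioms submodule_image[OF E0.left_module_axioms E1.left_module_axioms d0]])
  have dC: "d 0 \<in> mod_hom R (E 0) C" by (rule mod_homI) (simp_all add: C_def mod_homD[OF d0])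
  have dC2: "d 0 ` carrier (E 0) = carrier C" by (simp add: C_def)
  have "short_exact R M (E 0) C \<epsilon> (d 0)" unfolding short_exact_def
  proof (intro conjI e(2,4) dC dC2)
    have "mod_kernel (E 0) C (d 0) = mod_kernel (E 0) (E 1) (d 0)" unfolding mod_kernel_def C_def by simp
    then show "\<epsilon> ` carrier M = mod_kernel (E 0) C (d 0)" using e(5) by simp
  qed
  moreover have "fg_module R C" by (rule fg_module_image[OF injective_moduleD[OF e(1)] C dC dC2])
  moreover have "injective_resolution R C (\<lambda>i. E (Suc i)) (\<lambda>x. x) (\<lambda>i. d (Suc i))"
    unfolding injective_resolution_def
  proof (intro conjI allI e)
    show "(\<lambda>x. x) \<in> mod_hom R C (E (Suc 0))" by (rule mod_homI) (use mod_homD(1)[OF d0] in "auto simp: C_def")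
    show "(\<lambda>x. x) ` carrier C = mod_kernel (E (Suc 0)) (E (Suc 1)) (d (Suc 0))" using e(6)[of 0] by (simp add: C_def)
  qed auto
  then have "inj_dim_at_most R n C" unfolding inj_dim_at_most_def using *(2) by (meson Suc_mono)
  ultimately show ?thesis using that e(1) by blast
qed

text \<open>Splicing in the other direction. The module \<open>E\<close> may have any element type,
  hence the copy \<open>E'\<close> that enters the resolution in its place.\<close>

lemma inj_dim_at_most_SucI:
  fixes R :: "('r, 's) ring_scheme"
  assumes inj: "injective_module R E" and fg: "fg_module R C"
    and ses: "short_exact R M E C i p" and C: "inj_dim_at_most R n C"
  shows "inj_dim_at_most R (Suc n) M"
proof -
  note sesD = ses[unfolded short_exact_def]
  have fgE: "fg_module R E" by (rule injective_moduleD[OF inj])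
  obtain E' :: "('r, 'r fg_carrier) module" and q r where E': "fg_module R E'" "q \<in> mod_hom R E E'"
    "r \<in> mod_hom R E' E" "!!x. x \<in> carrier E ==> r (q x) = x" "!!y. y \<in> carrier E' ==> q (r y) = y"
    using fg_copy_exists[OF fgE] by metis
  have injE': "injective_module R E'" by (rule injective_module_retract[OF inj E'(1) E'(3,2)]) (rule E'(5))
  obtain F \<epsilon> d where *: "injective_resolution R C F \<epsilon> d" "!!i. i>n ==> carrier (F i) = {\<zero>\<^bsub>F i\<^esub>}"
    using C unfolding inj_dim_at_most_def by blast
  have e: "!!i. injective_module R (F i)" "\<epsilon> \<in> mod_hom R C (F 0)" "!!i. d i \<in> mod_hom R (F i) (F (Suc i))"
    "inj_on \<epsilon> (carrier C)" "\<epsilon> ` carrier C = mod_kernel (F 0) (F 1) (d 0)"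
    "!!i. d i ` carrier (F i) = mod_kernel (F (Suc i)) (F (Suc (Suc i))) (d (Suc i))" using *(1) unfolding injective_resolution_def by auto
  interpret C: left_module R C using fg by (rule fg_module_left)
  interpret F0: left_module R "F 0" using injective_moduleD[OF e(1)] by (rule fg_module_left)
  define G where "G j = (case j of 0 => E' | Suc j => F j)" for j
  \<comment> \<open>The joint is the composite of the isomorphism from \<open>E'\<close> to
    \<open>E\<close>, the projection \<open>p\<close>, and the embedding of \<open>C\<close> into
    \<open>F 0\<close>.\<close>
  define d' where "d' j = (case j of 0 => (\<lambda>x. \<epsilon> (p (r x))) | Suc j => d j)" for j
  have G: "G 0 = E'" "!!j. G (Suc j) = F j" "d' 0 = (\<lambda>x. \<epsilon> (p (r x)))" "!!j. d' (Suc j) = d j"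
    by (simp_all add: G_def d'_def)
  have eps0: "\<epsilon> x = \<zero>\<^bsub>F 0\<^esub> \<longleftrightarrow> x = \<zero>\<^bsub>C\<^esub>" if "x \<in> carrier C" for x
    using mod_hom_zero[OF e(2) C.left_module_axioms F0.left_module_axioms] inj_onD[OF e(4), of x "\<zero>\<^bsub>C\<^esub>"] that by auto
  have eps00: "\<epsilon> \<zero>\<^bsub>C\<^esub> = \<zero>\<^bsub>F 0\<^esub>" using eps0[of "\<zero>\<^bsub>C\<^esub>"] by simp
  have rr: "r ` carrier E' = carrier E" using mod_homD(1)[OF E'(2)] mod_homD(1)[OF E'(3)] E'(4) by (force simp: image_iff)
  have "injective_resolution R M G (\<lambda>x. q (i x)) d'" unfolding injective_resolution_def
  proof (intro conjI allI)
    fix j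
    show "injective_module R (G j)" using injE' e(1) by (cases j) (simp_all add: G)
    show "d' j \<in> mod_hom R (G j) (G (Suc j))"
      using e(3) mod_hom_comp[OF mod_hom_comp[OF E'(3)] e(2)] sesD by (cases j) (simp_all add: G)
    show "d' j ` carrier (G j) = mod_kernel (G (Suc j)) (G (Suc (Suc j))) (d' (Suc j))"
    proof (cases j)
      case 0
      have "(\<lambda>x. \<epsilon> (p (r x))) ` carrier E' = \<epsilon> ` p ` r ` carrier E'" by (simp add: image_image)
      then show ?thesis using 0 e(5) rr sesD by (simp add: G)
    qed (simp add: G e(6))
  next
    show "(\<lambda>x. q (i x)) \<in> mod_hom R M (G 0)" using mod_hom_comp[OF conjunct1[OF sesD] E'(2)] by (simp add: G)
    show "inj_on (\<lambda>x. q (i x)) (carrier M)" using sesD by (intro inj_onI) (metis E'(4) inj_onD mod_homD(1))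
    have "q ` mod_kernel E C p = mod_kernel E' (F 0) (\<lambda>x. \<epsilon> (p (r x)))" (is "?A = ?B")
    proof
      show "?A \<subseteq> ?B" using mod_homD(1)[OF E'(2)] sesD by (auto simp: mod_kernel_def E'(4) eps00)
      show "?B \<subseteq> ?A"
      proof
        fix x assume x: "x \<in> ?B"
        then have "r x \<in> mod_kernel E C p" "x = q (r x)" using mod_homD(1)[OF E'(3)] mod_homD(1)[of p R E C] sesD
          by (auto simp: mod_kernel_def E'(5) eps0)
        then show "x \<in> ?A" by blast
      qed
    qed
    moreover have "(\<lambda>x. q (i x)) ` carrier M = q ` mod_kernel E C p" using sesD by (simp add: image_image[of q i, symmetric])
    ultimately show "(\<lambda>x. q (i x)) ` carrier M = mod_kernel (G 0) (G 1) (d' 0)"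
      by (simp add: G One_nat_def del: One_nat_def) (simp add: G)
  qed
  moreover have "carrier (G j) = {\<zero>\<^bsub>G j\<^esub>}" if "j > Suc n" for j using that *(2) by (cases j) (simp_all add: G)
  ultimately show ?thesis unfolding inj_dim_at_most_def by blast
qed

lemma inj_dim_at_most_prod_aux:
  fixes M N :: "('r, 'r fg_carrier) module"
  assumes "fg_module R M" "fg_module R N" "inj_dim_at_most R n M" "inj_dim_at_most R n N"
  shows "inj_dim_at_most R n (prod_module M N)" using assms
proof (induction n arbitrary: M N)
  case 0
  then show ?case by (simp add: inj_dim_at_most_0_iff injective_module_prod fg_module_prod)
next
  case (Suc n)
  obtain E C :: "('r, 'r fg_carrier) module" and i p where 1: "injective_module R E" "fg_module R C"
    "short_exact R M E C i p" "inj_dim_at_most R n C" using inj_dim_at_most_SucD[OF Suc.prems(3)] by metis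
  obtain F D :: "('r, 'r fg_carrier) module" and j q where 2: "injective_module R F" "fg_module R D"
    "short_exact R N F D j q" "inj_dim_at_most R n D" using inj_dim_at_most_SucD[OF Suc.prems(4)] by metis
  note s1 = 1(3)[unfolded short_exact_def] and s2 = 2(3)[unfolded short_exact_def]
  have "short_exact R (prod_module M N) (prod_module E F) (prod_module C D)
    (\<lambda>x. (i (fst x), j (snd x))) (\<lambda>x. (p (fst x), q (snd x)))" unfolding short_exact_def
  proof (intro conjI mod_hom_pair mod_hom_comp[OF mod_hom_fst] mod_hom_comp[OF mod_hom_snd])
    show "inj_on (\<lambda>x. (i (fst x), j (snd x))) (carrier (prod_module M N))" using s1 s2 by (auto simp: inj_on_def)
    have "(\<lambda>x. (p (fst x), q (snd x))) ` (carrier E \<times> carrier F) = p ` carrier E \<times> q ` carrier F"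
      by (auto simp: image_iff)
    then show "(\<lambda>x. (p (fst x), q (snd x))) ` carrier (prod_module E F) = carrier (prod_module C D)" using s1 s2 by simp
    have "(\<lambda>x. (i (fst x), j (snd x))) ` (carrier M \<times> carrier N) = i ` carrier M \<times> j ` carrier N"
      by (auto simp: image_iff)
    then show "(\<lambda>x. (i (fst x), j (snd x))) ` carrier (prod_module M N) =
      mod_kernel (prod_module E F) (prod_module C D) (\<lambda>x. (p (fst x), q (snd x)))" using s1 s2 by (auto simp: mod_kernel_def)
  qed (use s1 s2 in auto)
  then show ?case by (rule inj_dim_at_most_SucI[OF injective_module_prod[OF 1(1) 2(1)] fg_module_prod[OF 1(2) 2(2)]])
       (rule Suc.IH[OF 1(2) 2(2) 1(4) 2(4)])
qed

lemma inj_dim_at_most_copy: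
  fixes R :: "('r, 's) ring_scheme"
  assumes "fg_module R M" "inj_dim_at_most R n M"
  obtains C :: "('r, 'r fg_carrier) module" and q p where "fg_module R C" "q \<in> mod_hom R M C"
    "p \<in> mod_hom R C M" "!!x. x \<in> carrier M ==> p (q x) = x" "!!y. y \<in> carrier C ==> q (p y) = y"
    "inj_dim_at_most R n C"
proof -
  obtain C :: "('r, 'r fg_carrier) module" and q p where C: "fg_module R C" "q \<in> mod_hom R M C"
    "p \<in> mod_hom R C M" "!!x. x \<in> carrier M ==> p (q x) = x" "!!y. y \<in> carrier C ==> q (p y) = y"
    using fg_copy_exists[OF assms(1)] by metis
  have "bij_betw p (carrier C) (carrier M)" by (rule bij_betw_byWitness[of _ q]) (use C mod_homD(1)[OF C(2)] mod_homD(1)[OF C(3)] in auto)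
  then show ?thesis using that C inj_dim_at_most_iso[OF assms(2) C(3)] by blast
qed

lemma inj_dim_at_most_prod:
  fixes R :: "('r, 's) ring_scheme"
  assumes "fg_module R M" "fg_module R N" "inj_dim_at_most R n M" "inj_dim_at_most R n N"
  shows "inj_dim_at_most R n (prod_module M N)"
proof -
  obtain C :: "('r, 'r fg_carrier) module" and q p where C: "fg_module R C" "q \<in> mod_hom R M C"
    "p \<in> mod_hom R C M" "!!x. x \<in> carrier M ==> p (q x) = x" "!!y. y \<in> carrier C ==> q (p y) = y"
    "inj_dim_at_most R n C" using inj_dim_at_most_copy[OF assms(1,3)] by metis
  obtain D :: "('r, 'r fg_carrier) module" and q' p' where D: "fg_module R D" "q' \<in> mod_hom R N D"
    "p' \<in> mod_hom R D N" "!!x. x \<in> carrier N ==> p' (q' x) = x" "!!y. y \<in> carrier D ==> q' (p' y) = y"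
    "inj_dim_at_most R n D" using inj_dim_at_most_copy[OF assms(2,4)] by metis
  have "bij_betw (\<lambda>x. (q (fst x), q' (snd x))) (carrier (prod_module M N)) (carrier (prod_module C D))"
    by (rule bij_betw_byWitness[of _ "\<lambda>x. (p (fst x), p' (snd x))"])
       (use C(4,5) D(4,5) mod_homD(1)[OF C(2)] mod_homD(1)[OF C(3)] mod_homD(1)[OF D(2)] mod_homD(1)[OF D(3)] in auto)
  then show ?thesis by (rule inj_dim_at_most_iso[OF inj_dim_at_most_prod_aux[OF C(1) D(1) C(6) D(6)]
         mod_hom_pair[OF mod_hom_comp[OF mod_hom_fst C(2)] mod_hom_comp[OF mod_hom_snd D(2)]]])
qed

text \<open>A form of Schanuel's lemma for retracts. It replaces minimal resolutions and long exact
  sequences: with identities for \<open>s\<close> and \<open>t\<close> it compares two cosyzygies of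
  the same module up to an injective summand.\<close>

lemma cosyzygy_retract:
  assumes injE: "injective_module R E" and injF: "injective_module R F"
    and ses: "short_exact R L E C i p" "short_exact R M F D j q"
    and fg: "fg_module R L" "fg_module R M" "fg_module R C" "fg_module R D"
    and s: "s \<in> mod_hom R M L" and t: "t \<in> mod_hom R L M" and ts: "!!x. x \<in> carrier M ==> t (s x) = x"
  obtains u v where "u \<in> mod_hom R D (prod_module C F)" "v \<in> mod_hom R (prod_module C F) D"
    "!!x. x \<in> carrier D ==> v (u x) = x"
proof -
  note E = injective_moduleD[OF injE] and F = injective_moduleD[OF injF]
  note lm = fg[THEN fg_module_left] fg_module_left[OF E] fg_module_left[OF F]
  interpret C: left_module R C by (rule lm)
  interpret D: left_module R D by (rule lm)
  interpret F: left_module R F by (rule lm)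
  have ip: "i \<in> mod_hom R L E" "inj_on i (carrier L)" "p \<in> mod_hom R E C" "p ` carrier E = carrier C"
      "i ` carrier L = mod_kernel E C p"
    and jq: "j \<in> mod_hom R M F" "inj_on j (carrier M)" "q \<in> mod_hom R F D" "q ` carrier F = carrier D"
      "j ` carrier M = mod_kernel F D q" using ses by (auto simp: short_exact_def)
  \<comment> \<open>Injectivity extends \<open>s\<close> and \<open>t\<close> to the injective
    modules; these extensions induce the maps \<open>s''\<close> and \<open>t''\<close> between the
    cosyzygies.\<close>
  obtain s' where s': "s' \<in> mod_hom R F E" "!!x. x \<in> carrier M ==> s' (j x) = i (s x)"
    using injective_module_extend[OF injE fg(2) F jq(1,2) mod_hom_comp[OF s ip(1)]] by blast
  obtain t' where t': "t' \<in> mod_hom R E F" "!!x. x \<in> carrier L ==> t' (i x) = j (t x)"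
    using injective_module_extend[OF injF fg(1) E ip(1,2) mod_hom_comp[OF t jq(1)]] by blast
  have kq: "\<exists>m\<in>carrier M. y = j m" if "y \<in> carrier F" "q y = \<zero>\<^bsub>D\<^esub>" for y
    using that jq(5) unfolding mod_kernel_def by blast
  have kp: "\<exists>m\<in>carrier L. y = i m" if "y \<in> carrier E" "p y = \<zero>\<^bsub>C\<^esub>" for y
    using that ip(5) unfolding mod_kernel_def by blast
  have pi: "p (i x) = \<zero>\<^bsub>C\<^esub>" if "x \<in> carrier L" for x using that ip(5) unfolding mod_kernel_def by blast
  have qj: "q (j x) = \<zero>\<^bsub>D\<^esub>" if "x \<in> carrier M" for x using that jq(5) unfolding mod_kernel_def by blast
  obtain s'' where s'': "s'' \<in> mod_hom R D C" "!!y. y \<in> carrier F ==> s'' (q y) = p (s' y)"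
    by (rule mod_hom_factor[OF lm(6,4,3) jq(3,4) mod_hom_comp[OF s'(1) ip(3)]])
       (use kq s'(2) pi mod_homD(1)[OF s] in fastforce)+
  obtain t'' where t'': "t'' \<in> mod_hom R C D" "!!y. y \<in> carrier E ==> t'' (p y) = q (t' y)"
    by (rule mod_hom_factor[OF lm(5,3,4) ip(3,4) mod_hom_comp[OF t'(1) jq(3)]])
       (use kp t'(2) qj mod_homD(1)[OF t] in fastforce)+
  \<comment> \<open>The composite of \<open>s'\<close> and \<open>t'\<close> need not be the
    identity of \<open>F\<close>, but the difference vanishes on the image of \<open>M\<close>,
    which is the kernel of \<open>q\<close>. It factors through \<open>q\<close> as
    \<open>k\<close>, so the defect of \<open>t''\<close> after \<open>s''\<close> is
    \<open>q\<close> after \<open>k\<close>; the extra summand \<open>F\<close> absorbs it.\<close>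
  have kk: "(\<lambda>y. t' (s' y) \<ominus>\<^bsub>F\<^esub> y) \<in> mod_hom R F F"
    by (rule mod_hom_sub[OF lm(6) mod_hom_comp[OF s'(1) t'(1)] mod_hom_id])
  have "t' (s' y) \<ominus>\<^bsub>F\<^esub> y = \<zero>\<^bsub>F\<^esub>" if y: "y \<in> carrier F" "q y = \<zero>\<^bsub>D\<^esub>" for y
  proof -
    obtain m where m: "m \<in> carrier M" "y = j m" using kq[OF y] by blast
    then have "t' (s' y) = y" using s'(2) t'(2) ts mod_homD(1)[OF s] by simp
    then show ?thesis using y by (simp add: F.M.minus_eq F.M.r_neg)
  qed
  then obtain k where k: "k \<in> mod_hom R D F" "!!y. y \<in> carrier F ==> k (q y) = t' (s' y) \<ominus>\<^bsub>F\<^esub> y"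
    using mod_hom_factor[OF lm(6,4,6) jq(3,4) kk] by blast
  have u: "(\<lambda>x. (s'' x, k x)) \<in> mod_hom R D (prod_module C F)" by (rule mod_hom_pair[OF s''(1) k(1)])
  have v: "(\<lambda>z. t'' (fst z) \<ominus>\<^bsub>D\<^esub> q (snd z)) \<in> mod_hom R (prod_module C F) D"
    by (rule mod_hom_sub[OF lm(4) mod_hom_comp[OF mod_hom_fst t''(1)] mod_hom_comp[OF mod_hom_snd jq(3)]])
  show ?thesis
  proof (rule that[OF u v])
    fix x assume "x \<in> carrier D"
    then obtain y where y: "y \<in> carrier F" "x = q y" using jq(4) by blast
    have c: "t' (s' y) \<in> carrier F" "s' y \<in> carrier E" using y mod_homD(1)[OF s'(1)] mod_homD(1)[OF t'(1)] by auto
    have "q (t' (s' y)) \<ominus>\<^bsub>D\<^esub> (q (t' (s' y)) \<ominus>\<^bsub>D\<^esub> q y) = q y"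
      using mod_homD(1)[OF jq(3)] c y by (simp add: D.M.minus_eq D.M.minus_add D.M.r_neg D.M.a_assoc[symmetric])
    then show "t'' (fst (s'' x, k x)) \<ominus>\<^bsub>D\<^esub> q (snd (s'' x, k x)) = x"
      using y c by (simp add: s'' t'' k mod_hom_diff[OF jq(3) lm(6,4)])
  qed
qed

text \<open>Kept as a hypothesis for now, because the construction of injective modules uses the
  finite dimension of the algebra.\<close>

definition enough_injectives :: "('r, 's) ring_scheme => bool" where
  "enough_injectives R \<longleftrightarrow> (\<forall>M :: ('r, 'r fg_carrier) module. fg_module R M -->
     (\<exists>(E :: ('r, 'r fg_carrier) module) C i p. injective_module R E \<and> fg_module R C \<and> short_exact R M E (C :: ('r, 'r fg_carrier) module) i p))"

text \<open>By \<open>cosyzygy_retract\<close> the cosyzygy of the summand is a summand of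
  \<open>C\<close> times an injective module. The induction hypothesis applies to it once that
  product has been moved to the type \<open>fg_carrier\<close>.\<close>

lemma inj_dim_at_most_retract_aux:
  fixes L M :: "('r, 'r fg_carrier) module"
  assumes "enough_injectives R" "fg_module R L" "fg_module R M" "inj_dim_at_most R n L"
    and "s \<in> mod_hom R M L" "t \<in> mod_hom R L M" "!!x. x \<in> carrier M ==> t (s x) = x"
  shows "inj_dim_at_most R n M" using assms(2-)
proof (induction n arbitrary: L M s t)
  case 0
  then show ?case using injective_module_retract[of R L M s t] by (simp add: inj_dim_at_most_0_iff)
next
  case (Suc n)
  obtain E C :: "('r, 'r fg_carrier) module" and i p where 1: "injective_module R E" "fg_module R C"
    "short_exact R L E C i p" "inj_dim_at_most R n C" using inj_dim_at_most_SucD[OF Suc.prems(3)] by metis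
  obtain F D :: "('r, 'r fg_carrier) module" and j q where 2: "injective_module R F" "fg_module R D"
    "short_exact R M F D j q" using assms(1) Suc.prems(2) unfolding enough_injectives_def by blast
  obtain u v where uv: "u \<in> mod_hom R D (prod_module C F)" "v \<in> mod_hom R (prod_module C F) D"
    "!!x. x \<in> carrier D ==> v (u x) = x" using cosyzygy_retract[OF 1(1) 2(1) 1(3) 2(3) Suc.prems(1,2) 1(2) 2(2) Suc.prems(4-6)] by blast
  have fgF: "fg_module R F" by (rule injective_moduleD[OF 2(1)])
  have "inj_dim_at_most R n F" using inj_dim_at_most_mono[of R 0 F n] inj_dim_at_most_0_iff[OF fgF] 2(1) by simp
  note pr = inj_dim_at_most_prod[OF 1(2) fgF 1(4) this]
  obtain P :: "('r, 'r fg_carrier) module" and a b where P: "fg_module R P" "a \<in> mod_hom R (prod_module C F) P"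
    "b \<in> mod_hom R P (prod_module C F)" "!!x. x \<in> carrier (prod_module C F) ==> b (a x) = x"
    "inj_dim_at_most R n P" using inj_dim_at_most_copy[OF fg_module_prod[OF 1(2) fgF] pr] by metis
  have "inj_dim_at_most R n D" by (rule Suc.IH[OF P(1) 2(2) P(5) mod_hom_comp[OF uv(1) P(2)] mod_hom_comp[OF P(3) uv(2)]])
       (use P(4) uv(3) mod_homD(1)[OF uv(1)] in simp)
  then show ?case by (rule inj_dim_at_most_SucI[OF 2])
qed

lemma inj_dim_at_most_retract:
  fixes R :: "('r, 's) ring_scheme"
  assumes "enough_injectives R" "fg_module R L" "fg_module R M" "inj_dim_at_most R n L"
    and st: "s \<in> mod_hom R M L" "t \<in> mod_hom R L M" "!!x. x \<in> carrier M ==> t (s x) = x"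
  shows "inj_dim_at_most R n M"
proof -
  obtain C :: "('r, 'r fg_carrier) module" and q p where C: "fg_module R C" "q \<in> mod_hom R L C"
    "p \<in> mod_hom R C L" "!!x. x \<in> carrier L ==> p (q x) = x" "inj_dim_at_most R n C"
    using inj_dim_at_most_copy[OF assms(2,4)] by metis
  obtain D :: "('r, 'r fg_carrier) module" and q' p' where D: "fg_module R D" "q' \<in> mod_hom R M D"
    "p' \<in> mod_hom R D M" "!!x. x \<in> carrier M ==> p' (q' x) = x" "!!y. y \<in> carrier D ==> q' (p' y) = y"
    using fg_copy_exists[OF assms(3)] by metis
  have *: "inj_dim_at_most R n D" by (rule inj_dim_at_most_retract_aux[OF assms(1) C(1) D(1) C(5)
          mod_hom_comp[OF mod_hom_comp[OF D(3) st(1)] C(2)] mod_hom_comp[OF mod_hom_comp[OF C(3) st(2)] D(2)]])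
       (use C(4) D(5) st mod_homD(1)[OF D(3)] mod_homD(1)[OF st(1)] in simp)
  have "bij_betw q' (carrier M) (carrier D)" by (rule bij_betw_byWitness[of _ p']) (use D mod_homD(1)[OF D(2)] mod_homD(1)[OF D(3)] in auto)
  then show ?thesis by (rule inj_dim_at_most_iso[OF * D(2)])
qed

text \<open>The given embedding into \<open>E\<close> need not begin a short resolution. Comparison
  with one that does, through the identity of \<open>L\<close>, makes \<open>C\<close> a summand of
  the good cosyzygy times \<open>E\<close>.\<close>

lemma inj_dim_at_most_cosyzygy:
  assumes "enough_injectives R" "fg_module R L" "inj_dim_at_most R (Suc n) L"
    and "injective_module R E" "fg_module R C" "short_exact R L E C i p"
  shows "inj_dim_at_most R n C"
proof -
  obtain F D :: "('a, 'a fg_carrier) module" and j q where 2: "injective_module R F" "fg_module R D"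
    "short_exact R L F D j q" "inj_dim_at_most R n D" using inj_dim_at_most_SucD[OF assms(3)] by metis
  obtain u v where uv: "u \<in> mod_hom R C (prod_module D E)" "v \<in> mod_hom R (prod_module D E) C"
    "!!x. x \<in> carrier C ==> v (u x) = x"
    using cosyzygy_retract[OF 2(1) assms(4) 2(3) assms(6,2,2) 2(2) assms(5) mod_hom_id mod_hom_id] by blast
  have fgE: "fg_module R E" by (rule injective_moduleD[OF assms(4)])
  have "inj_dim_at_most R n E" using inj_dim_at_most_mono[of R 0 E n] inj_dim_at_most_0_iff[OF fgE] assms(4) by simp
  from inj_dim_at_most_prod[OF 2(2) fgE 2(4) this] show ?thesis
    by (rule inj_dim_at_most_retract[OF assms(1) fg_module_prod[OF 2(2) fgE] assms(5) _ uv])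
qed

lemma enough_injectivesD:
  fixes R :: "('r, 's) ring_scheme"
  assumes "enough_injectives R" "fg_module R M"
  obtains E C :: "('r, 'r fg_carrier) module" and i p where "injective_module R E" "fg_module R C"
    "short_exact R M E C i p"
proof -
  obtain D :: "('r, 'r fg_carrier) module" and q p where D: "fg_module R D" "q \<in> mod_hom R M D"
    "p \<in> mod_hom R D M" "!!x. x \<in> carrier M ==> p (q x) = x" "!!y. y \<in> carrier D ==> q (p y) = y"
    using fg_copy_exists[OF assms(2)] by metis
  obtain E C :: "('r, 'r fg_carrier) module" and i r where E: "injective_module R E" "fg_module R C"
    "short_exact R D E C i r" using assms(1) D(1) unfolding enough_injectives_def by blast
  have q: "q ` carrier M = carrier D" "inj_on q (carrier M)"
    using mod_homD(1)[OF D(2)] mod_homD(1)[OF D(3)] D(4,5) by (force simp: image_iff, metis inj_onI)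
  have "short_exact R M E C (\<lambda>x. i (q x)) r" using E(3) mod_hom_comp[OF D(2)] comp_inj_on[OF q(2), of i] unfolding short_exact_def
    by (auto simp: q(1) image_image[of i q, symmetric] comp_def)
  then show ?thesis using that E by blast
qed

section \<open>Augmented algebras\<close>

lemma finsum_additive:
  assumes "abelian_group G" "abelian_group H" "f \<in> carrier G \<rightarrow> carrier H"
    and "!!x y. x \<in> carrier G ==> y \<in> carrier G ==> f (x \<oplus>\<^bsub>G\<^esub> y) = f x \<oplus>\<^bsub>H\<^esub> f y"
    and "g \<in> S \<rightarrow> carrier G"
  shows "f (\<Oplus>\<^bsub>G\<^esub>s\<in>S. g s) = (\<Oplus>\<^bsub>H\<^esub>s\<in>S. f (g s))"
proof -
  interpret G: abelian_group G by fact
  interpret H: abelian_group H by fact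
  have z: "f \<zero>\<^bsub>G\<^esub> = \<zero>\<^bsub>H\<^esub>"
    using assms(4)[of "\<zero>\<^bsub>G\<^esub>" "\<zero>\<^bsub>G\<^esub>"] assms(3)
    by (metis G.l_zero G.zero_closed H.add.r_cancel_one PiE)
  show ?thesis
  proof (cases "finite S")
    case True
    then show ?thesis using assms(5)
    proof (induction S)
      case (insert s S)
      then have "g \<in> S \<rightarrow> carrier G" "g s \<in> carrier G" "finsum G g S \<in> carrier G"
        "(\<lambda>s. f (g s)) \<in> S \<rightarrow> carrier H" "f (g s) \<in> carrier H" using assms(3) by (auto intro!: G.finsum_closed)
      then show ?case using insert assms(4) by simp
    qed (simp add: z)
  next
    case False
    then show ?thesis by (simp add: G.finsum_infinite H.finsum_infinite z)
  qed
qed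

fun kernel_products :: "('r, 's) ring_scheme => ('x => 'r => 'k::zero) => 'x list => 'r set" where
  "kernel_products R \<epsilon> [] = {\<one>\<^bsub>R\<^esub>}"
| "kernel_products R \<epsilon> (x # xs) =
     {r \<otimes>\<^bsub>R\<^esub> t |r t. r \<in> carrier R \<and> \<epsilon> x r = 0 \<and> t \<in> kernel_products R \<epsilon> xs}"

definition lin_functional :: "('r, 's) ring_scheme => ('k::field => 'r) => ('r => 'k) => bool" where
  "lin_functional R sc \<phi> \<longleftrightarrow>
     (\<forall>r\<in>carrier R. \<forall>s\<in>carrier R. \<phi> (r \<oplus>\<^bsub>R\<^esub> s) = \<phi> r + \<phi> s) \<and>
     (\<forall>c. \<forall>r\<in>carrier R. \<phi> (sc c \<otimes>\<^bsub>R\<^esub> r) = c * \<phi> r)"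

text \<open>
  A family \<open>(w b, co b)\<close> with \<open>r = \<Sum> co b r \<cdot> w b\<close> expresses finite dimensionality, and the existence
  of a list of augmentations whose kernels multiply to zero says that the regular module has a finite
  filtration whose factors are the one-dimensional modules given by the augmentations.
\<close>

locale augmented_algebra = ring R for R :: "('r, 's) ring_scheme" (structure) +
  fixes sc :: "'k::field => 'r" and V :: "'x set" and \<epsilon> :: "'x => 'r => 'k"
  assumes sc_closed [simp]: "sc c \<in> carrier R"
    and sc_add: "sc (c + d) = sc c \<oplus> sc d"
    and sc_mult: "sc (c * d) = sc c \<otimes> sc d"
    and sc_one [simp]: "sc 1 = \<one>"
    and sc_commute: "r \<in> carrier R ==> sc c \<otimes> r = r \<otimes> sc c"
    and eps_add: "[|x \<in> V; r \<in> carrier R; s \<in> carrier R|] ==> \<epsilon> x (r \<oplus> s) = \<epsilon> x r + \<epsilon> x s"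
    and eps_mult: "[|x \<in> V; r \<in> carrier R; s \<in> carrier R|] ==> \<epsilon> x (r \<otimes> s) = \<epsilon> x r * \<epsilon> x s"
    and eps_sc [simp]: "x \<in> V ==> \<epsilon> x (sc c) = c"
    and nilpotent: "\<exists>xs. set xs \<subseteq> V \<and> kernel_products R \<epsilon> xs \<subseteq> {\<zero>}"
    and dual_basis: "\<exists>(F :: nat set) w co. finite F \<and> w \<in> F \<rightarrow> carrier R \<and>
      (\<forall>b\<in>F. lin_functional R sc (co b)) \<and>
      (\<forall>r\<in>carrier R. r = (\<Oplus>b\<in>F. sc (co b r) \<otimes> w b))"
begin

lemma sc_zero [simp]: "sc 0 = \<zero>" using sc_add[of 0 0] by (metis add.r_cancel_one add_0 sc_closed)

lemma eps_zero [simp]: "x \<in> V ==> \<epsilon> x \<zero> = 0" using eps_sc[of x 0] by simp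

lemma eps_one [simp]: "x \<in> V ==> \<epsilon> x \<one> = 1" using eps_sc[of x 1] by simp

lemma eps_minus: "[|x \<in> V; r \<in> carrier R|] ==> \<epsilon> x (\<ominus> r) = - \<epsilon> x r"
  using eps_add[of x "\<ominus> r" r] by (simp add: l_neg add_eq_0_iff2)

lemma eps_diff: "[|x \<in> V; r \<in> carrier R; s \<in> carrier R|] ==> \<epsilon> x (r \<ominus> s) = \<epsilon> x r - \<epsilon> x s"
  by (simp add: minus_eq eps_add eps_minus)

lemma left_module_regular: "left_module R (regular_module R)" by (rule left_moduleI[OF ring_axioms abelian_groupI])
     (auto simp: regular_module_def l_distr r_distr m_assoc a_ac intro: l_neg exI[of _ "\<ominus> _"] bexI[of _ "\<ominus> _"])

section \<open>Twisted derivations and Baer's criterion\<close>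

text \<open>These are the 1-cocycles for Ext^1 of the one-dimensional module on which
  \<open>R\<close> acts through \<open>\<epsilon> x\<close>, with values in \<open>M\<close>, and
  \<open>inner\<close> gives the coboundaries. Vanishing on \<open>sc c\<close> encodes linearity
  over the ground field.\<close>

definition derivation :: "'x => ('r, 'm) module => ('r => 'm) => bool" where
  "derivation x M D \<longleftrightarrow> D ` carrier R \<subseteq> carrier M \<and>
     (\<forall>r\<in>carrier R. \<forall>s\<in>carrier R. D (r \<oplus> s) = D r \<oplus>\<^bsub>M\<^esub> D s) \<and>
     (\<forall>r\<in>carrier R. \<forall>s\<in>carrier R. D (r \<otimes> s) = r \<odot>\<^bsub>M\<^esub> D s \<oplus>\<^bsub>M\<^esub> sc (\<epsilon> x s) \<odot>\<^bsub>M\<^esub> D r) \<and>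
     (\<forall>c. D (sc c) = \<zero>\<^bsub>M\<^esub>)"

definition inner :: "'x => ('r, 'm) module => 'm => 'r => 'm" where
  "inner x M m r = r \<odot>\<^bsub>M\<^esub> m \<ominus>\<^bsub>M\<^esub> sc (\<epsilon> x r) \<odot>\<^bsub>M\<^esub> m"

definition derivations_inner :: "('r, 'm) module => bool" where
  "derivations_inner M \<longleftrightarrow>
     (\<forall>x\<in>V. \<forall>D. derivation x M D --> (\<exists>m\<in>carrier M. \<forall>r\<in>carrier R. D r = inner x M m r))"

lemma derivationD:
  assumes "derivation x M D"
  shows "r \<in> carrier R ==> D r \<in> carrier M"
    "r \<in> carrier R ==> s \<in> carrier R ==> D (r \<oplus> s) = D r \<oplus>\<^bsub>M\<^esub> D s"
    "r \<in> carrier R ==> s \<in> carrier R ==> D (r \<otimes> s) = r \<odot>\<^bsub>M\<^esub> D s \<oplus>\<^bsub>M\<^esub> sc (\<epsilon> x s) \<odot>\<^bsub>M\<^esub> D r"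
    "D (sc c) = \<zero>\<^bsub>M\<^esub>" using assms unfolding derivation_def by auto

lemma sc_smult_commute:
  assumes "left_module R M" "r \<in> carrier R" "m \<in> carrier M"
  shows "r \<odot>\<^bsub>M\<^esub> (sc c \<odot>\<^bsub>M\<^esub> m) = sc c \<odot>\<^bsub>M\<^esub> (r \<odot>\<^bsub>M\<^esub> m)"
proof -
  interpret M: left_module R M by fact
  show ?thesis using assms(2,3) by (simp add: M.smult_assoc[symmetric] sc_commute)
qed

text \<open>The finitely many products of some \<open>w b\<close> with a module generator span
  \<open>M\<close> over the ground field.\<close>

lemma fg_module_K_span:
  assumes "fg_module R M"
  obtains T where "finite T" "T \<subseteq> carrier M"
    "!!H. [|H \<subseteq> carrier M; \<zero>\<^bsub>M\<^esub> \<in> H; !!x y. x \<in> H ==> y \<in> H ==> x \<oplus>\<^bsub>M\<^esub> y \<in> H;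
      !!c x. x \<in> H ==> sc c \<odot>\<^bsub>M\<^esub> x \<in> H; T \<subseteq> H|] ==> H = carrier M"
proof -
  interpret M: left_module R M using assms by (rule fg_module_left)
  obtain S where S: "finite S" "S \<subseteq> carrier M" "!!H. submodule_set R M H ==> S \<subseteq> H ==> H = carrier M"
    using assms M.fg_module_iff by blast
  obtain F :: "nat set" and w co where dual: "finite F" "w \<in> F \<rightarrow> carrier R"
    "\<forall>b\<in>F. lin_functional R sc (co b)" "\<forall>r\<in>carrier R. r = (\<Oplus>b\<in>F. sc (co b r) \<otimes> w b)"
    using dual_basis by (elim exE conjE)
  note F = dual(1,2) bspec[OF dual(3)] bspec[OF dual(4)] and wF [simp] = funcset_mem[OF dual(2)]
  let ?T = "(\<lambda>(b, s). w b \<odot>\<^bsub>M\<^esub> s) ` (F \<times> S)"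
  show ?thesis
  proof (rule that)
    show "finite ?T" using S(1) F(1) by simp
    show "?T \<subseteq> carrier M" using S(2) F(2) by (auto simp: Pi_def subset_iff M.smult_closed)
    fix H assume H: "H \<subseteq> carrier M" "\<zero>\<^bsub>M\<^esub> \<in> H" "!!x y. x \<in> H ==> y \<in> H ==> x \<oplus>\<^bsub>M\<^esub> y \<in> H"
      "!!c x. x \<in> H ==> sc c \<odot>\<^bsub>M\<^esub> x \<in> H" "?T \<subseteq> H"
    \<comment> \<open>The largest \<open>R\<close>-submodule contained in the subspace
      \<open>H\<close>.\<close>
    let ?H = "{x \<in> carrier M. \<forall>r\<in>carrier R. r \<odot>\<^bsub>M\<^esub> x \<in> H}"
    have 1: "submodule_set R M ?H" unfolding submodule_set_def using H(2,3)
      by (auto simp: M.smult_zero_r M.smult_r_distr M.smult_assoc[symmetric] M.smult_closed)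
    have "r \<odot>\<^bsub>M\<^esub> s \<in> H" if rs: "r \<in> carrier R" "s \<in> S" for r s
    proof -
      have sM: "s \<in> carrier M" using rs S by auto
      have sumH: "(\<Oplus>\<^bsub>M\<^esub>b\<in>B. sc (co b r) \<odot>\<^bsub>M\<^esub> (w b \<odot>\<^bsub>M\<^esub> s)) \<in> H" if "B \<subseteq> F" for B
      proof -
        have "finite B" using that F(1) finite_subset by blast
        then show ?thesis using that
        proof (induction B)
          case (insert b B)
          have "w b \<odot>\<^bsub>M\<^esub> s \<in> H" using insert.prems H(5) rs by auto
          moreover have "(\<lambda>b. sc (co b r) \<odot>\<^bsub>M\<^esub> (w b \<odot>\<^bsub>M\<^esub> s)) \<in> insert b B \<rightarrow> carrier M"
            using insert.prems F(2) sM by (auto intro!: M.smult_closed)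
          ultimately show ?case using insert H(3,4) by simp
        qed (simp add: H(2))
      qed
      have cl: "(\<lambda>b. sc (co b r) \<otimes> w b) \<in> F \<rightarrow> carrier R" using F(2) by auto
      have "r \<odot>\<^bsub>M\<^esub> s = (\<Oplus>b\<in>F. sc (co b r) \<otimes> w b) \<odot>\<^bsub>M\<^esub> s" using F(4)[OF rs(1)] by simp
      also have "\<dots> = (\<Oplus>\<^bsub>M\<^esub>b\<in>F. (sc (co b r) \<otimes> w b) \<odot>\<^bsub>M\<^esub> s)" by (rule M.finsum_smult[OF sM cl])
      also have "\<dots> = (\<Oplus>\<^bsub>M\<^esub>b\<in>F. sc (co b r) \<odot>\<^bsub>M\<^esub> (w b \<odot>\<^bsub>M\<^esub> s))"
        by (rule M.M.finsum_cong') (use sM in "auto simp: M.smult_assoc M.smult_closed")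
      finally show ?thesis using sumH[of F] by simp
    qed
    then have "S \<subseteq> ?H" using S(2) by auto
    from S(3)[OF 1 this] have e: "?H = carrier M" .
    have "x \<in> H" if x: "x \<in> carrier M" for x
    proof -
      have "\<one> \<odot>\<^bsub>M\<^esub> x \<in> H" using e x by blast
      then show ?thesis using x by (simp add: M.smult_one)
    qed
    then show "H = carrier M" using H(1) by blast
  qed
qed

lemma fg_module_K_spanI:
  assumes "left_module R M" "finite T" "T \<subseteq> carrier M"
    "!!H. submodule_set R M H ==> T \<subseteq> H ==> H = carrier M"
  shows "fg_module R M"
proof -
  interpret M: left_module R M by fact
  show ?thesis unfolding M.fg_module_iff using assms(2-4) by blast
qed

lemma fg_regular: "fg_module R (regular_module R)"
proof (rule fg_module_K_spanI[OF left_module_regular, of "{\<one>}"])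
  fix H assume H: "submodule_set R (regular_module R) H" "{\<one>} \<subseteq> H"
  have "r \<in> H" if "r \<in> carrier R" for r using submodule_setD(4)[OF H(1), of r \<one>] H(2) that by (simp add: regular_module_def)
  then show "H = carrier (regular_module R)" using H(1) by (auto simp: submodule_set_def regular_module_def)
qed (auto simp: regular_module_def)

text \<open>For finite generation: the projection \<open>k\<close> of \<open>R\<close> onto the
  kernel along the scalars is linear over the ground field, so the images of the spanning elements
  \<open>w b\<close> span the kernel.\<close>

lemma augmentation_kernel:
  assumes x: "x \<in> V"
  shows "submodule_set R (regular_module R) {r \<in> carrier R. \<epsilon> x r = 0}"
    and "fg_module R ((regular_module R)\<lparr>carrier := {r \<in> carrier R. \<epsilon> x r = 0}\<rparr>)"
proof -
  show 1: "submodule_set R (regular_module R) {r \<in> carrier R. \<epsilon> x r = 0}"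
    using x by (auto simp: submodule_set_def regular_module_def eps_add eps_mult)
  let ?K = "(regular_module R)\<lparr>carrier := {r \<in> carrier R. \<epsilon> x r = 0}\<rparr>"
  have K: "left_module R ?K" by (rule left_module_submodule[OF left_module_regular 1])
  interpret K: left_module R ?K by (rule K)
  obtain F :: "nat set" and w co where dual: "finite F" "w \<in> F \<rightarrow> carrier R"
    "\<forall>b\<in>F. lin_functional R sc (co b)" "\<forall>r\<in>carrier R. r = (\<Oplus>b\<in>F. sc (co b r) \<otimes> w b)"
    using dual_basis by (elim exE conjE)
  note F = dual(1,2) bspec[OF dual(3)] bspec[OF dual(4)] and wF [simp] = funcset_mem[OF dual(2)]
  define k where "k r = r \<ominus> sc (\<epsilon> x r)" for r
  have kc: "k r \<in> carrier ?K" if "r \<in> carrier R" for r using that x by (simp add: k_def regular_module_def eps_diff)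
  have kadd: "k (r \<oplus> s) = k r \<oplus>\<^bsub>?K\<^esub> k s" if "r \<in> carrier R" "s \<in> carrier R" for r s
    using that x by (simp add: k_def regular_module_def eps_add sc_add minus_eq minus_add a_ac)
  have ksc: "k (sc c \<otimes> r) = sc c \<odot>\<^bsub>?K\<^esub> k r" if "r \<in> carrier R" for r c
    using that x by (simp add: k_def regular_module_def eps_mult sc_mult minus_eq r_distr r_minus)
  have kid: "k r = r" if "r \<in> carrier ?K" for r using that by (simp add: k_def regular_module_def minus_eq)
  show "fg_module R ?K"
  proof (rule fg_module_K_spanI[OF K, of "(\<lambda>b. k (w b)) ` F"])
    fix H assume H: "submodule_set R ?K H" "(\<lambda>b. k (w b)) ` F \<subseteq> H"
    have "r \<in> H" if r: "r \<in> carrier ?K" for r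
    proof -
      have rR: "r \<in> carrier R" using r by (simp add: regular_module_def)
      have cl: "(\<lambda>b. sc (co b r) \<otimes> w b) \<in> F \<rightarrow> carrier R" using F(2) by auto
      have "r = k (\<Oplus>b\<in>F. sc (co b r) \<otimes> w b)" using F(4)[OF rR] kid[OF r] by simp
      also have "\<dots> = (\<Oplus>\<^bsub>?K\<^esub>b\<in>F. k (sc (co b r) \<otimes> w b))"
        by (rule finsum_additive[OF _ K.M.abelian_group_axioms _ kadd cl])
           (use kc abelian_group_axioms in auto)
      also have "\<dots> = (\<Oplus>\<^bsub>?K\<^esub>b\<in>F. sc (co b r) \<odot>\<^bsub>?K\<^esub> k (w b))"
        by (rule K.M.finsum_cong'[OF refl _ ksc[OF wF]]) (intro funcsetI K.smult_closed sc_closed kc wF)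
      also have "\<dots> \<in> H" using H(2) by (intro K.submodule_finsum[OF H(1)] funcsetI submodule_setD(4)[OF H(1)]) auto
      finally show ?thesis .
    qed
    then show "H = carrier ?K" using H(1) by (auto simp: submodule_set_def)
  qed (use F(1,2) kc in auto)
qed

text \<open>On the kernel of \<open>\<epsilon> x\<close> the twist disappears and a derivation is a
  module homomorphism. Extended to all of \<open>R\<close>, it is determined by its value at 1, and
  this value implements the derivation.\<close>

lemma injective_imp_derivations_inner:
  assumes inj: "injective_module R M"
  shows "derivations_inner M" unfolding derivations_inner_def
proof (intro ballI allI impI)
  fix x D assume x: "x \<in> V" and D: "derivation x M D"
  interpret M: left_module R M using injective_moduleD[OF inj] by (rule fg_module_left)
  let ?K = "(regular_module R)\<lparr>carrier := {r \<in> carrier R. \<epsilon> x r = 0}\<rparr>"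
  have i: "(\<lambda>r. r) \<in> mod_hom R ?K (regular_module R)" by (rule mod_homI) (auto simp: regular_module_def)
  have g: "D \<in> mod_hom R ?K M" by (rule mod_homI) (auto simp: regular_module_def derivationD[OF D] M.smult_zero_l M.smult_closed)
  obtain h where h: "h \<in> mod_hom R (regular_module R) M" "!!r. r \<in> carrier ?K ==> h r = D r"
    using injective_module_extend[OF inj augmentation_kernel(2)[OF x] fg_regular i _ g] by auto
  have hm: "h r = r \<odot>\<^bsub>M\<^esub> h \<one>" if "r \<in> carrier R" for r
    using mod_homD(3)[OF h(1) that, of \<one>] that by (simp add: regular_module_def)
  have h1: "h \<one> \<in> carrier M" using mod_homD(1)[OF h(1), of \<one>] by (simp add: regular_module_def)
  have "D r = inner x M (h \<one>) r" if r: "r \<in> carrier R" for r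
  proof -
    let ?s = "r \<ominus> sc (\<epsilon> x r)"
    have s: "?s \<in> carrier R" "\<epsilon> x ?s = 0" using r x by (auto simp: eps_diff)
    have "r = ?s \<oplus> sc (\<epsilon> x r)" using r by (simp add: minus_eq a_assoc l_neg)
    then have "D r = D (?s \<oplus> sc (\<epsilon> x r))" by simp
    also have "\<dots> = D ?s" using s by (simp add: derivationD[OF D])
    also have "\<dots> = ?s \<odot>\<^bsub>M\<^esub> h \<one>" using h(2)[of ?s] hm[OF s(1)] s by (simp add: regular_module_def)
    also have "\<dots> = inner x M (h \<one>) r" using r h1 by (simp add: inner_def M.smult_diff_l)
    finally show ?thesis .
  qed
  then show "\<exists>m\<in>carrier M. \<forall>r\<in>carrier R. D r = inner x M m r" using h1 by blast
qed

text \<open>A nonzero quotient \<open>N/L\<close> has a one-dimensional submodule. Otherwise every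
  element outside \<open>L\<close> could be multiplied by an element of any prescribed augmentation
  kernel and stay outside \<open>L\<close>; along a list as in \<open>nilpotent\<close> this would
  keep the zero multiple of \<open>n\<close> outside \<open>L\<close>.\<close>

lemma one_dimensional_step:
  assumes "left_module R N" "submodule_set R N L" "n \<in> carrier N" "n \<notin> L"
  obtains m x where "m \<in> carrier N" "m \<notin> L" "x \<in> V" "!!r. r \<in> carrier R ==> (r \<ominus> sc (\<epsilon> x r)) \<odot>\<^bsub>N\<^esub> m \<in> L"
proof (rule ccontr)
  interpret N: left_module R N by fact
  assume "\<not> thesis"
  then have no: "\<exists>r\<in>carrier R. (r \<ominus> sc (\<epsilon> x r)) \<odot>\<^bsub>N\<^esub> m \<notin> L" if "m \<in> carrier N" "m \<notin> L" "x \<in> V" for m x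
    using that \<open>\<not> thesis\<close> \<open>!!m x. [|m \<in> carrier N; m \<notin> L; x \<in> V; !!r. r \<in> carrier R ==> (r \<ominus> sc (\<epsilon> x r)) \<odot>\<^bsub>N\<^esub> m \<in> L|] ==> thesis\<close> by blast
  have "\<exists>t\<in>kernel_products R \<epsilon> xs. t \<in> carrier R \<and> t \<odot>\<^bsub>N\<^esub> n \<notin> L" if "set xs \<subseteq> V" for xs
    using that
  proof (induction xs)
    case Nil
    then show ?case using assms(3,4) by (simp add: N.smult_one)
  next
    case (Cons x xs)
    then obtain t where t: "t \<in> kernel_products R \<epsilon> xs" "t \<in> carrier R" "t \<odot>\<^bsub>N\<^esub> n \<notin> L" by auto
    obtain r where r: "r \<in> carrier R" "(r \<ominus> sc (\<epsilon> x r)) \<odot>\<^bsub>N\<^esub> (t \<odot>\<^bsub>N\<^esub> n) \<notin> L"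
      using no[of "t \<odot>\<^bsub>N\<^esub> n" x] t Cons.prems assms(3) by (auto simp: N.smult_closed)
    let ?r = "r \<ominus> sc (\<epsilon> x r)"
    have "?r \<in> carrier R" "\<epsilon> x ?r = 0" using r Cons.prems by (auto simp: eps_diff)
    then show ?case using t r(2) assms(3) by (intro bexI[of _ "?r \<otimes> t"]) (auto simp: N.smult_assoc)
  qed
  then obtain t where "t = \<zero>" "t \<odot>\<^bsub>N\<^esub> n \<notin> L" using nilpotent by blast
  then show False using submodule_setD(2)[OF assms(2)] assms(3) by (simp add: N.smult_zero_l)
qed

text \<open>Homomorphisms from submodules of \<open>N\<close> to \<open>M\<close>, encoded as
  graphs. For a submodule it is enough to ask for a single value over zero, and unions of chains are
  plain unions of sets.\<close>

definition partial_homs ::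
    "('r, 'm) module => ('r, 'n) module => ('m \<times> 'n) set => ('m \<times> 'n) set set" where
  "partial_homs N M \<Gamma>\<^sub>0 = {\<Gamma>. submodule_set R (prod_module N M) \<Gamma> \<and> (\<forall>y. (\<zero>\<^bsub>N\<^esub>, y) \<in> \<Gamma> --> y = \<zero>\<^bsub>M\<^esub>) \<and> \<Gamma>\<^sub>0 \<subseteq> \<Gamma>}"

lemma partial_hom_unique:
  assumes "left_module R N" "left_module R M" "\<Gamma> \<in> partial_homs N M \<Gamma>\<^sub>0" "(u, y) \<in> \<Gamma>" "(u, z) \<in> \<Gamma>"
  shows "y = z"
proof -
  interpret N: left_module R N by fact
  interpret M: left_module R M by fact
  have G: "submodule_set R (prod_module N M) \<Gamma>" "!!y. (\<zero>\<^bsub>N\<^esub>, y) \<in> \<Gamma> ==> y = \<zero>\<^bsub>M\<^esub>"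
    using assms(3) unfolding partial_homs_def by auto
  have c: "u \<in> carrier N" "y \<in> carrier M" "z \<in> carrier M" using submodule_setD(1)[OF G(1)] assms(4,5) by auto
  have "(\<ominus> \<one>) \<odot>\<^bsub>prod_module N M\<^esub> (u, z) \<in> \<Gamma>" by (rule submodule_setD(4)[OF G(1)]) (use assms in auto)
  then have "(\<ominus>\<^bsub>N\<^esub> u, \<ominus>\<^bsub>M\<^esub> z) \<in> \<Gamma>" using c by (simp add: N.smult_minus_l N.smult_one M.smult_minus_l M.smult_one)
  from submodule_setD(3)[OF G(1) assms(4) this] have "(\<zero>\<^bsub>N\<^esub>, y \<ominus>\<^bsub>M\<^esub> z) \<in> \<Gamma>" using c by (simp add: N.M.r_neg M.M.minus_eq)
  then have "y \<ominus>\<^bsub>M\<^esub> z = \<zero>\<^bsub>M\<^esub>" by (rule G(2))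
  then show ?thesis using c by (metis M.M.add.inv_solve_right M.M.l_zero M.M.minus_eq M.M.zero_closed)
qed

text \<open>The obstruction to adding a vector \<open>m\<close> as in
  \<open>one_dimensional_step\<close> to the domain is a derivation: at \<open>r\<close> it takes
  the value prescribed on \<open>(r - \<epsilon> x r) m\<close>, which already lies in the domain.
  If it is the inner derivation of \<open>d\<close>, sending \<open>m\<close> to \<open>d\<close> is
  consistent.\<close>

lemma partial_hom_extend:
  assumes N: "left_module R N" and M: "left_module R M" and di: "derivations_inner M"
    and G: "\<Gamma> \<in> partial_homs N M \<Gamma>\<^sub>0" and n: "n \<in> carrier N" "n \<notin> Domain \<Gamma>"
  shows "\<exists>\<Gamma>'\<in>partial_homs N M \<Gamma>\<^sub>0. \<Gamma> \<subset> \<Gamma>'"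
proof -
  interpret N: left_module R N by fact
  interpret M: left_module R M by fact
  have GD: "submodule_set R (prod_module N M) \<Gamma>" "!!y. (\<zero>\<^bsub>N\<^esub>, y) \<in> \<Gamma> ==> y = \<zero>\<^bsub>M\<^esub>" "\<Gamma>\<^sub>0 \<subseteq> \<Gamma>"
    using G unfolding partial_homs_def by auto
  note GS = submodule_setD[OF GD(1)]
  have Gc: "u \<in> carrier N" "y \<in> carrier M" if "(u, y) \<in> \<Gamma>" for u y using GS(1)[OF that] by auto
  have Gadd: "(u \<oplus>\<^bsub>N\<^esub> u', y \<oplus>\<^bsub>M\<^esub> y') \<in> \<Gamma>" if "(u, y) \<in> \<Gamma>" "(u', y') \<in> \<Gamma>" for u u' y y'
    using GS(3)[OF that] by simp
  have Gsm: "(r \<odot>\<^bsub>N\<^esub> u, r \<odot>\<^bsub>M\<^esub> y) \<in> \<Gamma>" if "(u, y) \<in> \<Gamma>" "r \<in> carrier R" for u y r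
    using GS(4)[OF that(2,1)] by simp
  note uniq = partial_hom_unique[OF N M G]
  have dom: "submodule_set R N (Domain \<Gamma>)" unfolding submodule_set_def
  proof (intro conjI ballI subsetI)
    show "\<zero>\<^bsub>N\<^esub> \<in> Domain \<Gamma>" using GS(2) by (simp add: DomainI)
    fix u assume "u \<in> Domain \<Gamma>"
    then obtain y where y: "(u, y) \<in> \<Gamma>" by blast
    show "u \<in> carrier N" by (rule Gc(1)[OF y])
    { fix u' assume "u' \<in> Domain \<Gamma>"
      then obtain y' where y': "(u', y') \<in> \<Gamma>" by blast
      show "u \<oplus>\<^bsub>N\<^esub> u' \<in> Domain \<Gamma>" by (rule DomainI[OF Gadd[OF y y']]) }
    fix r assume "r \<in> carrier R"
    then show "r \<odot>\<^bsub>N\<^esub> u \<in> Domain \<Gamma>" by (rule DomainI[OF Gsm[OF y]])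
  qed
  obtain m x where m: "m \<in> carrier N" "m \<notin> Domain \<Gamma>" "x \<in> V"
    "!!r. r \<in> carrier R ==> (r \<ominus> sc (\<epsilon> x r)) \<odot>\<^bsub>N\<^esub> m \<in> Domain \<Gamma>"
    using one_dimensional_step[OF N dom n] by blast
  define D where "D r = (THE y. ((r \<ominus> sc (\<epsilon> x r)) \<odot>\<^bsub>N\<^esub> m, y) \<in> \<Gamma>)" for r
  have DI: "D r = y" if "((r \<ominus> sc (\<epsilon> x r)) \<odot>\<^bsub>N\<^esub> m, y) \<in> \<Gamma>" for r y
    unfolding D_def using that uniq by blast
  have D: "((r \<ominus> sc (\<epsilon> x r)) \<odot>\<^bsub>N\<^esub> m, D r) \<in> \<Gamma>" if "r \<in> carrier R" for r
    using m(4)[OF that] DI by (metis DomainE)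
  have "derivation x M D" unfolding derivation_def
  proof (intro conjI ballI allI)
    show "D ` carrier R \<subseteq> carrier M" using D Gc by blast
    fix r s assume rs: "r \<in> carrier R" "s \<in> carrier R"
    have "(r \<oplus> s) \<ominus> sc (\<epsilon> x (r \<oplus> s)) = (r \<ominus> sc (\<epsilon> x r)) \<oplus> (s \<ominus> sc (\<epsilon> x s))"
      using rs m(3) by (simp add: eps_add sc_add minus_eq minus_add a_ac)
    then show "D (r \<oplus> s) = D r \<oplus>\<^bsub>M\<^esub> D s"
      using Gadd[OF D[OF rs(1)] D[OF rs(2)]] rs m(1) by (intro DI) (simp add: N.smult_l_distr)
    have "(r \<otimes> s) \<ominus> sc (\<epsilon> x (r \<otimes> s)) = r \<otimes> (s \<ominus> sc (\<epsilon> x s)) \<oplus> sc (\<epsilon> x s) \<otimes> (r \<ominus> sc (\<epsilon> x r))"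
    proof -
      have "sc (\<epsilon> x r * \<epsilon> x s) = sc (\<epsilon> x s) \<otimes> sc (\<epsilon> x r)" by (metis mult.commute sc_mult)
      moreover have "sc (\<epsilon> x s) \<otimes> r = r \<otimes> sc (\<epsilon> x s)" using rs by (simp add: sc_commute)
      ultimately show ?thesis using rs m(3) by (simp add: eps_mult minus_eq r_distr r_minus a_assoc r_neg1 r_neg2)
    qed
    then show "D (r \<otimes> s) = r \<odot>\<^bsub>M\<^esub> D s \<oplus>\<^bsub>M\<^esub> sc (\<epsilon> x s) \<odot>\<^bsub>M\<^esub> D r"
      using Gadd[OF Gsm[OF D[OF rs(2)] rs(1)] Gsm[OF D[OF rs(1)] sc_closed]] rs m(1) by (intro DI) (simp add: N.smult_l_distr N.smult_assoc)
  next
    fix c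
    show "D (sc c) = \<zero>\<^bsub>M\<^esub>" using GS(2) m by (intro DI) (simp add: minus_eq r_neg N.smult_zero_l)
  qed
  then obtain d where d: "d \<in> carrier M" "!!r. r \<in> carrier R ==> D r = inner x M d r"
    using di m(3) unfolding derivations_inner_def by blast
  \<comment> \<open>Adding scalar multiples of \<open>m\<close> suffices: a ring multiple of
    \<open>m\<close> differs from a scalar one by an element of the old domain.\<close>
  define \<Gamma>' where "\<Gamma>' = {(u \<oplus>\<^bsub>N\<^esub> sc c \<odot>\<^bsub>N\<^esub> m, y \<oplus>\<^bsub>M\<^esub> sc c \<odot>\<^bsub>M\<^esub> d) |u y c. (u, y) \<in> \<Gamma>}"
  have sub: "\<Gamma> \<subseteq> \<Gamma>'"
  proof
    fix z assume z: "z \<in> \<Gamma>"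
    then have "z = (fst z \<oplus>\<^bsub>N\<^esub> sc 0 \<odot>\<^bsub>N\<^esub> m, snd z \<oplus>\<^bsub>M\<^esub> sc 0 \<odot>\<^bsub>M\<^esub> d)"
      using m d Gc[of "fst z" "snd z"] by (simp add: N.smult_zero_l M.smult_zero_l)
    then show "z \<in> \<Gamma>'" unfolding \<Gamma>'_def using z by (intro CollectI exI[of _ "fst z"] exI[of _ "snd z"] exI[of _ 0]) simp
  qed
  have "(\<zero>\<^bsub>N\<^esub>, \<zero>\<^bsub>M\<^esub>) \<in> \<Gamma>" using GS(2) by simp
  then have "(\<zero>\<^bsub>N\<^esub> \<oplus>\<^bsub>N\<^esub> sc 1 \<odot>\<^bsub>N\<^esub> m, \<zero>\<^bsub>M\<^esub> \<oplus>\<^bsub>M\<^esub> sc 1 \<odot>\<^bsub>M\<^esub> d) \<in> \<Gamma>'" unfolding \<Gamma>'_def by blast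
  then have mem: "(m, d) \<in> \<Gamma>'" using m d by (simp add: N.smult_one M.smult_one)
  have "\<Gamma>' \<in> partial_homs N M \<Gamma>\<^sub>0" unfolding partial_homs_def
  proof (intro CollectI conjI allI impI)
    show "\<Gamma>\<^sub>0 \<subseteq> \<Gamma>'" using sub GD(3) by blast
    show "submodule_set R (prod_module N M) \<Gamma>'" unfolding submodule_set_def
    proof (intro conjI ballI)
      show "\<Gamma>' \<subseteq> carrier (prod_module N M)" using Gc m d by (auto simp: \<Gamma>'_def N.smult_closed M.smult_closed)
      show "\<zero>\<^bsub>prod_module N M\<^esub> \<in> \<Gamma>'" using sub GS(2) by blast
      fix z assume "z \<in> \<Gamma>'"
      then obtain u y c where z: "z = (u \<oplus>\<^bsub>N\<^esub> sc c \<odot>\<^bsub>N\<^esub> m, y \<oplus>\<^bsub>M\<^esub> sc c \<odot>\<^bsub>M\<^esub> d)" "(u, y) \<in> \<Gamma>"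
        unfolding \<Gamma>'_def by blast
      { fix z' assume "z' \<in> \<Gamma>'"
        then obtain u' y' c' where z': "z' = (u' \<oplus>\<^bsub>N\<^esub> sc c' \<odot>\<^bsub>N\<^esub> m, y' \<oplus>\<^bsub>M\<^esub> sc c' \<odot>\<^bsub>M\<^esub> d)" "(u', y') \<in> \<Gamma>"
          unfolding \<Gamma>'_def by blast
        have "z \<oplus>\<^bsub>prod_module N M\<^esub> z' =
          ((u \<oplus>\<^bsub>N\<^esub> u') \<oplus>\<^bsub>N\<^esub> sc (c + c') \<odot>\<^bsub>N\<^esub> m, (y \<oplus>\<^bsub>M\<^esub> y') \<oplus>\<^bsub>M\<^esub> sc (c + c') \<odot>\<^bsub>M\<^esub> d)"
          using z z' Gc m d by (simp add: sc_add N.smult_l_distr M.smult_l_distr N.smult_closed M.smult_closed N.M.a_ac M.M.a_ac)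
        then show "z \<oplus>\<^bsub>prod_module N M\<^esub> z' \<in> \<Gamma>'"
          unfolding \<Gamma>'_def using Gadd[OF z(2) z'(2)] by blast }
      fix r assume r: "r \<in> carrier R"
      let ?k = "r \<ominus> sc (\<epsilon> x r)"
      let ?u = "r \<odot>\<^bsub>N\<^esub> u \<oplus>\<^bsub>N\<^esub> sc c \<odot>\<^bsub>N\<^esub> (?k \<odot>\<^bsub>N\<^esub> m)" and ?y = "r \<odot>\<^bsub>M\<^esub> y \<oplus>\<^bsub>M\<^esub> sc c \<odot>\<^bsub>M\<^esub> D r"
      have uy: "(?u, ?y) \<in> \<Gamma>" by (rule Gadd[OF Gsm[OF z(2) r] Gsm[OF D[OF r] sc_closed]])
      have kr: "?k \<oplus> sc (\<epsilon> x r) = r" using r by (simp add: minus_eq a_assoc l_neg)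
      have rm: "?k \<odot>\<^bsub>N\<^esub> m \<oplus>\<^bsub>N\<^esub> sc (\<epsilon> x r) \<odot>\<^bsub>N\<^esub> m = r \<odot>\<^bsub>N\<^esub> m"
        using N.smult_l_distr[of ?k "sc (\<epsilon> x r)" m] kr r m by simp
      have rd: "D r \<oplus>\<^bsub>M\<^esub> sc (\<epsilon> x r) \<odot>\<^bsub>M\<^esub> d = r \<odot>\<^bsub>M\<^esub> d"
        using d r by (simp add: inner_def M.M.minus_eq M.M.a_assoc M.M.l_neg M.smult_closed)
      have "r \<odot>\<^bsub>N\<^esub> (u \<oplus>\<^bsub>N\<^esub> sc c \<odot>\<^bsub>N\<^esub> m) = ?u \<oplus>\<^bsub>N\<^esub> sc (c * \<epsilon> x r) \<odot>\<^bsub>N\<^esub> m"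
      proof -
        have "r \<odot>\<^bsub>N\<^esub> (u \<oplus>\<^bsub>N\<^esub> sc c \<odot>\<^bsub>N\<^esub> m) = r \<odot>\<^bsub>N\<^esub> u \<oplus>\<^bsub>N\<^esub> sc c \<odot>\<^bsub>N\<^esub> (r \<odot>\<^bsub>N\<^esub> m)"
          using r m Gc[OF z(2)] by (simp add: N.smult_r_distr N.smult_closed sc_smult_commute[OF N])
        also have "\<dots> = ?u \<oplus>\<^bsub>N\<^esub> sc (c * \<epsilon> x r) \<odot>\<^bsub>N\<^esub> m"
          unfolding rm[symmetric] using r m Gc[OF z(2)] by (simp add: N.smult_r_distr N.smult_closed sc_mult N.smult_assoc N.M.a_assoc)
        finally show ?thesis .
      qed
      moreover have "r \<odot>\<^bsub>M\<^esub> (y \<oplus>\<^bsub>M\<^esub> sc c \<odot>\<^bsub>M\<^esub> d) = ?y \<oplus>\<^bsub>M\<^esub> sc (c * \<epsilon> x r) \<odot>\<^bsub>M\<^esub> d"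
      proof -
        have Dr: "D r \<in> carrier M" using D[OF r] Gc by blast
        have "r \<odot>\<^bsub>M\<^esub> (y \<oplus>\<^bsub>M\<^esub> sc c \<odot>\<^bsub>M\<^esub> d) = r \<odot>\<^bsub>M\<^esub> y \<oplus>\<^bsub>M\<^esub> sc c \<odot>\<^bsub>M\<^esub> (r \<odot>\<^bsub>M\<^esub> d)"
          using r d Gc[OF z(2)] by (simp add: M.smult_r_distr M.smult_closed sc_smult_commute[OF M])
        also have "\<dots> = ?y \<oplus>\<^bsub>M\<^esub> sc (c * \<epsilon> x r) \<odot>\<^bsub>M\<^esub> d"
          unfolding rd[symmetric] using r d(1) Gc[OF z(2)] Dr
          by (simp add: M.smult_r_distr M.smult_closed sc_mult M.smult_assoc M.M.a_assoc)
        finally show ?thesis .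
      qed
      ultimately show "r \<odot>\<^bsub>prod_module N M\<^esub> z \<in> \<Gamma>'" unfolding \<Gamma>'_def z(1) using uy by auto
    qed
    fix t assume "(\<zero>\<^bsub>N\<^esub>, t) \<in> \<Gamma>'"
    then obtain u y c where z: "\<zero>\<^bsub>N\<^esub> = u \<oplus>\<^bsub>N\<^esub> sc c \<odot>\<^bsub>N\<^esub> m" "t = y \<oplus>\<^bsub>M\<^esub> sc c \<odot>\<^bsub>M\<^esub> d" "(u, y) \<in> \<Gamma>"
      unfolding \<Gamma>'_def by blast
    \<comment> \<open>Over a field, a nonzero multiple of \<open>m\<close> in the domain would put
      \<open>m\<close> itself there.\<close>
    have "c = 0"
    proof (rule ccontr)
      assume c: "c \<noteq> 0"
      have "sc c \<odot>\<^bsub>N\<^esub> m = \<ominus>\<^bsub>N\<^esub> u"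
        using z(1) Gc[OF z(3)] m(1) by (metis N.M.add.m_comm N.M.minus_equality N.smult_closed sc_closed)
      then have "sc c \<odot>\<^bsub>N\<^esub> m \<in> Domain \<Gamma>" using N.submodule_minus[OF dom] z(3) by auto
      then have "sc (inverse c) \<odot>\<^bsub>N\<^esub> (sc c \<odot>\<^bsub>N\<^esub> m) \<in> Domain \<Gamma>" by (rule submodule_setD(4)[OF dom sc_closed])
      then show False using m(1,2) c by (simp add: N.smult_assoc[symmetric] sc_mult[symmetric] N.smult_one)
    qed
    then have "u = \<zero>\<^bsub>N\<^esub>" "t = y" using z Gc[OF z(3)] m d by (auto simp: N.smult_zero_l M.smult_zero_l)
    then show "t = \<zero>\<^bsub>M\<^esub>" using GD(2) z(3) by simp
  qed
  moreover have "\<Gamma> \<noteq> \<Gamma>'" using mem m(2) by blast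
  ultimately show ?thesis using sub by blast
qed

text \<open>Zorn's lemma gives a maximal partial extension, and \<open>partial_hom_extend\<close>
  shows that it is defined everywhere.\<close>

lemma derivations_inner_imp_injective:
  assumes fg: "fg_module R M" and di: "derivations_inner M"
  shows "injective_module R M" unfolding injective_module_def
proof (intro conjI allI impI fg; elim conjE)
  fix L N :: "('r, 'r fg_carrier) module" and f g
  assume *: "fg_module R L" "fg_module R N" "f \<in> mod_hom R L N" "inj_on f (carrier L)" "g \<in> mod_hom R L M"
  interpret M: left_module R M using fg by (rule fg_module_left)
  interpret L: left_module R L using *(1) by (rule fg_module_left)
  interpret N: left_module R N using *(2) by (rule fg_module_left)
  note lmP = left_module_prod[OF N.left_module_axioms M.left_module_axioms]
  let ?\<G>0 = "(\<lambda>x. (f x, g x)) ` carrier L"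
  let ?A = "partial_homs N M ?\<G>0"
  have "?\<G>0 \<in> ?A"
  proof -
    have "y = \<zero>\<^bsub>M\<^esub>" if "(\<zero>\<^bsub>N\<^esub>, y) \<in> ?\<G>0" for y
    proof -
      from that obtain l where l: "l \<in> carrier L" "f l = \<zero>\<^bsub>N\<^esub>" "y = g l" by auto
      then have "l = \<zero>\<^bsub>L\<^esub>"
        using inj_onD[OF *(4), of l "\<zero>\<^bsub>L\<^esub>"] mod_hom_zero[OF *(3) L.left_module_axioms N.left_module_axioms] by simp
      then show ?thesis using l mod_hom_zero[OF *(5) L.left_module_axioms M.left_module_axioms] by simp
    qed
    then show ?thesis unfolding partial_homs_def using submodule_image[OF L.left_module_axioms lmP mod_hom_pair[OF *(3,5)]] by auto
  qed
  then have ne: "?A \<noteq> {}" by blast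
  have "\<exists>\<Gamma>\<in>?A. \<forall>\<Gamma>'\<in>?A. \<Gamma> \<subseteq> \<Gamma>' --> \<Gamma>' = \<Gamma>"
  proof (rule subset_Zorn_nonempty[OF ne])
    fix \<C> assume C: "\<C> \<noteq> {}" "subset.chain ?A \<C>"
    have sub: "\<Gamma> \<in> ?A" if "\<Gamma> \<in> \<C>" for \<Gamma> using C(2) that by (auto simp: subset.chain_def)
    have tot: "\<Gamma> \<subseteq> \<Gamma>' \<or> \<Gamma>' \<subseteq> \<Gamma>" if "\<Gamma> \<in> \<C>" "\<Gamma>' \<in> \<C>" for \<Gamma> \<Gamma>'
      using C(2) that by (auto simp: subset.chain_def)
    have S: "submodule_set R (prod_module N M) \<Gamma>" if "\<Gamma> \<in> \<C>" for \<Gamma>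
      using sub[OF that] by (auto simp: partial_homs_def)
    have "submodule_set R (prod_module N M) (\<Union>\<C>)" unfolding submodule_set_def
    proof (intro conjI ballI)
      show "\<Union>\<C> \<subseteq> carrier (prod_module N M)" using submodule_setD(1)[OF S] by blast
      show "\<zero>\<^bsub>prod_module N M\<^esub> \<in> \<Union>\<C>" using submodule_setD(2)[OF S] C(1) by blast
      fix z assume "z \<in> \<Union>\<C>"
      then obtain \<Gamma> where z: "\<Gamma> \<in> \<C>" "z \<in> \<Gamma>" by blast
      { fix z' assume "z' \<in> \<Union>\<C>"
        then obtain \<Gamma>' where z': "\<Gamma>' \<in> \<C>" "z' \<in> \<Gamma>'" by blast
        show "z \<oplus>\<^bsub>prod_module N M\<^esub> z' \<in> \<Union>\<C>"
          using tot[OF z(1) z'(1)] submodule_setD(3)[OF S[OF z(1)]] submodule_setD(3)[OF S[OF z'(1)]] z z' by blast }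
      fix r assume "r \<in> carrier R"
      then show "r \<odot>\<^bsub>prod_module N M\<^esub> z \<in> \<Union>\<C>" using submodule_setD(4)[OF S[OF z(1)] _ z(2)] z(1) by blast
    qed
    moreover have "\<forall>y. (\<zero>\<^bsub>N\<^esub>, y) \<in> \<Union>\<C> --> y = \<zero>\<^bsub>M\<^esub>" using sub by (auto simp: partial_homs_def)
    moreover have "?\<G>0 \<subseteq> \<Union>\<C>" using sub C(1) unfolding partial_homs_def by blast
    ultimately show "\<Union>\<C> \<in> ?A" by (simp add: partial_homs_def)
  qed
  then obtain \<Gamma> where G: "\<Gamma> \<in> ?A" and max: "!!\<Gamma>'. \<Gamma>' \<in> ?A ==> \<Gamma> \<subseteq> \<Gamma>' ==> \<Gamma>' = \<Gamma>" by blast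
  have dom: "n \<in> Domain \<Gamma>" if "n \<in> carrier N" for n
    using partial_hom_extend[OF N.left_module_axioms M.left_module_axioms di G that] max by blast
  have GS: "submodule_set R (prod_module N M) \<Gamma>" "?\<G>0 \<subseteq> \<Gamma>" using G by (auto simp: partial_homs_def)
  define h where "h n = (THE y. (n, y) \<in> \<Gamma>)" for n
  have hI: "h n = y" if "(n, y) \<in> \<Gamma>" for n y
    unfolding h_def using that partial_hom_unique[OF N.left_module_axioms M.left_module_axioms G] by blast
  have h: "(n, h n) \<in> \<Gamma>" if "n \<in> carrier N" for n using dom[OF that] hI by (metis DomainE)
  have "h \<in> mod_hom R N M"
  proof (rule mod_homI)
    show "h n \<in> carrier M" if "n \<in> carrier N" for n using submodule_setD(1)[OF GS(1) h[OF that]] by simp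
    show "h (n \<oplus>\<^bsub>N\<^esub> n') = h n \<oplus>\<^bsub>M\<^esub> h n'" if "n \<in> carrier N" "n' \<in> carrier N" for n n'
      using submodule_setD(3)[OF GS(1) h[OF that(1)] h[OF that(2)]] by (intro hI) simp
    show "h (r \<odot>\<^bsub>N\<^esub> n) = r \<odot>\<^bsub>M\<^esub> h n" if "r \<in> carrier R" "n \<in> carrier N" for r n
      using submodule_setD(4)[OF GS(1) that(1) h[OF that(2)]] by (intro hI) simp
  qed
  moreover have "h (f x) = g x" if "x \<in> carrier L" for x using GS(2) that by (intro hI) blast
  ultimately show "\<exists>h\<in>mod_hom R N M. \<forall>x\<in>carrier L. h (f x) = g x" by blast
qed

section \<open>Coinduced modules and enough injectives\<close>

text \<open>This is Hom_K(R, M) with the left action (r h)(s) = h(s r); only the vector space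
  structure of \<open>M\<close> enters. The functions are fixed outside the carrier so that equality
  of functions is equality of maps.\<close>

definition coinduced :: "('r, 'm) module => ('r, 'r => 'm) module" where
  "coinduced M =
     \<lparr> carrier = {h \<in> carrier R \<rightarrow>\<^sub>E carrier M.
         (\<forall>r\<in>carrier R. \<forall>s\<in>carrier R. h (r \<oplus> s) = h r \<oplus>\<^bsub>M\<^esub> h s) \<and>
         (\<forall>c. \<forall>r\<in>carrier R. h (sc c \<otimes> r) = sc c \<odot>\<^bsub>M\<^esub> h r)},
       monoid.mult = undefined, monoid.one = undefined,
       ring.zero = (\<lambda>r\<in>carrier R. \<zero>\<^bsub>M\<^esub>), ring.add = (\<lambda>h k. \<lambda>r\<in>carrier R. h r \<oplus>\<^bsub>M\<^esub> k r),
       module.smult = (\<lambda>r h. \<lambda>s\<in>carrier R. h (s \<otimes> r)) \<rparr>"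

lemma coinduced_simps:
  "\<zero>\<^bsub>coinduced M\<^esub> = (\<lambda>r\<in>carrier R. \<zero>\<^bsub>M\<^esub>)"
  "h \<oplus>\<^bsub>coinduced M\<^esub> k = (\<lambda>r\<in>carrier R. h r \<oplus>\<^bsub>M\<^esub> k r)"
  "r \<odot>\<^bsub>coinduced M\<^esub> h = (\<lambda>s\<in>carrier R. h (s \<otimes> r))" by (simp_all add: coinduced_def)

lemma coinducedD:
  assumes "h \<in> carrier (coinduced M)"
  shows "h \<in> extensional (carrier R)" "r \<in> carrier R ==> h r \<in> carrier M"
    "r \<in> carrier R ==> s \<in> carrier R ==> h (r \<oplus> s) = h r \<oplus>\<^bsub>M\<^esub> h s"
    "r \<in> carrier R ==> h (sc c \<otimes> r) = sc c \<odot>\<^bsub>M\<^esub> h r"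
  using assms unfolding coinduced_def by (auto simp: PiE_def)

lemma coinducedI:
  assumes "!!r. r \<in> carrier R ==> h r \<in> carrier M"
    "!!r s. r \<in> carrier R ==> s \<in> carrier R ==> h (r \<oplus> s) = h r \<oplus>\<^bsub>M\<^esub> h s"
    "!!r c. r \<in> carrier R ==> h (sc c \<otimes> r) = sc c \<odot>\<^bsub>M\<^esub> h r"
  shows "restrict h (carrier R) \<in> carrier (coinduced M)" using assms unfolding coinduced_def by auto

lemma coinduced_eqI:
  assumes "h \<in> extensional (carrier R)" "k \<in> extensional (carrier R)"
    "!!r. r \<in> carrier R ==> h r = k r"
  shows "h = k" using assms by (rule extensionalityI)

lemma left_module_coinduced:
  assumes "left_module R M"
  shows "left_module R (coinduced M)"
proof -
  interpret M: left_module R M by fact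
  let ?I = "coinduced M"
  note simps = coinduced_simps
  have add: "h \<oplus>\<^bsub>?I\<^esub> k \<in> carrier ?I" if "h \<in> carrier ?I" "k \<in> carrier ?I" for h k unfolding simps
    by (rule coinducedI) (use coinducedD[OF that(1)] coinducedD[OF that(2)] in "auto simp: M.smult_r_distr M.M.a_ac")
  have zero: "\<zero>\<^bsub>?I\<^esub> \<in> carrier ?I" unfolding simps by (rule coinducedI) (auto simp: M.smult_zero_r)
  have ag: "abelian_group ?I"
  proof (rule abelian_groupI)
    fix h assume h: "h \<in> carrier ?I"
    note hD = coinducedD[OF h]
    have "(\<lambda>r\<in>carrier R. \<ominus>\<^bsub>M\<^esub> h r) \<in> carrier ?I"
      by (rule coinducedI) (use hD in "auto simp: M.smult_minus_r M.M.minus_add")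
    moreover have "(\<lambda>r\<in>carrier R. \<ominus>\<^bsub>M\<^esub> h r) \<oplus>\<^bsub>?I\<^esub> h = \<zero>\<^bsub>?I\<^esub>"
      unfolding simps by (rule restrict_ext) (simp add: hD M.M.l_neg)
    ultimately show "\<exists>y\<in>carrier ?I. y \<oplus>\<^bsub>?I\<^esub> h = \<zero>\<^bsub>?I\<^esub>" by blast
    show "\<zero>\<^bsub>?I\<^esub> \<oplus>\<^bsub>?I\<^esub> h = h" by (rule coinduced_eqI) (simp_all add: simps hD)
    fix k assume k: "k \<in> carrier ?I"
    show "h \<oplus>\<^bsub>?I\<^esub> k = k \<oplus>\<^bsub>?I\<^esub> h"
      unfolding simps by (rule restrict_ext) (simp add: hD coinducedD[OF k] M.M.a_comm)
    fix l assume l: "l \<in> carrier ?I"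
    show "h \<oplus>\<^bsub>?I\<^esub> k \<oplus>\<^bsub>?I\<^esub> l = h \<oplus>\<^bsub>?I\<^esub> (k \<oplus>\<^bsub>?I\<^esub> l)"
      unfolding simps by (rule restrict_ext) (simp add: hD coinducedD[OF k] coinducedD[OF l] M.M.a_assoc)
  qed (use add zero in auto)
  show ?thesis
  proof (rule left_moduleI[OF ring_axioms ag])
    fix r h assume r: "r \<in> carrier R" and h: "h \<in> carrier ?I"
    note hD = coinducedD[OF h]
    show "r \<odot>\<^bsub>?I\<^esub> h \<in> carrier ?I" unfolding simps by (rule coinducedI) (use r hD in "auto simp: l_distr m_assoc")
    fix s assume s: "s \<in> carrier R"
    show "(r \<oplus> s) \<odot>\<^bsub>?I\<^esub> h = r \<odot>\<^bsub>?I\<^esub> h \<oplus>\<^bsub>?I\<^esub> s \<odot>\<^bsub>?I\<^esub> h"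
      unfolding simps by (rule restrict_ext) (simp add: r s hD r_distr)
    show "(r \<otimes> s) \<odot>\<^bsub>?I\<^esub> h = r \<odot>\<^bsub>?I\<^esub> (s \<odot>\<^bsub>?I\<^esub> h)"
      unfolding simps by (rule restrict_ext) (simp add: r s hD m_assoc)
  next
    fix r h k assume r: "r \<in> carrier R" and h: "h \<in> carrier ?I" "k \<in> carrier ?I"
    show "r \<odot>\<^bsub>?I\<^esub> (h \<oplus>\<^bsub>?I\<^esub> k) = r \<odot>\<^bsub>?I\<^esub> h \<oplus>\<^bsub>?I\<^esub> r \<odot>\<^bsub>?I\<^esub> k"
      unfolding simps by (rule restrict_ext) (simp add: r)
  next
    fix h assume h: "h \<in> carrier ?I"
    show "\<one> \<odot>\<^bsub>?I\<^esub> h = h" by (rule coinduced_eqI) (simp_all add: simps coinducedD[OF h])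
  qed
qed

text \<open>Each \<open>h\<close> is the sum over \<open>b\<close> of the maps that send
  \<open>r\<close> to \<open>co b r\<close> times \<open>h (w b)\<close>. Hence the maps
  \<open>e b t\<close> generate, with \<open>t\<close> in a finite spanning set of
  \<open>M\<close>.\<close>

lemma fg_module_coinduced:
  assumes fg: "fg_module R M"
  shows "fg_module R (coinduced M)"
proof -
  interpret M: left_module R M using fg by (rule fg_module_left)
  let ?I = "coinduced M"
  interpret I: left_module R ?I by (rule left_module_coinduced[OF M.left_module_axioms])
  obtain T where T: "finite T" "T \<subseteq> carrier M"
    "!!H. [|H \<subseteq> carrier M; \<zero>\<^bsub>M\<^esub> \<in> H; !!x y. x \<in> H ==> y \<in> H ==> x \<oplus>\<^bsub>M\<^esub> y \<in> H;
      !!c x. x \<in> H ==> sc c \<odot>\<^bsub>M\<^esub> x \<in> H; T \<subseteq> H|] ==> H = carrier M"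
    using fg_module_K_span[OF fg] by blast
  obtain F :: "nat set" and w co where dual: "finite F" "w \<in> F \<rightarrow> carrier R"
    "\<forall>b\<in>F. lin_functional R sc (co b)" "\<forall>r\<in>carrier R. r = (\<Oplus>b\<in>F. sc (co b r) \<otimes> w b)"
    using dual_basis by (elim exE conjE)
  note F = dual(1,2) bspec[OF dual(3)] bspec[OF dual(4)] and wF [simp] = funcset_mem[OF dual(2)]
  have coadd: "co b (r \<oplus> s) = co b r + co b s" and cosc: "co b (sc c \<otimes> r) = c * co b r"
    if "b \<in> F" "r \<in> carrier R" "s \<in> carrier R" for b r s c using F(3)[OF that(1)] that(2,3) by (auto simp: lin_functional_def)
  define e where "e b m = (\<lambda>r\<in>carrier R. sc (co b r) \<odot>\<^bsub>M\<^esub> m)" for b m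
  have e: "e b m \<in> carrier ?I" if "b \<in> F" "m \<in> carrier M" for b m unfolding e_def
    by (rule coinducedI) (use that in "auto simp: coadd cosc sc_add sc_mult M.smult_closed M.smult_l_distr M.smult_assoc")
  show ?thesis
  proof (rule fg_module_K_spanI[OF I.left_module_axioms, of "(\<lambda>(b, t). e b t) ` (F \<times> T)"])
    fix H assume H: "submodule_set R ?I H" "(\<lambda>(b, t). e b t) ` (F \<times> T) \<subseteq> H"
    have eH: "e b m \<in> H" if b: "b \<in> F" and m: "m \<in> carrier M" for b m
    proof -
      \<comment> \<open>For fixed \<open>b\<close> the admissible \<open>m\<close> form a subspace,
        so it suffices to look at the spanning set \<open>T\<close>.\<close>
      let ?H = "{m \<in> carrier M. e b m \<in> H}"
      have "?H = carrier M"
      proof (rule T(3))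
        have "e b \<zero>\<^bsub>M\<^esub> = \<zero>\<^bsub>?I\<^esub>" unfolding e_def coinduced_simps by (rule restrict_ext) (simp add: M.smult_zero_r)
        then show "\<zero>\<^bsub>M\<^esub> \<in> ?H" using submodule_setD(2)[OF H(1)] by simp
        show "T \<subseteq> ?H" using H(2) T(2) b by auto
        fix m n assume "m \<in> ?H" "n \<in> ?H"
        moreover from this have "e b (m \<oplus>\<^bsub>M\<^esub> n) = e b m \<oplus>\<^bsub>?I\<^esub> e b n"
          unfolding e_def coinduced_simps by (intro restrict_ext) (simp add: M.smult_r_distr)
        ultimately show "m \<oplus>\<^bsub>M\<^esub> n \<in> ?H" using submodule_setD(3)[OF H(1)] by simp
      next
        fix c m assume m: "m \<in> ?H"
        have "e b (sc c \<odot>\<^bsub>M\<^esub> m) = sc c \<odot>\<^bsub>?I\<^esub> e b m" unfolding e_def coinduced_simps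
        proof (rule restrict_ext)
          fix r assume r: "r \<in> carrier R"
          \<comment> \<open>The action multiplies the argument on the right by \<open>sc c\<close>;
            centrality of scalars brings the factor to the left, where \<open>co b\<close> is
            linear.\<close>
          have "co b (r \<otimes> sc c) = c * co b r" using cosc[OF b r r, of c] r by (simp add: sc_commute)
          then show "sc (co b r) \<odot>\<^bsub>M\<^esub> (sc c \<odot>\<^bsub>M\<^esub> m) = (\<lambda>r\<in>carrier R. sc (co b r) \<odot>\<^bsub>M\<^esub> m) (r \<otimes> sc c)"
            using m r by (simp add: sc_mult[symmetric] M.smult_assoc[symmetric] mult.commute)
        qed
        then show "sc c \<odot>\<^bsub>M\<^esub> m \<in> ?H" using m submodule_setD(4)[OF H(1)] by (simp add: M.smult_closed)
      qed auto
      then show ?thesis using m by blast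
    qed
    have "h \<in> H" if h: "h \<in> carrier ?I" for h
    proof -
      note hD = coinducedD[OF h]
      have cl: "(\<lambda>b. e b (h (w b))) \<in> F \<rightarrow> carrier ?I" using e hD(2) F(2) by auto
      let ?s = "\<Oplus>\<^bsub>?I\<^esub>b\<in>F. e b (h (w b))"
      have sI: "?s \<in> carrier ?I" by (rule I.M.finsum_closed[OF cl])
      have "h = ?s"
      proof (rule coinduced_eqI)
        show "?s \<in> extensional (carrier R)" by (rule coinducedD(1)[OF sI])
        fix r assume r: "r \<in> carrier R"
        have cl2: "(\<lambda>b. sc (co b r) \<otimes> w b) \<in> F \<rightarrow> carrier R" using F(2) by auto
        have "?s r = (\<Oplus>\<^bsub>M\<^esub>b\<in>F. e b (h (w b)) r)"
          by (rule finsum_additive[OF I.M.abelian_group_axioms M.M.abelian_group_axioms _ _ cl, of "\<lambda>h. h r"])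
             (use r in "auto simp: coinducedD coinduced_simps")
        also have "\<dots> = (\<Oplus>\<^bsub>M\<^esub>b\<in>F. h (sc (co b r) \<otimes> w b))"
          by (rule M.M.finsum_cong') (use hD r in "auto simp: e_def M.smult_closed")
        also have "\<dots> = h (\<Oplus>b\<in>F. sc (co b r) \<otimes> w b)"
          by (rule finsum_additive[OF abelian_group_axioms M.M.abelian_group_axioms _ _ cl2, symmetric])
             (use hD in auto)
        also have "\<dots> = h r" using F(4)[OF r] by simp
        finally show "h r = ?s r" by simp
      qed (rule hD)
      also have "?s \<in> H" by (rule I.submodule_finsum[OF H(1)]) (use eH hD(2) F(2) in auto)
      finally show ?thesis .
    qed
    then show "H = carrier ?I" using H(1) by (auto simp: submodule_set_def)
  qed (use F(1) T(1,2) e in auto)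
qed

text \<open>A derivation \<open>D\<close> into the coinduced module is inner via \<open>r \<mapsto> D r 1\<close>.\<close>

lemma injective_module_coinduced:
  assumes fg: "fg_module R M"
  shows "injective_module R (coinduced M)"
proof (rule derivations_inner_imp_injective[OF fg_module_coinduced[OF fg]])
  interpret M: left_module R M using fg by (rule fg_module_left)
  let ?I = "coinduced M"
  interpret I: left_module R ?I by (rule left_module_coinduced[OF M.left_module_axioms])
  show "derivations_inner ?I" unfolding derivations_inner_def
  proof (intro ballI allI impI)
    fix x D assume x: "x \<in> V" and D: "derivation x ?I D"
    note DD = derivationD[OF D]
    note DI = coinducedD[OF DD(1)]
    let ?H = "\<lambda>r\<in>carrier R. D r \<one>"
    have H: "?H \<in> carrier ?I"
    proof (rule coinducedI)
      fix r c assume r: "r \<in> carrier R"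
      have "D (sc c \<otimes> r) \<one> = (sc c \<odot>\<^bsub>?I\<^esub> D r \<oplus>\<^bsub>?I\<^esub> sc (\<epsilon> x r) \<odot>\<^bsub>?I\<^esub> \<zero>\<^bsub>?I\<^esub>) \<one>"
        using DD(3)[OF sc_closed r, of c] DD(4) by simp
      also have "\<dots> = D r (\<one> \<otimes> sc c)"
        using r DD(1)[OF r] DI(2)[OF r] by (simp add: I.smult_zero_r I.smult_closed) (simp add: coinduced_simps)
      also have "\<dots> = sc c \<odot>\<^bsub>M\<^esub> D r \<one>" using DI(4)[OF r, of \<one> c] by simp
      finally show "D (sc c \<otimes> r) \<one> = sc c \<odot>\<^bsub>M\<^esub> D r \<one>" .
    qed (use DD(2) DI(2) in "auto simp: coinduced_simps")
    have H1: "?H \<one> = \<zero>\<^bsub>M\<^esub>" using DD(4)[of 1] by (simp add: coinduced_simps)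
    have "D r = inner x ?I ?H r" if r: "r \<in> carrier R" for r
    proof (rule coinduced_eqI)
      show "D r \<in> extensional (carrier R)" by (rule DI(1)[OF r])
      have "inner x ?I ?H r \<in> carrier ?I" unfolding inner_def using r H by (simp add: I.smult_closed)
      then show "inner x ?I ?H r \<in> extensional (carrier R)" by (rule coinducedD)
      fix s assume s: "s \<in> carrier R"
      \<comment> \<open>The derivation rule evaluated at 1: acting with \<open>s\<close> on
        \<open>D r\<close> and then evaluating at 1 yields \<open>D r s\<close>.\<close>
      have eq: "D (s \<otimes> r) \<one> = D r s \<oplus>\<^bsub>M\<^esub> sc (\<epsilon> x r) \<odot>\<^bsub>M\<^esub> D s \<one>"
        using r s DI(4)[OF s, of \<one> "\<epsilon> x r"] by (simp add: DD(3)) (simp add: coinduced_simps)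
      have neg: "(\<ominus>\<^bsub>?I\<^esub> h) s = \<ominus>\<^bsub>M\<^esub> h s" if h: "h \<in> carrier ?I" for h
      proof -
        have "(\<ominus>\<^bsub>?I\<^esub> h \<oplus>\<^bsub>?I\<^esub> h) s = \<zero>\<^bsub>M\<^esub>" unfolding I.M.l_neg[OF h] using s by (simp add: coinduced_simps)
        then have "(\<ominus>\<^bsub>?I\<^esub> h) s \<oplus>\<^bsub>M\<^esub> h s = \<zero>\<^bsub>M\<^esub>" using s by (simp add: coinduced_simps)
        then show ?thesis using coinducedD(2)[OF h s] coinducedD(2)[OF I.M.a_inv_closed[OF h] s] by (metis M.M.minus_equality)
      qed
      have sr: "sc (\<epsilon> x r) \<odot>\<^bsub>?I\<^esub> ?H \<in> carrier ?I" using H by (simp add: I.smult_closed)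
      have "inner x ?I ?H r s = (r \<odot>\<^bsub>?I\<^esub> ?H) s \<oplus>\<^bsub>M\<^esub> (\<ominus>\<^bsub>?I\<^esub> (sc (\<epsilon> x r) \<odot>\<^bsub>?I\<^esub> ?H)) s"
        unfolding inner_def a_minus_def using s by (simp add: coinduced_simps(2))
      also have "\<dots> = D (s \<otimes> r) \<one> \<oplus>\<^bsub>M\<^esub> \<ominus>\<^bsub>M\<^esub> (?H (s \<otimes> sc (\<epsilon> x r)))"
        unfolding neg[OF sr] using r s by (simp add: coinduced_simps(3))
      also have "?H (s \<otimes> sc (\<epsilon> x r)) = sc (\<epsilon> x r) \<odot>\<^bsub>M\<^esub> D s \<one>"
        using coinducedD(4)[OF H s, of "\<epsilon> x r"] s sc_commute[OF s] by simp
      also have "D (s \<otimes> r) \<one> \<oplus>\<^bsub>M\<^esub> \<ominus>\<^bsub>M\<^esub> (sc (\<epsilon> x r) \<odot>\<^bsub>M\<^esub> D s \<one>) = D r s"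
        unfolding eq using r s DI(2) by (simp add: M.M.a_assoc M.M.r_neg M.smult_closed)
      finally show "D r s = inner x ?I ?H r s" by (rule sym)
    qed
    then show "\<exists>m\<in>carrier ?I. \<forall>r\<in>carrier R. D r = inner x ?I m r" using H by blast
  qed
qed

text \<open>An element \<open>m\<close> is sent to the map \<open>s \<mapsto> s m\<close> in the
  coinduced module; evaluation at 1 shows that this is an embedding.\<close>

theorem enough_injectives: "enough_injectives R" unfolding enough_injectives_def
proof (intro allI impI)
  fix M :: "('r, 'r fg_carrier) module" assume fg: "fg_module R M"
  interpret M: left_module R M using fg by (rule fg_module_left)
  let ?I = "coinduced M"
  interpret I: left_module R ?I by (rule left_module_coinduced[OF M.left_module_axioms])
  define j where "j m = (\<lambda>s\<in>carrier R. s \<odot>\<^bsub>M\<^esub> m)" for m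
  have j: "j \<in> mod_hom R M ?I"
  proof (rule mod_homI)
    show "j m \<in> carrier ?I" if "m \<in> carrier M" for m unfolding j_def
      by (rule coinducedI) (use that in "auto simp: M.smult_closed M.smult_l_distr M.smult_assoc")
  qed (auto simp: j_def coinduced_simps M.smult_r_distr M.smult_assoc intro!: restrict_ext)
  have jinj: "inj_on j (carrier M)"
  proof (rule inj_onI)
    fix m n assume mn: "m \<in> carrier M" "n \<in> carrier M" "j m = j n"
    then have "j m \<one> = j n \<one>" by simp
    then show "m = n" using mn by (simp add: j_def M.smult_one)
  qed
  obtain E :: "('r, 'r fg_carrier) module" and q p where E: "fg_module R E" "q \<in> mod_hom R ?I E"
    "p \<in> mod_hom R E ?I" "!!x. x \<in> carrier ?I ==> p (q x) = x" "!!y. y \<in> carrier E ==> q (p y) = y"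
    using fg_copy_exists[OF fg_module_coinduced[OF fg]] by metis
  interpret E: left_module R E using E(1) by (rule fg_module_left)
  have injE: "injective_module R E" by (rule injective_module_retract[OF injective_module_coinduced[OF fg] E(1) E(3,2)]) (rule E(5))
  have i: "(\<lambda>m. q (j m)) \<in> mod_hom R M E" by (rule mod_hom_comp[OF j E(2)])
  have ii: "inj_on (\<lambda>m. q (j m)) (carrier M)" by (rule inj_onI) (metis E(4) inj_onD[OF jinj] mod_homD(1)[OF j])
  obtain C :: "('r, 'r fg_carrier) module" and r where
    "fg_module R C" "r \<in> mod_hom R E C" "r ` carrier E = carrier C" "mod_kernel E C r = (\<lambda>m. q (j m)) ` carrier M"
    by (rule fg_quotient_exists[OF E(1) submodule_image[OF M.left_module_axioms E.left_module_axioms i]])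
  then show "\<exists>(E :: ('r, 'r fg_carrier) module) C i p. injective_module R E \<and> fg_module R C \<and> short_exact R M E (C :: ('r, 'r fg_carrier) module) i p"
    unfolding short_exact_def using injE i ii by metis
qed

end

section \<open>Opposite rings\<close>

lemma opposite_ring_simps [simp]:
  "carrier (opposite_ring R) = carrier R" "\<one>\<^bsub>opposite_ring R\<^esub> = \<one>\<^bsub>R\<^esub>" "\<zero>\<^bsub>opposite_ring R\<^esub> = \<zero>\<^bsub>R\<^esub>"
  "x \<oplus>\<^bsub>opposite_ring R\<^esub> y = x \<oplus>\<^bsub>R\<^esub> y" "x \<otimes>\<^bsub>opposite_ring R\<^esub> y = y \<otimes>\<^bsub>R\<^esub> x"
  by (simp_all add: opposite_ring_def)

lemma opposite_opposite_ring [simp]: "opposite_ring (opposite_ring R) = R" by (simp add: opposite_ring_def)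

lemma add_monoid_opposite_ring [simp]: "add_monoid (opposite_ring R) = add_monoid R" by (simp add: opposite_ring_def)

lemma finsum_opposite_ring [simp]: "finsum (opposite_ring R) f S = finsum R f S" unfolding finsum_def opposite_ring_def by simp

lemma a_inv_opposite_ring [simp]: "\<ominus>\<^bsub>opposite_ring R\<^esub> x = \<ominus>\<^bsub>R\<^esub> x"
  unfolding a_inv_def opposite_ring_def by simp

lemma a_minus_opposite_ring [simp]: "x \<ominus>\<^bsub>opposite_ring R\<^esub> y = x \<ominus>\<^bsub>R\<^esub> y"
  unfolding a_minus_def by simp

lemma ring_opposite_ring:
  assumes "ring R"
  shows "ring (opposite_ring R)"
proof -
  interpret R: ring R by fact
  show ?thesis
  proof (rule ringI)
    show "abelian_group (opposite_ring R)"
      by (rule abelian_groupI) (auto simp: R.a_ac intro: R.l_neg bexI[of _ "\<ominus>\<^bsub>R\<^esub> _"])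
    show "monoid (opposite_ring R)" by (rule monoidI) (auto simp: R.m_assoc)
  qed (auto simp: R.l_distr R.r_distr)
qed

lemma (in abelian_group) finsum_swap:
  assumes "finite S" "finite T" "!!a b. a \<in> S ==> b \<in> T ==> f a b \<in> carrier G"
  shows "(\<Oplus>a\<in>S. \<Oplus>b\<in>T. f a b) = (\<Oplus>b\<in>T. \<Oplus>a\<in>S. f a b)" using assms(1,3)
proof (induction S)
  case empty
  show ?case by (simp add: finsum_zero)
next
  case (insert s S)
  have "(\<Oplus>b\<in>T. \<Oplus>a\<in>insert s S. f a b) = (\<Oplus>b\<in>T. f s b \<oplus> (\<Oplus>a\<in>S. f a b))"
    by (rule finsum_cong') (use insert in "auto intro!: finsum_closed")
  also have "\<dots> = (\<Oplus>b\<in>T. f s b) \<oplus> (\<Oplus>b\<in>T. \<Oplus>a\<in>S. f a b)"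
    by (rule finsum_addf) (use insert in "auto intro!: finsum_closed")
  also have "\<dots> = (\<Oplus>b\<in>T. f s b) \<oplus> (\<Oplus>a\<in>S. \<Oplus>b\<in>T. f a b)" using insert by simp
  also have "\<dots> = (\<Oplus>a\<in>insert s S. \<Oplus>b\<in>T. f a b)"
    by (rule finsum_insert[symmetric]) (use insert in "auto intro!: finsum_closed")
  finally show ?case by simp
qed

text \<open>Scalars are central, so the conditions are symmetric except for the order of the factors
  in \<open>kernel_products\<close>. This order is restored by reversing the list of
  augmentations.\<close>

lemma augmented_algebra_opposite:
  assumes "augmented_algebra R sc V \<epsilon>"
  shows "augmented_algebra (opposite_ring R) sc V \<epsilon>"
proof -
  interpret R: augmented_algebra R sc V \<epsilon> by fact
  interpret O: ring "opposite_ring R" by (rule ring_opposite_ring[OF R.ring_axioms])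
  have opp: "kernel_products (opposite_ring R) \<epsilon> (rev xs) = kernel_products R \<epsilon> xs" for xs
  proof -
    have app: "kernel_products (opposite_ring R) \<epsilon> (ys @ [x]) =
      {r \<otimes>\<^bsub>R\<^esub> s |r s. r \<in> carrier R \<and> \<epsilon> x r = 0 \<and> s \<in> kernel_products (opposite_ring R) \<epsilon> ys}" for ys x
    proof (induction ys)
      case (Cons y ys)
      have c: "kernel_products (opposite_ring R) \<epsilon> zs \<subseteq> carrier R" for zs by (induction zs) auto
      show ?case
      proof (intro subset_antisym subsetI)
        fix z assume "z \<in> kernel_products (opposite_ring R) \<epsilon> ((y # ys) @ [x])"
        then obtain r t s where *: "z = (t \<otimes>\<^bsub>R\<^esub> s) \<otimes>\<^bsub>R\<^esub> r" "r \<in> carrier R" "\<epsilon> y r = 0"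
          "t \<in> carrier R" "\<epsilon> x t = 0" "s \<in> kernel_products (opposite_ring R) \<epsilon> ys" by (auto simp: Cons)
        have "s \<otimes>\<^bsub>R\<^esub> r \<in> kernel_products (opposite_ring R) \<epsilon> (y # ys)" using * by auto
        moreover have "z = t \<otimes>\<^bsub>R\<^esub> (s \<otimes>\<^bsub>R\<^esub> r)" using * c by (metis R.m_assoc subsetD)
        ultimately show "z \<in> {r \<otimes>\<^bsub>R\<^esub> s |r s. r \<in> carrier R \<and> \<epsilon> x r = 0 \<and> s \<in> kernel_products (opposite_ring R) \<epsilon> (y # ys)}"
          using *(4,5) by blast
      next
        fix z assume "z \<in> {r \<otimes>\<^bsub>R\<^esub> s |r s. r \<in> carrier R \<and> \<epsilon> x r = 0 \<and> s \<in> kernel_products (opposite_ring R) \<epsilon> (y # ys)}"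
        then obtain r t s where *: "z = t \<otimes>\<^bsub>R\<^esub> (s \<otimes>\<^bsub>R\<^esub> r)" "r \<in> carrier R" "\<epsilon> y r = 0"
          "t \<in> carrier R" "\<epsilon> x t = 0" "s \<in> kernel_products (opposite_ring R) \<epsilon> ys" by auto
        have "t \<otimes>\<^bsub>R\<^esub> s \<in> kernel_products (opposite_ring R) \<epsilon> (ys @ [x])" using * Cons by blast
        moreover have "z = r \<otimes>\<^bsub>opposite_ring R\<^esub> (t \<otimes>\<^bsub>R\<^esub> s)" using * c by (metis R.m_assoc opposite_ring_simps(5) subsetD)
        ultimately show "z \<in> kernel_products (opposite_ring R) \<epsilon> ((y # ys) @ [x])"
          unfolding append_Cons kernel_products.simps using *(2,3) by auto
      qed
    next
      case Nil
      show ?case by auto (metis R.r_one, metis R.l_one)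
    qed
    show ?thesis by (induction xs) (auto simp: app)
  qed
  obtain F :: "nat set" and w co where dual: "finite F" "w \<in> F \<rightarrow> carrier R"
    "\<forall>b\<in>F. lin_functional R sc (co b)" "\<forall>r\<in>carrier R. r = (\<Oplus>\<^bsub>R\<^esub>b\<in>F. sc (co b r) \<otimes>\<^bsub>R\<^esub> w b)"
    using R.dual_basis by (elim exE conjE)
  have fs: "(\<Oplus>\<^bsub>R\<^esub>b\<in>F. w b \<otimes>\<^bsub>R\<^esub> sc (co b r)) = (\<Oplus>\<^bsub>R\<^esub>b\<in>F. sc (co b r) \<otimes>\<^bsub>R\<^esub> w b)" for r
    by (rule R.finsum_cong') (use dual(2) in "auto simp: R.sc_commute Pi_def")
  have db: "\<forall>r\<in>carrier R. r = (\<Oplus>\<^bsub>R\<^esub>b\<in>F. w b \<otimes>\<^bsub>R\<^esub> sc (co b r))"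
    by (rule ballI, rule trans[OF bspec[OF dual(4)] fs[symmetric]])
  have lf: "\<forall>b\<in>F. lin_functional (opposite_ring R) sc (co b)"
    using dual(3) by (simp add: lin_functional_def R.sc_commute[symmetric])
  obtain xs where xs: "set xs \<subseteq> V" "kernel_products R \<epsilon> xs \<subseteq> {\<zero>\<^bsub>R\<^esub>}" using R.nilpotent by blast
  show ?thesis
  proof unfold_locales
    show "\<exists>xs. set xs \<subseteq> V \<and> kernel_products (opposite_ring R) \<epsilon> xs \<subseteq> {\<zero>\<^bsub>opposite_ring R\<^esub>}"
      by (rule exI[of _ "rev xs"]) (simp add: opp xs)
    show "\<exists>(F :: nat set) w co. finite F \<and> w \<in> F \<rightarrow> carrier (opposite_ring R) \<and>
      (\<forall>b\<in>F. lin_functional (opposite_ring R) sc (co b)) \<and>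
      (\<forall>r\<in>carrier (opposite_ring R). r = (\<Oplus>\<^bsub>opposite_ring R\<^esub>b\<in>F. sc (co b r) \<otimes>\<^bsub>opposite_ring R\<^esub> w b))"
      unfolding opposite_ring_simps finsum_opposite_ring by (intro exI[of _ F] exI[of _ w] exI[of _ co] conjI dual(1,2) db lf)
    show "sc (c * d) = sc c \<otimes>\<^bsub>opposite_ring R\<^esub> sc d" for c d using R.sc_mult[of c d] R.sc_commute[of "sc d" c] by simp
    show "\<epsilon> x (r \<otimes>\<^bsub>opposite_ring R\<^esub> s) = \<epsilon> x r * \<epsilon> x s"
      if "x \<in> V" "r \<in> carrier (opposite_ring R)" "s \<in> carrier (opposite_ring R)" for x r s using that by (simp add: R.eps_mult)
  qed (simp_all add: R.sc_add R.eps_add R.sc_commute)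
qed

section \<open>Corner subalgebras\<close>

text \<open>The embedding \<open>\<iota>\<close> need not be unital, so \<open>M\<close> itself need
  not be an \<open>A\<close>-module; the part of \<open>M\<close> fixed by the image of the unit is
  one.\<close>

definition restrict_scalars :: "('a, 't) ring_scheme => ('a => 'r) => ('r, 'm) module => ('a, 'm) module" where
  "restrict_scalars A \<iota> M =
     \<lparr> carrier = {m \<in> carrier M. \<iota> \<one>\<^bsub>A\<^esub> \<odot>\<^bsub>M\<^esub> m = m}, monoid.mult = undefined, monoid.one = undefined,
       ring.zero = \<zero>\<^bsub>M\<^esub>, ring.add = ring.add M, module.smult = (\<lambda>x m. \<iota> x \<odot>\<^bsub>M\<^esub> m) \<rparr>"

lemma restrict_scalars_simps:
  "carrier (restrict_scalars A \<iota> M) = {m \<in> carrier M. \<iota> \<one>\<^bsub>A\<^esub> \<odot>\<^bsub>M\<^esub> m = m}"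
  "\<zero>\<^bsub>restrict_scalars A \<iota> M\<^esub> = \<zero>\<^bsub>M\<^esub>" "m \<oplus>\<^bsub>restrict_scalars A \<iota> M\<^esub> n = m \<oplus>\<^bsub>M\<^esub> n"
  "x \<odot>\<^bsub>restrict_scalars A \<iota> M\<^esub> m = \<iota> x \<odot>\<^bsub>M\<^esub> m" by (simp_all add: restrict_scalars_def)

text \<open>
  In a path algebra of a glued quiver, every path \<open>p\<close> ending in the first quiver is uniquely \<open>p = r q\<close>
  with \<open>q\<close> the longest final segment in the first quiver. A \<open>suffix_map\<close> sends a functional \<open>\<phi>\<close> and
  such a \<open>p\<close> to \<open>\<phi>(r) q\<close>. It encodes that, as a right \<open>A\<close>-module, the glued algebra times the unit
  of \<open>A\<close> is a direct sum of \<open>A\<close> and copies of \<open>e A\<close>.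
\<close>

definition suffix_map ::
  "('r, 's) ring_scheme => ('k::field => 'r) => ('a, 't) ring_scheme => ('k => 'a) => ('a => 'r) => ('r => 'a)
    => 'a => 'r set => (('r => 'k) => 'r => 'a) => bool" where
  "suffix_map R sc A scA \<iota> \<pi> e C T \<longleftrightarrow>
     (\<forall>\<phi>. lin_functional R sc \<phi> -->
        (\<forall>r\<in>carrier R. T \<phi> r \<in> carrier A) \<and>
        (\<forall>r\<in>carrier R. \<forall>s\<in>carrier R. T \<phi> (r \<oplus>\<^bsub>R\<^esub> s) = T \<phi> r \<oplus>\<^bsub>A\<^esub> T \<phi> s) \<and>
        (\<forall>c. \<forall>r\<in>carrier R. T \<phi> (sc c \<otimes>\<^bsub>R\<^esub> r) = scA c \<otimes>\<^bsub>A\<^esub> T \<phi> r) \<and>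
        (\<forall>r\<in>carrier R. \<forall>x\<in>carrier A. T \<phi> (r \<otimes>\<^bsub>R\<^esub> \<iota> x) = T \<phi> r \<otimes>\<^bsub>A\<^esub> x) \<and>
        (\<forall>x\<in>carrier A. T \<phi> (\<iota> x) = scA (\<phi> (\<iota> \<one>\<^bsub>A\<^esub>)) \<otimes>\<^bsub>A\<^esub> x) \<and>
        (\<forall>r\<in>carrier R. \<forall>s\<in>carrier R. \<pi> s = \<zero>\<^bsub>A\<^esub> --> T \<phi> (r \<otimes>\<^bsub>R\<^esub> s) = T (\<lambda>t. \<phi> (r \<otimes>\<^bsub>R\<^esub> t)) s) \<and>
        (\<forall>r\<in>C. \<exists>c. T \<phi> r = scA c \<otimes>\<^bsub>A\<^esub> e)) \<and>
     (\<forall>(F :: nat set) w co. finite F --> w \<in> F \<rightarrow> carrier R --> (\<forall>b\<in>F. lin_functional R sc (co b)) -->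
        (\<forall>r\<in>carrier R. r = (\<Oplus>\<^bsub>R\<^esub>b\<in>F. sc (co b r) \<otimes>\<^bsub>R\<^esub> w b)) -->
        (\<forall>r\<in>carrier R. r \<otimes>\<^bsub>R\<^esub> \<iota> \<one>\<^bsub>A\<^esub> = (\<Oplus>\<^bsub>R\<^esub>b\<in>F. w b \<otimes>\<^bsub>R\<^esub> \<iota> (T (co b) r))) \<and>
        (\<forall>\<phi> r. lin_functional R sc \<phi> --> r \<in> carrier R -->
           T \<phi> r = (\<Oplus>\<^bsub>A\<^esub>b\<in>F. scA (\<phi> (w b)) \<otimes>\<^bsub>A\<^esub> T (co b) r)))"

text \<open>\<open>\<pi>\<close> is a multiplicative retraction of \<open>\<iota>\<close> through
  which the augmentations at the vertices of \<open>A\<close> factor. In the application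
  \<open>e\<close> is the idempotent of the glued vertex and \<open>C\<close> the image of the other
  algebra.\<close>

locale corner = R: augmented_algebra R sc V \<epsilon> + A: augmented_algebra A scA VA \<epsilon>A
  for R :: "('r, 's) ring_scheme" and sc :: "'k::field => 'r" and V :: "'x set" and \<epsilon>
    and A :: "('a, 't) ring_scheme" and scA :: "'k => 'a" and VA :: "'y set" and \<epsilon>A +
  fixes \<iota> :: "'a => 'r" and \<pi> :: "'r => 'a" and j :: "'y => 'x" and e :: 'a and C :: "'r set"
  assumes iota_closed [simp]: "x \<in> carrier A ==> \<iota> x \<in> carrier R"
    and iota_add: "x \<in> carrier A ==> y \<in> carrier A ==> \<iota> (x \<oplus>\<^bsub>A\<^esub> y) = \<iota> x \<oplus>\<^bsub>R\<^esub> \<iota> y"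
    and iota_mult: "x \<in> carrier A ==> y \<in> carrier A ==> \<iota> (x \<otimes>\<^bsub>A\<^esub> y) = \<iota> x \<otimes>\<^bsub>R\<^esub> \<iota> y"
    and iota_sc: "x \<in> carrier A ==> \<iota> (scA c \<otimes>\<^bsub>A\<^esub> x) = sc c \<otimes>\<^bsub>R\<^esub> \<iota> x"
    and pi_closed [simp]: "r \<in> carrier R ==> \<pi> r \<in> carrier A"
    and pi_add: "r \<in> carrier R ==> s \<in> carrier R ==> \<pi> (r \<oplus>\<^bsub>R\<^esub> s) = \<pi> r \<oplus>\<^bsub>A\<^esub> \<pi> s"
    and pi_mult: "r \<in> carrier R ==> s \<in> carrier R ==> \<pi> (r \<otimes>\<^bsub>R\<^esub> s) = \<pi> r \<otimes>\<^bsub>A\<^esub> \<pi> s"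
    and pi_iota [simp]: "x \<in> carrier A ==> \<pi> (\<iota> x) = x"
    and e_closed [simp]: "e \<in> carrier A"
    and j_closed [simp]: "v \<in> VA ==> j v \<in> V"
    and eps_j: "v \<in> VA ==> r \<in> carrier R ==> \<epsilon> (j v) r = \<epsilon>A v (\<pi> r)"
    and C_closed: "C \<subseteq> carrier R"
    and suffix_map_exists: "\<exists>T. suffix_map R sc A scA \<iota> \<pi> e C T"
begin

abbreviation "res \<equiv> restrict_scalars A \<iota>"

lemma eps_iota: "x \<in> VA ==> y \<in> carrier A ==> \<epsilon> (j x) (\<iota> y) = \<epsilon>A x y" by (simp add: eps_j)

lemma iota_one_mult:
  "x \<in> carrier A ==> \<iota> \<one>\<^bsub>A\<^esub> \<otimes>\<^bsub>R\<^esub> \<iota> x = \<iota> x" "x \<in> carrier A ==> \<iota> x \<otimes>\<^bsub>R\<^esub> \<iota> \<one>\<^bsub>A\<^esub> = \<iota> x"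
  by (simp_all add: iota_mult[symmetric])

lemma left_module_res:
  assumes "left_module R M"
  shows "left_module A (res M)"
proof -
  interpret M: left_module R M by fact
  note s = restrict_scalars_simps
  have ag: "abelian_group (res M)"
  proof (rule abelian_groupI)
    fix m assume "m \<in> carrier (res M)"
    then show "\<exists>n\<in>carrier (res M). n \<oplus>\<^bsub>res M\<^esub> m = \<zero>\<^bsub>res M\<^esub>"
      by (intro bexI[of _ "\<ominus>\<^bsub>M\<^esub> m"]) (auto simp: s M.M.l_neg M.smult_minus_r)
  qed (auto simp: s M.M.a_ac M.smult_r_distr M.smult_zero_r)
  show ?thesis
  proof (rule left_moduleI[OF A.ring_axioms ag])
    fix x m assume x: "x \<in> carrier A" "m \<in> carrier (res M)"
    have "\<iota> \<one>\<^bsub>A\<^esub> \<odot>\<^bsub>M\<^esub> (\<iota> x \<odot>\<^bsub>M\<^esub> m) = (\<iota> \<one>\<^bsub>A\<^esub> \<otimes>\<^bsub>R\<^esub> \<iota> x) \<odot>\<^bsub>M\<^esub> m"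
      using x by (simp add: s M.smult_assoc)
    then show "x \<odot>\<^bsub>res M\<^esub> m \<in> carrier (res M)" using x by (simp add: s M.smult_closed iota_one_mult)
  qed (auto simp: s M.smult_l_distr M.smult_r_distr M.smult_assoc iota_add iota_mult)
qed

lemma e_smult_res:
  assumes "left_module R M" "m \<in> carrier M"
  shows "\<iota> \<one>\<^bsub>A\<^esub> \<odot>\<^bsub>M\<^esub> m \<in> carrier (res M)"
proof -
  interpret M: left_module R M by fact
  show ?thesis using assms(2) by (simp add: restrict_scalars_simps M.smult_closed M.smult_assoc[symmetric] iota_mult[symmetric])
qed

text \<open>A spanning set over the ground field is used because generators over \<open>R\<close>
  need not generate over the smaller algebra. The idempotent maps it to a spanning set of the
  restricted module.\<close>

lemma fg_module_res:
  assumes fg: "fg_module R M"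
  shows "fg_module A (res M)"
proof -
  interpret M: left_module R M using fg by (rule fg_module_left)
  interpret N: left_module A "res M" by (rule left_module_res[OF M.left_module_axioms])
  note s = restrict_scalars_simps
  obtain T where T: "finite T" "T \<subseteq> carrier M"
    "!!H. [|H \<subseteq> carrier M; \<zero>\<^bsub>M\<^esub> \<in> H; !!x y. x \<in> H ==> y \<in> H ==> x \<oplus>\<^bsub>M\<^esub> y \<in> H;
      !!c x. x \<in> H ==> sc c \<odot>\<^bsub>M\<^esub> x \<in> H; T \<subseteq> H|] ==> H = carrier M"
    using R.fg_module_K_span[OF fg] by blast
  let ?e = "\<iota> \<one>\<^bsub>A\<^esub>"
  show ?thesis unfolding N.fg_module_iff
  proof (intro exI[of _ "(\<lambda>t. ?e \<odot>\<^bsub>M\<^esub> t) ` T"] conjI allI impI; (elim conjE)?)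
    show "finite ((\<lambda>t. ?e \<odot>\<^bsub>M\<^esub> t) ` T)" using T(1) by simp
    show "(\<lambda>t. ?e \<odot>\<^bsub>M\<^esub> t) ` T \<subseteq> carrier (res M)" using T(2) e_smult_res[OF M.left_module_axioms] by auto
    fix H assume H: "submodule_set A (res M) H" "(\<lambda>t. ?e \<odot>\<^bsub>M\<^esub> t) ` T \<subseteq> H"
    have "{x \<in> carrier M. ?e \<odot>\<^bsub>M\<^esub> x \<in> H} = carrier M"
    proof (rule T(3))
      show "\<zero>\<^bsub>M\<^esub> \<in> {x \<in> carrier M. ?e \<odot>\<^bsub>M\<^esub> x \<in> H}"
        using submodule_setD(2)[OF H(1)] by (simp add: s M.smult_zero_r)
      show "T \<subseteq> {x \<in> carrier M. ?e \<odot>\<^bsub>M\<^esub> x \<in> H}" using T(2) H(2) by auto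
      show "x \<oplus>\<^bsub>M\<^esub> y \<in> {x \<in> carrier M. ?e \<odot>\<^bsub>M\<^esub> x \<in> H}"
        if "x \<in> {x \<in> carrier M. ?e \<odot>\<^bsub>M\<^esub> x \<in> H}" "y \<in> {x \<in> carrier M. ?e \<odot>\<^bsub>M\<^esub> x \<in> H}" for x y
        using that submodule_setD(3)[OF H(1)] by (auto simp: s M.smult_r_distr)
      show "sc c \<odot>\<^bsub>M\<^esub> x \<in> {x \<in> carrier M. ?e \<odot>\<^bsub>M\<^esub> x \<in> H}"
        if x: "x \<in> {x \<in> carrier M. ?e \<odot>\<^bsub>M\<^esub> x \<in> H}" for c x
      proof -
        have "\<iota> (scA c) \<odot>\<^bsub>M\<^esub> (?e \<odot>\<^bsub>M\<^esub> x) \<in> H"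
          using submodule_setD(4)[OF H(1), of "scA c"] x by (simp add: s)
        moreover have "\<iota> (scA c) = sc c \<otimes>\<^bsub>R\<^esub> ?e" using iota_sc[of "\<one>\<^bsub>A\<^esub>" c] by simp
        moreover have "?e \<otimes>\<^bsub>R\<^esub> ?e = ?e" by (simp add: iota_mult[symmetric])
        ultimately have "sc c \<odot>\<^bsub>M\<^esub> (?e \<odot>\<^bsub>M\<^esub> x) \<in> H" using x
          by (simp add: M.smult_assoc[symmetric] R.m_assoc)
        then show ?thesis using x by (simp add: M.smult_closed R.sc_smult_commute[OF M.left_module_axioms])
      qed
    qed auto
    then have "x \<in> H" if "x \<in> carrier (res M)" for x using that by (force simp: s)
    then show "H = carrier (res M)" using H(1) by (auto simp: submodule_set_def)
  qed
qed

lemma mod_hom_res: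
  assumes "h \<in> mod_hom R M N"
  shows "h \<in> mod_hom A (res M) (res N)" unfolding mod_hom_def using mod_homD[OF assms] mod_homD(3)[OF assms, symmetric]
  by (auto simp: restrict_scalars_simps)

text \<open>Passing to the part fixed by an idempotent is exact: a preimage of a fixed element
  becomes fixed when multiplied by the idempotent.\<close>

lemma short_exact_res:
  assumes "left_module R L" "left_module R M" "left_module R N" "short_exact R L M N i p"
  shows "short_exact A (res L) (res M) (res N) i p"
proof -
  interpret L: left_module R L by fact
  interpret M: left_module R M by fact
  interpret N: left_module R N by fact
  note s = restrict_scalars_simps
  have ip: "i \<in> mod_hom R L M" "inj_on i (carrier L)" "p \<in> mod_hom R M N" "p ` carrier M = carrier N"
      "i ` carrier L = mod_kernel M N p" using assms(4) by (auto simp: short_exact_def)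
  show ?thesis unfolding short_exact_def
  proof (intro conjI mod_hom_res ip)
    show "inj_on i (carrier (res L))" using ip(2) by (auto simp: inj_on_def s)
    show "p ` carrier (res M) = carrier (res N)"
    proof
      show "p ` carrier (res M) \<subseteq> carrier (res N)" using mod_homD(1)[OF mod_hom_res[OF ip(3)]] by blast
      show "carrier (res N) \<subseteq> p ` carrier (res M)"
      proof
        fix n assume n: "n \<in> carrier (res N)"
        then obtain m where m: "m \<in> carrier M" "n = p m" using ip(4) by (auto simp: s)
        have "p (\<iota> \<one>\<^bsub>A\<^esub> \<odot>\<^bsub>M\<^esub> m) = n" using n m mod_homD(3)[OF ip(3)] by (simp add: s)
        then show "n \<in> p ` carrier (res M)" using e_smult_res[OF M.left_module_axioms m(1)] by blast
      qed
    qed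
    show "i ` carrier (res L) = mod_kernel (res M) (res N) p"
    proof
      show "i ` carrier (res L) \<subseteq> mod_kernel (res M) (res N) p"
        using ip(5) mod_homD(1)[OF mod_hom_res[OF ip(1)]] by (fastforce simp: mod_kernel_def s)
      show "mod_kernel (res M) (res N) p \<subseteq> i ` carrier (res L)"
      proof
        fix m assume m: "m \<in> mod_kernel (res M) (res N) p"
        then have "m \<in> mod_kernel M N p" by (simp add: mod_kernel_def s)
        then obtain l where l: "l \<in> carrier L" "m = i l" using ip(5) by blast
        have "i (\<iota> \<one>\<^bsub>A\<^esub> \<odot>\<^bsub>L\<^esub> l) = i l" using m l mod_homD(3)[OF ip(1)] by (simp add: mod_kernel_def s)
        then have "\<iota> \<one>\<^bsub>A\<^esub> \<odot>\<^bsub>L\<^esub> l = l" using inj_onD[OF ip(2)] l(1) by (simp add: L.smult_closed)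
        then show "m \<in> i ` carrier (res L)" using l by (simp add: s)
      qed
    qed
  qed
qed

text \<open>On a path \<open>p = r q\<close>, with \<open>q\<close> the longest final segment in
  \<open>A\<close>, the extension takes the value \<open>r\<close> applied to \<open>d q\<close>.
  The suffix map expresses this without mentioning paths.\<close>

lemma derivation_extend:
  assumes fg: "left_module R M" and x: "x \<in> VA" and d: "A.derivation x (res M) d"
  obtains D where "R.derivation (j x) M D" "!!y. y \<in> carrier A ==> D (\<iota> y) = d y"
    "d e = \<zero>\<^bsub>M\<^esub> ==> \<forall>r\<in>C. D r = \<zero>\<^bsub>M\<^esub>"
proof -
  interpret M: left_module R M by fact
  interpret N: left_module A "res M" by (rule left_module_res[OF M.left_module_axioms])
  note s = restrict_scalars_simps
  note dD = A.derivationD[OF d]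
  have dM: "d y \<in> carrier M" "\<iota> \<one>\<^bsub>A\<^esub> \<odot>\<^bsub>M\<^esub> d y = d y" if "y \<in> carrier A" for y
    using dD(1)[OF that] by (auto simp: s)
  obtain T where T: "suffix_map R sc A scA \<iota> \<pi> e C T" using suffix_map_exists by blast
  obtain F :: "nat set" and w co where dual: "finite F" "w \<in> F \<rightarrow> carrier R"
    "\<forall>b\<in>F. lin_functional R sc (co b)" "\<forall>r\<in>carrier R. r = (\<Oplus>\<^bsub>R\<^esub>b\<in>F. sc (co b r) \<otimes>\<^bsub>R\<^esub> w b)"
    using R.dual_basis by (elim exE conjE)
  note wF [simp] = funcset_mem[OF dual(2)] and lF = bspec[OF dual(3)]
  have T_closed [simp]: "T \<phi> r \<in> carrier A"
    and T_add: "s \<in> carrier R ==> T \<phi> (r \<oplus>\<^bsub>R\<^esub> s) = T \<phi> r \<oplus>\<^bsub>A\<^esub> T \<phi> s"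
    and T_sc: "T \<phi> (sc c \<otimes>\<^bsub>R\<^esub> r) = scA c \<otimes>\<^bsub>A\<^esub> T \<phi> r"
    and T_right: "y \<in> carrier A ==> T \<phi> (r \<otimes>\<^bsub>R\<^esub> \<iota> y) = T \<phi> r \<otimes>\<^bsub>A\<^esub> y"
    and T_ker: "s \<in> carrier R ==> \<pi> s = \<zero>\<^bsub>A\<^esub> ==> T \<phi> (r \<otimes>\<^bsub>R\<^esub> s) = T (\<lambda>t. \<phi> (r \<otimes>\<^bsub>R\<^esub> t)) s"
    if "lin_functional R sc \<phi>" "r \<in> carrier R" for \<phi> r c s y using T that unfolding suffix_map_def by auto
  have T_iota: "T \<phi> (\<iota> y) = scA (\<phi> (\<iota> \<one>\<^bsub>A\<^esub>)) \<otimes>\<^bsub>A\<^esub> y"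
    if "lin_functional R sc \<phi>" "y \<in> carrier A" for \<phi> y using T that unfolding suffix_map_def by auto
  have T_C: "\<exists>c. T \<phi> r = scA c \<otimes>\<^bsub>A\<^esub> e" if "lin_functional R sc \<phi>" "r \<in> C" for \<phi> r
    using T that unfolding suffix_map_def by auto
  note T2 = T[unfolded suffix_map_def, THEN conjunct2, THEN spec, THEN spec, THEN spec, THEN mp, OF dual(1),
      THEN mp, OF dual(2), THEN mp, OF dual(3), THEN mp, OF dual(4)]
  have T_rec: "r \<otimes>\<^bsub>R\<^esub> \<iota> \<one>\<^bsub>A\<^esub> = (\<Oplus>\<^bsub>R\<^esub>b\<in>F. w b \<otimes>\<^bsub>R\<^esub> \<iota> (T (co b) r))"
    if "r \<in> carrier R" for r using T2 that by blast
  have T_dual: "T \<phi> r = (\<Oplus>\<^bsub>A\<^esub>b\<in>F. scA (\<phi> (w b)) \<otimes>\<^bsub>A\<^esub> T (co b) r)"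
    if "lin_functional R sc \<phi>" "r \<in> carrier R" for \<phi> r using T2 that by blast
  have d_sc: "d (scA c \<otimes>\<^bsub>A\<^esub> y) = sc c \<odot>\<^bsub>M\<^esub> d y" if y: "y \<in> carrier A" for c y
  proof -
    have "d (scA c \<otimes>\<^bsub>A\<^esub> y) = \<iota> (scA c) \<odot>\<^bsub>M\<^esub> d y"
      using dD(3)[OF A.sc_closed y, of c] y dM[OF y] by (simp add: dD(4)) (simp add: s M.smult_zero_r M.smult_closed)
    also have "\<iota> (scA c) = sc c \<otimes>\<^bsub>R\<^esub> \<iota> \<one>\<^bsub>A\<^esub>" using iota_sc[of "\<one>\<^bsub>A\<^esub>" c] by simp
    finally show ?thesis using dM[OF y] by (simp add: M.smult_assoc)
  qed
  \<comment> \<open>If \<open>T (co b)\<close> turns \<open>p = r q\<close> into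
    \<open>co b r\<close> times \<open>q\<close>, the sum over \<open>b\<close> collapses to
    \<open>r\<close> applied to \<open>d q\<close>, because \<open>r\<close> is the sum of the
    \<open>co b r\<close> multiples of \<open>w b\<close>.\<close>
  define D where "D r = (\<Oplus>\<^bsub>M\<^esub>b\<in>F. w b \<odot>\<^bsub>M\<^esub> d (T (co b) r))" for r
  have cl: "(\<lambda>b. w b \<odot>\<^bsub>M\<^esub> d (T (co b) r)) \<in> F \<rightarrow> carrier M" if "r \<in> carrier R" for r
    using that by (auto simp: lF dM M.smult_closed)
  have D_closed: "D r \<in> carrier M" if "r \<in> carrier R" for r unfolding D_def by (rule M.M.finsum_closed[OF cl[OF that]])
  have D_add: "D (r \<oplus>\<^bsub>R\<^esub> t) = D r \<oplus>\<^bsub>M\<^esub> D t" if rt: "r \<in> carrier R" "t \<in> carrier R" for r t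
    unfolding D_def M.M.finsum_addf[OF cl[OF rt(1)] cl[OF rt(2)], symmetric]
  proof (rule M.M.finsum_cong'[OF refl])
    fix b assume b: "b \<in> F"
    show "w b \<odot>\<^bsub>M\<^esub> d (T (co b) (r \<oplus>\<^bsub>R\<^esub> t)) = w b \<odot>\<^bsub>M\<^esub> d (T (co b) r) \<oplus>\<^bsub>M\<^esub> w b \<odot>\<^bsub>M\<^esub> d (T (co b) t)"
      using b rt lF[OF b] dD(2)[of "T (co b) r" "T (co b) t"] by (simp add: T_add s M.smult_r_distr dM)
  qed (use cl rt in "auto")
  have D_sc: "D (sc c \<otimes>\<^bsub>R\<^esub> r) = sc c \<odot>\<^bsub>M\<^esub> D r" if r: "r \<in> carrier R" for c r
    unfolding D_def M.smult_finsum[OF R.sc_closed cl[OF r]]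
  proof (rule M.M.finsum_cong'[OF refl])
    fix b assume b: "b \<in> F"
    show "w b \<odot>\<^bsub>M\<^esub> d (T (co b) (sc c \<otimes>\<^bsub>R\<^esub> r)) = sc c \<odot>\<^bsub>M\<^esub> (w b \<odot>\<^bsub>M\<^esub> d (T (co b) r))"
      using b r lF[OF b] by (simp add: T_sc d_sc dM R.sc_smult_commute[OF M.left_module_axioms])
  qed (use r lF dM in "auto simp: M.smult_closed")
  have rec_smult: "(\<Oplus>\<^bsub>M\<^esub>b\<in>F. w b \<odot>\<^bsub>M\<^esub> (\<iota> (T (co b) r) \<odot>\<^bsub>M\<^esub> m)) = r \<odot>\<^bsub>M\<^esub> (\<iota> \<one>\<^bsub>A\<^esub> \<odot>\<^bsub>M\<^esub> m)"
    if r: "r \<in> carrier R" and m: "m \<in> carrier M" for r m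
  proof -
    have "(\<Oplus>\<^bsub>M\<^esub>b\<in>F. w b \<odot>\<^bsub>M\<^esub> (\<iota> (T (co b) r) \<odot>\<^bsub>M\<^esub> m)) = (\<Oplus>\<^bsub>M\<^esub>b\<in>F. (w b \<otimes>\<^bsub>R\<^esub> \<iota> (T (co b) r)) \<odot>\<^bsub>M\<^esub> m)"
      by (rule M.M.finsum_cong'[OF refl]) (use r m lF in "auto simp: M.smult_assoc M.smult_closed")
    also have "\<dots> = (\<Oplus>\<^bsub>R\<^esub>b\<in>F. w b \<otimes>\<^bsub>R\<^esub> \<iota> (T (co b) r)) \<odot>\<^bsub>M\<^esub> m"
      by (rule M.finsum_smult[symmetric, OF m]) (use r lF in auto)
    also have "\<dots> = r \<odot>\<^bsub>M\<^esub> (\<iota> \<one>\<^bsub>A\<^esub> \<odot>\<^bsub>M\<^esub> m)" using r m by (simp add: T_rec[symmetric] M.smult_assoc)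
    finally show ?thesis .
  qed
  have D_iota: "D (\<iota> y) = d y" if y: "y \<in> carrier A" for y
  proof -
    have one: "\<iota> \<one>\<^bsub>A\<^esub> \<in> carrier R" by simp
    have "D (\<iota> y) = (\<Oplus>\<^bsub>M\<^esub>b\<in>F. sc (co b (\<iota> \<one>\<^bsub>A\<^esub>)) \<odot>\<^bsub>M\<^esub> (w b \<odot>\<^bsub>M\<^esub> d y))"
      unfolding D_def by (rule M.M.finsum_cong'[OF refl])
         (use y lF dM in "auto simp: T_iota d_sc R.sc_smult_commute[OF M.left_module_axioms] M.smult_closed")
    also have "\<dots> = (\<Oplus>\<^bsub>M\<^esub>b\<in>F. (sc (co b (\<iota> \<one>\<^bsub>A\<^esub>)) \<otimes>\<^bsub>R\<^esub> w b) \<odot>\<^bsub>M\<^esub> d y)"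
      by (rule M.M.finsum_cong'[OF refl]) (use y dM in "auto simp: M.smult_assoc M.smult_closed")
    also have "\<dots> = (\<Oplus>\<^bsub>R\<^esub>b\<in>F. sc (co b (\<iota> \<one>\<^bsub>A\<^esub>)) \<otimes>\<^bsub>R\<^esub> w b) \<odot>\<^bsub>M\<^esub> d y"
      by (rule M.finsum_smult[symmetric]) (use y dM in auto)
    also have "\<dots> = d y" using bspec[OF dual(4) one] dM[OF y] by simp
    finally show ?thesis .
  qed
  have D_right: "D (r \<otimes>\<^bsub>R\<^esub> \<iota> y) = r \<odot>\<^bsub>M\<^esub> d y \<oplus>\<^bsub>M\<^esub> sc (\<epsilon>A x y) \<odot>\<^bsub>M\<^esub> D r"
    if r: "r \<in> carrier R" and y: "y \<in> carrier A" for r y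
  proof -
    have eq: "d (T (co b) r \<otimes>\<^bsub>A\<^esub> y) = \<iota> (T (co b) r) \<odot>\<^bsub>M\<^esub> d y \<oplus>\<^bsub>M\<^esub> sc (\<epsilon>A x y) \<odot>\<^bsub>M\<^esub> d (T (co b) r)" if b: "b \<in> F" for b
    proof -
      have t: "T (co b) r \<in> carrier A" using r lF[OF b] by simp
      have "\<iota> (scA (\<epsilon>A x y)) \<odot>\<^bsub>M\<^esub> d (T (co b) r) = sc (\<epsilon>A x y) \<odot>\<^bsub>M\<^esub> d (T (co b) r)"
        using iota_sc[of "\<one>\<^bsub>A\<^esub>" "\<epsilon>A x y"] dM[OF t] by (simp add: M.smult_assoc)
      then show ?thesis using dD(3)[OF t y] by (simp add: s)
    qed
    have "D (r \<otimes>\<^bsub>R\<^esub> \<iota> y) = (\<Oplus>\<^bsub>M\<^esub>b\<in>F. w b \<odot>\<^bsub>M\<^esub> (\<iota> (T (co b) r) \<odot>\<^bsub>M\<^esub> d y) \<oplus>\<^bsub>M\<^esub> sc (\<epsilon>A x y) \<odot>\<^bsub>M\<^esub> (w b \<odot>\<^bsub>M\<^esub> d (T (co b) r)))"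
      unfolding D_def by (rule M.M.finsum_cong'[OF refl])
         (use r y lF dM in "auto simp: T_right eq R.sc_smult_commute[OF M.left_module_axioms] M.smult_closed M.smult_r_distr")
    also have "\<dots> = (\<Oplus>\<^bsub>M\<^esub>b\<in>F. w b \<odot>\<^bsub>M\<^esub> (\<iota> (T (co b) r) \<odot>\<^bsub>M\<^esub> d y)) \<oplus>\<^bsub>M\<^esub> (\<Oplus>\<^bsub>M\<^esub>b\<in>F. sc (\<epsilon>A x y) \<odot>\<^bsub>M\<^esub> (w b \<odot>\<^bsub>M\<^esub> d (T (co b) r)))"
      by (rule M.M.finsum_addf) (use r y lF dM in "auto simp: M.smult_closed")
    also have "\<dots> = r \<odot>\<^bsub>M\<^esub> d y \<oplus>\<^bsub>M\<^esub> sc (\<epsilon>A x y) \<odot>\<^bsub>M\<^esub> D r"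
      unfolding D_def using r y dM[OF y] by (simp add: rec_smult M.smult_finsum[OF R.sc_closed cl[OF r]])
    finally show ?thesis .
  qed
  \<comment> \<open>Elements killed by \<open>\<pi>\<close> stand for paths that do not lie inside
    the first quiver; multiplication from the left does not change their longest final segment
    there.\<close>
  have D_ker: "D (r \<otimes>\<^bsub>R\<^esub> t) = r \<odot>\<^bsub>M\<^esub> D t"
    if r: "r \<in> carrier R" and t: "t \<in> carrier R" "\<pi> t = \<zero>\<^bsub>A\<^esub>" for r t
  proof -
    have lin: "lin_functional R sc (\<lambda>u. co b (r \<otimes>\<^bsub>R\<^esub> u))" if b: "b \<in> F" for b unfolding lin_functional_def
    proof (intro conjI ballI allI)
      fix u v c assume u: "u \<in> carrier R"
      { assume v: "v \<in> carrier R"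
        show "co b (r \<otimes>\<^bsub>R\<^esub> (u \<oplus>\<^bsub>R\<^esub> v)) = co b (r \<otimes>\<^bsub>R\<^esub> u) + co b (r \<otimes>\<^bsub>R\<^esub> v)"
          using lF[OF b] u v r by (simp add: lin_functional_def R.r_distr) }
      have "r \<otimes>\<^bsub>R\<^esub> (sc c \<otimes>\<^bsub>R\<^esub> u) = sc c \<otimes>\<^bsub>R\<^esub> (r \<otimes>\<^bsub>R\<^esub> u)"
        using r u R.sc_commute[OF r, of c] by (simp add: R.m_assoc[symmetric])
      then show "co b (r \<otimes>\<^bsub>R\<^esub> (sc c \<otimes>\<^bsub>R\<^esub> u)) = c * co b (r \<otimes>\<^bsub>R\<^esub> u)"
        using lF[OF b] u r by (simp add: lin_functional_def)
    qed
    have Tt: "T (co b) t \<in> carrier A" if "b \<in> F" for b using that t lF by simp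
    have dsum: "d (\<Oplus>\<^bsub>A\<^esub>c\<in>F. f c) = (\<Oplus>\<^bsub>M\<^esub>c\<in>F. d (f c))" if f: "f \<in> F \<rightarrow> carrier A" for f
      by (rule finsum_additive[OF A.abelian_group_axioms M.M.abelian_group_axioms _ _ f]) (use dM dD(2) in "auto simp: s")
    have eq: "d (T (co b) (r \<otimes>\<^bsub>R\<^esub> t)) = (\<Oplus>\<^bsub>M\<^esub>c\<in>F. sc (co b (r \<otimes>\<^bsub>R\<^esub> w c)) \<odot>\<^bsub>M\<^esub> d (T (co c) t))" if b: "b \<in> F" for b
    proof -
      have "d (T (co b) (r \<otimes>\<^bsub>R\<^esub> t)) = d (\<Oplus>\<^bsub>A\<^esub>c\<in>F. scA (co b (r \<otimes>\<^bsub>R\<^esub> w c)) \<otimes>\<^bsub>A\<^esub> T (co c) t)"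
        using T_ker[OF lF[OF b] r t] T_dual[OF lin[OF b] t(1)] by simp
      also have "\<dots> = (\<Oplus>\<^bsub>M\<^esub>c\<in>F. d (scA (co b (r \<otimes>\<^bsub>R\<^esub> w c)) \<otimes>\<^bsub>A\<^esub> T (co c) t))"
        by (rule dsum) (use Tt in auto)
      also have "\<dots> = (\<Oplus>\<^bsub>M\<^esub>c\<in>F. sc (co b (r \<otimes>\<^bsub>R\<^esub> w c)) \<odot>\<^bsub>M\<^esub> d (T (co c) t))"
        by (rule M.M.finsum_cong'[OF refl]) (use Tt in "auto simp: d_sc dM M.smult_closed")
      finally show ?thesis .
    qed
    have "D (r \<otimes>\<^bsub>R\<^esub> t) = (\<Oplus>\<^bsub>M\<^esub>b\<in>F. \<Oplus>\<^bsub>M\<^esub>c\<in>F. (sc (co b (r \<otimes>\<^bsub>R\<^esub> w c)) \<otimes>\<^bsub>R\<^esub> w b) \<odot>\<^bsub>M\<^esub> d (T (co c) t))"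
      unfolding D_def
    proof (rule M.M.finsum_cong'[OF refl])
      fix b assume b: "b \<in> F"
      have "w b \<odot>\<^bsub>M\<^esub> d (T (co b) (r \<otimes>\<^bsub>R\<^esub> t)) = (\<Oplus>\<^bsub>M\<^esub>c\<in>F. w b \<odot>\<^bsub>M\<^esub> (sc (co b (r \<otimes>\<^bsub>R\<^esub> w c)) \<odot>\<^bsub>M\<^esub> d (T (co c) t)))"
        unfolding eq[OF b] by (rule M.smult_finsum) (use b Tt in "auto simp: dM M.smult_closed")
      also have "\<dots> = (\<Oplus>\<^bsub>M\<^esub>c\<in>F. (sc (co b (r \<otimes>\<^bsub>R\<^esub> w c)) \<otimes>\<^bsub>R\<^esub> w b) \<odot>\<^bsub>M\<^esub> d (T (co c) t))"
        by (rule M.M.finsum_cong'[OF refl])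
           (use b Tt in "auto simp: dM M.smult_closed M.smult_assoc R.sc_smult_commute[OF M.left_module_axioms]")
      finally show "w b \<odot>\<^bsub>M\<^esub> d (T (co b) (r \<otimes>\<^bsub>R\<^esub> t)) =
        (\<Oplus>\<^bsub>M\<^esub>c\<in>F. (sc (co b (r \<otimes>\<^bsub>R\<^esub> w c)) \<otimes>\<^bsub>R\<^esub> w b) \<odot>\<^bsub>M\<^esub> d (T (co c) t))" .
    qed (use Tt in "auto simp: dM M.smult_closed intro!: M.M.finsum_closed")
    also have "\<dots> = (\<Oplus>\<^bsub>M\<^esub>c\<in>F. \<Oplus>\<^bsub>M\<^esub>b\<in>F. (sc (co b (r \<otimes>\<^bsub>R\<^esub> w c)) \<otimes>\<^bsub>R\<^esub> w b) \<odot>\<^bsub>M\<^esub> d (T (co c) t))"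
      by (rule M.M.finsum_swap[OF dual(1,1)]) (use Tt in "auto simp: dM M.smult_closed")
    also have "\<dots> = (\<Oplus>\<^bsub>M\<^esub>c\<in>F. r \<odot>\<^bsub>M\<^esub> (w c \<odot>\<^bsub>M\<^esub> d (T (co c) t)))"
    proof (rule M.M.finsum_cong'[OF refl])
      fix c assume c: "c \<in> F"
      have "(\<Oplus>\<^bsub>M\<^esub>b\<in>F. (sc (co b (r \<otimes>\<^bsub>R\<^esub> w c)) \<otimes>\<^bsub>R\<^esub> w b) \<odot>\<^bsub>M\<^esub> d (T (co c) t)) =
        (\<Oplus>\<^bsub>R\<^esub>b\<in>F. sc (co b (r \<otimes>\<^bsub>R\<^esub> w c)) \<otimes>\<^bsub>R\<^esub> w b) \<odot>\<^bsub>M\<^esub> d (T (co c) t)"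
        by (rule M.finsum_smult[symmetric]) (use c Tt in "auto simp: dM")
      also have "\<dots> = (r \<otimes>\<^bsub>R\<^esub> w c) \<odot>\<^bsub>M\<^esub> d (T (co c) t)"
        using bspec[OF dual(4), of "r \<otimes>\<^bsub>R\<^esub> w c"] r c by simp
      finally show "(\<Oplus>\<^bsub>M\<^esub>b\<in>F. (sc (co b (r \<otimes>\<^bsub>R\<^esub> w c)) \<otimes>\<^bsub>R\<^esub> w b) \<odot>\<^bsub>M\<^esub> d (T (co c) t)) = r \<odot>\<^bsub>M\<^esub> (w c \<odot>\<^bsub>M\<^esub> d (T (co c) t))"
        using r c Tt[OF c] by (simp add: M.smult_assoc dM)
    qed (use r Tt in "auto simp: dM M.smult_closed")
    also have "\<dots> = r \<odot>\<^bsub>M\<^esub> D t" unfolding D_def by (rule M.smult_finsum[symmetric, OF r cl[OF t(1)]])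
    finally show ?thesis .
  qed
  have D_mult: "D (r \<otimes>\<^bsub>R\<^esub> t) = r \<odot>\<^bsub>M\<^esub> D t \<oplus>\<^bsub>M\<^esub> sc (\<epsilon> (j x) t) \<odot>\<^bsub>M\<^esub> D r"
    if r: "r \<in> carrier R" and t: "t \<in> carrier R" for r t
  proof -
    \<comment> \<open>Split \<open>t\<close> into its part in \<open>A\<close> and a part killed by
      \<open>\<pi>\<close>. The augmentation at \<open>j x\<close> factors through
      \<open>\<pi>\<close>, so the second part produces no twist term.\<close>
    let ?a = "\<iota> (\<pi> t)" let ?k = "t \<ominus>\<^bsub>R\<^esub> ?a"
    have k: "?k \<in> carrier R" "?a \<in> carrier R" using t by auto
    have tk: "t = ?k \<oplus>\<^bsub>R\<^esub> ?a" using t by (simp add: R.minus_eq R.a_assoc R.l_neg)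
    have "\<pi> t = \<pi> ?k \<oplus>\<^bsub>A\<^esub> \<pi> t" using pi_add[OF k] tk t by simp
    then have "\<pi> ?k = \<zero>\<^bsub>A\<^esub>" using k t by (metis A.add.l_cancel_one' A.a_comm pi_closed)
    then have "D (r \<otimes>\<^bsub>R\<^esub> ?k) = r \<odot>\<^bsub>M\<^esub> D ?k" by (rule D_ker[OF r k(1)])
    moreover have "D (r \<otimes>\<^bsub>R\<^esub> ?a) = r \<odot>\<^bsub>M\<^esub> D ?a \<oplus>\<^bsub>M\<^esub> sc (\<epsilon>A x (\<pi> t)) \<odot>\<^bsub>M\<^esub> D r"
      using D_right[OF r, of "\<pi> t"] D_iota[of "\<pi> t"] t by simp
    moreover have "r \<otimes>\<^bsub>R\<^esub> t = r \<otimes>\<^bsub>R\<^esub> ?k \<oplus>\<^bsub>R\<^esub> r \<otimes>\<^bsub>R\<^esub> ?a" using r k by (subst tk) (simp add: R.r_distr)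
    moreover have "D t = D ?k \<oplus>\<^bsub>M\<^esub> D ?a" using k by (subst tk) (rule D_add)
    ultimately show ?thesis using r k D_closed by (simp add: D_add M.smult_r_distr eps_j x t M.M.a_assoc M.smult_closed)
  qed
  have "D \<one>\<^bsub>R\<^esub> = D \<one>\<^bsub>R\<^esub> \<oplus>\<^bsub>M\<^esub> D \<one>\<^bsub>R\<^esub>"
    using D_mult[of "\<one>\<^bsub>R\<^esub>" "\<one>\<^bsub>R\<^esub>"] D_closed[of "\<one>\<^bsub>R\<^esub>"] x by (simp add: M.smult_one)
  then have D_one: "D \<one>\<^bsub>R\<^esub> = \<zero>\<^bsub>M\<^esub>" using D_closed[of "\<one>\<^bsub>R\<^esub>"] by (metis M.M.add.r_cancel_one' R.one_closed)
  show ?thesis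
  proof (rule that[of D])
    show "R.derivation (j x) M D" unfolding R.derivation_def using D_closed D_add D_mult D_sc[of "\<one>\<^bsub>R\<^esub>"] D_one
      by (auto simp: M.smult_zero_r)
    show "D (\<iota> y) = d y" if "y \<in> carrier A" for y by (rule D_iota[OF that])
    assume de: "d e = \<zero>\<^bsub>M\<^esub>"
    show "\<forall>r\<in>C. D r = \<zero>\<^bsub>M\<^esub>"
    proof
      fix r assume r: "r \<in> C"
      \<comment> \<open>On \<open>C\<close> the final segment is a multiple of \<open>e\<close>,
        where \<open>d\<close> vanishes.\<close>
      have "w b \<odot>\<^bsub>M\<^esub> d (T (co b) r) = \<zero>\<^bsub>M\<^esub>" if b: "b \<in> F" for b
        using T_C[OF lF[OF b] r] b de by (auto simp: d_sc M.smult_zero_r)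
      then show "D r = \<zero>\<^bsub>M\<^esub>" unfolding D_def by (simp add: M.M.add.finprod_one_eqI)
    qed
  qed
qed

lemma smult_scA_res:
  assumes "left_module R M" "m \<in> carrier (res M)"
  shows "\<iota> (scA c) \<odot>\<^bsub>M\<^esub> m = sc c \<odot>\<^bsub>M\<^esub> m"
proof -
  interpret M: left_module R M by fact
  show ?thesis using iota_sc[of "\<one>\<^bsub>A\<^esub>" c] assms(2) by (simp add: M.smult_assoc restrict_scalars_simps)
qed

lemma inner_res:
  assumes "left_module R M" and m: "m \<in> carrier (res M)" and v: "v \<in> VA" and y: "y \<in> carrier A"
  shows "A.inner v (res M) m y = R.inner (j v) M m (\<iota> y)"
proof -
  interpret M: left_module R M by fact
  interpret N: left_module A "res M" by (rule left_module_res[OF M.left_module_axioms])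
  have "n \<ominus>\<^bsub>res M\<^esub> n' = n \<ominus>\<^bsub>M\<^esub> n'" if "n \<in> carrier (res M)" "n' \<in> carrier (res M)" for n n'
  proof -
    have "\<ominus>\<^bsub>res M\<^esub> n' \<oplus>\<^bsub>M\<^esub> n' = \<zero>\<^bsub>M\<^esub>" "\<ominus>\<^bsub>res M\<^esub> n' \<in> carrier M"
      using N.M.l_neg[OF that(2)] N.M.a_inv_closed[OF that(2)] by (auto simp: restrict_scalars_simps)
    moreover have "n' \<in> carrier M" using that(2) by (simp add: restrict_scalars_simps)
    ultimately have "\<ominus>\<^bsub>res M\<^esub> n' = \<ominus>\<^bsub>M\<^esub> n'" by (metis M.M.minus_equality)
    then show ?thesis by (simp add: a_minus_def restrict_scalars_simps)
  qed
  note minus_res = this[OF N.smult_closed[OF y m] N.smult_closed[OF A.sc_closed m]]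
  show ?thesis unfolding A.inner_def R.inner_def minus_res
    unfolding restrict_scalars_simps(4) smult_scA_res[OF M.left_module_axioms m] eps_iota[OF v y] ..
qed

text \<open>By the product rule, vanishing at the unit of \<open>A\<close> forces the values on
  \<open>A\<close> to be fixed by the idempotent, hence to lie in the restricted module.\<close>

lemma derivation_res:
  assumes "left_module R M" and v: "v \<in> VA" and D: "R.derivation (j v) M D" and one: "D (\<iota> \<one>\<^bsub>A\<^esub>) = \<zero>\<^bsub>M\<^esub>"
  shows "A.derivation v (res M) (\<lambda>y. D (\<iota> y))"
proof -
  interpret M: left_module R M by fact
  note DD = R.derivationD[OF D]
  have c: "D (\<iota> y) \<in> carrier (res M)" if y: "y \<in> carrier A" for y
    using DD(3)[of "\<iota> \<one>\<^bsub>A\<^esub>" "\<iota> y"] DD(1)[of "\<iota> y"] y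
    by (simp add: iota_one_mult one M.smult_zero_r M.smult_closed restrict_scalars_simps)
  show ?thesis unfolding A.derivation_def
  proof (intro conjI ballI allI)
    show "(\<lambda>y. D (\<iota> y)) ` carrier A \<subseteq> carrier (res M)" using c by blast
    fix r s assume rs: "r \<in> carrier A" "s \<in> carrier A"
    show "D (\<iota> (r \<oplus>\<^bsub>A\<^esub> s)) = D (\<iota> r) \<oplus>\<^bsub>res M\<^esub> D (\<iota> s)"
      using rs DD(2) by (simp add: iota_add restrict_scalars_simps)
    show "D (\<iota> (r \<otimes>\<^bsub>A\<^esub> s)) = r \<odot>\<^bsub>res M\<^esub> D (\<iota> s) \<oplus>\<^bsub>res M\<^esub> scA (\<epsilon>A v s) \<odot>\<^bsub>res M\<^esub> D (\<iota> r)"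
      using rs DD(3) smult_scA_res[OF M.left_module_axioms c[OF rs(1)]] v by (simp add: iota_mult restrict_scalars_simps eps_iota)
  next
    fix k
    have "\<iota> (scA k) = sc k \<otimes>\<^bsub>R\<^esub> \<iota> \<one>\<^bsub>A\<^esub>" using iota_sc[of "\<one>\<^bsub>A\<^esub>" k] by simp
    then show "D (\<iota> (scA k)) = \<zero>\<^bsub>res M\<^esub>" by (simp add: DD(3,4) one M.smult_zero_r restrict_scalars_simps)
  qed
qed

text \<open>A derivation of \<open>A\<close> extends to \<open>R\<close> and is inner there; the
  implementing element also serves over \<open>A\<close>.\<close>

lemma injective_module_res:
  assumes inj: "injective_module R E"
  shows "injective_module A (res E)"
proof (rule A.derivations_inner_imp_injective)
  note fg = injective_moduleD[OF inj]
  interpret E: left_module R E using fg by (rule fg_module_left)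
  show "fg_module A (res E)" by (rule fg_module_res[OF fg])
  show "A.derivations_inner (res E)" unfolding A.derivations_inner_def
  proof (intro ballI allI impI)
    fix x d assume x: "x \<in> VA" and d: "A.derivation x (res E) d"
    obtain D where D: "R.derivation (j x) E D" "!!y. y \<in> carrier A ==> D (\<iota> y) = d y"
      using derivation_extend[OF E.left_module_axioms x d] by metis
    obtain m where m: "m \<in> carrier E" "!!r. r \<in> carrier R ==> D r = R.inner (j x) E m r"
      using R.injective_imp_derivations_inner[OF inj] D(1) x unfolding R.derivations_inner_def by (metis j_closed)
    \<comment> \<open>A derivation kills the unit; for the inner derivation of \<open>m\<close> this
      says that the idempotent fixes \<open>m\<close>.\<close>
    have "d \<one>\<^bsub>A\<^esub> = \<zero>\<^bsub>E\<^esub>" using A.derivationD(4)[OF d, of 1] by (simp add: restrict_scalars_simps)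
    then have "\<iota> \<one>\<^bsub>A\<^esub> \<odot>\<^bsub>E\<^esub> m \<ominus>\<^bsub>E\<^esub> m = \<zero>\<^bsub>E\<^esub>"
      using D(2)[of "\<one>\<^bsub>A\<^esub>"] m(2)[of "\<iota> \<one>\<^bsub>A\<^esub>"] x m(1) by (simp add: R.inner_def eps_iota E.smult_one)
    then have "\<iota> \<one>\<^bsub>A\<^esub> \<odot>\<^bsub>E\<^esub> m = m"
      using m(1) by (metis A.one_closed E.M.add.inv_solve_right E.M.l_zero E.M.minus_eq E.M.zero_closed E.smult_closed iota_closed)
    then have mr: "m \<in> carrier (res E)" using m(1) by (simp add: restrict_scalars_simps)
    have "d y = A.inner x (res E) m y" if y: "y \<in> carrier A" for y
      using D(2)[OF y] m(2)[of "\<iota> y"] y by (simp add: inner_res[OF E.left_module_axioms mr x y])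
    then show "\<exists>m\<in>carrier (res E). \<forall>y\<in>carrier A. d y = A.inner x (res E) m y" using mr by blast
  qed
qed

lemma inj_dim_at_most_res_aux:
  fixes M :: "('r, 'r fg_carrier) module"
  assumes "fg_module R M" "inj_dim_at_most R n M"
  shows "inj_dim_at_most A n (res M)" using assms
proof (induction n arbitrary: M)
  case 0
  then show ?case by (simp add: inj_dim_at_most_0_iff injective_module_res fg_module_res)
next
  case (Suc n)
  obtain E C :: "('r, 'r fg_carrier) module" and i p where 1: "injective_module R E" "fg_module R C"
    "short_exact R M E C i p" "inj_dim_at_most R n C" using inj_dim_at_most_SucD[OF Suc.prems(2)] by metis
  note E = injective_moduleD[OF 1(1)]
  show ?case by (rule inj_dim_at_most_SucI[OF injective_module_res[OF 1(1)] fg_module_res[OF 1(2)]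
          short_exact_res[OF fg_module_left[OF Suc.prems(1)] fg_module_left[OF E] fg_module_left[OF 1(2)] 1(3)]
          Suc.IH[OF 1(2,4)]])
qed

lemma inj_dim_at_most_res:
  assumes "fg_module R M" "inj_dim_at_most R n M"
  shows "inj_dim_at_most A n (res M)"
proof -
  obtain C :: "('r, 'r fg_carrier) module" and q p where C: "fg_module R C" "q \<in> mod_hom R M C"
    "p \<in> mod_hom R C M" "!!x. x \<in> carrier M ==> p (q x) = x" "!!y. y \<in> carrier C ==> q (p y) = y"
    "inj_dim_at_most R n C" using inj_dim_at_most_copy[OF assms] by metis
  have q: "q \<in> mod_hom A (res M) (res C)" and p: "p \<in> mod_hom A (res C) (res M)"
    by (rule mod_hom_res[OF C(2)], rule mod_hom_res[OF C(3)])
  have "bij_betw q (carrier (res M)) (carrier (res C))" by (rule bij_betw_byWitness[of _ p])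
       (use mod_homD(1)[OF q] mod_homD(1)[OF p] C(4,5) in "auto simp: restrict_scalars_simps")
  then show ?thesis by (rule inj_dim_at_most_iso[OF inj_dim_at_most_res_aux[OF C(1,6)] q])
qed

text \<open>The maps \<open>\<iota>\<close> and \<open>\<pi>\<close> make the regular module of
  \<open>A\<close> a retract of the restricted regular module of \<open>R\<close>.\<close>

lemma inj_dim_at_most_regular:
  assumes "inj_dim_at_most R n (regular_module R)"
  shows "inj_dim_at_most A n (regular_module A)"
proof -
  have "inj_dim_at_most A n (res (regular_module R))" by (rule inj_dim_at_most_res[OF R.fg_regular assms])
  moreover have "\<iota> \<in> mod_hom A (regular_module A) (res (regular_module R))"
    by (rule mod_homI) (auto simp: restrict_scalars_simps regular_module_def iota_add iota_mult iota_one_mult)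
  moreover have "\<pi> \<in> mod_hom A (res (regular_module R)) (regular_module A)"
    by (rule mod_homI) (auto simp: restrict_scalars_simps regular_module_def pi_add pi_mult)
  ultimately show ?thesis by (rule inj_dim_at_most_retract[OF A.enough_injectives fg_module_res[OF R.fg_regular] A.fg_regular])
       (simp add: regular_module_def)
qed

end

lemma mod_hom_finsum_pointwise:
  assumes "left_module R N" "finite F" "!!b. b \<in> F ==> f b \<in> mod_hom R M N"
  shows "(\<lambda>x. \<Oplus>\<^bsub>N\<^esub>b\<in>F. f b x) \<in> mod_hom R M N"
proof -
  interpret N: left_module R N by fact
  show ?thesis
  proof (rule mod_homI)
    fix x assume x: "x \<in> carrier M"
    have fx: "(\<lambda>b. f b x) \<in> F \<rightarrow> carrier N" if "x \<in> carrier M" for x using mod_homD(1)[OF assms(3)] that by blast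
    show "(\<Oplus>\<^bsub>N\<^esub>b\<in>F. f b x) \<in> carrier N" by (rule N.M.finsum_closed[OF fx[OF x]])
    { fix y assume y: "y \<in> carrier M"
      have "(\<Oplus>\<^bsub>N\<^esub>b\<in>F. f b (x \<oplus>\<^bsub>M\<^esub> y)) = (\<Oplus>\<^bsub>N\<^esub>b\<in>F. f b x \<oplus>\<^bsub>N\<^esub> f b y)"
        by (rule N.M.finsum_cong'[OF refl]) (use x y mod_homD(1,2)[OF assms(3)] in auto)
      then show "(\<Oplus>\<^bsub>N\<^esub>b\<in>F. f b (x \<oplus>\<^bsub>M\<^esub> y)) = (\<Oplus>\<^bsub>N\<^esub>b\<in>F. f b x) \<oplus>\<^bsub>N\<^esub> (\<Oplus>\<^bsub>N\<^esub>b\<in>F. f b y)"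
        by (simp only: N.M.finsum_addf[OF fx[OF x] fx[OF y]]) }
    fix r assume r: "r \<in> carrier R"
    have "(\<Oplus>\<^bsub>N\<^esub>b\<in>F. f b (r \<odot>\<^bsub>M\<^esub> x)) = (\<Oplus>\<^bsub>N\<^esub>b\<in>F. r \<odot>\<^bsub>N\<^esub> f b x)"
      by (rule N.M.finsum_cong'[OF refl]) (use x r mod_homD(1,3)[OF assms(3)] N.smult_closed in auto)
    then show "(\<Oplus>\<^bsub>N\<^esub>b\<in>F. f b (r \<odot>\<^bsub>M\<^esub> x)) = r \<odot>\<^bsub>N\<^esub> (\<Oplus>\<^bsub>N\<^esub>b\<in>F. f b x)"
      by (simp only: N.smult_finsum[OF r fx[OF x]])
  qed
qed

text \<open>The families \<open>\<sigma>\<close> and \<open>\<tau>\<close> exhibit \<open>M\<close>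
  as a retract of a finite power of \<open>P\<close>.\<close>

lemma inj_dim_at_most_sum_of_copies:
  fixes R :: "('r, 's) ring_scheme"
  assumes enough: "enough_injectives R" and P: "fg_module R P" "inj_dim_at_most R n P"
    and M: "fg_module R M" and F: "finite F"
    and \<sigma>: "!!b. b \<in> F ==> \<sigma> b \<in> mod_hom R M P" and \<tau>: "!!b. b \<in> F ==> \<tau> b \<in> mod_hom R P M"
    and sum: "!!x. x \<in> carrier M ==> (\<Oplus>\<^bsub>M\<^esub>b\<in>F. \<tau> b (\<sigma> b x)) = x"
  shows "inj_dim_at_most R n M"
proof -
  interpret M: left_module R M using M by (rule fg_module_left)
  interpret P: left_module R P using P(1) by (rule fg_module_left)
  \<comment> \<open>The power is built one factor at a time and moved back to the type
    \<open>fg_carrier\<close> each time; only its coordinate maps are remembered.\<close>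
  have "\<exists>(Q :: ('r, 'r fg_carrier) module) u pr. fg_module R Q \<and> inj_dim_at_most R n Q \<and> u \<in> mod_hom R M Q \<and>
    (\<forall>b\<in>F. pr b \<in> mod_hom R Q P \<and> (\<forall>x\<in>carrier M. pr b (u x) = \<sigma> b x))" using F \<sigma>
  proof (induction F)
    case empty
    obtain Q :: "('r, 'r fg_carrier) module" and q p where Q: "fg_module R Q" "q \<in> mod_hom R P Q"
      "p \<in> mod_hom R Q P" "inj_dim_at_most R n Q" using inj_dim_at_most_copy[OF P] by metis
    interpret Q: left_module R Q using Q(1) by (rule fg_module_left)
    have "(\<lambda>_. \<zero>\<^bsub>Q\<^esub>) \<in> mod_hom R M Q" by (rule mod_homI) (auto simp: Q.smult_zero_r)
    then show ?case using Q(1,4) by blast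
  next
    case (insert b F)
    then obtain Q :: "('r, 'r fg_carrier) module" and u pr where Q: "fg_module R Q" "inj_dim_at_most R n Q"
      "u \<in> mod_hom R M Q" "!!b. b \<in> F ==> pr b \<in> mod_hom R Q P"
      "!!b x. b \<in> F ==> x \<in> carrier M ==> pr b (u x) = \<sigma> b x" by (metis insertCI)
    obtain S :: "('r, 'r fg_carrier) module" and q p where S: "fg_module R S" "q \<in> mod_hom R (prod_module Q P) S"
      "p \<in> mod_hom R S (prod_module Q P)" "!!x. x \<in> carrier (prod_module Q P) ==> p (q x) = x"
      "inj_dim_at_most R n S"
      using inj_dim_at_most_copy[OF fg_module_prod[OF Q(1) P(1)] inj_dim_at_most_prod[OF Q(1) P(1) Q(2) P(2)]] by metis
    have sb: "\<sigma> b \<in> mod_hom R M P" using insert.prems by simp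
    have u: "(\<lambda>x. q (u x, \<sigma> b x)) \<in> mod_hom R M S" by (rule mod_hom_comp[OF mod_hom_pair[OF Q(3) sb] S(2)])
    let ?pr = "\<lambda>c. if c = b then (\<lambda>y. snd (p y)) else (\<lambda>y. pr c (fst (p y)))"
    have "?pr c \<in> mod_hom R S P \<and> (\<forall>x\<in>carrier M. ?pr c (q (u x, \<sigma> b x)) = \<sigma> c x)" if c: "c \<in> insert b F" for c
    proof (intro conjI ballI)
      show "?pr c \<in> mod_hom R S P"
        using c Q(4) mod_hom_comp[OF S(3) mod_hom_snd] mod_hom_comp[OF mod_hom_comp[OF S(3) mod_hom_fst]] by auto
      fix x assume x: "x \<in> carrier M"
      have "p (q (u x, \<sigma> b x)) = (u x, \<sigma> b x)" using mod_homD(1)[OF Q(3) x] mod_homD(1)[OF sb x] S(4) by simp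
      then show "?pr c (q (u x, \<sigma> b x)) = \<sigma> c x" using c Q(5) x by auto
    qed
    then show ?case using S(1,5) u by (intro exI[of _ S] exI[of _ "\<lambda>x. q (u x, \<sigma> b x)"] exI[of _ ?pr]) blast
  qed
  then obtain Q :: "('r, 'r fg_carrier) module" and u pr where Q: "fg_module R Q" "inj_dim_at_most R n Q"
    "u \<in> mod_hom R M Q" "!!b. b \<in> F ==> pr b \<in> mod_hom R Q P"
    "!!b x. b \<in> F ==> x \<in> carrier M ==> pr b (u x) = \<sigma> b x" by metis
  have v: "(\<lambda>y. \<Oplus>\<^bsub>M\<^esub>b\<in>F. \<tau> b (pr b y)) \<in> mod_hom R Q M"
    by (rule mod_hom_finsum_pointwise[OF M.left_module_axioms F mod_hom_comp[OF Q(4) \<tau>]])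
  show ?thesis
  proof (rule inj_dim_at_most_retract[OF enough Q(1) M Q(2,3) v])
    fix x assume x: "x \<in> carrier M"
    have "(\<Oplus>\<^bsub>M\<^esub>b\<in>F. \<tau> b (pr b (u x))) = (\<Oplus>\<^bsub>M\<^esub>b\<in>F. \<tau> b (\<sigma> b x))"
      by (rule M.M.finsum_cong'[OF refl]) (use x Q(5) mod_homD(1)[OF \<sigma>] mod_homD(1)[OF \<tau>] in auto)
    then show "(\<Oplus>\<^bsub>M\<^esub>b\<in>F. \<tau> b (pr b (u x))) = x" using sum[OF x] by simp
  qed
qed

context augmented_algebra
begin

lemma inner_closed: "[|left_module R M; m \<in> carrier M; r \<in> carrier R|] ==> inner x M m r \<in> carrier M"
proof -
  assume "left_module R M" and m: "m \<in> carrier M" "r \<in> carrier R"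
  then interpret M: left_module R M by simp
  show ?thesis using m by (simp add: inner_def M.smult_closed)
qed

lemma inner_add:
  assumes "left_module R M" "m \<in> carrier M" "n \<in> carrier M" "r \<in> carrier R"
  shows "inner x M (m \<oplus>\<^bsub>M\<^esub> n) r = inner x M m r \<oplus>\<^bsub>M\<^esub> inner x M n r"
proof -
  interpret M: left_module R M by fact
  show ?thesis using assms(2-) by (simp add: inner_def M.smult_r_distr M.smult_closed M.M.minus_eq M.M.minus_add M.M.a_ac)
qed

lemma inner_minus:
  assumes "left_module R M" "m \<in> carrier M" "r \<in> carrier R"
  shows "inner x M (\<ominus>\<^bsub>M\<^esub> m) r = \<ominus>\<^bsub>M\<^esub> inner x M m r"
proof -
  interpret M: left_module R M by fact
  show ?thesis using assms(2-) by (simp add: inner_def M.smult_minus_r M.smult_closed M.M.minus_eq M.M.minus_add)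
qed

lemma derivation_inner:
  assumes "left_module R M" "m \<in> carrier M" "x \<in> V"
  shows "derivation x M (inner x M m)"
proof -
  interpret M: left_module R M by fact
  show ?thesis unfolding derivation_def
  proof (intro conjI ballI allI)
    show "inner x M m ` carrier R \<subseteq> carrier M" using inner_closed[OF assms(1,2)] by blast
    fix r s assume rs: "r \<in> carrier R" "s \<in> carrier R"
    show "inner x M m (r \<oplus> s) = inner x M m r \<oplus>\<^bsub>M\<^esub> inner x M m s"
      using rs assms(2,3) by (simp add: inner_def eps_add sc_add M.smult_l_distr M.smult_closed M.M.minus_eq M.M.minus_add M.M.a_ac)
    have "sc (\<epsilon> x r * \<epsilon> x s) \<odot>\<^bsub>M\<^esub> m = sc (\<epsilon> x s) \<odot>\<^bsub>M\<^esub> (sc (\<epsilon> x r) \<odot>\<^bsub>M\<^esub> m)"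
      using assms(2) sc_mult[of "\<epsilon> x s" "\<epsilon> x r"] by (simp add: mult.commute M.smult_assoc)
    moreover have "r \<odot>\<^bsub>M\<^esub> (sc (\<epsilon> x s) \<odot>\<^bsub>M\<^esub> m) = sc (\<epsilon> x s) \<odot>\<^bsub>M\<^esub> (r \<odot>\<^bsub>M\<^esub> m)"
      by (rule sc_smult_commute[OF assms(1) rs(1) assms(2)])
    ultimately show "inner x M m (r \<otimes> s) = r \<odot>\<^bsub>M\<^esub> inner x M m s \<oplus>\<^bsub>M\<^esub> sc (\<epsilon> x s) \<odot>\<^bsub>M\<^esub> inner x M m r"
      using rs assms(2,3)
      by (simp add: inner_def eps_mult M.smult_assoc M.smult_r_distr M.smult_minus_r M.smult_closed M.M.minus_eq M.M.a_assoc M.M.r_neg1)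
  next
    fix c
    show "inner x M m (sc c) = \<zero>\<^bsub>M\<^esub>" using assms(2,3) by (simp add: inner_def M.smult_closed M.M.minus_eq M.M.r_neg)
  qed
qed

lemma derivation_add:
  assumes "left_module R M" "x \<in> V" and D: "derivation x M D" and D': "derivation x M D'"
  shows "derivation x M (\<lambda>r. D r \<oplus>\<^bsub>M\<^esub> D' r)"
proof -
  interpret M: left_module R M by fact
  show ?thesis unfolding derivation_def using derivationD[OF D] derivationD[OF D'] by (auto simp: M.smult_r_distr M.smult_closed M.M.a_ac)
qed

lemma derivation_one: "derivation x M D ==> D \<one> = \<zero>\<^bsub>M\<^esub>" using derivationD(4)[of x M D 1] by simp

text \<open>Derivations can be normalised by adding inner ones; in this way they are made to vanish
  on the units of the two halves.\<close>

lemma inner_absorb: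
  assumes "left_module R M" "x \<in> V" "derivation x M D" "n \<in> carrier M"
    and "\<exists>m\<in>carrier M. \<forall>r\<in>carrier R. D r \<oplus>\<^bsub>M\<^esub> inner x M n r = inner x M m r"
  shows "\<exists>m\<in>carrier M. \<forall>r\<in>carrier R. D r = inner x M m r"
proof -
  interpret M: left_module R M by fact
  obtain m where m: "m \<in> carrier M" "\<forall>r\<in>carrier R. D r \<oplus>\<^bsub>M\<^esub> inner x M n r = inner x M m r"
    using assms(5) by blast
  have "D r = inner x M (m \<oplus>\<^bsub>M\<^esub> \<ominus>\<^bsub>M\<^esub> n) r" if r: "r \<in> carrier R" for r
  proof -
    note c = derivationD(1)[OF assms(3) r] inner_closed[OF assms(1,4) r]
    have "inner x M (m \<oplus>\<^bsub>M\<^esub> \<ominus>\<^bsub>M\<^esub> n) r = (D r \<oplus>\<^bsub>M\<^esub> inner x M n r) \<oplus>\<^bsub>M\<^esub> \<ominus>\<^bsub>M\<^esub> inner x M n r"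
      using m r assms(1,4) by (simp add: inner_add inner_minus)
    also have "\<dots> = D r" using c by (simp add: M.M.a_assoc M.M.r_neg)
    finally show ?thesis ..
  qed
  then show ?thesis using m(1) assms(4) by (intro bexI[of _ "m \<oplus>\<^bsub>M\<^esub> \<ominus>\<^bsub>M\<^esub> n"]) auto
qed

end

context corner
begin

text \<open>By the mirror image of \<open>suffix_map\<close>, the right module is a summand of a sum of copies of \<open>A\<close>.\<close>

lemma inj_dim_at_most_res_opposite:
  defines "M \<equiv> restrict_scalars (opposite_ring A) \<iota> (regular_module (opposite_ring R))"
  assumes fg: "fg_module (opposite_ring A) M"
    and id: "inj_dim_at_most (opposite_ring A) n (regular_module (opposite_ring A))"
  shows "inj_dim_at_most (opposite_ring A) n M"
proof -
  interpret RO: augmented_algebra "opposite_ring R" sc V \<epsilon> by (rule augmented_algebra_opposite) (rule R.augmented_algebra_axioms)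
  interpret AO: augmented_algebra "opposite_ring A" scA VA \<epsilon>A by (rule augmented_algebra_opposite) (rule A.augmented_algebra_axioms)
  interpret M: left_module "opposite_ring A" M using fg by (rule fg_module_left)
  have M_simps: "carrier M = {r \<in> carrier R. r \<otimes>\<^bsub>R\<^esub> \<iota> \<one>\<^bsub>A\<^esub> = r}" "!!r s. r \<oplus>\<^bsub>M\<^esub> s = r \<oplus>\<^bsub>R\<^esub> s"
    "!!x r. x \<odot>\<^bsub>M\<^esub> r = r \<otimes>\<^bsub>R\<^esub> \<iota> x"
    by (simp_all add: M_def restrict_scalars_simps) (simp_all add: regular_module_def)
  obtain T where T: "suffix_map R sc A scA \<iota> \<pi> e C T" using suffix_map_exists by blast
  obtain F :: "nat set" and w co where dual: "finite F" "w \<in> F \<rightarrow> carrier R"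
    "\<forall>b\<in>F. lin_functional R sc (co b)" "\<forall>r\<in>carrier R. r = (\<Oplus>\<^bsub>R\<^esub>b\<in>F. sc (co b r) \<otimes>\<^bsub>R\<^esub> w b)"
    using R.dual_basis by (elim exE conjE)
  note wF [simp] = funcset_mem[OF dual(2)] and lF = bspec[OF dual(3)]
  note T1 = T[unfolded suffix_map_def, THEN conjunct1]
  note T2 = T[unfolded suffix_map_def, THEN conjunct2, THEN spec, THEN spec, THEN spec, THEN mp, OF dual(1),
      THEN mp, OF dual(2), THEN mp, OF dual(3), THEN mp, OF dual(4)]
  show ?thesis
  proof (rule inj_dim_at_most_sum_of_copies[OF AO.enough_injectives AO.fg_regular id fg dual(1),
        of "\<lambda>b. T (co b)" "\<lambda>b y. w b \<otimes>\<^bsub>R\<^esub> \<iota> y"])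
    fix b assume b: "b \<in> F"
    show "T (co b) \<in> mod_hom (opposite_ring A) M (regular_module (opposite_ring A))"
      by (rule mod_homI) (use T1 lF[OF b] in "auto simp: M_simps regular_module_def")
    show "(\<lambda>y. w b \<otimes>\<^bsub>R\<^esub> \<iota> y) \<in> mod_hom (opposite_ring A) (regular_module (opposite_ring A)) M"
      by (rule mod_homI)
         (use b in "auto simp: M_simps regular_module_def R.m_assoc iota_one_mult iota_add iota_mult R.r_distr")
  next
    fix r assume "r \<in> carrier M"
    then have r: "r \<in> carrier R" "r \<otimes>\<^bsub>R\<^esub> \<iota> \<one>\<^bsub>A\<^esub> = r" by (auto simp: M_simps)
    have cl: "T (co b) r \<in> carrier A" if "b \<in> F" for b using T1 lF[OF that] r by blast
    have "(\<Oplus>\<^bsub>M\<^esub>b\<in>F. w b \<otimes>\<^bsub>R\<^esub> \<iota> (T (co b) r)) = (\<Oplus>\<^bsub>R\<^esub>b\<in>F. w b \<otimes>\<^bsub>R\<^esub> \<iota> (T (co b) r))"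
      by (rule finsum_additive[OF M.M.abelian_group_axioms R.abelian_group_axioms, of "\<lambda>x. x"])
         (use cl in "auto simp: M_simps R.m_assoc iota_one_mult")
    also have "\<dots> = r" using T2 r by (metis (no_types, lifting))
    finally show "(\<Oplus>\<^bsub>M\<^esub>b\<in>F. w b \<otimes>\<^bsub>R\<^esub> \<iota> (T (co b) r)) = r" .
  qed
qed

end

section \<open>Gluing two algebras along an idempotent\<close>

text \<open>Each algebra needs a corner on both sides: extending derivations into left modules uses
  final segments, while decomposing the left regular module uses initial ones. In
  \<open>one_eq\<close> the vertex idempotent appears because the glued vertex is counted in both
  units.\<close>

locale glued_algebra =
  ca: corner R sc V \<epsilon> A scA VA \<epsilon>A \<iota>A \<pi>A jA eA CA +
  cb: corner R sc V \<epsilon> B scB VB \<epsilon>B \<iota>B \<pi>B jB eB CB +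
  coa: corner "opposite_ring R" sc V \<epsilon> "opposite_ring A" scA VA \<epsilon>A \<iota>A \<pi>A jA eA CA +
  cob: corner "opposite_ring R" sc V \<epsilon> "opposite_ring B" scB VB \<epsilon>B \<iota>B \<pi>B jB eB CB
  for R :: "('r, 's) ring_scheme" and sc :: "'k::field => 'r" and V :: "'x set" and \<epsilon>
    and A :: "('a, 't) ring_scheme" and scA :: "'k => 'a" and VA :: "'y set" and \<epsilon>A \<iota>A \<pi>A jA eA CA
    and B :: "('b, 'u) ring_scheme" and scB :: "'k => 'b" and VB :: "'z set" and \<epsilon>B \<iota>B \<pi>B jB eB CB +
  fixes a :: 'y and b :: 'z
  assumes CA: "CA = \<iota>B ` carrier B" and CB: "CB = \<iota>A ` carrier A"
    and e_eq: "\<iota>A eA = \<iota>B eB"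
    and one_eq: "\<iota>A \<one>\<^bsub>A\<^esub> \<oplus>\<^bsub>R\<^esub> \<iota>B \<one>\<^bsub>B\<^esub> = \<one>\<^bsub>R\<^esub> \<oplus>\<^bsub>R\<^esub> \<iota>A eA"
    and prod_AB: "\<iota>A \<one>\<^bsub>A\<^esub> \<otimes>\<^bsub>R\<^esub> \<iota>B \<one>\<^bsub>B\<^esub> = \<iota>A eA"
    and prod_BA: "\<iota>B \<one>\<^bsub>B\<^esub> \<otimes>\<^bsub>R\<^esub> \<iota>A \<one>\<^bsub>A\<^esub> = \<iota>A eA"
    and generated: "[|H \<subseteq> carrier R; !!r s. r \<in> H ==> s \<in> H ==> r \<oplus>\<^bsub>R\<^esub> s \<in> H;
      !!r s. r \<in> H ==> s \<in> H ==> r \<otimes>\<^bsub>R\<^esub> s \<in> H; \<iota>A ` carrier A \<subseteq> H; \<iota>B ` carrier B \<subseteq> H|] ==> H = carrier R"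
    and V_cases: "V \<subseteq> jA ` VA \<union> jB ` VB"
    and a_in: "a \<in> VA" and b_in: "b \<in> VB"
    and eps_ab: "r \<in> carrier R ==> \<epsilon> (jA a) r = \<epsilon> (jB b) r"
    and eps_eA: "y \<in> VA ==> \<epsilon>A y eA = (if y = a then 1 else 0)"
    and eps_eB: "z \<in> VB ==> \<epsilon>B z eB = (if z = b then 1 else 0)"
begin

lemma swap: "glued_algebra R sc V \<epsilon> B scB VB \<epsilon>B \<iota>B \<pi>B jB eB CB A scA VA \<epsilon>A \<iota>A \<pi>A jA eA CA b a"
proof (rule glued_algebra.intro[OF cb.corner_axioms ca.corner_axioms cob.corner_axioms coa.corner_axioms], unfold_locales)
  show "\<iota>B \<one>\<^bsub>B\<^esub> \<oplus>\<^bsub>R\<^esub> \<iota>A \<one>\<^bsub>A\<^esub> = \<one>\<^bsub>R\<^esub> \<oplus>\<^bsub>R\<^esub> \<iota>B eB"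
    using one_eq e_eq by (simp add: ca.R.a_comm)
  show "H = carrier R" if "H \<subseteq> carrier R" "!!r s. r \<in> H ==> s \<in> H ==> r \<oplus>\<^bsub>R\<^esub> s \<in> H"
      "!!r s. r \<in> H ==> s \<in> H ==> r \<otimes>\<^bsub>R\<^esub> s \<in> H" "\<iota>B ` carrier B \<subseteq> H" "\<iota>A ` carrier A \<subseteq> H" for H
    by (rule generated) (use that in auto)
qed (use CA CB e_eq prod_AB prod_BA V_cases a_in b_in eps_ab eps_eA eps_eB in auto)

text \<open>The hypotheses come in mirrored pairs, so statements about left injective dimension turn
  into statements about right injective dimension.\<close>

lemma opposite:
  "glued_algebra (opposite_ring R) sc V \<epsilon> (opposite_ring A) scA VA \<epsilon>A \<iota>A \<pi>A jA eA CA
     (opposite_ring B) scB VB \<epsilon>B \<iota>B \<pi>B jB eB CB a b"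
proof (rule glued_algebra.intro[OF coa.corner_axioms cob.corner_axioms])
  show "corner (opposite_ring (opposite_ring R)) sc V \<epsilon> (opposite_ring (opposite_ring A)) scA VA \<epsilon>A \<iota>A \<pi>A jA eA CA"
    using ca.corner_axioms by simp
  show "corner (opposite_ring (opposite_ring R)) sc V \<epsilon> (opposite_ring (opposite_ring B)) scB VB \<epsilon>B \<iota>B \<pi>B jB eB CB"
    using cb.corner_axioms by simp
  show "glued_algebra_axioms (opposite_ring R) V \<epsilon> (opposite_ring A) VA \<epsilon>A \<iota>A jA eA CA (opposite_ring B) VB \<epsilon>B \<iota>B jB eB CB a b"
  proof unfold_locales
    show "H = carrier (opposite_ring R)" if "H \<subseteq> carrier (opposite_ring R)"
        "!!r s. r \<in> H ==> s \<in> H ==> r \<oplus>\<^bsub>opposite_ring R\<^esub> s \<in> H"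
        "!!r s. r \<in> H ==> s \<in> H ==> r \<otimes>\<^bsub>opposite_ring R\<^esub> s \<in> H"
        "\<iota>A ` carrier (opposite_ring A) \<subseteq> H" "\<iota>B ` carrier (opposite_ring B) \<subseteq> H" for H
      using generated[of H] that by simp
  qed (use CA CB e_eq one_eq prod_AB prod_BA V_cases a_in b_in eps_ab eps_eA eps_eB in auto)
qed

section \<open>The socle condition at the glued vertex\<close>

text \<open>Seen over \<open>A\<close>, the element \<open>s\<close> is zero or spans a copy of the
  simple module at \<open>a\<close>; likewise \<open>t\<close> over \<open>B\<close>.\<close>

definition socle_condition :: "('r, 'm) module => bool" where
  "socle_condition M \<longleftrightarrow> (\<forall>c\<in>carrier M. \<iota>A eA \<odot>\<^bsub>M\<^esub> c = c -->
     (\<exists>s\<in>carrier M. \<exists>t\<in>carrier M. c = s \<oplus>\<^bsub>M\<^esub> t \<and>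
        (\<forall>y\<in>carrier A. \<iota>A y \<odot>\<^bsub>M\<^esub> s = sc (\<epsilon>A a y) \<odot>\<^bsub>M\<^esub> s) \<and>
        (\<forall>z\<in>carrier B. \<iota>B z \<odot>\<^bsub>M\<^esub> t = sc (\<epsilon>B b z) \<odot>\<^bsub>M\<^esub> t)))"

lemma eps_iota_ab: "y \<in> carrier A ==> \<epsilon> (jB b) (\<iota>A y) = \<epsilon>A a y"
  using eps_ab[of "\<iota>A y"] ca.eps_iota[OF a_in] by simp

lemma eps_iota_ba: "z \<in> carrier B ==> \<epsilon> (jA a) (\<iota>B z) = \<epsilon>B b z"
  using eps_ab[of "\<iota>B z"] cb.eps_iota[OF b_in] by simp

text \<open>
  Split the extension of the simple module at the glued vertex on which \<open>A\<close> acts trivially and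
  \<open>B\<close> acts through the inner derivation of \<open>c\<close>.
\<close>

lemma injective_socle_condition:
  assumes inj: "injective_module R E"
  shows "socle_condition E" unfolding socle_condition_def
proof (intro ballI impI)
  interpret E: left_module R E using injective_moduleD[OF inj] by (rule fg_module_left)
  fix c assume c: "c \<in> carrier E" "\<iota>A eA \<odot>\<^bsub>E\<^esub> c = c"
  have "\<iota>B \<one>\<^bsub>B\<^esub> \<odot>\<^bsub>E\<^esub> (\<iota>B eB \<odot>\<^bsub>E\<^esub> c) = \<iota>B eB \<odot>\<^bsub>E\<^esub> c"
    using c(1) by (simp add: E.smult_assoc[symmetric] cb.iota_one_mult)
  then have cB: "c \<in> carrier (cb.res E)" using c e_eq by (simp add: restrict_scalars_simps)
  let ?d = "cb.A.inner b (cb.res E) c"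
  have lm: "left_module B (cb.res E)" by (rule cb.left_module_res[OF E.left_module_axioms])
  have d: "cb.A.derivation b (cb.res E) ?d" by (rule cb.A.derivation_inner[OF lm cB b_in])
  \<comment> \<open>Since \<open>c\<close> lies at the glued vertex, its inner derivation vanishes
    at the vertex idempotent, so the extension can be taken to vanish on the whole image of
    \<open>A\<close>.\<close>
  have de: "?d eB = \<zero>\<^bsub>E\<^esub>" using c e_eq eps_eB[OF b_in] b_in
    by (simp add: cb.inner_res[OF E.left_module_axioms cB b_in] ca.R.inner_def cb.eps_iota E.smult_one E.M.minus_eq E.M.r_neg)
  obtain D where D: "ca.R.derivation (jB b) E D" "!!z. z \<in> carrier B ==> D (\<iota>B z) = ?d z"
    "\<forall>r\<in>CB. D r = \<zero>\<^bsub>E\<^esub>" using cb.derivation_extend[OF E.left_module_axioms b_in d] de by metis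
  obtain m where m: "m \<in> carrier E" "!!r. r \<in> carrier R ==> D r = ca.R.inner (jB b) E m r"
    using ca.R.injective_imp_derivations_inner[OF inj] D(1) b_in unfolding ca.R.derivations_inner_def by (metis cb.j_closed)
  \<comment> \<open>The summands are \<open>m\<close> and \<open>c - m\<close>: vanishing of
    \<open>D\<close> on \<open>A\<close> makes \<open>A\<close> act on \<open>m\<close> through the
    augmentation, and on \<open>B\<close> the elements \<open>m\<close> and \<open>c\<close> define
    the same inner derivation.\<close>
  have A: "\<iota>A y \<odot>\<^bsub>E\<^esub> m = sc (\<epsilon>A a y) \<odot>\<^bsub>E\<^esub> m" if y: "y \<in> carrier A" for y
  proof -
    have "\<iota>A y \<odot>\<^bsub>E\<^esub> m \<ominus>\<^bsub>E\<^esub> sc (\<epsilon>A a y) \<odot>\<^bsub>E\<^esub> m = \<zero>\<^bsub>E\<^esub>"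
      using D(3) m(2)[of "\<iota>A y"] y by (simp add: CB ca.R.inner_def eps_iota_ab)
    then show ?thesis using y m(1)
      by (metis E.M.add.inv_solve_right E.M.l_zero E.M.minus_eq E.M.zero_closed E.smult_closed ca.R.sc_closed ca.iota_closed)
  qed
  have B: "\<iota>B z \<odot>\<^bsub>E\<^esub> (c \<ominus>\<^bsub>E\<^esub> m) = sc (\<epsilon>B b z) \<odot>\<^bsub>E\<^esub> (c \<ominus>\<^bsub>E\<^esub> m)" if z: "z \<in> carrier B" for z
  proof -
    have "ca.R.inner (jB b) E m (\<iota>B z) = ca.R.inner (jB b) E c (\<iota>B z)"
      using D(2)[OF z] m(2)[of "\<iota>B z"] z cb.inner_res[OF E.left_module_axioms cB b_in z] by simp
    then have "ca.R.inner (jB b) E (c \<oplus>\<^bsub>E\<^esub> \<ominus>\<^bsub>E\<^esub> m) (\<iota>B z) = \<zero>\<^bsub>E\<^esub>"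
      using z c(1) m(1) ca.R.inner_closed[OF E.left_module_axioms c(1), of "\<iota>B z"]
      by (simp add: ca.R.inner_add[OF E.left_module_axioms] ca.R.inner_minus[OF E.left_module_axioms] E.M.r_neg)
    then have "\<iota>B z \<odot>\<^bsub>E\<^esub> (c \<ominus>\<^bsub>E\<^esub> m) \<ominus>\<^bsub>E\<^esub> sc (\<epsilon>B b z) \<odot>\<^bsub>E\<^esub> (c \<ominus>\<^bsub>E\<^esub> m) = \<zero>\<^bsub>E\<^esub>"
      using z b_in by (simp add: ca.R.inner_def cb.eps_iota E.M.minus_eq)
    then show ?thesis using z m(1) c(1)
      by (metis E.M.add.inv_solve_right E.M.l_zero E.M.minus_closed E.M.minus_eq E.M.zero_closed E.smult_closed ca.R.sc_closed cb.iota_closed)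
  qed
  have "c = m \<oplus>\<^bsub>E\<^esub> (c \<ominus>\<^bsub>E\<^esub> m)" using c(1) m(1) by (simp add: E.M.minus_eq E.M.a_lcomm E.M.r_neg)
  then show "\<exists>s\<in>carrier E. \<exists>t\<in>carrier E. c = s \<oplus>\<^bsub>E\<^esub> t \<and>
        (\<forall>y\<in>carrier A. \<iota>A y \<odot>\<^bsub>E\<^esub> s = sc (\<epsilon>A a y) \<odot>\<^bsub>E\<^esub> s) \<and>
        (\<forall>z\<in>carrier B. \<iota>B z \<odot>\<^bsub>E\<^esub> t = sc (\<epsilon>B b z) \<odot>\<^bsub>E\<^esub> t)"
    using A B m(1) c(1) by (intro bexI[of _ m] bexI[of _ "c \<ominus>\<^bsub>E\<^esub> m"] conjI) auto
qed

text \<open>Lift the element, move the lift to the glued vertex with the idempotent, split it there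
  and push the parts forward. Cosyzygies, being quotients of injective modules, thus satisfy the
  condition whatever the original module is.\<close>

lemma socle_condition_quotient:
  assumes "left_module R E" "left_module R M" "p \<in> mod_hom R E M" "p ` carrier E = carrier M" "socle_condition E"
  shows "socle_condition M" unfolding socle_condition_def
proof (intro ballI impI)
  interpret E: left_module R E by fact
  interpret M: left_module R M by fact
  note p = mod_homD[OF assms(3)]
  fix c assume c: "c \<in> carrier M" "\<iota>A eA \<odot>\<^bsub>M\<^esub> c = c"
  then obtain d where d: "d \<in> carrier E" "c = p d" using assms(4) by blast
  let ?d = "\<iota>A eA \<odot>\<^bsub>E\<^esub> d"
  have idem: "\<iota>A eA \<otimes>\<^bsub>R\<^esub> \<iota>A eA = \<iota>A eA"
    using ca.iota_one_mult(1)[of eA] cb.iota_one_mult(1)[of eB] prod_AB e_eq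
    by (metis ca.R.m_assoc ca.e_closed ca.iota_closed ca.A.one_closed cb.A.one_closed cb.e_closed cb.iota_closed)
  have "\<iota>A eA \<odot>\<^bsub>E\<^esub> ?d = ?d" using d(1) by (simp add: E.smult_assoc[symmetric] idem)
  then obtain s t where st: "s \<in> carrier E" "t \<in> carrier E" "?d = s \<oplus>\<^bsub>E\<^esub> t"
    "\<forall>y\<in>carrier A. \<iota>A y \<odot>\<^bsub>E\<^esub> s = sc (\<epsilon>A a y) \<odot>\<^bsub>E\<^esub> s" "\<forall>z\<in>carrier B. \<iota>B z \<odot>\<^bsub>E\<^esub> t = sc (\<epsilon>B b z) \<odot>\<^bsub>E\<^esub> t"
    using assms(5) d(1) unfolding socle_condition_def by (metis E.smult_closed ca.e_closed ca.iota_closed)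
  have "c = p ?d" using c d p(3) by simp
  also have "\<dots> = p s \<oplus>\<^bsub>M\<^esub> p t" using st p(2) by simp
  finally have "c = p s \<oplus>\<^bsub>M\<^esub> p t" .
  moreover have "\<iota>A y \<odot>\<^bsub>M\<^esub> p s = sc (\<epsilon>A a y) \<odot>\<^bsub>M\<^esub> p s" if "y \<in> carrier A" for y
    using st that p(3) by (metis ca.R.sc_closed ca.iota_closed)
  moreover have "\<iota>B z \<odot>\<^bsub>M\<^esub> p t = sc (\<epsilon>B b z) \<odot>\<^bsub>M\<^esub> p t" if "z \<in> carrier B" for z
    using st that p(3) by (metis ca.R.sc_closed cb.iota_closed)
  ultimately show "\<exists>s\<in>carrier M. \<exists>t\<in>carrier M. c = s \<oplus>\<^bsub>M\<^esub> t \<and>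
        (\<forall>y\<in>carrier A. \<iota>A y \<odot>\<^bsub>M\<^esub> s = sc (\<epsilon>A a y) \<odot>\<^bsub>M\<^esub> s) \<and>
        (\<forall>z\<in>carrier B. \<iota>B z \<odot>\<^bsub>M\<^esub> t = sc (\<epsilon>B b z) \<odot>\<^bsub>M\<^esub> t)"
    using st(1,2) p(1) by blast
qed

section \<open>Injectivity over the gluing from injectivity over the halves\<close>

text \<open>The set where two derivations agree is closed under sums and products, so
  \<open>generated\<close> applies to it.\<close>

lemma derivation_eqI:
  assumes "left_module R M" "ca.R.derivation x M D" "ca.R.derivation x M D'"
    and "!!y. y \<in> carrier A ==> D (\<iota>A y) = D' (\<iota>A y)" "!!z. z \<in> carrier B ==> D (\<iota>B z) = D' (\<iota>B z)"
    and "r \<in> carrier R"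
  shows "D r = D' r"
proof -
  have "{r \<in> carrier R. D r = D' r} = carrier R"
    by (rule generated) (use assms ca.R.derivationD[OF assms(2)] ca.R.derivationD[OF assms(3)] in auto)
  then show ?thesis using assms(6) by blast
qed

lemma derivation_idem:
  assumes "left_module R M" "ca.R.derivation x M D" "f \<in> carrier R" "f \<otimes>\<^bsub>R\<^esub> f = f" "\<epsilon> x f = 1"
  shows "f \<odot>\<^bsub>M\<^esub> D f = \<zero>\<^bsub>M\<^esub>"
proof -
  interpret M: left_module R M by fact
  have "D f = f \<odot>\<^bsub>M\<^esub> D f \<oplus>\<^bsub>M\<^esub> D f"
    using ca.R.derivationD(3)[OF assms(2,3,3)] ca.R.derivationD(1)[OF assms(2,3)] assms(4,5) by (simp add: M.smult_one)
  then show ?thesis using ca.R.derivationD(1)[OF assms(2,3)] assms(3) by (metis M.M.add.l_cancel_one' M.M.a_comm M.smult_closed)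
qed

lemma units_idem:
  "\<iota>A \<one>\<^bsub>A\<^esub> \<otimes>\<^bsub>R\<^esub> \<iota>A \<one>\<^bsub>A\<^esub> = \<iota>A \<one>\<^bsub>A\<^esub>" "\<iota>B \<one>\<^bsub>B\<^esub> \<otimes>\<^bsub>R\<^esub> \<iota>B \<one>\<^bsub>B\<^esub> = \<iota>B \<one>\<^bsub>B\<^esub>"
  by (simp_all add: ca.iota_one_mult cb.iota_one_mult)

text \<open>After normalisation \<open>D\<close> restricts to derivations of \<open>A\<close> and of
  \<open>B\<close>, implemented by elements \<open>mA\<close> and \<open>mB\<close> at the glued
  vertex. These may differ; the socle condition splits the difference into a part invisible to
  \<open>A\<close> and a part invisible to \<open>B\<close>, and correcting by them yields one
  element for both halves.\<close>

lemma derivation_inner_at_v: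
  assumes C: "left_module R C" and inj: "injective_module A (ca.res C)" "injective_module B (cb.res C)"
    and soc: "socle_condition C" and D: "ca.R.derivation (jA a) C D"
  shows "\<exists>m\<in>carrier C. \<forall>r\<in>carrier R. D r = ca.R.inner (jA a) C m r"
proof -
  interpret C: left_module R C by fact
  let ?x = "jA a" and ?fA = "\<iota>A \<one>\<^bsub>A\<^esub>" and ?fB = "\<iota>B \<one>\<^bsub>B\<^esub>"
  have x: "?x \<in> V" using a_in by simp
  have eA1: "\<epsilon> ?x ?fA = 1" using a_in by (simp add: ca.eps_iota)
  have eB1: "\<epsilon> ?x ?fB = 1" using b_in by (simp add: eps_iota_ba)
  note DD = ca.R.derivationD[OF D]
  have DA: "D ?fA \<in> carrier C" by (rule DD(1)) simp
  \<comment> \<open>By \<open>derivation_idem\<close> the inner derivation of \<open>D ?fA\<close>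
    takes the value \<open>- D ?fA\<close> at \<open>?fA\<close>.\<close>
  define D1 where "D1 r = D r \<oplus>\<^bsub>C\<^esub> ca.R.inner ?x C (D ?fA) r" for r
  have D1: "ca.R.derivation ?x C D1" unfolding D1_def by (rule ca.R.derivation_add[OF C x D ca.R.derivation_inner[OF C DA x]])
  note D1D = ca.R.derivationD[OF D1]
  have D1A: "D1 ?fA = \<zero>\<^bsub>C\<^esub>" unfolding D1_def ca.R.inner_def using derivation_idem[OF C D _ units_idem(1) eA1] DA eA1
    by (simp add: C.smult_one C.M.minus_eq C.M.r_neg)
  have DB: "D1 ?fB \<in> carrier C" by (rule D1D(1)) simp
  define D2 where "D2 r = D1 r \<oplus>\<^bsub>C\<^esub> ca.R.inner ?x C (D1 ?fB) r" for r
  have D2: "ca.R.derivation ?x C D2" unfolding D2_def by (rule ca.R.derivation_add[OF C x D1 ca.R.derivation_inner[OF C DB x]])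
  have D2B: "D2 ?fB = \<zero>\<^bsub>C\<^esub>" unfolding D2_def ca.R.inner_def using derivation_idem[OF C D1 _ units_idem(2) eB1] DB eB1
    by (simp add: C.smult_one C.M.minus_eq C.M.r_neg)
  \<comment> \<open>The two units multiply to the vertex idempotent in either order. Comparing the
    product rule for both orders gives this identity, so the second correction leaves the value at
    \<open>?fA\<close> zero.\<close>
  have "?fA \<odot>\<^bsub>C\<^esub> D1 ?fB = D1 ?fB" using D1D(3)[of ?fA ?fB] D1D(3)[of ?fB ?fA] prod_AB prod_BA DB eA1 eB1
    by (simp add: D1A C.smult_zero_r C.smult_one C.smult_closed)
  then have D2A: "D2 ?fA = \<zero>\<^bsub>C\<^esub>"
    unfolding D2_def ca.R.inner_def using D1A DB eA1 by (simp add: C.smult_one C.M.minus_eq C.M.r_neg)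
  have D2e: "D2 (\<iota>A eA) = \<zero>\<^bsub>C\<^esub>"
    using ca.R.derivationD(3)[OF D2, of ?fA ?fB] by (simp add: prod_AB D2A D2B C.smult_zero_r)
  have D2B': "ca.R.derivation (jB b) C D2" using D2 eps_ab unfolding ca.R.derivation_def by simp
  obtain mA where mA: "mA \<in> carrier (ca.res C)" "!!y. y \<in> carrier A ==> D2 (\<iota>A y) = ca.A.inner a (ca.res C) mA y"
    using ca.A.injective_imp_derivations_inner[OF inj(1)] ca.derivation_res[OF C a_in D2 D2A] a_in
    unfolding ca.A.derivations_inner_def by blast
  obtain mB where mB: "mB \<in> carrier (cb.res C)" "!!z. z \<in> carrier B ==> D2 (\<iota>B z) = cb.A.inner b (cb.res C) mB z"
    using cb.A.injective_imp_derivations_inner[OF inj(2)] cb.derivation_res[OF C b_in D2B' D2B] b_in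
    unfolding cb.A.derivations_inner_def by blast
  have m: "mA \<in> carrier C" "mB \<in> carrier C" using mA mB by (auto simp: restrict_scalars_simps)
  have innA: "D2 (\<iota>A y) = \<iota>A y \<odot>\<^bsub>C\<^esub> mA \<ominus>\<^bsub>C\<^esub> sc (\<epsilon>A a y) \<odot>\<^bsub>C\<^esub> mA" if y: "y \<in> carrier A" for y
    using mA(2)[OF y] ca.inner_res[OF C mA(1) a_in y] y a_in by (simp add: ca.R.inner_def ca.eps_iota)
  have innB: "D2 (\<iota>B z) = \<iota>B z \<odot>\<^bsub>C\<^esub> mB \<ominus>\<^bsub>C\<^esub> sc (\<epsilon>B b z) \<odot>\<^bsub>C\<^esub> mB" if z: "z \<in> carrier B" for z
    using mB(2)[OF z] cb.inner_res[OF C mB(1) b_in z] z b_in by (simp add: ca.R.inner_def cb.eps_iota)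
  have eq0: "u = v" if "u \<ominus>\<^bsub>C\<^esub> v = \<zero>\<^bsub>C\<^esub>" "u \<in> carrier C" "v \<in> carrier C" for u v
    using that by (metis C.M.add.inv_solve_right C.M.l_zero C.M.minus_eq C.M.zero_closed)
  \<comment> \<open>\<open>D2\<close> vanishes at the vertex idempotent, whose augmentation is 1;
    hence the idempotent fixes \<open>mA\<close>.\<close>
  have vA: "\<iota>A eA \<odot>\<^bsub>C\<^esub> mA = mA"
    by (rule eq0) (use innA[of eA] D2e m eps_eA[OF a_in] in "auto simp: C.smult_one C.smult_closed")
  have vB: "\<iota>A eA \<odot>\<^bsub>C\<^esub> mB = mB"
    by (rule eq0) (use innB[of eB] D2e e_eq m eps_eB[OF b_in] in "auto simp: C.smult_one C.smult_closed")
  have "\<iota>A eA \<odot>\<^bsub>C\<^esub> (mA \<ominus>\<^bsub>C\<^esub> mB) = mA \<ominus>\<^bsub>C\<^esub> mB" using m vA vB by (simp add: C.smult_diff_r)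
  then obtain s t where st: "s \<in> carrier C" "t \<in> carrier C" "mA \<ominus>\<^bsub>C\<^esub> mB = s \<oplus>\<^bsub>C\<^esub> t"
    "\<forall>y\<in>carrier A. \<iota>A y \<odot>\<^bsub>C\<^esub> s = sc (\<epsilon>A a y) \<odot>\<^bsub>C\<^esub> s" "\<forall>z\<in>carrier B. \<iota>B z \<odot>\<^bsub>C\<^esub> t = sc (\<epsilon>B b z) \<odot>\<^bsub>C\<^esub> t"
    using soc m unfolding socle_condition_def by (metis C.M.minus_closed)
  \<comment> \<open>This equals \<open>mB\<close> plus \<open>t\<close>: subtracting
    \<open>s\<close> changes nothing over \<open>A\<close>, and adding \<open>t\<close> changes
    nothing over \<open>B\<close>.\<close>
  let ?m = "mA \<oplus>\<^bsub>C\<^esub> \<ominus>\<^bsub>C\<^esub> s"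
  have m': "?m \<in> carrier C" using m st by simp
  have mm: "?m = mB \<oplus>\<^bsub>C\<^esub> t"
  proof -
    have "mA = (mA \<ominus>\<^bsub>C\<^esub> mB) \<oplus>\<^bsub>C\<^esub> mB" using m by (simp add: C.M.minus_eq C.M.a_assoc C.M.l_neg)
    then have "mA = (s \<oplus>\<^bsub>C\<^esub> t) \<oplus>\<^bsub>C\<^esub> mB" using st(3) by simp
    moreover have "s \<oplus>\<^bsub>C\<^esub> (t \<oplus>\<^bsub>C\<^esub> \<ominus>\<^bsub>C\<^esub> s) = t"
      using st(1,2) C.M.a_comm[of t "\<ominus>\<^bsub>C\<^esub> s"] by (simp add: C.M.r_neg2)
    ultimately show ?thesis using m st(1,2) by (simp add: C.M.a_ac)
  qed
  have inner_s: "ca.R.inner ?x C s (\<iota>A y) = \<zero>\<^bsub>C\<^esub>" if "y \<in> carrier A" for y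
    using st that a_in by (simp add: ca.R.inner_def ca.eps_iota C.M.minus_eq C.M.r_neg C.smult_closed)
  have inner_t: "ca.R.inner ?x C t (\<iota>B z) = \<zero>\<^bsub>C\<^esub>" if "z \<in> carrier B" for z
    using st that by (simp add: ca.R.inner_def eps_iota_ba C.M.minus_eq C.M.r_neg C.smult_closed)
  have "D2 r = ca.R.inner ?x C ?m r" if r: "r \<in> carrier R" for r
  proof (rule derivation_eqI[OF C D2 ca.R.derivation_inner[OF C m' x] _ _ r])
    show "D2 (\<iota>A y) = ca.R.inner ?x C ?m (\<iota>A y)" if y: "y \<in> carrier A" for y
    proof -
      have "ca.R.inner ?x C ?m (\<iota>A y) = ca.R.inner ?x C mA (\<iota>A y) \<oplus>\<^bsub>C\<^esub> \<ominus>\<^bsub>C\<^esub> \<zero>\<^bsub>C\<^esub>"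
        using y m st by (simp add: ca.R.inner_add[OF C] ca.R.inner_minus[OF C] inner_s)
      then show ?thesis using y m a_in ca.R.inner_closed[OF C m(1), of "\<iota>A y" ?x]
        by (simp add: innA) (simp add: ca.R.inner_def ca.eps_iota)
    qed
    show "D2 (\<iota>B z) = ca.R.inner ?x C ?m (\<iota>B z)" if z: "z \<in> carrier B" for z
    proof -
      have "ca.R.inner ?x C ?m (\<iota>B z) = ca.R.inner ?x C mB (\<iota>B z) \<oplus>\<^bsub>C\<^esub> \<zero>\<^bsub>C\<^esub>"
        unfolding mm using z m st by (simp add: ca.R.inner_add[OF C] inner_t)
      then show ?thesis using z m ca.R.inner_closed[OF C m(2), of "\<iota>B z" ?x]
        by (simp add: innB) (simp add: ca.R.inner_def eps_iota_ba)
    qed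
  qed
  then have "\<exists>m\<in>carrier C. \<forall>r\<in>carrier R. D2 r = ca.R.inner ?x C m r" using m' by blast
  then have "\<exists>m\<in>carrier C. \<forall>r\<in>carrier R. D1 r = ca.R.inner ?x C m r"
    unfolding D2_def by (rule ca.R.inner_absorb[OF C x D1 DB])
  then show ?thesis unfolding D1_def by (rule ca.R.inner_absorb[OF C x D DA])
qed

text \<open>The augmentation at another vertex of \<open>A\<close> vanishes on all of
  \<open>B\<close>, so \<open>D\<close> can be normalised to vanish on \<open>B\<close>. The element
  found over \<open>A\<close> is then killed by the vertex idempotent, hence by \<open>B\<close>,
  and implements the derivation on both halves.\<close>

lemma derivation_inner_off_v:
  assumes C: "left_module R C" and inj: "injective_module A (ca.res C)"
    and y: "y \<in> VA" "y \<noteq> a" and D: "ca.R.derivation (jA y) C D"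
  shows "\<exists>m\<in>carrier C. \<forall>r\<in>carrier R. D r = ca.R.inner (jA y) C m r"
proof -
  interpret C: left_module R C by fact
  let ?x = "jA y" and ?fA = "\<iota>A \<one>\<^bsub>A\<^esub>" and ?fB = "\<iota>B \<one>\<^bsub>B\<^esub>"
  have x: "?x \<in> V" using y by simp
  have eA1: "\<epsilon> ?x ?fA = 1" using y by (simp add: ca.eps_iota)
  have ev: "\<epsilon> ?x (\<iota>A eA) = 0" using y by (simp add: ca.eps_iota eps_eA)
  have "\<epsilon> ?x (?fA \<oplus>\<^bsub>R\<^esub> ?fB) = \<epsilon> ?x (\<one>\<^bsub>R\<^esub> \<oplus>\<^bsub>R\<^esub> \<iota>A eA)" using one_eq by simp
  then have eB0: "\<epsilon> ?x ?fB = 0" using x eA1 ev by (simp add: ca.R.eps_add)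
  have eB: "\<epsilon> ?x (\<iota>B z) = 0" if z: "z \<in> carrier B" for z
    using ca.R.eps_mult[OF x, of ?fB "\<iota>B z"] z eB0 by (simp add: cb.iota_one_mult)
  note DD = ca.R.derivationD[OF D]
  have DB: "D ?fB \<in> carrier C" by (rule DD(1)) simp
  have fDB: "?fB \<odot>\<^bsub>C\<^esub> D ?fB = D ?fB"
    using DD(3)[of ?fB ?fB] units_idem(2) eB0 DB by (simp add: C.smult_zero_l C.smult_closed)
  \<comment> \<open>The sign differs from the case of the glued vertex: here the twist at
    \<open>?fB\<close> is 0 and \<open>?fB\<close> fixes \<open>D ?fB\<close>, so the inner
    derivation of \<open>?n\<close> takes the value \<open>?n\<close> at \<open>?fB\<close>.\<close>
  let ?n = "\<ominus>\<^bsub>C\<^esub> D ?fB"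
  have n: "?n \<in> carrier C" using DB by simp
  define D1 where "D1 r = D r \<oplus>\<^bsub>C\<^esub> ca.R.inner ?x C ?n r" for r
  have D1: "ca.R.derivation ?x C D1" unfolding D1_def by (rule ca.R.derivation_add[OF C x D ca.R.derivation_inner[OF C n x]])
  note D1D = ca.R.derivationD[OF D1]
  have D1B: "D1 ?fB = \<zero>\<^bsub>C\<^esub>" unfolding D1_def ca.R.inner_def using DB eB0 fDB
    by (simp add: C.smult_minus_r C.smult_zero_l C.M.minus_eq C.M.r_neg)
  have D1b: "D1 (\<iota>B z) = \<zero>\<^bsub>C\<^esub>" if z: "z \<in> carrier B" for z
    using D1D(3)[of "\<iota>B z" ?fB] z D1B eB0 D1D(1)[of "\<iota>B z"] by (simp add: cb.iota_one_mult C.smult_zero_r C.smult_zero_l)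
  have D1v: "D1 (\<iota>A eA) = \<zero>\<^bsub>C\<^esub>" using D1b[of eB] e_eq by simp
  have "D1 (?fA \<oplus>\<^bsub>R\<^esub> ?fB) = D1 (\<one>\<^bsub>R\<^esub> \<oplus>\<^bsub>R\<^esub> \<iota>A eA)" using one_eq by simp
  then have D1A: "D1 ?fA = \<zero>\<^bsub>C\<^esub>" using D1B D1v ca.R.derivation_one[OF D1] D1D(1)[of ?fA] by (simp add: D1D(2))
  obtain m where m: "m \<in> carrier (ca.res C)" "!!z. z \<in> carrier A ==> D1 (\<iota>A z) = ca.A.inner y (ca.res C) m z"
    using ca.A.injective_imp_derivations_inner[OF inj] ca.derivation_res[OF C y(1) D1 D1A] y(1)
    unfolding ca.A.derivations_inner_def by blast
  have mC: "m \<in> carrier C" and mfA: "?fA \<odot>\<^bsub>C\<^esub> m = m" using m by (auto simp: restrict_scalars_simps)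
  have inn: "D1 (\<iota>A z) = ca.R.inner ?x C m (\<iota>A z)" if z: "z \<in> carrier A" for z
    using m(2)[OF z] ca.inner_res[OF C m(1) y(1) z] by simp
  have "\<iota>A eA \<odot>\<^bsub>C\<^esub> m = \<zero>\<^bsub>C\<^esub>"
    using inn[of eA] D1v ev mC C.M.minus_equality[of "\<zero>\<^bsub>C\<^esub>" "\<zero>\<^bsub>C\<^esub>"]
    by (simp add: ca.R.inner_def C.smult_zero_l C.M.minus_eq C.smult_closed)
  \<comment> \<open>\<open>m\<close> is fixed by \<open>?fA\<close>, and \<open>?fB\<close> times
    \<open>?fA\<close> is the vertex idempotent.\<close>
  then have "?fB \<odot>\<^bsub>C\<^esub> m = \<zero>\<^bsub>C\<^esub>" using mC mfA prod_BA C.smult_assoc[of ?fB ?fA m] by simp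
  then have zm: "\<iota>B z \<odot>\<^bsub>C\<^esub> m = \<zero>\<^bsub>C\<^esub>" if z: "z \<in> carrier B" for z
    using C.smult_assoc[of "\<iota>B z" ?fB m] z mC by (simp add: cb.iota_one_mult C.smult_zero_r)
  have z0: "\<ominus>\<^bsub>C\<^esub> \<zero>\<^bsub>C\<^esub> = \<zero>\<^bsub>C\<^esub>" by (rule C.M.minus_equality) simp_all
  have "D1 r = ca.R.inner ?x C m r" if r: "r \<in> carrier R" for r
    by (rule derivation_eqI[OF C D1 ca.R.derivation_inner[OF C mC x] inn _ r])
       (simp_all add: ca.R.inner_def D1b zm eB mC C.smult_zero_l C.M.minus_eq z0)
  then have "\<exists>m\<in>carrier C. \<forall>r\<in>carrier R. D1 r = ca.R.inner ?x C m r" using mC by blast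
  then show ?thesis unfolding D1_def by (rule ca.R.inner_absorb[OF C x D n])
qed

lemma derivation_inner_A:
  assumes "left_module R C" "injective_module A (ca.res C)" "injective_module B (cb.res C)"
    "socle_condition C" "y \<in> VA" "ca.R.derivation (jA y) C D"
  shows "\<exists>m\<in>carrier C. \<forall>r\<in>carrier R. D r = ca.R.inner (jA y) C m r"
  using derivation_inner_at_v[OF assms(1-4)] derivation_inner_off_v[OF assms(1,2,5)] assms(6) by (cases "y = a") auto

lemma socle_condition_swap:
  assumes "left_module R M" "socle_condition M"
  shows "glued_algebra.socle_condition sc B \<epsilon>B \<iota>B eB A \<epsilon>A \<iota>A b a M"
  unfolding glued_algebra.socle_condition_def[OF swap] e_eq[symmetric]
proof (intro ballI impI)
  interpret M: left_module R M by fact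
  fix c assume "c \<in> carrier M" "\<iota>A eA \<odot>\<^bsub>M\<^esub> c = c"
  then obtain s t where st: "s \<in> carrier M" "t \<in> carrier M" "c = s \<oplus>\<^bsub>M\<^esub> t"
    "\<forall>y\<in>carrier A. \<iota>A y \<odot>\<^bsub>M\<^esub> s = sc (\<epsilon>A a y) \<odot>\<^bsub>M\<^esub> s" "\<forall>z\<in>carrier B. \<iota>B z \<odot>\<^bsub>M\<^esub> t = sc (\<epsilon>B b z) \<odot>\<^bsub>M\<^esub> t"
    using assms(2) unfolding socle_condition_def by blast
  have "c = t \<oplus>\<^bsub>M\<^esub> s" using M.M.a_comm[OF st(1,2)] st(3) by simp
  then show "\<exists>s\<in>carrier M. \<exists>t\<in>carrier M. c = s \<oplus>\<^bsub>M\<^esub> t \<and>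
      (\<forall>z\<in>carrier B. \<iota>B z \<odot>\<^bsub>M\<^esub> s = sc (\<epsilon>B b z) \<odot>\<^bsub>M\<^esub> s) \<and>
      (\<forall>y\<in>carrier A. \<iota>A y \<odot>\<^bsub>M\<^esub> t = sc (\<epsilon>A a y) \<odot>\<^bsub>M\<^esub> t)"
    by (intro bexI[OF _ st(2)] bexI[OF _ st(1)] conjI st(4,5))
qed

text \<open>Each augmentation of \<open>R\<close> comes from a vertex of one half, so the criterion
  for \<open>R\<close> reduces to \<open>derivation_inner_A\<close>, which is applied to
  \<open>B\<close> through \<open>swap\<close>.\<close>

theorem injective_iff_restrictions:
  assumes fg: "fg_module R C" and inj: "injective_module A (ca.res C)" "injective_module B (cb.res C)"
    and soc: "socle_condition C"
  shows "injective_module R C"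
proof (rule ca.R.derivations_inner_imp_injective[OF fg])
  interpret S: glued_algebra R sc V \<epsilon> B scB VB \<epsilon>B \<iota>B \<pi>B jB eB CB A scA VA \<epsilon>A \<iota>A \<pi>A jA eA CA b a by (rule swap)
  note C = fg_module_left[OF fg]
  show "ca.R.derivations_inner C" unfolding ca.R.derivations_inner_def
  proof (intro ballI allI impI)
    fix x D assume x: "x \<in> V" and D: "ca.R.derivation x C D"
    from x V_cases consider y where "y \<in> VA" "x = jA y" | z where "z \<in> VB" "x = jB z" by blast
    then show "\<exists>m\<in>carrier C. \<forall>r\<in>carrier R. D r = ca.R.inner x C m r"
    proof cases
      case 1
      then show ?thesis using derivation_inner_A[OF C inj soc] D by simp
    next
      case 2
      then show ?thesis using S.derivation_inner_A[OF C inj(2,1) socle_condition_swap[OF C soc]] D by simp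
    qed
  qed
qed

section \<open>Injective dimension of the gluing\<close>

text \<open>The bound starts at 1 because the socle condition is available for the cosyzygy
  \<open>C\<close> and not for \<open>M\<close>. Otherwise this is dimension shifting with one short
  exact sequence, read over all three algebras.\<close>

lemma inj_dim_at_most_glue_aux:
  fixes M :: "('r, 'r fg_carrier) module"
  assumes "fg_module R M" "inj_dim_at_most A (Suc n) (ca.res M)" "inj_dim_at_most B (Suc n) (cb.res M)"
  shows "inj_dim_at_most R (Suc n) M" using assms
proof (induction n arbitrary: M)
  case (Suc n)
  note M = fg_module_left[OF Suc.prems(1)]
  obtain E C :: "('r, 'r fg_carrier) module" and i p where 1: "injective_module R E" "fg_module R C"
    "short_exact R M E C i p" using enough_injectivesD[OF ca.R.enough_injectives Suc.prems(1)] by metis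
  note E = fg_module_left[OF injective_moduleD[OF 1(1)]] and C = fg_module_left[OF 1(2)]
  have "inj_dim_at_most A (Suc n) (ca.res C)"
    by (rule inj_dim_at_most_cosyzygy[OF ca.A.enough_injectives ca.fg_module_res[OF Suc.prems(1)] Suc.prems(2)
          ca.injective_module_res[OF 1(1)] ca.fg_module_res[OF 1(2)] ca.short_exact_res[OF M E C 1(3)]])
  moreover have "inj_dim_at_most B (Suc n) (cb.res C)"
    by (rule inj_dim_at_most_cosyzygy[OF cb.A.enough_injectives cb.fg_module_res[OF Suc.prems(1)] Suc.prems(3)
          cb.injective_module_res[OF 1(1)] cb.fg_module_res[OF 1(2)] cb.short_exact_res[OF M E C 1(3)]])
  ultimately show ?case by (intro inj_dim_at_most_SucI[OF 1] Suc.IH[OF 1(2)])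
next
  case 0
  note M = fg_module_left[OF 0(1)]
  obtain E C :: "('r, 'r fg_carrier) module" and i p where 1: "injective_module R E" "fg_module R C"
    "short_exact R M E C i p" using enough_injectivesD[OF ca.R.enough_injectives 0(1)] by metis
  note E = fg_module_left[OF injective_moduleD[OF 1(1)]] and C = fg_module_left[OF 1(2)]
  have "inj_dim_at_most A 0 (ca.res C)" by (rule inj_dim_at_most_cosyzygy[OF ca.A.enough_injectives ca.fg_module_res[OF 0(1)] 0(2)
          ca.injective_module_res[OF 1(1)] ca.fg_module_res[OF 1(2)] ca.short_exact_res[OF M E C 1(3)]])
  then have iA: "injective_module A (ca.res C)" by (simp add: inj_dim_at_most_0_iff ca.fg_module_res[OF 1(2)])
  have "inj_dim_at_most B 0 (cb.res C)" by (rule inj_dim_at_most_cosyzygy[OF cb.A.enough_injectives cb.fg_module_res[OF 0(1)] 0(3)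
          cb.injective_module_res[OF 1(1)] cb.fg_module_res[OF 1(2)] cb.short_exact_res[OF M E C 1(3)]])
  then have iB: "injective_module B (cb.res C)" by (simp add: inj_dim_at_most_0_iff cb.fg_module_res[OF 1(2)])
  have "socle_condition C" by (rule socle_condition_quotient[OF E C _ _ injective_socle_condition[OF 1(1)]])
       (use 1(3) in "auto simp: short_exact_def")
  then have "injective_module R C" by (rule injective_iff_restrictions[OF 1(2) iA iB])
  then show ?case by (intro inj_dim_at_most_SucI[OF 1]) (simp add: inj_dim_at_most_0_iff 1(2))
qed

lemma res_copy:
  assumes "fg_module R M" "inj_dim_at_most A n (ca.res M)"
    and "q \<in> mod_hom R M C" "p \<in> mod_hom R C M" "!!x. x \<in> carrier M ==> p (q x) = x" "!!y. y \<in> carrier C ==> q (p y) = y"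
  shows "inj_dim_at_most A n (ca.res C)"
proof -
  note q = ca.mod_hom_res[OF assms(3)] and p = ca.mod_hom_res[OF assms(4)]
  have "bij_betw p (carrier (ca.res C)) (carrier (ca.res M))" by (rule bij_betw_byWitness[of _ q])
       (use mod_homD(1)[OF q] mod_homD(1)[OF p] assms(5,6) in "auto simp: restrict_scalars_simps")
  then show ?thesis by (rule inj_dim_at_most_iso[OF assms(2) p])
qed

text \<open>As a left \<open>A\<close>-module the restricted regular module is a summand of a power
  of \<open>A\<close>: this is \<open>inj_dim_at_most_res_opposite\<close> for the corner of the
  opposite algebras, read through the double opposite.\<close>

lemma inj_dim_at_most_regular_glue:
  assumes "inj_dim_at_most A (Suc n) (regular_module A)" "inj_dim_at_most B (Suc n) (regular_module B)"
  shows "inj_dim_at_most R (Suc n) (regular_module R)"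
proof -
  interpret S: glued_algebra R sc V \<epsilon> B scB VB \<epsilon>B \<iota>B \<pi>B jB eB CB A scA VA \<epsilon>A \<iota>A \<pi>A jA eA CA b a by (rule swap)
  note fgR = ca.R.fg_regular
  have A: "inj_dim_at_most A (Suc n) (ca.res (regular_module R))"
    using coa.inj_dim_at_most_res_opposite[unfolded opposite_opposite_ring, OF ca.fg_module_res[OF fgR] assms(1)] .
  have B: "inj_dim_at_most B (Suc n) (cb.res (regular_module R))"
    using cob.inj_dim_at_most_res_opposite[unfolded opposite_opposite_ring, OF cb.fg_module_res[OF fgR] assms(2)] .
  obtain M :: "('r, 'r fg_carrier) module" and q p where M: "fg_module R M" "q \<in> mod_hom R (regular_module R) M"
    "p \<in> mod_hom R M (regular_module R)" "!!x. x \<in> carrier (regular_module R) ==> p (q x) = x"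
    "!!y. y \<in> carrier M ==> q (p y) = y" using fg_copy_exists[OF fgR] by metis
  have "inj_dim_at_most R (Suc n) M" by (rule inj_dim_at_most_glue_aux[OF M(1) res_copy[OF fgR A M(2-5)] S.res_copy[OF fgR B M(2-5)]])
  moreover have "bij_betw q (carrier (regular_module R)) (carrier M)"
    by (rule bij_betw_byWitness[of _ p]) (use M mod_homD(1)[OF M(2)] mod_homD(1)[OF M(3)] in auto)
  ultimately show ?thesis by (rule inj_dim_at_most_iso[OF _ M(2)])
qed

lemma left_inj_dim_bounds:
  "max (left_inj_dim A) (left_inj_dim B) \<le> left_inj_dim R"
  "left_inj_dim R \<le> max (max (left_inj_dim A) (left_inj_dim B)) 1"
proof -
  show "max (left_inj_dim A) (left_inj_dim B) \<le> left_inj_dim R"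
  proof (cases "left_inj_dim R")
    case (enat n)
    then have "inj_dim_at_most R n (regular_module R)" unfolding left_inj_dim_def inj_dim_le_iff[symmetric] by simp
    then have "inj_dim_at_most A n (regular_module A)" "inj_dim_at_most B n (regular_module B)"
      by (rule ca.inj_dim_at_most_regular, rule cb.inj_dim_at_most_regular)
    then have "left_inj_dim A \<le> enat n" "left_inj_dim B \<le> enat n" unfolding left_inj_dim_def inj_dim_le_iff .
    then show ?thesis by (simp add: enat)
  qed simp
  show "left_inj_dim R \<le> max (max (left_inj_dim A) (left_inj_dim B)) 1"
  proof (cases "max (max (left_inj_dim A) (left_inj_dim B)) 1")
    case (enat n)
    \<comment> \<open>The maximum with 1 puts the bound into the form \<open>Suc m\<close> that the
      gluing lemma requires.\<close>
    then have "enat 1 \<le> enat n" by (metis max.cobounded2 one_enat_def)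
    then obtain m where m: "n = Suc m" by (metis One_nat_def Suc_le_D enat_ord_simps(1))
    have "left_inj_dim A \<le> enat n" "left_inj_dim B \<le> enat n" using enat by (metis max.bounded_iff max.cobounded1)+
    then have "left_inj_dim R \<le> enat n" unfolding m left_inj_dim_def inj_dim_le_iff by (rule inj_dim_at_most_regular_glue)
    then show ?thesis by (simp only: enat)
  qed simp
qed

end

lemma right_inj_dim_opposite: "right_inj_dim R = left_inj_dim (opposite_ring R)" by (simp add: right_inj_dim_def left_inj_dim_def)

text \<open>Finiteness passes through the two inequalities on each side; the right-hand side is the
  left-hand side of the opposite gluing.\<close>

theorem (in glued_algebra) Gorenstein_glued:
  "(Gorenstein R \<longleftrightarrow> Gorenstein A \<and> Gorenstein B) \<and>
   max (Gd A) (Gd B) \<le> Gd R \<and> Gd R \<le> max (max (Gd A) (Gd B)) 1"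
proof -
  interpret opp: glued_algebra "opposite_ring R" sc V \<epsilon> "opposite_ring A" scA VA \<epsilon>A \<iota>A \<pi>A jA eA CA
     "opposite_ring B" scB VB \<epsilon>B \<iota>B \<pi>B jB eB CB a b by (rule opposite)
  have *: "r < \<infinity> \<longleftrightarrow> x < \<infinity> \<and> y < \<infinity>" if "max x y \<le> r" "r \<le> max (max x y) 1" for x y r :: enat
    using that by (cases x; cases y; cases r) (auto simp: max_def one_enat_def split: if_splits)
  show ?thesis using left_inj_dim_bounds *[OF left_inj_dim_bounds] *[OF opp.left_inj_dim_bounds]
    unfolding Gorenstein_def Gd_def right_inj_dim_opposite by blast
qed

section \<open>Algebras with a basis and their quotients\<close>

abbreviation "lookup \<equiv> Poly_Mapping.lookup"
abbreviation "keys \<equiv> Poly_Mapping.keys"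
abbreviation "single \<equiv> Poly_Mapping.single"
abbreviation basis :: "'p => ('p \<Rightarrow>\<^sub>0 'k::field)" where "basis q \<equiv> single q 1"

definition scale :: "'k::field => ('p \<Rightarrow>\<^sub>0 'k) => ('p \<Rightarrow>\<^sub>0 'k)" where
  "scale c f = Poly_Mapping.map ((*) c) f"

lemma lookup_scale [simp]: "lookup (scale c f) p = c * lookup f p" by (simp add: scale_def Poly_Mapping.map.rep_eq when_def)

lemma scale_simps [simp]:
  "scale c (f + g) = scale c f + scale c g" "scale c (f - g) = scale c f - scale c g" "scale (c + d) f = scale c f + scale d f"
  "scale c (scale d f) = scale (c * d) f" "scale 1 f = f" "scale 0 f = 0" "scale c 0 = 0"
  "scale c (single p d) = single p (c * d)" by (rule poly_mapping_eqI;
      simp add: lookup_add lookup_minus algebra_simps lookup_single when_def)+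

lemma scale_sum: "scale c (\<Sum>s\<in>S. h s) = (\<Sum>s\<in>S. scale c (h s))"
  by (rule poly_mapping_eqI) (simp add: lookup_sum sum_distrib_left)

lemma scale_minus_one: "scale (- 1) f = - f" by (rule poly_mapping_eqI) simp

lemma keys_scale: "keys (scale c f) \<subseteq> keys f" by (auto simp: in_keys_iff)

lemma sum_single_lookup:
  assumes "finite S" "keys f \<subseteq> S"
  shows "(\<Sum>p\<in>S. single p (lookup f p)) = f"
proof (rule poly_mapping_eqI)
  fix q
  have "q \<notin> S ==> lookup f q = 0" using assms(2) by (auto simp: in_keys_iff)
  moreover have "lookup (\<Sum>p\<in>S. single p (lookup f p)) q
      = (\<Sum>p\<in>S. if p = q then lookup f q else 0)"
    unfolding lookup_sum by (rule sum.cong[OF refl]) (simp add: lookup_single when_def)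
  ultimately show "lookup (\<Sum>p\<in>S. single p (lookup f p)) q = lookup f q"
    using assms(1) by (cases "q \<in> S") (simp_all only: sum.delta if_True if_False not_False_eq_True simp_thms)
qed

text \<open>Induction over finitely supported functions that keeps all supports inside
  \<open>S\<close>; it reduces multilinear identities to single basis elements.\<close>

lemma poly_mapping_single_induct [consumes 1, case_names zero add single]:
  fixes f :: "'p \<Rightarrow>\<^sub>0 'k::field"
  assumes "keys f \<subseteq> S" "P 0"
    and "!!f g. keys f \<subseteq> S ==> keys g \<subseteq> S ==> P f ==> P g ==> P (f + g)"
    and "!!p c. p \<in> S ==> P (single p c)"
  shows "P f"
proof -
  let ?h = "\<lambda>p. single p (lookup f p)"
  have "P (\<Sum>p\<in>T. ?h p) \<and> keys (\<Sum>p\<in>T. ?h p) \<subseteq> S" if "T \<subseteq> keys f" for T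
  proof -
    have "finite T" by (rule finite_subset[OF that finite_keys])
    then show ?thesis using that
    proof (induction T)
      case (insert p T)
      have p: "p \<in> S" using insert.prems assms(1) by auto
      have 1: "keys (?h p) \<subseteq> S" using p by simp
      have 2: "P (\<Sum>p\<in>T. ?h p)" "keys (\<Sum>p\<in>T. ?h p) \<subseteq> S" using insert by auto
      have "P (?h p + (\<Sum>p\<in>T. ?h p))" by (rule assms(3)[OF 1 2(2) assms(4)[OF p] 2(1)])
      moreover have "keys (?h p + (\<Sum>p\<in>T. ?h p)) \<subseteq> S" using 1 2(2) keys_add[of "?h p" "\<Sum>p\<in>T. ?h p"] by blast
      ultimately show ?case using insert.hyps by simp
    qed (simp add: assms(2))
  qed
  from this[of "keys f"] show ?thesis by (simp add: sum_single_lookup)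
qed

definition linear_extension :: "('p => ('q \<Rightarrow>\<^sub>0 'k::field)) => ('p \<Rightarrow>\<^sub>0 'k) => ('q \<Rightarrow>\<^sub>0 'k)" where
  "linear_extension h f = (\<Sum>p\<in>keys f. scale (lookup f p) (h p))"

lemma linear_extension_superset:
  assumes "finite S" "keys f \<subseteq> S"
  shows "linear_extension h f = (\<Sum>p\<in>S. scale (lookup f p) (h p))" unfolding linear_extension_def
  by (rule sum.mono_neutral_left) (use assms in "auto simp: in_keys_iff")

lemma linear_extension_simps [simp]:
  "linear_extension h 0 = 0"
  "linear_extension h (f + g) = linear_extension h f + linear_extension h g"
  "linear_extension h (scale c f) = scale c (linear_extension h f)"
  "linear_extension h (single p c) = scale c (h p)"
proof -
  show "linear_extension h 0 = 0" by (simp add: linear_extension_def)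
  let ?S = "keys f \<union> keys g"
  have "linear_extension h (f + g) = (\<Sum>p\<in>?S. scale (lookup (f + g) p) (h p))"
    by (rule linear_extension_superset[OF _ keys_add]) simp
  also have "\<dots> = (\<Sum>p\<in>?S. scale (lookup f p) (h p)) + (\<Sum>p\<in>?S. scale (lookup g p) (h p))"
    by (simp add: lookup_add sum.distrib)
  also have "\<dots> = linear_extension h f + linear_extension h g"
    using linear_extension_superset[of ?S f h] linear_extension_superset[of ?S g h] by simp
  finally show "linear_extension h (f + g) = linear_extension h f + linear_extension h g" .
  show "linear_extension h (scale c f) = scale c (linear_extension h f)"
    using linear_extension_superset[OF _ keys_scale, of f h c] by (simp add: linear_extension_def scale_sum)
  show "linear_extension h (single p c) = scale c (h p)" using linear_extension_superset[of "{p}" "single p c" h] by simp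
qed

lemma keys_linear_extension:
  assumes "!!p. p \<in> keys f ==> keys (h p) \<subseteq> S"
  shows "keys (linear_extension h f) \<subseteq> S" unfolding linear_extension_def
  by (rule order_trans[OF keys_sum UN_least[OF order_trans[OF keys_scale assms]]])

text \<open>Isolates the linear algebra of path algebras, so that it applies equally to a path
  algebra and to its opposite.\<close>

locale based_algebra = ring P for P :: "('p \<Rightarrow>\<^sub>0 'k::field) ring" (structure) +
  fixes S :: "'p set"
  assumes carrier_eq: "carrier P = {f. keys f \<subseteq> S}"
    and zero_eq: "\<zero> = 0" and add_eq: "f \<oplus> g = f + g"
    and scale_mult_left: "f \<in> carrier P ==> g \<in> carrier P ==> scale c f \<otimes> g = scale c (f \<otimes> g)"
    and scale_mult_right: "f \<in> carrier P ==> g \<in> carrier P ==> f \<otimes> scale c g = scale c (f \<otimes> g)"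
begin

lemma scale_closed [simp]: "f \<in> carrier P ==> scale c f \<in> carrier P" using keys_scale[of c f] by (auto simp: carrier_eq)

lemma single_closed [simp]: "p \<in> S ==> single p c \<in> carrier P" by (simp add: carrier_eq)

lemma plus_closed [simp]: "f \<in> carrier P ==> g \<in> carrier P ==> f + g \<in> carrier P" using a_closed by (simp add: add_eq)

lemma zero_in_carrier [simp]: "0 \<in> carrier P" by (simp add: carrier_eq)

lemma a_inv_eq: "f \<in> carrier P ==> \<ominus> f = - f" by (rule minus_equality) (simp_all add: add_eq zero_eq carrier_eq)

lemma a_minus_eq: "f \<in> carrier P ==> g \<in> carrier P ==> f \<ominus> g = f - g" by (simp add: a_minus_def a_inv_eq add_eq)

lemma based_induct [consumes 1, case_names zero add single]:
  assumes "f \<in> carrier P" "Q 0"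
    and "!!f g. f \<in> carrier P ==> g \<in> carrier P ==> Q f ==> Q g ==> Q (f + g)"
    and "!!p c. p \<in> S ==> Q (single p c)"
  shows "Q f"
proof -
  have "keys f \<subseteq> S" using assms(1) by (simp add: carrier_eq)
  then show ?thesis by (induction rule: poly_mapping_single_induct) (use assms in "auto simp: carrier_eq")
qed

lemma finsum_eq_sum: "h \<in> F \<rightarrow> carrier P ==> finsum P h F = sum h F"
proof (cases "finite F")
  case True
  assume "h \<in> F \<rightarrow> carrier P"
  with True show ?thesis by (induction F) (auto simp: zero_eq add_eq Pi_def)
qed (simp add: finsum_infinite zero_eq)

lemma based_algebra_opposite: "based_algebra (opposite_ring P) S"
proof (intro based_algebra.intro ring_opposite_ring[OF ring_axioms] based_algebra_axioms.intro)
qed (simp_all add: carrier_eq zero_eq add_eq scale_mult_left scale_mult_right del: carrier_eq, simp_all add: carrier_eq)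

end

locale based_quotient = based_algebra P S + ideal I P
  for P :: "('p \<Rightarrow>\<^sub>0 'k::field) ring" (structure) and S I
begin

abbreviation "qt f \<equiv> I +> f"
abbreviation "qr \<equiv> P Quot I"

definition rep :: "('p \<Rightarrow>\<^sub>0 'k) set => ('p \<Rightarrow>\<^sub>0 'k)" where
  "rep r = (SOME f. f \<in> carrier P \<and> qt f = r)"

definition sc :: "'k => ('p \<Rightarrow>\<^sub>0 'k) set" where
  "sc c = qt (scale c \<one>)"

lemma carrier_quotient: "carrier qr = qt ` carrier P" by (auto simp: FactRing_def A_RCOSETS_def' )

lemma qt_closed [simp]: "f \<in> carrier P ==> qt f \<in> carrier qr" by (simp add: carrier_quotient)

lemma qt_add: "f \<in> carrier P ==> g \<in> carrier P ==> qt f \<oplus>\<^bsub>qr\<^esub> qt g = qt (f + g)"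
  by (simp add: FactRing_def a_rcos_sum add_eq)

lemma qt_mult: "f \<in> carrier P ==> g \<in> carrier P ==> qt f \<otimes>\<^bsub>qr\<^esub> qt g = qt (f \<otimes> g)"
  by (simp add: FactRing_def rcoset_mult_add)

lemma one_quotient: "\<one>\<^bsub>qr\<^esub> = qt \<one>" by (simp add: FactRing_def)

lemma qt_eq_iff: "f \<in> carrier P ==> g \<in> carrier P ==> qt f = qt g \<longleftrightarrow> f - g \<in> I"
  using quotient_eq_iff_same_a_r_cos[OF ideal_axioms] by (metis a_minus_eq)

lemma zero_quotient: "\<zero>\<^bsub>qr\<^esub> = qt 0"
  using a_rcos_const[OF additive_subgroup.zero_closed[OF is_additive_subgroup]] by (simp add: FactRing_def zero_eq)

lemma qt_eq_zero_iff: "f \<in> carrier P ==> qt f = \<zero>\<^bsub>qr\<^esub> \<longleftrightarrow> f \<in> I"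
  using qt_eq_iff[of f 0] by (simp add: zero_quotient)

lemma rep: "r \<in> carrier qr ==> rep r \<in> carrier P \<and> qt (rep r) = r"
  unfolding rep_def by (rule someI_ex) (auto simp: carrier_quotient)

lemma rep_qt: "f \<in> carrier P ==> rep (qt f) - f \<in> I" using rep[of "qt f"] qt_eq_iff[of "rep (qt f)" f] by simp

lemma I_subset: "f \<in> I ==> f \<in> carrier P" using Icarr by simp

lemma I_add: "f \<in> I ==> g \<in> I ==> f + g \<in> I" using additive_subgroup.a_closed[OF is_additive_subgroup] by (simp add: add_eq)

lemma I_zero: "0 \<in> I" using additive_subgroup.zero_closed[OF is_additive_subgroup] by (simp add: zero_eq)

lemma I_scale: "f \<in> I ==> scale c f \<in> I" using I_l_closed[of f "scale c \<one>"] I_subset[of f] by (simp add: scale_mult_left)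

lemma I_diff: "f \<in> I ==> g \<in> I ==> f - g \<in> I" using I_add[of f "scale (-1) g"] I_scale[of g "-1"] by (simp add: scale_minus_one)

lemma sc_closed [simp]: "sc c \<in> carrier qr" by (simp add: sc_def)

lemma sc_mult_qt: "f \<in> carrier P ==> sc c \<otimes>\<^bsub>qr\<^esub> qt f = qt (scale c f)"
  by (simp add: sc_def qt_mult scale_mult_left)

lemma qt_mult_sc: "f \<in> carrier P ==> qt f \<otimes>\<^bsub>qr\<^esub> sc c = qt (scale c f)"
  by (simp add: sc_def qt_mult scale_mult_right)

lemma finsum_qt:
  assumes "h \<in> F \<rightarrow> carrier P"
  shows "(\<Oplus>\<^bsub>qr\<^esub>b\<in>F. qt (h b)) = qt (\<Sum>b\<in>F. h b)"
proof -
  interpret R: ring "qr" by (rule quotient_is_ring)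
  show ?thesis using finsum_additive[OF abelian_group_axioms R.abelian_group_axioms _ _ assms, of "\<lambda>f. qt f"]
    by (simp add: finsum_eq_sum[OF assms] qt_add add_eq)
qed

text \<open>Coordinates with respect to a minimal set of basis elements spanning the quotient.\<close>

lemma quotient_dual_basis:
  assumes Y: "finite Y" "Y \<subseteq> S" "!!p. p \<in> S - Y ==> basis p \<in> I"
  obtains F :: "nat set" and w co where "finite F" "w \<in> F \<rightarrow> carrier qr"
    "\<forall>b\<in>F. lin_functional qr sc (co b)"
    "\<forall>r\<in>carrier qr. r = (\<Oplus>\<^bsub>qr\<^esub>b\<in>F. sc (co b r) \<otimes>\<^bsub>qr\<^esub> w b)"
proof -
  interpret R: ring "qr" by (rule quotient_is_ring)
  let ?comb = "\<lambda>T c. \<Sum>s\<in>T. single s (c s)"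
  define spans where "spans T \<longleftrightarrow> (\<forall>f\<in>carrier P. \<exists>c. f - ?comb T c \<in> I)" for T
  have comb_closed: "?comb T c \<in> carrier P" if "T \<subseteq> S" for T c
  proof -
    have "finsum P (\<lambda>s. single s (c s)) T \<in> carrier P" by (rule finsum_closed) (use that in auto)
    then show ?thesis using that by (subst (asm) finsum_eq_sum) auto
  qed
  have I_keys: "f \<in> I" if "keys f \<subseteq> S - Y" for f using that
  proof (induction rule: poly_mapping_single_induct)
    case (single p c)
    then show ?case using I_scale[OF Y(3), of p c] by simp
  qed (simp_all add: I_zero I_add)
  have "spans Y" unfolding spans_def
  proof (intro ballI exI)
    fix f assume f: "f \<in> carrier P"
    let ?g = "f - ?comb Y (lookup f)"
    have "lookup ?g p = 0" if "p \<notin> S - Y" for p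
    proof -
      have "p \<notin> S ==> lookup f p = 0" using f by (auto simp: carrier_eq in_keys_iff)
      then show ?thesis using that Y(1) by (auto simp: lookup_minus lookup_sum lookup_single when_def)
    qed
    then have "keys ?g \<subseteq> S - Y" by (auto simp: in_keys_iff)
    then show "?g \<in> I" by (rule I_keys)
  qed
  then have "\<exists>T. (spans T \<and> T \<subseteq> Y) \<and> (\<forall>T'. spans T' \<and> T' \<subseteq> Y --> card T \<le> card T')"
    using ex_has_least_nat[of "\<lambda>T. spans T \<and> T \<subseteq> Y" Y card] by auto
  then obtain T where T: "spans T" "T \<subseteq> Y" "!!T'. spans T' ==> T' \<subseteq> Y ==> card T \<le> card T'" by blast
  have fT: "finite T" and TS: "T \<subseteq> S" using T(2) Y(1,2) finite_subset by auto
  have uniq0: "c s = 0" if c: "?comb T c \<in> I" and s: "s \<in> T" for c s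
  proof (rule ccontr)
    assume cs: "c s \<noteq> 0"
    \<comment> \<open>A relation with a nonzero coefficient at \<open>s\<close> lets
      \<open>s\<close> be eliminated, against minimality.\<close>
    have "spans (T - {s})" unfolding spans_def
    proof (intro ballI)
      fix f assume "f \<in> carrier P"
      then obtain d where d: "f - ?comb T d \<in> I" using T(1) spans_def by blast
      let ?k = "d s / c s"
      have "f - ?comb T d + scale ?k (?comb T c) \<in> I" using d c by (intro I_add I_scale)
      moreover have "f - ?comb T d + scale ?k (?comb T c) = f - ?comb (T - {s}) (\<lambda>t. d t - ?k * c t)"
      proof (rule poly_mapping_eqI)
        fix p
        show "lookup (f - ?comb T d + scale ?k (?comb T c)) p =
          lookup (f - ?comb (T - {s}) (\<lambda>t. d t - ?k * c t)) p"
          using fT s cs by (auto simp: lookup_add lookup_minus lookup_sum lookup_single when_def sum.delta)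
      qed
      ultimately show "\<exists>e. f - ?comb (T - {s}) e \<in> I" by auto
    qed
    then have "card T \<le> card (T - {s})" using T(2,3) by auto
    then show False using s fT by (metis card_Diff1_less not_le)
  qed
  have uniq: "c s = d s" if "f - ?comb T c \<in> I" "f - ?comb T d \<in> I" "s \<in> T" for f c d s
  proof -
    have "(f - ?comb T d) - (f - ?comb T c) \<in> I" by (rule I_diff[OF that(2,1)])
    also have "(f - ?comb T d) - (f - ?comb T c) = ?comb T (\<lambda>s. c s - d s)" by (simp add: single_diff sum_subtractf)
    finally have "?comb T (\<lambda>s. c s - d s) \<in> I" .
    from uniq0[OF this that(3)] show ?thesis by simp
  qed
  \<comment> \<open>The coefficients are chosen, but \<open>uniq\<close> determines them on
    \<open>T\<close>; hence they are linear and constant on classes.\<close>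
  define cf where "cf f = (SOME c. f - ?comb T c \<in> I)" for f
  have cf: "f - ?comb T (cf f) \<in> I" if "f \<in> carrier P" for f
    unfolding cf_def using someI_ex[of "\<lambda>c. f - ?comb T c \<in> I"] T(1) that spans_def by blast
  have cf_eq: "cf f s = d s" if "f \<in> carrier P" "f - ?comb T d \<in> I" "s \<in> T" for f d s using uniq[OF cf[OF that(1)] that(2,3)] .
  have cf_cong: "cf f s = cf g s" if "f \<in> carrier P" "g \<in> carrier P" "f - g \<in> I" "s \<in> T" for f g s
  proof (rule cf_eq[OF that(1) _ that(4)])
    have "(f - g) + (g - ?comb T (cf g)) \<in> I" using that cf by (intro I_add) auto
    then show "f - ?comb T (cf g) \<in> I" by simp
  qed
  have cf_add: "cf (f + g) s = cf f s + cf g s" if "f \<in> carrier P" "g \<in> carrier P" "s \<in> T" for f g s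
  proof (rule cf_eq[OF _ _ that(3)])
    show "f + g \<in> carrier P" using that by simp
    have "(f - ?comb T (cf f)) + (g - ?comb T (cf g)) \<in> I" using that cf by (intro I_add) auto
    then show "f + g - ?comb T (\<lambda>s. cf f s + cf g s) \<in> I" by (simp add: single_add sum.distrib algebra_simps)
  qed
  have cf_scale: "cf (scale k f) s = k * cf f s" if "f \<in> carrier P" "s \<in> T" for f s k
  proof (rule cf_eq[OF _ _ that(2)])
    have "scale k (f - ?comb T (cf f)) \<in> I" using that cf by (intro I_scale) auto
    then show "scale k f - ?comb T (\<lambda>s. k * cf f s) \<in> I" by (simp add: scale_sum)
  qed (use that in simp)
  obtain n h where h: "bij_betw h {..<n::nat} T" using ex_bij_betw_nat_finite[OF fT] atLeast0LessThan by metis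
  define co where "co b r = cf (rep r) (h b)" for b r
  have co_qt: "co b (qt f) = cf f (h b)" if "b < n" "f \<in> carrier P" for b f
    unfolding co_def using rep[of "qt f"] rep_qt[OF that(2)] that h by (intro cf_cong) (auto simp: bij_betw_def)
  show ?thesis
  proof (rule that[of "{..<n}" "\<lambda>b. qt (basis (h b))" co])
    have hS: "h b \<in> S" if "b < n" for b using h that TS by (auto simp: bij_betw_def)
    then show "(\<lambda>b. qt (basis (h b))) \<in> {..<n} \<rightarrow> carrier qr" by auto
    have hT: "h b \<in> T" if "b < n" for b using h that by (auto simp: bij_betw_def)
    show "\<forall>b\<in>{..<n}. lin_functional qr sc (co b)" unfolding lin_functional_def
    proof (intro ballI conjI allI)
      fix b r s c assume b: "b \<in> {..<n}" and r: "r \<in> carrier qr"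
      obtain f where f: "f \<in> carrier P" "r = qt f" using r by (auto simp: carrier_quotient)
      show "co b (sc c \<otimes>\<^bsub>qr\<^esub> r) = c * co b r" using b f hT by (simp add: sc_mult_qt co_qt cf_scale)
      assume s: "s \<in> carrier qr"
      obtain g where g: "g \<in> carrier P" "s = qt g" using s by (auto simp: carrier_quotient)
      show "co b (r \<oplus>\<^bsub>qr\<^esub> s) = co b r + co b s" using b f g hT by (simp add: qt_add co_qt cf_add)
    qed
    show "\<forall>r\<in>carrier qr. r = (\<Oplus>\<^bsub>qr\<^esub>b\<in>{..<n}. sc (co b r) \<otimes>\<^bsub>qr\<^esub> qt (basis (h b)))"
    proof
      fix r assume "r \<in> carrier qr"
      then obtain f where f: "f \<in> carrier P" "r = qt f" by (auto simp: carrier_quotient)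
      have "(\<Oplus>\<^bsub>qr\<^esub>b\<in>{..<n}. sc (co b r) \<otimes>\<^bsub>qr\<^esub> qt (basis (h b))) =
        (\<Oplus>\<^bsub>qr\<^esub>b\<in>{..<n}. qt (single (h b) (cf f (h b))))"
        by (rule R.finsum_cong'[OF refl]) (use hS f in "auto simp: sc_mult_qt co_qt")
      also have "\<dots> = qt (\<Sum>b\<in>{..<n}. single (h b) (cf f (h b)))" by (rule finsum_qt) (use hS in auto)
      also have "(\<Sum>b\<in>{..<n}. single (h b) (cf f (h b))) = ?comb T (cf f)" by (rule sum.reindex_bij_betw[OF h])
      also have "qt \<dots> = r" using qt_eq_iff[OF f(1) comb_closed[OF TS]] cf[OF f(1)] f(2) by metis
      finally show "r = (\<Oplus>\<^bsub>qr\<^esub>b\<in>{..<n}. sc (co b r) \<otimes>\<^bsub>qr\<^esub> qt (basis (h b)))" by (rule sym)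
    qed
  qed simp
qed

text \<open>Multiplicative functionals that vanish on \<open>I\<close> descend to the quotient. They
  are evaluated on chosen representatives, and the second conclusion removes the choice.\<close>

lemma augmented_quotient:
  fixes V :: "'x set" and eps :: "'x => ('p \<Rightarrow>\<^sub>0 'k) => 'k"
  assumes Y: "finite Y" "Y \<subseteq> S" "!!p. p \<in> S - Y ==> basis p \<in> I"
    and add: "!!v f g. v \<in> V ==> f \<in> carrier P ==> g \<in> carrier P ==> eps v (f + g) = eps v f + eps v g"
    and mult: "!!v f g. v \<in> V ==> f \<in> carrier P ==> g \<in> carrier P ==> eps v (f \<otimes> g) = eps v f * eps v g"
    and scale: "!!v f c. v \<in> V ==> f \<in> carrier P ==> eps v (scale c f) = c * eps v f"
    and one: "!!v. v \<in> V ==> eps v \<one> = 1"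
    and van: "!!v f. v \<in> V ==> f \<in> I ==> eps v f = 0"
    and nil: "\<exists>xs. set xs \<subseteq> V \<and> kernel_products P eps xs \<subseteq> I"
  shows "augmented_algebra qr sc V (\<lambda>v r. eps v (rep r))"
    and "!!v f. v \<in> V ==> f \<in> carrier P ==> eps v (rep (qt f)) = eps v f"
proof -
  interpret R: ring "qr" by (rule quotient_is_ring)
  have e: "eps v (rep (qt f)) = eps v f" if v: "v \<in> V" and f: "f \<in> carrier P" for v f
  proof -
    have r: "rep (qt f) - f \<in> I" by (rule rep_qt[OF f])
    have "eps v ((rep (qt f) - f) + f) = 0 + eps v f" using add[OF v I_subset[OF r] f] van[OF v r] by simp
    then show ?thesis by simp
  qed
  then show "!!v f. v \<in> V ==> f \<in> carrier P ==> eps v (rep (qt f)) = eps v f" .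
  have kp: "\<exists>f\<in>kernel_products P eps xs. f \<in> carrier P \<and> r = qt f"
    if "r \<in> kernel_products qr (\<lambda>v r. eps v (rep r)) xs" "set xs \<subseteq> V" for xs r using that
  proof (induction xs arbitrary: r)
    case Nil
    then show ?case by (simp add: one_quotient)
  next
    case (Cons x xs)
    then obtain s t where st: "r = s \<otimes>\<^bsub>qr\<^esub> t" "s \<in> carrier qr" "eps x (rep s) = 0"
      "t \<in> kernel_products qr (\<lambda>v r. eps v (rep r)) xs" by auto
    obtain g where g: "g \<in> kernel_products P eps xs" "g \<in> carrier P" "t = qt g" using Cons.IH[OF st(4)] Cons.prems by auto
    have f: "rep s \<in> carrier P" "qt (rep s) = s" using rep[OF st(2)] by auto
    have "r = qt (rep s \<otimes> g)" using st(1) f g by (metis qt_mult)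
    then show ?case using f g st(3) by (intro bexI[of _ "rep s \<otimes> g"]) auto
  qed
  obtain xs where xs: "set xs \<subseteq> V" "kernel_products P eps xs \<subseteq> I" using nil by blast
  show "augmented_algebra qr sc V (\<lambda>v r. eps v (rep r))"
  proof (intro augmented_algebra.intro R.ring_axioms augmented_algebra_axioms.intro)
    fix c d r s v
    show "sc c \<in> carrier qr" by simp
    show "sc (c + d) = sc c \<oplus>\<^bsub>qr\<^esub> sc d" by (simp add: sc_def qt_add)
    show "sc (c * d) = sc c \<otimes>\<^bsub>qr\<^esub> sc d" using sc_mult_qt[of "scale d \<one>" c] by (simp add: sc_def)
    show "sc 1 = \<one>\<^bsub>qr\<^esub>" by (simp add: sc_def one_quotient)
    { assume "r \<in> carrier qr"
      then obtain f where f: "f \<in> carrier P" "r = qt f" by (auto simp: carrier_quotient)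
      show "sc c \<otimes>\<^bsub>qr\<^esub> r = r \<otimes>\<^bsub>qr\<^esub> sc c" using f by (simp add: sc_mult_qt qt_mult_sc) }
    { assume v: "v \<in> V"
      show "eps v (rep (sc c)) = c" using v one scale by (simp add: sc_def e)
      assume "r \<in> carrier qr" "s \<in> carrier qr"
      then obtain f g where fg: "f \<in> carrier P" "r = qt f" "g \<in> carrier P" "s = qt g" by (auto simp: carrier_quotient)
      show "eps v (rep (r \<oplus>\<^bsub>qr\<^esub> s)) = eps v (rep r) + eps v (rep s)" using v fg add by (simp add: qt_add e)
      show "eps v (rep (r \<otimes>\<^bsub>qr\<^esub> s)) = eps v (rep r) * eps v (rep s)" using v fg mult by (simp add: qt_mult e) }
    show "\<exists>xs. set xs \<subseteq> V \<and> kernel_products qr (\<lambda>v r. eps v (rep r)) xs \<subseteq> {\<zero>\<^bsub>qr\<^esub>}"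
      using xs kp qt_eq_zero_iff by (intro exI[of _ xs]) blast
    show "\<exists>(F :: nat set) w co. finite F \<and> w \<in> F \<rightarrow> carrier qr \<and> (\<forall>b\<in>F. lin_functional qr sc (co b)) \<and>
      (\<forall>r\<in>carrier qr. r = (\<Oplus>\<^bsub>qr\<^esub>b\<in>F. sc (co b r) \<otimes>\<^bsub>qr\<^esub> w b))"
      by (rule quotient_dual_basis[OF Y]) blast+
  qed
qed

lemma a_r_coset_opposite: "I +>\<^bsub>opposite_ring P\<^esub> f = I +> f" unfolding a_r_coset_def opposite_ring_def by simp

text \<open>An equality and not just an isomorphism, because the classes are the same sets; results
  about the opposite algebra can therefore be obtained by rewriting.\<close>

lemma opposite_quotient: "opposite_ring (P Quot I) = opposite_ring P Quot I"
proof -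
  have "rcoset_mult (opposite_ring P) I u v = rcoset_mult P I v u" for u v unfolding rcoset_mult_def by (auto simp: a_r_coset_opposite)
  moreover have "a_rcosets\<^bsub>opposite_ring P\<^esub> I = a_rcosets I" "set_add (opposite_ring P) = set_add P"
    unfolding A_RCOSETS_def set_add_def opposite_ring_def by simp_all
  ultimately show ?thesis by (simp add: FactRing_def a_r_coset_opposite) (simp add: opposite_ring_def fun_eq_iff)
qed

lemma based_quotient_opposite: "based_quotient (opposite_ring P) S I"
proof -
  interpret O: based_algebra "opposite_ring P" S by (rule based_algebra_opposite)
  have "subgroup I (add_monoid (opposite_ring P))" using a_subgroup unfolding opposite_ring_def by simp
  then have "ideal I (opposite_ring P)" by (rule idealI[OF O.ring_axioms]) (auto intro: I_l_closed I_r_closed)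
  then show ?thesis by (intro based_quotient.intro O.based_algebra_axioms)
qed

end

section \<open>Suffix maps on quotients of based algebras\<close>

lemma (in based_algebra) diff_closed [simp]:
  "f \<in> carrier P ==> g \<in> carrier P ==> f - g \<in> carrier P"
  using plus_closed[of f "scale (- 1) g"] scale_closed[of g "- 1"] by (simp add: scale_minus_one)

definition linear_on :: "('p \<Rightarrow>\<^sub>0 'k::field) set => (('p \<Rightarrow>\<^sub>0 'k) => 'k) => bool" where
  "linear_on U \<theta> \<longleftrightarrow> (\<forall>f\<in>U. \<forall>g\<in>U. \<theta> (f + g) = \<theta> f + \<theta> g) \<and> (\<forall>c. \<forall>f\<in>U. \<theta> (scale c f) = c * \<theta> f)"

text \<open>This is the map from \<open>p\<close> to the tensor product of \<open>rr p\<close> and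
  \<open>gg p\<close>, followed by \<open>\<theta>\<close> on the first factor. Letting
  \<open>\<theta>\<close> vary takes the place of working in the tensor product.\<close>

definition tensor_map ::
  "('p => ('p \<Rightarrow>\<^sub>0 'k::field)) => ('p => ('q \<Rightarrow>\<^sub>0 'k)) => (('p \<Rightarrow>\<^sub>0 'k) => 'k) => ('p \<Rightarrow>\<^sub>0 'k) => ('q \<Rightarrow>\<^sub>0 'k)" where
  "tensor_map rr gg \<theta> = linear_extension (\<lambda>p. scale (\<theta> (rr p)) (gg p))"

lemma tensor_map_simps [simp]:
  "tensor_map rr gg \<theta> 0 = 0"
  "tensor_map rr gg \<theta> (f + g) = tensor_map rr gg \<theta> f + tensor_map rr gg \<theta> g"
  "tensor_map rr gg \<theta> (scale c f) = scale c (tensor_map rr gg \<theta> f)"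
  "tensor_map rr gg \<theta> (single p c) = scale (c * \<theta> (rr p)) (gg p)" by (simp_all add: tensor_map_def)

text \<open>
  The algebra \<open>A\<close> of the first quiver sits in the algebra \<open>P\<close> of the glued quiver by \<open>\<iota>\<close>, with
  retraction \<open>\<pi>\<close>; a basis element \<open>p\<close> ending in the first quiver is \<open>rr p \<cdot> \<iota> (gg p)\<close> with \<open>gg p\<close> its
  longest final segment there. The ideal \<open>I\<close> is generated by \<open>\<iota> IA\<close> and the relations \<open>G\<close> of the
  second quiver.
\<close>

locale based_corner = p: based_quotient P S I + a: based_quotient A SA IA
  for P :: "('p \<Rightarrow>\<^sub>0 'k::field) ring" and S I and A :: "('q \<Rightarrow>\<^sub>0 'k) ring" and SA IA +
  fixes \<iota> :: "('q \<Rightarrow>\<^sub>0 'k) => ('p \<Rightarrow>\<^sub>0 'k)" and \<pi> :: "('p \<Rightarrow>\<^sub>0 'k) => ('q \<Rightarrow>\<^sub>0 'k)"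
    and e :: "'q \<Rightarrow>\<^sub>0 'k" and rr gg and G C :: "('p \<Rightarrow>\<^sub>0 'k) set"
  assumes iota_closed [simp]: "x \<in> carrier A ==> \<iota> x \<in> carrier P"
    and iota_add: "\<iota> (x + y) = \<iota> x + \<iota> y" and iota_scale: "\<iota> (scale c x) = scale c (\<iota> x)"
    and iota_mult: "x \<in> carrier A ==> y \<in> carrier A ==> \<iota> (x \<otimes>\<^bsub>A\<^esub> y) = \<iota> x \<otimes>\<^bsub>P\<^esub> \<iota> y"
    and pi_closed [simp]: "f \<in> carrier P ==> \<pi> f \<in> carrier A"
    and pi_add: "\<pi> (f + g) = \<pi> f + \<pi> g" and pi_scale: "\<pi> (scale c f) = scale c (\<pi> f)"
    and pi_mult: "f \<in> carrier P ==> g \<in> carrier P ==> \<pi> (f \<otimes>\<^bsub>P\<^esub> g) = \<pi> f \<otimes>\<^bsub>A\<^esub> \<pi> g"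
    and pi_iota [simp]: "x \<in> carrier A ==> \<pi> (\<iota> x) = x"
    and pi_keys: "[|f \<in> carrier P; \<pi> f = 0; q \<in> keys f|] ==> \<pi> (basis q) = 0"
    and e_closed [simp]: "e \<in> carrier A"
    and rr_closed [simp]: "q \<in> S ==> rr q \<in> carrier P" and gg_closed [simp]: "q \<in> S ==> gg q \<in> carrier A"
    and T_right_single: "[|linear_on (carrier P) \<theta>; q \<in> S; t \<in> SA|] ==>
      tensor_map rr gg \<theta> (basis q \<otimes>\<^bsub>P\<^esub> \<iota> (basis t)) =
      tensor_map rr gg \<theta> (basis q) \<otimes>\<^bsub>A\<^esub> basis t"
    and T_ker_single: "[|linear_on (carrier P) \<theta>; q \<in> S; s \<in> S; \<pi> (basis s) = 0|] ==>
      tensor_map rr gg \<theta> (basis q \<otimes>\<^bsub>P\<^esub> basis s) =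
      tensor_map rr gg (\<lambda>f. \<theta> (basis q \<otimes>\<^bsub>P\<^esub> f)) (basis s)"
    and T_iota_single: "[|linear_on (carrier P) \<theta>; t \<in> SA|] ==>
      tensor_map rr gg \<theta> (\<iota> (basis t)) = scale (\<theta> (\<iota> \<one>\<^bsub>A\<^esub>)) (basis t)"
    and rr_gg: "q \<in> S ==> rr q \<otimes>\<^bsub>P\<^esub> \<iota> (gg q) = basis q \<otimes>\<^bsub>P\<^esub> \<iota> \<one>\<^bsub>A\<^esub>"
    and I_gen: "I = Idl\<^bsub>P\<^esub> (\<iota> ` IA \<union> G)" and G_closed: "G \<subseteq> carrier P"
    and G_pi: "g \<in> G ==> \<pi> g \<in> IA"
    and G_T: "[|g \<in> G; linear_on (carrier P) \<theta>; !!f. f \<in> I ==> \<theta> f = 0|] ==> tensor_map rr gg \<theta> g \<in> IA"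
    and C_closed: "C \<subseteq> carrier P"
    and C_T: "[|f \<in> C; linear_on (carrier P) \<theta>|] ==> \<exists>c. tensor_map rr gg \<theta> f = scale c e"
begin

abbreviation "T \<equiv> tensor_map rr gg"

lemma T_closed [simp]: "f \<in> carrier P ==> T \<theta> f \<in> carrier A" by (induction rule: p.based_induct) simp_all

lemma T_cong:
  assumes "f \<in> carrier P" "!!g. g \<in> carrier P ==> \<theta> g = \<theta>' g"
  shows "T \<theta> f = T \<theta>' f" using assms(1) by (induction rule: p.based_induct) (simp_all add: assms(2))

lemma T_linear:
  "T (\<lambda>g. \<theta> g + \<theta>' g) f = T \<theta> f + T \<theta>' f" "T (\<lambda>g. c * \<theta> g) f = scale c (T \<theta> f)"
proof -
  have "keys f \<subseteq> UNIV" by simp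
  then have "T (\<lambda>g. \<theta> g + \<theta>' g) f = T \<theta> f + T \<theta>' f \<and> T (\<lambda>g. c * \<theta> g) f = scale c (T \<theta> f)"
    by (induction rule: poly_mapping_single_induct) (simp_all add: algebra_simps)
  then show "T (\<lambda>g. \<theta> g + \<theta>' g) f = T \<theta> f + T \<theta>' f" "T (\<lambda>g. c * \<theta> g) f = scale c (T \<theta> f)" by auto
qed

lemma mult_add_P: "[|f \<in> carrier P; g \<in> carrier P; h \<in> carrier P|] ==> (f + g) \<otimes>\<^bsub>P\<^esub> h = f \<otimes>\<^bsub>P\<^esub> h + g \<otimes>\<^bsub>P\<^esub> h"
  "[|f \<in> carrier P; g \<in> carrier P; h \<in> carrier P|] ==> h \<otimes>\<^bsub>P\<^esub> (f + g) = h \<otimes>\<^bsub>P\<^esub> f + h \<otimes>\<^bsub>P\<^esub> g"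
  using p.l_distr[of f g h] p.r_distr[of f g h] by (simp_all add: p.add_eq)

lemma mult_add_A: "[|f \<in> carrier A; g \<in> carrier A; h \<in> carrier A|] ==> (f + g) \<otimes>\<^bsub>A\<^esub> h = f \<otimes>\<^bsub>A\<^esub> h + g \<otimes>\<^bsub>A\<^esub> h"
  "[|f \<in> carrier A; g \<in> carrier A; h \<in> carrier A|] ==> h \<otimes>\<^bsub>A\<^esub> (f + g) = h \<otimes>\<^bsub>A\<^esub> f + h \<otimes>\<^bsub>A\<^esub> g"
  using a.l_distr[of f g h] a.r_distr[of f g h] by (simp_all add: a.add_eq)

lemma mult_zero_P: "f \<in> carrier P ==> 0 \<otimes>\<^bsub>P\<^esub> f = 0" "f \<in> carrier P ==> f \<otimes>\<^bsub>P\<^esub> 0 = 0"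
  using p.l_null[of f] p.r_null[of f] by (simp_all add: p.zero_eq)

lemma mult_zero_A: "f \<in> carrier A ==> 0 \<otimes>\<^bsub>A\<^esub> f = 0" "f \<in> carrier A ==> f \<otimes>\<^bsub>A\<^esub> 0 = 0"
  using a.l_null[of f] a.r_null[of f] by (simp_all add: a.zero_eq)

lemma iota_zero: "\<iota> 0 = 0" and pi_zero: "\<pi> 0 = 0" using iota_scale[of 0 0] pi_scale[of 0 0] by simp_all

lemma iota_diff: "\<iota> (x - y) = \<iota> x - \<iota> y" and pi_diff: "\<pi> (f - g) = \<pi> f - \<pi> g"
  using iota_add[of "x - y" y] pi_add[of "f - g" g] by (simp_all add: algebra_simps)

lemma T_diff: "T \<theta> (f - g) = T \<theta> f - T \<theta> g"
  using tensor_map_simps(2)[of rr gg \<theta> "f - g" g] by (simp add: algebra_simps)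

lemma T_right:
  assumes \<theta>: "linear_on (carrier P) \<theta>" and f: "f \<in> carrier P" and x: "x \<in> carrier A"
  shows "T \<theta> (f \<otimes>\<^bsub>P\<^esub> \<iota> x) = T \<theta> f \<otimes>\<^bsub>A\<^esub> x" using f
proof (induction rule: p.based_induct)
  case zero
  show ?case using x by (simp add: mult_zero_P mult_zero_A)
next
  case (add f g)
  then show ?case using x by (simp add: mult_add_P mult_add_A)
next
  case (single q c)
  show ?case using x
  proof (induction rule: a.based_induct)
    case zero
    show ?case using single by (simp add: iota_zero mult_zero_P mult_zero_A)
  next
    case (add x y)
    then show ?case using single by (simp add: iota_add mult_add_P mult_add_A)
  next
    case (single t d)
    have "T \<theta> (scale c (basis q) \<otimes>\<^bsub>P\<^esub> \<iota> (scale d (basis t))) =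
      T \<theta> (scale c (basis q)) \<otimes>\<^bsub>A\<^esub> scale d (basis t)"
      using T_right_single[OF \<theta> \<open>q \<in> S\<close> single] single \<open>q \<in> S\<close>
      by (simp only: iota_scale p.scale_mult_left p.scale_mult_right a.scale_mult_left a.scale_mult_right
          tensor_map_simps(3) p.single_closed a.single_closed iota_closed p.scale_closed a.scale_closed T_closed p.m_closed)
    then show ?case by simp
  qed
qed

lemma linear_on_mult:
  assumes "linear_on (carrier P) \<theta>" "f \<in> carrier P"
  shows "linear_on (carrier P) (\<lambda>g. \<theta> (f \<otimes>\<^bsub>P\<^esub> g))"
  using assms unfolding linear_on_def by (simp add: mult_add_P p.scale_mult_right)

lemma T_ker:
  assumes \<theta>: "linear_on (carrier P) \<theta>" and f: "f \<in> carrier P" and g: "g \<in> carrier P" "\<pi> g = 0"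
  shows "T \<theta> (f \<otimes>\<^bsub>P\<^esub> g) = T (\<lambda>h. \<theta> (f \<otimes>\<^bsub>P\<^esub> h)) g" using f
proof (induction rule: p.based_induct)
  case zero
  have "\<theta> 0 = 0" using \<theta> p.zero_in_carrier unfolding linear_on_def by (metis mult_zero_left scale_simps(6))
  then have "T (\<lambda>h. \<theta> (0 \<otimes>\<^bsub>P\<^esub> h)) g = T (\<lambda>h. 0 * \<theta> h) g"
    by (intro T_cong[OF g(1)]) (simp add: mult_zero_P)
  then show ?case using g by (simp add: mult_zero_P T_linear(2) del: mult_zero_left)
next
  case (add f f')
  have "T (\<lambda>h. \<theta> ((f + f') \<otimes>\<^bsub>P\<^esub> h)) g = T (\<lambda>h. \<theta> (f \<otimes>\<^bsub>P\<^esub> h) + \<theta> (f' \<otimes>\<^bsub>P\<^esub> h)) g"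
    by (rule T_cong[OF g(1)]) (use \<theta> add in "simp add: mult_add_P linear_on_def")
  then show ?case using add g by (simp add: mult_add_P T_linear(1))
next
  case (single q c)
  let ?q = "basis q"
  have q: "?q \<in> carrier P" using single by simp
  have 1: "T \<theta> (?q \<otimes>\<^bsub>P\<^esub> g) = T (\<lambda>h. \<theta> (?q \<otimes>\<^bsub>P\<^esub> h)) g"
  proof -
    \<comment> \<open>By \<open>pi_keys\<close> the kernel of \<open>\<pi>\<close> is spanned by
      basis elements, so the linear induction can stay inside it.\<close>
    have "keys g \<subseteq> {s \<in> S. \<pi> (basis s) = 0}" using pi_keys[OF g] g(1) by (auto simp: p.carrier_eq)
    then show ?thesis
    proof (induction rule: poly_mapping_single_induct)
      case zero
      show ?case using q by (simp add: mult_zero_P)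
    next
      case (add u v)
      then have "u \<in> carrier P" "v \<in> carrier P" by (auto simp: p.carrier_eq)
      then show ?case using add q by (simp add: mult_add_P)
    next
      case (single s d)
      then have s: "s \<in> S" "\<pi> (basis s) = 0" "basis s \<in> carrier P" by auto
      have "T \<theta> (?q \<otimes>\<^bsub>P\<^esub> scale d (basis s)) = T (\<lambda>h. \<theta> (?q \<otimes>\<^bsub>P\<^esub> h)) (scale d (basis s))"
        using T_ker_single[OF \<theta> \<open>q \<in> S\<close> s(1,2)] by (simp only: p.scale_mult_right[OF q s(3)] tensor_map_simps(3))
      then show ?case by simp
    qed
  qed
  have "T \<theta> (scale c ?q \<otimes>\<^bsub>P\<^esub> g) = T (\<lambda>h. \<theta> (scale c ?q \<otimes>\<^bsub>P\<^esub> h)) g"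
  proof -
    have "T (\<lambda>h. \<theta> (scale c ?q \<otimes>\<^bsub>P\<^esub> h)) g = T (\<lambda>h. c * \<theta> (?q \<otimes>\<^bsub>P\<^esub> h)) g"
      by (rule T_cong[OF g(1)]) (use \<theta> q in "simp only: p.scale_mult_left linear_on_def p.m_closed")
    then show ?thesis using 1 q g by (simp only: T_linear(2) p.scale_mult_left tensor_map_simps(3))
  qed
  then show ?case by simp
qed

lemma T_iota:
  assumes \<theta>: "linear_on (carrier P) \<theta>" and x: "x \<in> carrier A"
  shows "T \<theta> (\<iota> x) = scale (\<theta> (\<iota> \<one>\<^bsub>A\<^esub>)) x" using x
proof (induction rule: a.based_induct)
  case (single t c)
  have "T \<theta> (\<iota> (scale c (basis t))) = scale (\<theta> (\<iota> \<one>\<^bsub>A\<^esub>)) (scale c (basis t))"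
    unfolding iota_scale tensor_map_simps(3) T_iota_single[OF \<theta> single] by (simp add: mult.commute)
  then show ?case by simp
qed (simp_all add: iota_zero iota_add)

lemma iota_IA: "x \<in> IA ==> \<iota> x \<in> I"
proof -
  assume "x \<in> IA"
  moreover have "\<iota> ` IA \<union> G \<subseteq> carrier P" using a.I_subset G_closed by auto
  ultimately show ?thesis using p.genideal_self[of "\<iota> ` IA \<union> G"] I_gen by auto
qed

text \<open>The elements of \<open>I\<close> on which all the maps below vanish form an ideal containing the generators.\<close>

lemma pi_T_I:
  assumes "i \<in> I"
  shows "\<pi> i \<in> IA" "[|linear_on (carrier P) \<theta>; !!f. f \<in> I ==> \<theta> f = 0|] ==> T \<theta> i \<in> IA"
proof -
  let ?L = "\<lambda>\<theta>. linear_on (carrier P) \<theta> \<and> (\<forall>f\<in>I. \<theta> f = 0)"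
  \<comment> \<open>All functionals that vanish on \<open>I\<close> are treated together, since left
    multiplication by \<open>f\<close> replaces \<open>\<theta>\<close> by another such
    functional.\<close>
  let ?N = "{i \<in> I. \<pi> i \<in> IA \<and> (\<forall>\<theta>. ?L \<theta> --> T \<theta> i \<in> IA)}"
  have "ideal ?N P"
  proof (rule idealI[OF p.ring_axioms])
    show "subgroup ?N (add_monoid P)"
    proof (rule p.add.subgroupI)
      show "?N \<subseteq> carrier P" using p.I_subset by auto
      have "0 \<in> ?N" using p.I_zero a.I_zero by (simp add: pi_zero)
      then show "?N \<noteq> {}" by blast
      fix i assume i: "i \<in> ?N"
      have "scale (- 1) i \<in> ?N"
        using i p.I_scale[of i "- 1"] a.I_scale[of _ "- 1"] by (simp only: mem_Collect_eq pi_scale tensor_map_simps(3)) blast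
      then show "\<ominus>\<^bsub>P\<^esub> i \<in> ?N" using p.a_inv_eq[of i] p.I_subset i by (simp add: scale_minus_one)
      fix k assume "k \<in> ?N"
      then show "i \<oplus>\<^bsub>P\<^esub> k \<in> ?N" using i by (simp add: p.add_eq pi_add p.I_add a.I_add)
    qed
  next
    fix i f assume i: "i \<in> ?N" and f: "f \<in> carrier P"
    have iP: "i \<in> carrier P" using i p.I_subset by auto
    let ?f = "f - \<iota> (\<pi> f)" and ?i = "i - \<iota> (\<pi> i)"
    have cl: "?f \<in> carrier P" "?i \<in> carrier P" using f iP by auto
    have ker: "\<pi> ?f = 0" "\<pi> ?i = 0" using f iP by (simp_all add: pi_diff)
    show "f \<otimes>\<^bsub>P\<^esub> i \<in> ?N"
    proof (intro CollectI conjI allI impI)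
      show "f \<otimes>\<^bsub>P\<^esub> i \<in> I" using i f p.I_l_closed by simp
      show "\<pi> (f \<otimes>\<^bsub>P\<^esub> i) \<in> IA" using i f iP a.I_l_closed by (simp add: pi_mult)
      fix \<theta> assume \<theta>: "?L \<theta>"
      let ?\<theta> = "\<lambda>h. \<theta> (f \<otimes>\<^bsub>P\<^esub> h)"
      have \<theta>': "?L ?\<theta>" using linear_on_mult[of \<theta> f] \<theta> f p.I_l_closed by auto
      have "f \<otimes>\<^bsub>P\<^esub> i = f \<otimes>\<^bsub>P\<^esub> ?i + f \<otimes>\<^bsub>P\<^esub> \<iota> (\<pi> i)"
        using mult_add_P(2)[OF cl(2) _ f, of "\<iota> (\<pi> i)"] iP by simp
      then have "T \<theta> (f \<otimes>\<^bsub>P\<^esub> i) = T ?\<theta> ?i + T \<theta> f \<otimes>\<^bsub>A\<^esub> \<pi> i"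
        using T_ker[of \<theta> f ?i] T_right[of \<theta> f "\<pi> i"] \<theta> f cl ker iP by simp
      moreover have "T ?\<theta> ?i = T ?\<theta> i - scale (?\<theta> (\<iota> \<one>\<^bsub>A\<^esub>)) (\<pi> i)"
        using T_iota[of ?\<theta> "\<pi> i"] \<theta>' iP by (simp add: T_diff)
      moreover have "T ?\<theta> i \<in> IA" using i \<theta>' by blast
      moreover have "scale (?\<theta> (\<iota> \<one>\<^bsub>A\<^esub>)) (\<pi> i) \<in> IA" using i a.I_scale by blast
      moreover have "T \<theta> f \<otimes>\<^bsub>A\<^esub> \<pi> i \<in> IA" using i f a.I_l_closed by simp
      ultimately show "T \<theta> (f \<otimes>\<^bsub>P\<^esub> i) \<in> IA" using a.I_add a.I_diff by simp
    qed
    show "i \<otimes>\<^bsub>P\<^esub> f \<in> ?N"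
    proof (intro CollectI conjI allI impI)
      show "i \<otimes>\<^bsub>P\<^esub> f \<in> I" using i f p.I_r_closed by simp
      show "\<pi> (i \<otimes>\<^bsub>P\<^esub> f) \<in> IA" using i f iP a.I_r_closed by (simp add: pi_mult)
      fix \<theta> assume \<theta>: "?L \<theta>"
      have "i \<otimes>\<^bsub>P\<^esub> f = i \<otimes>\<^bsub>P\<^esub> ?f + i \<otimes>\<^bsub>P\<^esub> \<iota> (\<pi> f)"
        using mult_add_P(2)[OF cl(1) _ iP, of "\<iota> (\<pi> f)"] f by simp
      then have eq: "T \<theta> (i \<otimes>\<^bsub>P\<^esub> f) = T (\<lambda>h. \<theta> (i \<otimes>\<^bsub>P\<^esub> h)) ?f + T \<theta> i \<otimes>\<^bsub>A\<^esub> \<pi> f"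
        using T_ker[of \<theta> i ?f] T_right[of \<theta> i "\<pi> f"] \<theta> f cl ker iP by simp
      \<comment> \<open>All products \<open>i h\<close> lie in \<open>I\<close>, where
        \<open>\<theta>\<close> vanishes; only the part of \<open>f\<close> in \<open>A\<close>
        contributes.\<close>
      have "T (\<lambda>h. \<theta> (i \<otimes>\<^bsub>P\<^esub> h)) ?f = T (\<lambda>h. 0 * \<theta> h) ?f"
        by (rule T_cong[OF cl(1)]) (use \<theta> i p.I_r_closed in simp)
      then have "T (\<lambda>h. \<theta> (i \<otimes>\<^bsub>P\<^esub> h)) ?f = 0" unfolding T_linear(2) by simp
      moreover have "T \<theta> i \<otimes>\<^bsub>A\<^esub> \<pi> f \<in> IA" using i \<theta> f a.I_r_closed by simp
      ultimately show "T \<theta> (i \<otimes>\<^bsub>P\<^esub> f) \<in> IA" using eq by simp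
    qed
  qed
  moreover have "\<iota> ` IA \<union> G \<subseteq> ?N"
  proof
    fix x assume "x \<in> \<iota> ` IA \<union> G"
    then consider y where "y \<in> IA" "x = \<iota> y" | "x \<in> G" by blast
    then show "x \<in> ?N"
    proof cases
      case 1
      then show ?thesis using iota_IA a.I_subset a.I_scale by (simp add: T_iota)
    next
      case 2
      moreover have "\<iota> ` IA \<union> G \<subseteq> carrier P" using a.I_subset G_closed by auto
      ultimately have "x \<in> I" using p.genideal_self I_gen by blast
      then show ?thesis using 2 G_pi G_T by blast
    qed
  qed
  ultimately have "I \<subseteq> ?N" using p.genideal_minimal I_gen by simp
  then show "\<pi> i \<in> IA" "[|linear_on (carrier P) \<theta>; !!f. f \<in> I ==> \<theta> f = 0|] ==> T \<theta> i \<in> IA"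
    using assms by blast+
qed

definition \<iota>q :: "('q \<Rightarrow>\<^sub>0 'k) set => ('p \<Rightarrow>\<^sub>0 'k) set" where "\<iota>q x = p.qt (\<iota> (a.rep x))"

definition \<pi>q :: "('p \<Rightarrow>\<^sub>0 'k) set => ('q \<Rightarrow>\<^sub>0 'k) set" where "\<pi>q r = a.qt (\<pi> (p.rep r))"

definition Tq :: "(('p \<Rightarrow>\<^sub>0 'k) set => 'k) => ('p \<Rightarrow>\<^sub>0 'k) set => ('q \<Rightarrow>\<^sub>0 'k) set" where
  "Tq \<phi> r = a.qt (T (\<lambda>f. \<phi> (p.qt f)) (p.rep r))"

lemma iq_qt: "x \<in> carrier A ==> \<iota>q (a.qt x) = p.qt (\<iota> x)"
  unfolding \<iota>q_def using a.rep[of "a.qt x"] a.rep_qt[of x] iota_IA[of "a.rep (a.qt x) - x"] by (simp add: p.qt_eq_iff iota_diff)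

lemma piq_qt: "f \<in> carrier P ==> \<pi>q (p.qt f) = a.qt (\<pi> f)"
  unfolding \<pi>q_def using p.rep[of "p.qt f"] p.rep_qt[of f] pi_T_I(1)[of "p.rep (p.qt f) - f"] by (simp add: a.qt_eq_iff pi_diff)

lemma linear_on_functional:
  assumes "lin_functional p.qr p.sc \<phi>"
  shows "linear_on (carrier P) (\<lambda>f. \<phi> (p.qt f))" "f \<in> I ==> \<phi> (p.qt f) = 0"
proof -
  show "linear_on (carrier P) (\<lambda>f. \<phi> (p.qt f))" using assms unfolding linear_on_def lin_functional_def
    by (metis p.qt_add p.qt_closed p.sc_mult_qt)
  assume f: "f \<in> I"
  have "\<phi> (p.qt f) = \<phi> (p.qt (scale 0 f))"
    using f p.I_subset p.qt_eq_zero_iff p.I_zero p.zero_in_carrier by (metis scale_simps(6))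
  also have "\<dots> = 0 * \<phi> (p.qt f)" using assms f p.I_subset unfolding lin_functional_def by (metis p.qt_closed p.sc_mult_qt)
  finally show "\<phi> (p.qt f) = 0" by simp
qed

lemma Tq_qt:
  assumes "lin_functional p.qr p.sc \<phi>" "f \<in> carrier P"
  shows "Tq \<phi> (p.qt f) = a.qt (T (\<lambda>f. \<phi> (p.qt f)) f)"
proof -
  have "T (\<lambda>f. \<phi> (p.qt f)) (p.rep (p.qt f) - f) \<in> IA"
    by (rule pi_T_I(2)[OF p.rep_qt[OF assms(2)] linear_on_functional(1)[OF assms(1)] linear_on_functional(2)[OF assms(1)]])
  then show ?thesis unfolding Tq_def using p.rep[of "p.qt f"] assms(2) by (simp add: a.qt_eq_iff T_diff)
qed

lemma lin_functional_finsum: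
  assumes "lin_functional p.qr p.sc \<phi>" "finite F" "h \<in> F \<rightarrow> carrier p.qr"
  shows "\<phi> (finsum p.qr h F) = (\<Sum>b\<in>F. \<phi> (h b))"
proof -
  interpret R: ring "p.qr" by (rule p.quotient_is_ring)
  have z: "\<phi> \<zero>\<^bsub>p.qr\<^esub> = 0" using linear_on_functional(2)[OF assms(1) p.I_zero] by (simp add: p.zero_quotient)
  show ?thesis using assms(2,3) by (induction F) (use assms(1) in "auto simp: z lin_functional_def Pi_def R.finsum_closed")
qed

text \<open>A functional on the quotient pulls back to one that vanishes on \<open>I\<close>. For
  these, \<open>pi_T_I\<close> sends \<open>I\<close> into \<open>IA\<close>, so the maps
  \<open>T\<close> descend together with their identities.\<close>

lemma suffix_map_quotient:
  "suffix_map p.qr p.sc a.qr a.sc \<iota>q \<pi>q (a.qt e) (p.qt ` C) Tq"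
proof -
  interpret R: ring "p.qr" by (rule p.quotient_is_ring)
  interpret Q: ring "a.qr" by (rule a.quotient_is_ring)
  let ?\<theta> = "\<lambda>\<phi> f. \<phi> (p.qt f)"
  show ?thesis unfolding suffix_map_def
  proof (intro conjI allI impI ballI)
    fix \<phi> assume \<phi>: "lin_functional p.qr p.sc \<phi>"
    note \<theta> = linear_on_functional(1)[OF \<phi>] and Tq = Tq_qt[OF \<phi>]
    { fix x assume "x \<in> carrier a.qr"
      then obtain y where y: "y \<in> carrier A" "x = a.qt y" by (auto simp: a.carrier_quotient)
      show "Tq \<phi> (\<iota>q x) = a.sc (\<phi> (\<iota>q \<one>\<^bsub>a.qr\<^esub>)) \<otimes>\<^bsub>a.qr\<^esub> x"
        using y by (simp add: a.one_quotient iq_qt Tq T_iota[OF \<theta>] a.sc_mult_qt) }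
    { fix r assume "r \<in> p.qt ` C"
      then obtain f where f: "f \<in> C" "f \<in> carrier P" "r = p.qt f" using C_closed by blast
      obtain c where "T (?\<theta> \<phi>) f = scale c e" using C_T[OF f(1) \<theta>] by blast
      then show "\<exists>c. Tq \<phi> r = a.sc c \<otimes>\<^bsub>a.qr\<^esub> a.qt e"
        using f by (intro exI[of _ c]) (simp add: Tq a.sc_mult_qt) }
    fix r assume "r \<in> carrier p.qr"
    then obtain f where f: "f \<in> carrier P" "r = p.qt f" by (auto simp: p.carrier_quotient)
    show "Tq \<phi> r \<in> carrier a.qr" using f by (simp add: Tq)
    show "Tq \<phi> (p.sc c \<otimes>\<^bsub>p.qr\<^esub> r) = a.sc c \<otimes>\<^bsub>a.qr\<^esub> Tq \<phi> r" for c
      using f by (simp add: p.sc_mult_qt Tq a.sc_mult_qt)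
    { fix s assume "s \<in> carrier p.qr"
      then obtain g where g: "g \<in> carrier P" "s = p.qt g" by (auto simp: p.carrier_quotient)
      show "Tq \<phi> (r \<oplus>\<^bsub>p.qr\<^esub> s) = Tq \<phi> r \<oplus>\<^bsub>a.qr\<^esub> Tq \<phi> s"
        using f g by (simp add: p.qt_add Tq a.qt_add)
      assume "\<pi>q s = \<zero>\<^bsub>a.qr\<^esub>"
      then have "\<pi> g \<in> IA" using g by (simp add: piq_qt a.qt_eq_zero_iff)
      let ?g = "g - \<iota> (\<pi> g)"
      have g': "?g \<in> carrier P" "\<pi> ?g = 0" using g by (simp_all add: pi_diff)
      \<comment> \<open>The hypothesis only places \<open>\<pi> g\<close> in \<open>IA\<close>; this
        change of representative makes it zero, as \<open>T_ker\<close> requires.\<close>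
      have s': "s = p.qt ?g" using g g' iota_IA[OF \<open>\<pi> g \<in> IA\<close>] by (simp add: p.qt_eq_iff)
      have \<phi>': "lin_functional p.qr p.sc (\<lambda>t. \<phi> (r \<otimes>\<^bsub>p.qr\<^esub> t))" unfolding lin_functional_def
      proof (intro conjI ballI allI)
        fix u c assume "u \<in> carrier p.qr"
        then obtain k where k: "k \<in> carrier P" "u = p.qt k" by (auto simp: p.carrier_quotient)
        have "r \<otimes>\<^bsub>p.qr\<^esub> (p.sc c \<otimes>\<^bsub>p.qr\<^esub> u) = p.sc c \<otimes>\<^bsub>p.qr\<^esub> (r \<otimes>\<^bsub>p.qr\<^esub> u)"
          using f k by (simp add: p.sc_mult_qt p.qt_mult p.scale_mult_right)
        then show "\<phi> (r \<otimes>\<^bsub>p.qr\<^esub> (p.sc c \<otimes>\<^bsub>p.qr\<^esub> u)) = c * \<phi> (r \<otimes>\<^bsub>p.qr\<^esub> u)"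
          using \<phi> f k by (simp add: lin_functional_def)
      qed (use \<phi> f in "simp add: R.r_distr lin_functional_def")
      have "Tq (\<lambda>t. \<phi> (r \<otimes>\<^bsub>p.qr\<^esub> t)) s = a.qt (T (\<lambda>h. \<phi> (r \<otimes>\<^bsub>p.qr\<^esub> p.qt h)) ?g)"
        unfolding s' by (rule Tq_qt[OF \<phi>' g'(1)])
      also have "T (\<lambda>h. \<phi> (r \<otimes>\<^bsub>p.qr\<^esub> p.qt h)) ?g = T (\<lambda>h. ?\<theta> \<phi> (f \<otimes>\<^bsub>P\<^esub> h)) ?g"
        by (rule T_cong[OF g'(1)]) (use f in "simp add: p.qt_mult")
      also have "\<dots> = T (?\<theta> \<phi>) (f \<otimes>\<^bsub>P\<^esub> ?g)" by (rule T_ker[OF \<theta> f(1) g', symmetric])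
      also have "a.qt \<dots> = Tq \<phi> (r \<otimes>\<^bsub>p.qr\<^esub> s)" unfolding s' using f g' by (simp add: p.qt_mult Tq)
      finally show "Tq \<phi> (r \<otimes>\<^bsub>p.qr\<^esub> s) = Tq (\<lambda>t. \<phi> (r \<otimes>\<^bsub>p.qr\<^esub> t)) s" by (rule sym) }
    { fix x assume "x \<in> carrier a.qr"
      then obtain y where y: "y \<in> carrier A" "x = a.qt y" by (auto simp: a.carrier_quotient)
      show "Tq \<phi> (r \<otimes>\<^bsub>p.qr\<^esub> \<iota>q x) = Tq \<phi> r \<otimes>\<^bsub>a.qr\<^esub> x"
        using f y by (simp add: iq_qt p.qt_mult Tq a.qt_mult T_right[OF \<theta>]) }
  next
    fix F :: "nat set" and w co
    assume F: "finite F" "w \<in> F \<rightarrow> carrier p.qr" and "\<forall>b\<in>F. lin_functional p.qr p.sc (co b)"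
      and dual: "\<forall>r\<in>carrier p.qr. r = (\<Oplus>\<^bsub>p.qr\<^esub>b\<in>F. p.sc (co b r) \<otimes>\<^bsub>p.qr\<^esub> w b)"
    then have co: "lin_functional p.qr p.sc (co b)" if "b \<in> F" for b using that by blast
    note wF [simp] = funcset_mem[OF F(2)]
    have Tc: "Tq (co b) (p.qt f) = a.qt (T (?\<theta> (co b)) f)" if "b \<in> F" "f \<in> carrier P" for b f
      by (rule Tq_qt[OF co[OF that(1)] that(2)])
    have rec: "(\<Oplus>\<^bsub>p.qr\<^esub>b\<in>F. w b \<otimes>\<^bsub>p.qr\<^esub> p.qt (\<iota> (T (?\<theta> (co b)) f))) = p.qt (f \<otimes>\<^bsub>P\<^esub> \<iota> \<one>\<^bsub>A\<^esub>)"
      if "f \<in> carrier P" for f using that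
    proof (induction rule: p.based_induct)
      case zero
      have "(\<Oplus>\<^bsub>p.qr\<^esub>b\<in>F. w b \<otimes>\<^bsub>p.qr\<^esub> p.qt (\<iota> (T (?\<theta> (co b)) 0))) = (\<Oplus>\<^bsub>p.qr\<^esub>b\<in>F. \<zero>\<^bsub>p.qr\<^esub>)"
        by (rule R.finsum_cong'[OF refl]) (auto simp: iota_zero p.zero_quotient[symmetric])
      also have "\<dots> = \<zero>\<^bsub>p.qr\<^esub>" by (rule R.add.finprod_one_eqI) simp
      finally show ?case by (simp add: mult_zero_P p.zero_quotient)
    next
      case (add f g)
      have "(\<Oplus>\<^bsub>p.qr\<^esub>b\<in>F. w b \<otimes>\<^bsub>p.qr\<^esub> p.qt (\<iota> (T (?\<theta> (co b)) (f + g)))) =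
        (\<Oplus>\<^bsub>p.qr\<^esub>b\<in>F. w b \<otimes>\<^bsub>p.qr\<^esub> p.qt (\<iota> (T (?\<theta> (co b)) f)) \<oplus>\<^bsub>p.qr\<^esub> w b \<otimes>\<^bsub>p.qr\<^esub> p.qt (\<iota> (T (?\<theta> (co b)) g)))"
        by (rule R.finsum_cong'[OF refl]) (use add in "auto simp: iota_add p.qt_add[symmetric] R.r_distr")
      also have "\<dots> = p.qt (f \<otimes>\<^bsub>P\<^esub> \<iota> \<one>\<^bsub>A\<^esub>) \<oplus>\<^bsub>p.qr\<^esub> p.qt (g \<otimes>\<^bsub>P\<^esub> \<iota> \<one>\<^bsub>A\<^esub>)"
        by (subst R.finsum_addf) (use add in auto)
      finally show ?case using add by (simp add: p.qt_add mult_add_P)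
    next
      case (single q c)
      let ?r = "p.qt (rr q)" and ?t = "p.qt (\<iota> (scale c (gg q)))"
      have cl: "?r \<in> carrier p.qr" "?t \<in> carrier p.qr" "\<iota> (gg q) \<in> carrier P" using single by auto
      have "(\<Oplus>\<^bsub>p.qr\<^esub>b\<in>F. w b \<otimes>\<^bsub>p.qr\<^esub> p.qt (\<iota> (T (?\<theta> (co b)) (single q c)))) =
        (\<Oplus>\<^bsub>p.qr\<^esub>b\<in>F. (p.sc (co b ?r) \<otimes>\<^bsub>p.qr\<^esub> w b) \<otimes>\<^bsub>p.qr\<^esub> ?t)"
      proof (rule R.finsum_cong'[OF refl])
        fix b assume b: "b \<in> F"
        obtain k where k: "k \<in> carrier P" "w b = p.qt k" using wF[OF b] by (auto simp: p.carrier_quotient)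
        show "w b \<otimes>\<^bsub>p.qr\<^esub> p.qt (\<iota> (T (?\<theta> (co b)) (single q c))) =
          (p.sc (co b ?r) \<otimes>\<^bsub>p.qr\<^esub> w b) \<otimes>\<^bsub>p.qr\<^esub> ?t"
          using k cl(3) by (simp add: p.sc_mult_qt p.qt_mult iota_scale p.scale_mult_left p.scale_mult_right mult.commute)
      qed (use cl in auto)
      also have "\<dots> = (\<Oplus>\<^bsub>p.qr\<^esub>b\<in>F. p.sc (co b ?r) \<otimes>\<^bsub>p.qr\<^esub> w b) \<otimes>\<^bsub>p.qr\<^esub> ?t"
        by (rule R.finsum_ldistr[symmetric]) (use F cl in auto)
      also have "\<dots> = ?r \<otimes>\<^bsub>p.qr\<^esub> ?t" using bspec[OF dual cl(1)] by simp
      also have "\<dots> = p.qt (scale c (rr q \<otimes>\<^bsub>P\<^esub> \<iota> (gg q)))"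
        using single cl(3) by (simp add: p.qt_mult iota_scale p.scale_mult_right)
      also have "scale c (rr q \<otimes>\<^bsub>P\<^esub> \<iota> (gg q)) = scale c (basis q) \<otimes>\<^bsub>P\<^esub> \<iota> \<one>\<^bsub>A\<^esub>"
        unfolding rr_gg[OF single] by (rule p.scale_mult_left[symmetric]) (use single in auto)
      finally show ?case by simp
    qed
    { fix r assume "r \<in> carrier p.qr"
      then obtain f where f: "f \<in> carrier P" "r = p.qt f" by (auto simp: p.carrier_quotient)
      have "(\<Oplus>\<^bsub>p.qr\<^esub>b\<in>F. w b \<otimes>\<^bsub>p.qr\<^esub> \<iota>q (Tq (co b) r)) = (\<Oplus>\<^bsub>p.qr\<^esub>b\<in>F. w b \<otimes>\<^bsub>p.qr\<^esub> p.qt (\<iota> (T (?\<theta> (co b)) f)))"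
        by (rule R.finsum_cong'[OF refl]) (use f in "auto simp: Tc iq_qt")
      then show "r \<otimes>\<^bsub>p.qr\<^esub> \<iota>q \<one>\<^bsub>a.qr\<^esub> = (\<Oplus>\<^bsub>p.qr\<^esub>b\<in>F. w b \<otimes>\<^bsub>p.qr\<^esub> \<iota>q (Tq (co b) r))"
        using f rec[OF f(1)] by (simp add: a.one_quotient iq_qt p.qt_mult) }
    fix \<phi> r assume \<phi>: "lin_functional p.qr p.sc \<phi>" and r: "r \<in> carrier p.qr"
    have "(\<Oplus>\<^bsub>a.qr\<^esub>b\<in>F. a.sc (\<phi> (w b)) \<otimes>\<^bsub>a.qr\<^esub> a.qt (T (?\<theta> (co b)) f)) = a.qt (T (?\<theta> \<phi>) f)"
      if f: "f \<in> carrier P" for f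
    proof -
      have "(\<Oplus>\<^bsub>a.qr\<^esub>b\<in>F. a.sc (\<phi> (w b)) \<otimes>\<^bsub>a.qr\<^esub> a.qt (T (?\<theta> (co b)) f)) =
        (\<Oplus>\<^bsub>a.qr\<^esub>b\<in>F. a.qt (scale (\<phi> (w b)) (T (?\<theta> (co b)) f)))"
        by (rule Q.finsum_cong'[OF refl]) (use f in "auto simp: a.sc_mult_qt")
      also have "\<dots> = a.qt (\<Sum>b\<in>F. scale (\<phi> (w b)) (T (?\<theta> (co b)) f))" by (rule a.finsum_qt) (use f in auto)
      also have "(\<Sum>b\<in>F. scale (\<phi> (w b)) (T (?\<theta> (co b)) f)) = T (?\<theta> \<phi>) f" using f
      proof (induction rule: p.based_induct)
        case (single q c)
        let ?r = "p.qt (rr q)"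
        have cl: "?r \<in> carrier p.qr" using single by simp
        have "\<phi> ?r = \<phi> (\<Oplus>\<^bsub>p.qr\<^esub>b\<in>F. p.sc (co b ?r) \<otimes>\<^bsub>p.qr\<^esub> w b)" using bspec[OF dual cl] by simp
        also have "\<dots> = (\<Sum>b\<in>F. \<phi> (p.sc (co b ?r) \<otimes>\<^bsub>p.qr\<^esub> w b))"
          by (rule lin_functional_finsum[OF \<phi> F(1)]) auto
        also have "\<dots> = (\<Sum>b\<in>F. co b ?r * \<phi> (w b))"
          by (rule sum.cong[OF refl]) (use \<phi> in "simp add: lin_functional_def")
        finally have eq: "\<phi> ?r = (\<Sum>b\<in>F. co b ?r * \<phi> (w b))" .
        have sum_scale: "(\<Sum>b\<in>F. scale (h b) u) = scale (\<Sum>b\<in>F. h b) u" for h :: "nat => 'k" and u :: "'q \<Rightarrow>\<^sub>0 'k"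
          by (rule poly_mapping_eqI) (simp add: lookup_sum sum_distrib_right)
        show ?case by (simp add: eq sum_scale sum_distrib_left mult.left_commute mult.commute)
      qed (simp_all add: sum.distrib)
      finally show ?thesis .
    qed
    moreover obtain f where f: "f \<in> carrier P" "r = p.qt f" using r by (auto simp: p.carrier_quotient)
    moreover have "(\<Oplus>\<^bsub>a.qr\<^esub>b\<in>F. a.sc (\<phi> (w b)) \<otimes>\<^bsub>a.qr\<^esub> Tq (co b) r) =
      (\<Oplus>\<^bsub>a.qr\<^esub>b\<in>F. a.sc (\<phi> (w b)) \<otimes>\<^bsub>a.qr\<^esub> a.qt (T (?\<theta> (co b)) f))"
      by (rule Q.finsum_cong'[OF refl]) (use f in "auto simp: Tc")
    ultimately show "Tq \<phi> r = (\<Oplus>\<^bsub>a.qr\<^esub>b\<in>F. a.sc (\<phi> (w b)) \<otimes>\<^bsub>a.qr\<^esub> Tq (co b) r)"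
      by (simp add: Tq_qt[OF \<phi>])
  qed
qed

lemma corner_quotient:
  assumes "augmented_algebra p.qr p.sc V (\<lambda>v r. eps v (p.rep r))"
    and "augmented_algebra a.qr a.sc VA (\<lambda>v r. epsA v (a.rep r))"
    and eps: "!!v f. v \<in> V ==> f \<in> carrier P ==> eps v (p.rep (p.qt f)) = eps v f"
    and epsA: "!!v f. v \<in> VA ==> f \<in> carrier A ==> epsA v (a.rep (a.qt f)) = epsA v f"
    and j: "!!v. v \<in> VA ==> j v \<in> V" "!!v f. v \<in> VA ==> f \<in> carrier P ==> eps (j v) f = epsA v (\<pi> f)"
  shows "corner p.qr p.sc V (\<lambda>v r. eps v (p.rep r)) a.qr a.sc VA (\<lambda>v r. epsA v (a.rep r))
    \<iota>q \<pi>q j (a.qt e) (p.qt ` C)"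
proof (intro corner.intro assms(1,2) corner_axioms.intro)
  fix x y c assume "x \<in> carrier a.qr"
  then obtain x' where x: "x' \<in> carrier A" "x = a.qt x'" by (auto simp: a.carrier_quotient)
  show "\<iota>q x \<in> carrier p.qr" using x by (simp add: iq_qt)
  show "\<iota>q (a.sc c \<otimes>\<^bsub>a.qr\<^esub> x) = p.sc c \<otimes>\<^bsub>p.qr\<^esub> \<iota>q x"
    using x by (simp add: a.sc_mult_qt p.sc_mult_qt iq_qt iota_scale)
  show "\<pi>q (\<iota>q x) = x" using x by (simp add: iq_qt piq_qt)
  assume "y \<in> carrier a.qr"
  then obtain y' where y: "y' \<in> carrier A" "y = a.qt y'" by (auto simp: a.carrier_quotient)
  show "\<iota>q (x \<oplus>\<^bsub>a.qr\<^esub> y) = \<iota>q x \<oplus>\<^bsub>p.qr\<^esub> \<iota>q y"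
    using x y by (simp add: a.qt_add p.qt_add iq_qt iota_add)
  show "\<iota>q (x \<otimes>\<^bsub>a.qr\<^esub> y) = \<iota>q x \<otimes>\<^bsub>p.qr\<^esub> \<iota>q y"
    using x y by (simp add: a.qt_mult p.qt_mult iq_qt iota_mult)
next
  fix r s assume "r \<in> carrier p.qr"
  then obtain f where f: "f \<in> carrier P" "r = p.qt f" by (auto simp: p.carrier_quotient)
  show "\<pi>q r \<in> carrier a.qr" using f by (simp add: piq_qt)
  assume "s \<in> carrier p.qr"
  then obtain g where g: "g \<in> carrier P" "s = p.qt g" by (auto simp: p.carrier_quotient)
  show "\<pi>q (r \<oplus>\<^bsub>p.qr\<^esub> s) = \<pi>q r \<oplus>\<^bsub>a.qr\<^esub> \<pi>q s"
    using f g by (simp add: a.qt_add p.qt_add piq_qt pi_add)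
  show "\<pi>q (r \<otimes>\<^bsub>p.qr\<^esub> s) = \<pi>q r \<otimes>\<^bsub>a.qr\<^esub> \<pi>q s"
    using f g by (simp add: a.qt_mult p.qt_mult piq_qt pi_mult)
next
  fix v r assume v: "v \<in> VA" and "r \<in> carrier p.qr"
  then obtain f where f: "f \<in> carrier P" "r = p.qt f" by (auto simp: p.carrier_quotient)
  show "eps (j v) (p.rep r) = epsA v (a.rep (\<pi>q r))" using f v j by (simp add: piq_qt eps epsA)
next
  show "p.qt ` C \<subseteq> carrier p.qr" using C_closed by auto
  show "\<exists>T. suffix_map p.qr p.sc a.qr a.sc \<iota>q \<pi>q (a.qt e) (p.qt ` C) T" using suffix_map_quotient by blast
qed (use j in simp_all)

end

text \<open>
  Basis elements of \<open>P\<close> are of three kinds: those of \<open>A\<close>, products \<open>cat x t\<close> of \<open>x \<in> XX\<close> not ending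
  with an arrow of \<open>A\<close> and \<open>t\<close> of \<open>A\<close>, and the elements of \<open>Z\<close>, which do not end in the quiver of \<open>A\<close>.
\<close>

locale split_corner = p: based_quotient P S I + a: based_quotient A SA IA
  for P :: "('p \<Rightarrow>\<^sub>0 'k::field) ring" and S I and A :: "('q \<Rightarrow>\<^sub>0 'k) ring" and SA IA +
  fixes \<iota> :: "('q \<Rightarrow>\<^sub>0 'k) => ('p \<Rightarrow>\<^sub>0 'k)" and \<pi> :: "('p \<Rightarrow>\<^sub>0 'k) => ('q \<Rightarrow>\<^sub>0 'k)"
    and e :: "'q \<Rightarrow>\<^sub>0 'k" and rr :: "'p => ('p \<Rightarrow>\<^sub>0 'k)" and gg :: "'p => ('q \<Rightarrow>\<^sub>0 'k)" and G C :: "('p \<Rightarrow>\<^sub>0 'k) set"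
    and jj :: "'q => 'p" and XX Z :: "'p set" and TT :: "'q set" and cat :: "'p => 'q => 'p" and UU UU' :: "'p set" and v :: "'p \<Rightarrow>\<^sub>0 'k"
  assumes iota_closed [simp]: "x \<in> carrier A ==> \<iota> x \<in> carrier P"
    and iota_add: "\<iota> (x + y) = \<iota> x + \<iota> y" and iota_scale: "\<iota> (scale c x) = scale c (\<iota> x)"
    and iota_mult: "x \<in> carrier A ==> y \<in> carrier A ==> \<iota> (x \<otimes>\<^bsub>A\<^esub> y) = \<iota> x \<otimes>\<^bsub>P\<^esub> \<iota> y"
    and pi_closed [simp]: "f \<in> carrier P ==> \<pi> f \<in> carrier A"
    and pi_add: "\<pi> (f + g) = \<pi> f + \<pi> g" and pi_scale: "\<pi> (scale c f) = scale c (\<pi> f)"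
    and pi_mult: "f \<in> carrier P ==> g \<in> carrier P ==> \<pi> (f \<otimes>\<^bsub>P\<^esub> g) = \<pi> f \<otimes>\<^bsub>A\<^esub> \<pi> g"
    and pi_iota [simp]: "x \<in> carrier A ==> \<pi> (\<iota> x) = x"
    and pi_keys: "[|f \<in> carrier P; \<pi> f = 0; q \<in> keys f|] ==> \<pi> (basis q) = 0"
    and e_closed: "e \<in> carrier A"
    and iota_basis: "t \<in> SA ==> \<iota> (basis t) = basis (jj t)"
    and kinds: "q \<in> S ==> (\<exists>t\<in>SA. q = jj t) \<or> (\<exists>x\<in>XX. \<exists>t\<in>TT. q = cat x t) \<or> q \<in> Z"
    and XX: "XX \<subseteq> S" and TT: "TT \<subseteq> SA"
    and rg_jj: "t \<in> SA ==> rr (jj t) = \<iota> \<one>\<^bsub>A\<^esub> \<and> gg (jj t) = basis t"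
    and rg_cat: "w \<in> XX ==> t \<in> TT ==> rr (cat w t) = basis w \<and> gg (cat w t) = basis t"
    and rg_Z: "z \<in> Z ==> rr z = 0 \<and> gg z = 0"
    and basis_cat: "w \<in> XX ==> t \<in> TT ==> basis (cat w t) = basis w \<otimes>\<^bsub>P\<^esub> \<iota> (basis t)"
    and SA_mult: "t \<in> SA ==> s \<in> SA ==> basis t \<otimes>\<^bsub>A\<^esub> basis s = 0 \<or> (\<exists>r\<in>SA. basis t \<otimes>\<^bsub>A\<^esub> basis s = basis r)"
    and TT_mult: "t \<in> TT ==> s \<in> SA ==> basis t \<otimes>\<^bsub>A\<^esub> basis s = 0 \<or> (\<exists>r\<in>TT. basis t \<otimes>\<^bsub>A\<^esub> basis s = basis r)"
    and XX_mult: "q \<in> S ==> w \<in> XX ==> basis q \<otimes>\<^bsub>P\<^esub> basis w = 0 \<or> (\<exists>y\<in>XX. basis q \<otimes>\<^bsub>P\<^esub> basis w = basis y)"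
    and Z_mult: "q \<in> S ==> z \<in> Z ==> z \<in> S ==> basis q \<otimes>\<^bsub>P\<^esub> basis z = 0 \<or> (\<exists>y\<in>Z. basis q \<otimes>\<^bsub>P\<^esub> basis z = basis y)"
    and Z_iota: "z \<in> Z ==> z \<in> S ==> t \<in> SA ==> basis z \<otimes>\<^bsub>P\<^esub> \<iota> (basis t) = 0"
    and I_gen: "I = Idl\<^bsub>P\<^esub> (\<iota> ` IA \<union> G)"
    and UU: "UU \<subseteq> S" "!!q. q \<in> UU ==> gg q = 0 \<or> gg q = e"
    and C: "!!f. f \<in> C ==> keys f \<subseteq> UU"
    and UU': "UU' \<subseteq> UU" "!!q. q \<in> UU' ==> \<pi> (basis q) = 0"
      "!!q. q \<in> UU' ==> basis q \<otimes>\<^bsub>P\<^esub> v = 0 \<and> gg q = 0 \<or> basis q \<otimes>\<^bsub>P\<^esub> v = rr q \<and> gg q = e"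
    and v: "v \<in> carrier P"
    and G: "!!g. g \<in> G ==> keys g \<subseteq> UU'"
begin

lemma linear_on_zero: "linear_on (carrier P) \<theta> ==> \<theta> 0 = 0"
  unfolding linear_on_def using p.zero_in_carrier by (metis mult_zero_left scale_simps(6))

lemma rg_closed: "q \<in> S ==> rr q \<in> carrier P \<and> gg q \<in> carrier A"
  using kinds[of q] rg_jj rg_cat rg_Z XX TT by (auto simp: subset_iff)

lemma mult_zero: "f \<in> carrier P ==> 0 \<otimes>\<^bsub>P\<^esub> f = 0" "f \<in> carrier P ==> f \<otimes>\<^bsub>P\<^esub> 0 = 0"
  "x \<in> carrier A ==> 0 \<otimes>\<^bsub>A\<^esub> x = 0" "x \<in> carrier A ==> x \<otimes>\<^bsub>A\<^esub> 0 = 0"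
  using p.l_null[of f] p.r_null[of f] a.l_null[of x] a.r_null[of x] by (simp_all add: p.zero_eq a.zero_eq)

lemma iota_zero: "\<iota> 0 = 0" and pi_zero: "\<pi> 0 = 0" using iota_scale[of 0 0] pi_scale[of 0 0] by simp_all

lemma T_basis: "tensor_map rr gg \<theta> (basis q) = scale (\<theta> (rr q)) (gg q)" by simp

lemma Z_iota': "x \<in> carrier A ==> z \<in> Z ==> z \<in> S ==> basis z \<otimes>\<^bsub>P\<^esub> \<iota> x = 0"
proof (induction x rule: a.based_induct)
  case (add f g)
  then show ?case using p.r_distr[of "\<iota> f" "\<iota> g" "basis z"] by (simp add: iota_add p.add_eq)
next
  case (single q c)
  have "basis z \<otimes>\<^bsub>P\<^esub> \<iota> (scale c (basis q)) = scale c (basis z \<otimes>\<^bsub>P\<^esub> \<iota> (basis q))"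
    using single by (simp only: iota_scale p.scale_mult_right p.single_closed a.single_closed iota_closed)
  then have "basis z \<otimes>\<^bsub>P\<^esub> \<iota> (scale c (basis q)) = 0" using Z_iota[OF single(2,3,1)] by simp
  then show ?case by simp
qed (simp_all add: iota_zero mult_zero)

lemma T_right_basis:
  assumes \<theta>: "linear_on (carrier P) \<theta>" and q: "q \<in> S" and s: "s \<in> SA"
  shows "tensor_map rr gg \<theta> (basis q \<otimes>\<^bsub>P\<^esub> \<iota> (basis s)) = tensor_map rr gg \<theta> (basis q) \<otimes>\<^bsub>A\<^esub> basis s"
proof -
  have s': "basis s \<in> carrier A" using s by simp
  from kinds[OF q] consider t where "t \<in> SA" "q = jj t" | x t where "x \<in> XX" "t \<in> TT" "q = cat x t" | "q \<in> Z" by blast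
  then show ?thesis
  proof cases
    case 1
    have t': "basis t \<in> carrier A" using 1 by simp
    have eq: "basis q \<otimes>\<^bsub>P\<^esub> \<iota> (basis s) = \<iota> (basis t \<otimes>\<^bsub>A\<^esub> basis s)"
      using 1 t' s' by (simp only: iota_basis[symmetric] iota_mult)
    have r: "tensor_map rr gg \<theta> (basis q) \<otimes>\<^bsub>A\<^esub> basis s = scale (\<theta> (\<iota> \<one>\<^bsub>A\<^esub>)) (basis t \<otimes>\<^bsub>A\<^esub> basis s)"
      unfolding T_basis using 1 rg_jj[OF 1(1)] by (simp only: a.scale_mult_left[OF t' s'])
    from SA_mult[OF 1(1) s] show ?thesis
    proof
      assume "basis t \<otimes>\<^bsub>A\<^esub> basis s = 0"
      then show ?thesis unfolding eq r by (simp add: iota_zero)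
    next
      assume "\<exists>u\<in>SA. basis t \<otimes>\<^bsub>A\<^esub> basis s = basis u"
      then obtain u where u: "u \<in> SA" "basis t \<otimes>\<^bsub>A\<^esub> basis s = basis u" by blast
      show ?thesis unfolding eq r u(2) iota_basis[OF u(1)] using rg_jj[OF u(1)] by simp
    qed
  next
    case 2
    have t': "basis t \<in> carrier A" and x': "basis x \<in> carrier P" using 2 XX TT by auto
    have eq: "basis q \<otimes>\<^bsub>P\<^esub> \<iota> (basis s) = basis x \<otimes>\<^bsub>P\<^esub> \<iota> (basis t \<otimes>\<^bsub>A\<^esub> basis s)"
      unfolding 2(3) basis_cat[OF 2(1,2)] using t' x' s' by (simp only: iota_mult p.m_assoc iota_closed)
    have r: "tensor_map rr gg \<theta> (basis q) \<otimes>\<^bsub>A\<^esub> basis s = scale (\<theta> (basis x)) (basis t \<otimes>\<^bsub>A\<^esub> basis s)"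
      unfolding T_basis using 2 rg_cat[OF 2(1,2)] by (simp only: a.scale_mult_left[OF t' s'])
    from TT_mult[OF 2(2) s] show ?thesis
    proof
      assume "basis t \<otimes>\<^bsub>A\<^esub> basis s = 0"
      then show ?thesis unfolding eq r using x' by (simp add: iota_zero mult_zero)
    next
      assume "\<exists>u\<in>TT. basis t \<otimes>\<^bsub>A\<^esub> basis s = basis u"
      then obtain u where u: "u \<in> TT" "basis t \<otimes>\<^bsub>A\<^esub> basis s = basis u" by blast
      show ?thesis unfolding eq r u(2) basis_cat[OF 2(1) u(1), symmetric] using rg_cat[OF 2(1) u(1)] by simp
    qed
  next
    case 3
    then show ?thesis unfolding Z_iota[OF 3 q s] T_basis using rg_Z[OF 3] s' by (simp add: mult_zero)
  qed
qed

text \<open>A basis element coming from \<open>A\<close> is not killed by \<open>\<pi>\<close>. For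
  \<open>cat x t\<close>, left multiplication acts on \<open>x\<close> alone and keeps it in
  \<open>XX\<close> or gives zero, so the final segment \<open>t\<close> is unchanged; elements of
  \<open>Z\<close> stay in \<open>Z\<close> or vanish.\<close>

lemma T_ker_basis:
  assumes \<theta>: "linear_on (carrier P) \<theta>" and q: "q \<in> S" and s: "s \<in> S" "\<pi> (basis s) = 0"
  shows "tensor_map rr gg \<theta> (basis q \<otimes>\<^bsub>P\<^esub> basis s) = tensor_map rr gg (\<lambda>f. \<theta> (basis q \<otimes>\<^bsub>P\<^esub> f)) (basis s)"
proof -
  have q': "basis q \<in> carrier P" using q by simp
  from kinds[OF s(1)] consider t where "t \<in> SA" "s = jj t" | x t where "x \<in> XX" "t \<in> TT" "s = cat x t" | "s \<in> Z" by blast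
  then show ?thesis
  proof cases
    case 1
    have "\<pi> (basis s) = basis t" using 1 pi_iota[of "basis t"] by (simp only: iota_basis[symmetric] a.single_closed)
    then have "(basis t :: 'q \<Rightarrow>\<^sub>0 'k) = 0" using s(2) by metis
    then show ?thesis by (metis lookup_single_eq lookup_zero zero_neq_one)
  next
    case 2
    have t': "basis t \<in> carrier A" and x': "basis x \<in> carrier P" using 2 XX TT by auto
    have eq: "basis q \<otimes>\<^bsub>P\<^esub> basis s = (basis q \<otimes>\<^bsub>P\<^esub> basis x) \<otimes>\<^bsub>P\<^esub> \<iota> (basis t)"
      unfolding 2(3) basis_cat[OF 2(1,2)] using t' x' q' by (simp only: p.m_assoc iota_closed)
    have r: "tensor_map rr gg (\<lambda>f. \<theta> (basis q \<otimes>\<^bsub>P\<^esub> f)) (basis s) = scale (\<theta> (basis q \<otimes>\<^bsub>P\<^esub> basis x)) (basis t)"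
      unfolding T_basis using 2 rg_cat[OF 2(1,2)] by simp
    from XX_mult[OF q 2(1)] show ?thesis
    proof
      assume z: "basis q \<otimes>\<^bsub>P\<^esub> basis x = 0"
      show ?thesis unfolding eq r z using t' linear_on_zero[OF \<theta>] by (simp add: mult_zero)
    next
      assume "\<exists>y\<in>XX. basis q \<otimes>\<^bsub>P\<^esub> basis x = basis y"
      then obtain y where y: "y \<in> XX" "basis q \<otimes>\<^bsub>P\<^esub> basis x = basis y" by blast
      show ?thesis unfolding eq r y(2) basis_cat[OF y(1) 2(2), symmetric] using rg_cat[OF y(1) 2(2)] by simp
    qed
  next
    case 3
    have "tensor_map rr gg \<theta> (basis q \<otimes>\<^bsub>P\<^esub> basis s) = 0" using Z_mult[OF q 3 s(1)] rg_Z by auto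
    then show ?thesis unfolding T_basis using rg_Z[OF 3] by simp
  qed
qed

lemma rr_gg_basis: "q \<in> S ==> rr q \<otimes>\<^bsub>P\<^esub> \<iota> (gg q) = basis q \<otimes>\<^bsub>P\<^esub> \<iota> \<one>\<^bsub>A\<^esub>"
proof -
  assume q: "q \<in> S"
  from kinds[OF q] consider t where "t \<in> SA" "q = jj t" | x t where "x \<in> XX" "t \<in> TT" "q = cat x t" | "q \<in> Z" by blast
  then show ?thesis
  proof cases
    case 1
    then have t': "basis t \<in> carrier A" by simp
    have "rr q \<otimes>\<^bsub>P\<^esub> \<iota> (gg q) = \<iota> (\<one>\<^bsub>A\<^esub> \<otimes>\<^bsub>A\<^esub> basis t)"
      using 1 rg_jj[OF 1(1)] t' by (simp only: iota_mult a.one_closed)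
    also have "\<dots> = \<iota> (basis t \<otimes>\<^bsub>A\<^esub> \<one>\<^bsub>A\<^esub>)" using t' by (simp only: a.l_one a.r_one)
    also have "\<dots> = basis q \<otimes>\<^bsub>P\<^esub> \<iota> \<one>\<^bsub>A\<^esub>" using 1 t' by (simp only: iota_mult iota_basis a.one_closed)
    finally show ?thesis .
  next
    case 2
    have t': "basis t \<in> carrier A" and x': "basis x \<in> carrier P" using 2 XX TT by auto
    have "basis q \<otimes>\<^bsub>P\<^esub> \<iota> \<one>\<^bsub>A\<^esub> = basis x \<otimes>\<^bsub>P\<^esub> \<iota> (basis t \<otimes>\<^bsub>A\<^esub> \<one>\<^bsub>A\<^esub>)"
      unfolding 2(3) basis_cat[OF 2(1,2)] using t' x' by (simp only: iota_mult p.m_assoc iota_closed a.one_closed)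
    then show ?thesis using t' rg_cat[OF 2(1,2)] 2(3) by (simp only: a.r_one)
  next
    case 3
    then show ?thesis using Z_iota'[OF a.one_closed 3 q] rg_Z[OF 3] by (simp add: mult_zero iota_zero)
  qed
qed

lemma T_UU:
  assumes "keys f \<subseteq> UU"
  shows "\<exists>c. tensor_map rr gg \<theta> f = scale c e" using assms
proof (induction rule: poly_mapping_single_induct)
  case zero
  then show ?case by (intro exI[of _ 0]) simp
next
  case (add f g)
  then obtain c d where "tensor_map rr gg \<theta> f = scale c e" "tensor_map rr gg \<theta> g = scale d e" by blast
  then show ?case by (intro exI[of _ "c + d"]) simp
next
  case (single q c)
  show ?case
  proof (cases "gg q = 0")
    case True
    then show ?thesis by (intro exI[of _ 0]) simp
  next
    case False
    then have "gg q = e" using UU(2)[OF single] by simp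
    then show ?thesis by (intro exI[of _ "c * \<theta> (rr q)"]) simp
  qed
qed

text \<open>On relations of the second quiver, taking the rest amounts to right multiplication by
  \<open>v\<close>, and the final segment is \<open>e\<close> or zero. Thus the value is the
  multiple of \<open>e\<close> with coefficient \<open>\<theta>\<close> of \<open>f\<close> times
  \<open>v\<close>, which vanishes when \<open>f\<close> lies in the ideal and
  \<open>\<theta>\<close> is zero there.\<close>

lemma T_UU':
  assumes \<theta>: "linear_on (carrier P) \<theta>" and "keys f \<subseteq> UU'"
  shows "tensor_map rr gg \<theta> f = scale (\<theta> (f \<otimes>\<^bsub>P\<^esub> v)) e" "\<pi> f = 0"
proof -
  have "f \<in> carrier P \<and> tensor_map rr gg \<theta> f = scale (\<theta> (f \<otimes>\<^bsub>P\<^esub> v)) e \<and> \<pi> f = 0"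
    using assms(2)
  proof (induction rule: poly_mapping_single_induct)
    case zero
    then show ?case using v linear_on_zero[OF \<theta>] by (simp add: mult_zero pi_zero)
  next
    case (add f g)
    have "(f + g) \<otimes>\<^bsub>P\<^esub> v = f \<otimes>\<^bsub>P\<^esub> v + g \<otimes>\<^bsub>P\<^esub> v" using add v p.l_distr[of f g v] by (simp add: p.add_eq)
    moreover have "\<theta> (f \<otimes>\<^bsub>P\<^esub> v + g \<otimes>\<^bsub>P\<^esub> v) = \<theta> (f \<otimes>\<^bsub>P\<^esub> v) + \<theta> (g \<otimes>\<^bsub>P\<^esub> v)"
      using \<theta> add v unfolding linear_on_def by simp
    ultimately show ?case using add by (simp add: pi_add)
  next
    case (single q c)
    have qS: "q \<in> S" using single UU'(1) UU(1) by auto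
    then have q': "basis q \<in> carrier P" by simp
    have b: "tensor_map rr gg \<theta> (basis q) = scale (\<theta> (basis q \<otimes>\<^bsub>P\<^esub> v)) e"
      unfolding T_basis using UU'(3)[OF single] linear_on_zero[OF \<theta>] by auto
    have lin: "\<theta> (scale c (basis q) \<otimes>\<^bsub>P\<^esub> v) = c * \<theta> (basis q \<otimes>\<^bsub>P\<^esub> v)"
      using \<theta> q' v unfolding linear_on_def by (simp only: p.scale_mult_left p.m_closed)
    have "tensor_map rr gg \<theta> (scale c (basis q)) = scale (\<theta> (scale c (basis q) \<otimes>\<^bsub>P\<^esub> v)) e"
      unfolding tensor_map_simps(3) b lin by simp
    moreover have "\<pi> (scale c (basis q)) = 0" unfolding pi_scale UU'(2)[OF single] by simp
    ultimately show ?case using qS by simp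
  qed
  then show "tensor_map rr gg \<theta> f = scale (\<theta> (f \<otimes>\<^bsub>P\<^esub> v)) e" "\<pi> f = 0" by auto
qed

lemma G_closed: "G \<subseteq> carrier P" using G UU'(1) UU(1) by (force simp: p.carrier_eq)

lemma based_corner: "based_corner P S I A SA IA \<iota> \<pi> e rr gg G C"
proof (intro based_corner.intro p.based_quotient_axioms a.based_quotient_axioms based_corner_axioms.intro)
  show "C \<subseteq> carrier P" using C UU(1) by (force simp: p.carrier_eq)
  show "G \<subseteq> carrier P" by (rule G_closed)
  show "\<exists>c. tensor_map rr gg \<theta> f = scale c e" if "f \<in> C" for f \<theta> by (rule T_UU[OF C[OF that]])
  fix g assume g: "g \<in> G"
  have lz: "linear_on (carrier P) (\<lambda>_. 0)" by (simp add: linear_on_def)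
  show "\<pi> g \<in> IA" using T_UU'(2)[OF lz G[OF g]] a.I_zero by simp
  fix \<theta> assume \<theta>: "linear_on (carrier P) \<theta>" "!!f. f \<in> I ==> \<theta> f = 0"
  have "\<iota> ` IA \<union> G \<subseteq> carrier P" using a.I_subset G_closed by auto
  then have "g \<in> I" using p.genideal_self I_gen g by blast
  then have "\<theta> (g \<otimes>\<^bsub>P\<^esub> v) = 0" using \<theta>(2) p.I_r_closed v by simp
  then show "tensor_map rr gg \<theta> g \<in> IA" using T_UU'(1)[OF \<theta>(1) G[OF g]] a.I_zero by simp
next
  fix \<theta> t assume t: "t \<in> SA"
  show "tensor_map rr gg \<theta> (\<iota> (basis t)) = scale (\<theta> (\<iota> \<one>\<^bsub>A\<^esub>)) (basis t)"
    unfolding iota_basis[OF t] T_basis using rg_jj[OF t] by simp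
qed (use rg_closed iota_add iota_scale iota_mult pi_add pi_scale pi_mult pi_keys e_closed T_right_basis T_ker_basis rr_gg_basis I_gen
      in "simp_all")

end

section \<open>Path algebras\<close>

context pre_digraph
begin

text \<open>Structural recursion on the arrow list replaces the vertex lists behind
  \<open>awalk\<close> and \<open>awlast\<close>.\<close>

fun path_end :: "'a => 'b list => 'a" where
  "path_end u [] = u"
| "path_end u (e # es) = path_end (head G e) es"

fun is_path :: "'a => 'b list => bool" where
  "is_path u [] \<longleftrightarrow> u \<in> verts G"
| "is_path u (e # es) \<longleftrightarrow> e \<in> arcs G \<and> tail G e = u \<and> is_path (head G e) es"

lemma path_end_append [simp]: "path_end u (p @ q) = path_end (path_end u p) q" by (induction p arbitrary: u) auto

lemma path_end_last: "p \<noteq> [] ==> path_end u p = head G (last p)" by (induction p arbitrary: u) auto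

lemma is_path_arcs: "is_path u p ==> set p \<subseteq> arcs G" by (induction p arbitrary: u) auto

end

context wf_digraph
begin

lemma is_path_start: "is_path u p ==> u \<in> verts G" by (cases p) auto

lemma is_path_end: "is_path u p ==> path_end u p \<in> verts G" by (induction p arbitrary: u) auto

lemma is_path_append [simp]: "is_path u (p @ q) \<longleftrightarrow> is_path u p \<and> is_path (path_end u p) q"
  by (induction p arbitrary: u) (auto dest: is_path_start)

lemma awalk_iff_is_path: "awalk u p w \<longleftrightarrow> is_path u p \<and> path_end u p = w"
proof (induction p arbitrary: u)
  case (Cons e p)
  from Cons[of "head G e"] show ?case by (auto simp: awalk_def dest: is_path_start)
qed (auto simp: awalk_def)

lemma awlast_eq_path_end: "is_path u p ==> awlast u p = path_end u p"
proof (induction p arbitrary: u)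
  case (Cons e p)
  moreover have "awalk_verts (head G e) p \<noteq> []" by (cases p) auto
  ultimately show ?case by simp
qed simp

lemma quiver_paths_eq: "quiver_paths G = {(u, p). is_path u p}" by (auto simp: quiver_paths_def awalk_iff_is_path)

text \<open>The sums over supports in \<open>path_mult\<close> hide its bilinearity, which is
  visible in this form.\<close>

lemma path_mult_eq:
  "path_mult G f g = linear_extension (\<lambda>p. linear_extension (\<lambda>q.
     if awlast (fst p) (snd p) = fst q then basis (fst p, snd p @ snd q) else 0) g) f"
proof -
  have "scale (lookup f p) (scale (lookup g q)
      (if awlast (fst p) (snd p) = fst q then basis (fst p, snd p @ snd q) else 0)) =
    (if awlast (fst p) (snd p) = fst q then single (fst p, snd p @ snd q)
       (lookup f p * lookup g q) else 0)" for p q by simp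
  then show ?thesis unfolding path_mult_def linear_extension_def scale_sum by simp
qed

lemma path_mult_basis:
  assumes "is_path u p"
  shows "path_mult G (basis (u, p)) (basis (w, q)) = (if path_end u p = w then basis (u, p @ q) else 0)"
  using awlast_eq_path_end[OF assms] by (simp add: path_mult_eq)

lemma linear_extension_add_fun: "linear_extension (\<lambda>p. h p + h' p) f = linear_extension h f + linear_extension h' f"
  by (simp add: linear_extension_def sum.distrib)

lemma linear_extension_scale_fun: "linear_extension (\<lambda>p. scale c (h p)) f = scale c (linear_extension h f)"
  by (simp add: linear_extension_def scale_sum mult.commute)

lemma path_mult_simps [simp]:
  "path_mult G (f + f') g = path_mult G f g + path_mult G f' g"
  "path_mult G f (g + g') = path_mult G f g + path_mult G f g'"
  "path_mult G (scale c f) g = scale c (path_mult G f g)"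
  "path_mult G f (scale c g) = scale c (path_mult G f g)"
  "path_mult G 0 g = 0" "path_mult G f 0 = 0" by (simp_all add: path_mult_eq linear_extension_add_fun linear_extension_scale_fun)
    (simp_all add: linear_extension_def)

lemma path_mult_single:
  assumes "is_path u p"
  shows "path_mult G (single (u, p) c) (single (w, q) d) =
    (if path_end u p = w then single (u, p @ q) (c * d) else 0)"
proof -
  have "path_mult G (scale c (basis (u, p))) (scale d (basis (w, q))) =
    (if path_end u p = w then scale (c * d) (basis (u, p @ q)) else 0)"
    unfolding path_mult_simps path_mult_basis[OF assms] by (simp add: mult.commute)
  then show ?thesis by simp
qed

lemma path_algebra_simps [simp]:
  "carrier (path_algebra G) = {f. keys f \<subseteq> quiver_paths G}"
  "f \<otimes>\<^bsub>path_algebra G\<^esub> g = path_mult G f g" "\<one>\<^bsub>path_algebra G\<^esub> = path_scalar G 1"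
  "\<zero>\<^bsub>path_algebra G\<^esub> = 0" "f \<oplus>\<^bsub>path_algebra G\<^esub> g = f + g" by (simp_all add: path_algebra_def)

end

context fin_digraph
begin

lemma path_mult_closed:
  assumes "keys f \<subseteq> quiver_paths G" "keys g \<subseteq> quiver_paths G"
  shows "keys (path_mult G f g) \<subseteq> quiver_paths G" using assms(1)
proof (induction rule: poly_mapping_single_induct)
  case (add f f')
  then show ?case using keys_add[of "path_mult G f g" "path_mult G f' g"] by auto
next
  case (single p c)
  show ?case using assms(2)
  proof (induction rule: poly_mapping_single_induct)
    case (add g g')
    then show ?case using keys_add[of "path_mult G (single p c) g" "path_mult G (single p c) g'"] by auto
  next
    case (single q d)
    then show ?case using \<open>p \<in> quiver_paths G\<close> by (cases p; cases q) (auto simp: quiver_paths_eq path_mult_single)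
  qed simp
qed simp

lemma path_mult_assoc:
  assumes "keys f \<subseteq> quiver_paths G" "keys g \<subseteq> quiver_paths G" "keys h \<subseteq> quiver_paths G"
  shows "path_mult G (path_mult G f g) h = path_mult G f (path_mult G g h)" using assms(1)
proof (induction rule: poly_mapping_single_induct)
  case (single p c)
  show ?case using assms(2)
  proof (induction rule: poly_mapping_single_induct)
    case (single q d)
    show ?case using assms(3)
    proof (induction rule: poly_mapping_single_induct)
      case (single r k)
      then show ?case using \<open>p \<in> quiver_paths G\<close> \<open>q \<in> quiver_paths G\<close>
        by (cases p; cases q; cases r) (auto simp: quiver_paths_eq path_mult_single mult.assoc)
    qed simp_all
  qed simp_all
qed simp_all

lemma path_mult_vertex_left:
  "path_mult G (path_scalar G 1) (single (u, p) c) = single (u, p) c" if "is_path u p"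
proof -
  have "path_mult G (\<Sum>v\<in>U. basis (v, [])) (single (u, p) c) =
    (if u \<in> U then single (u, p) c else 0)" if "U \<subseteq> verts G" for U
  proof -
    have "finite U" using that finite_verts finite_subset by blast
    then show ?thesis using that by (induction U) (auto simp: path_mult_single)
  qed
  from this[of "verts G"] show ?thesis using that is_path_start by (auto simp: path_scalar_def)
qed

lemma path_mult_vertex_right:
  "path_mult G (single (u, p) c) (path_scalar G 1) = single (u, p) c" if "is_path u p"
proof -
  have "path_mult G (single (u, p) c) (\<Sum>v\<in>U. basis (v, [])) =
    (if path_end u p \<in> U then single (u, p) c else 0)" if "U \<subseteq> verts G" for U
  proof -
    have "finite U" using that finite_verts finite_subset by blast
    then show ?thesis using that by (induction U) (auto simp: path_mult_single[OF \<open>is_path u p\<close>])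
  qed
  from this[of "verts G"] show ?thesis using that is_path_end by (auto simp: path_scalar_def)
qed

lemma path_scalar_closed: "keys (path_scalar G c) \<subseteq> quiver_paths G"
  unfolding path_scalar_def using keys_sum[of "\<lambda>v. single (v, []) c" "verts G"] by (auto simp: quiver_paths_eq split: if_splits)

lemma path_mult_one:
  assumes "keys f \<subseteq> quiver_paths G"
  shows "path_mult G (path_scalar G 1) f = f" "path_mult G f (path_scalar G 1) = f"
proof -
  have "path_mult G (path_scalar G 1) f = f \<and> path_mult G f (path_scalar G 1) = f" using assms
  proof (induction rule: poly_mapping_single_induct)
    case (single p c)
    then show ?case by (cases p) (auto simp: quiver_paths_eq path_mult_vertex_left path_mult_vertex_right)
  qed simp_all
  then show "path_mult G (path_scalar G 1) f = f" "path_mult G f (path_scalar G 1) = f" by auto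
qed

lemma ring_path_algebra: "ring (path_algebra G :: (('a, 'b) qpath \<Rightarrow>\<^sub>0 'k::field) ring)"
proof (rule ringI)
  show "abelian_group (path_algebra G :: (('a, 'b) qpath \<Rightarrow>\<^sub>0 'k) ring)"
  proof (rule abelian_groupI)
    fix f g :: "('a, 'b) qpath \<Rightarrow>\<^sub>0 'k"
    assume f: "f \<in> carrier (path_algebra G)"
    show "\<exists>g\<in>carrier (path_algebra G). g \<oplus>\<^bsub>path_algebra G\<^esub> f = \<zero>\<^bsub>path_algebra G\<^esub>"
      using f by (intro bexI[of _ "- f"]) auto
    assume "g \<in> carrier (path_algebra G)"
    then show "f \<oplus>\<^bsub>path_algebra G\<^esub> g \<in> carrier (path_algebra G)" using f keys_add[of f g] by auto
  qed (auto simp: add.assoc add.commute)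
  show "monoid (path_algebra G :: (('a, 'b) qpath \<Rightarrow>\<^sub>0 'k) ring)"
    by (rule monoidI) (auto simp: path_mult_assoc path_mult_one dest: subsetD[OF path_mult_closed] subsetD[OF path_scalar_closed])
qed auto

lemma based_path_algebra: "based_algebra (path_algebra G) (quiver_paths G)"
  by (intro based_algebra.intro ring_path_algebra based_algebra_axioms.intro) auto

lemma scale_path_scalar: "scale c (path_scalar G d) = path_scalar G (c * d)" by (simp add: path_scalar_def scale_sum)

text \<open>A trivial path factors only as the square of itself, so reading off its coefficient is
  multiplicative. These are the augmentations of the path algebra.\<close>

lemma eps_path_mult:
  assumes "keys f \<subseteq> quiver_paths G" "keys g \<subseteq> quiver_paths G"
  shows "lookup (path_mult G f g) (v, []) = lookup f (v, []) * lookup g (v, [])" using assms(1)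
proof (induction rule: poly_mapping_single_induct)
  case (single p c)
  show ?case using assms(2)
  proof (induction rule: poly_mapping_single_induct)
    case (single q d)
    then show ?case using \<open>p \<in> quiver_paths G\<close>
      by (cases p; cases q) (auto simp: quiver_paths_eq path_mult_single lookup_single when_def)
  qed (simp_all add: lookup_add algebra_simps)
qed (simp_all add: lookup_add algebra_simps)

end

section \<open>Bound quiver algebras as augmented algebras\<close>

context fin_digraph
begin

lemma keys_path_mult:
  assumes "keys f \<subseteq> quiver_paths G" "r \<in> keys (path_mult G f g)"
  shows "\<exists>u p q. r = (u, p @ q) \<and> (u, p) \<in> keys f \<and> (path_end u p, q) \<in> keys g"
proof -
  let ?U = "{r. \<exists>u p q. r = (u, p @ q) \<and> (u, p) \<in> keys f \<and> (path_end u p, q) \<in> keys g}"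
  have "keys (path_mult G f g) \<subseteq> ?U" unfolding path_mult_eq
  proof (intro keys_linear_extension)
    fix p q assume pq: "p \<in> keys f" "q \<in> keys g"
    have "awlast (fst p) (snd p) = path_end (fst p) (snd p)" using awlast_eq_path_end assms(1) pq(1) by (auto simp: quiver_paths_eq)
    then show "keys (if awlast (fst p) (snd p) = fst q then basis (fst p, snd p @ snd q) else 0 :: ('a, 'b) qpath \<Rightarrow>\<^sub>0 'c) \<subseteq> ?U"
      using pq by (cases p; cases q) auto
  qed
  then show ?thesis using assms(2) by blast
qed

text \<open>Stands in for the arrow ideal: membership can be read off coefficients, and the
  augmentations at all vertices vanish on it.\<close>

definition no_trivial :: "(('a, 'b) qpath \<Rightarrow>\<^sub>0 'k::field) set" where
  "no_trivial = {f \<in> carrier (path_algebra G). \<forall>v\<in>verts G. lookup f (v, []) = 0}"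

lemma ideal_no_trivial: "ideal no_trivial (path_algebra G :: (('a, 'b) qpath \<Rightarrow>\<^sub>0 'k::field) ring)"
proof -
  interpret P: based_algebra "path_algebra G :: (('a, 'b) qpath \<Rightarrow>\<^sub>0 'k) ring" "quiver_paths G" by (rule based_path_algebra)
  let ?P = "path_algebra G :: (('a, 'b) qpath \<Rightarrow>\<^sub>0 'k) ring"
  show ?thesis
  proof (rule idealI[OF P.ring_axioms])
    show "subgroup no_trivial (add_monoid ?P)"
    proof (rule P.add.subgroupI)
      show "no_trivial \<noteq> {}" using P.zero_in_carrier by (auto simp: no_trivial_def intro!: exI[of _ 0])
      show "\<ominus>\<^bsub>?P\<^esub> f \<in> no_trivial" if "f \<in> no_trivial" for f :: "('a, 'b) qpath \<Rightarrow>\<^sub>0 'k"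
      proof -
        have "f \<in> carrier ?P" using that by (simp add: no_trivial_def)
        then show ?thesis using that P.a_inv_eq[of f] P.a_inv_closed[of f] by (simp add: no_trivial_def)
      qed
      show "f \<oplus>\<^bsub>?P\<^esub> g \<in> no_trivial" if "f \<in> no_trivial" "g \<in> no_trivial" for f g :: "('a, 'b) qpath \<Rightarrow>\<^sub>0 'k"
        using that P.plus_closed[of f g] by (simp add: no_trivial_def lookup_add)
    qed (auto simp: no_trivial_def)
    fix f g :: "('a, 'b) qpath \<Rightarrow>\<^sub>0 'k" assume fg: "f \<in> no_trivial" "g \<in> carrier ?P"
    then have "g \<otimes>\<^bsub>?P\<^esub> f \<in> carrier ?P" "f \<otimes>\<^bsub>?P\<^esub> g \<in> carrier ?P"
      using P.m_closed[of f g] P.m_closed[of g f] by (simp_all add: no_trivial_def)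
    then show "g \<otimes>\<^bsub>?P\<^esub> f \<in> no_trivial" "f \<otimes>\<^bsub>?P\<^esub> g \<in> no_trivial"
      using fg by (simp_all add: no_trivial_def eps_path_mult)
  qed
qed

section \<open>Long paths and nilpotence of the augmentation kernels\<close>

text \<open>Each pass through all vertices lengthens paths by at least one arrow: a factor from the
  kernel at \<open>x\<close> either contributes an arrow or a trivial path at a vertex other than
  \<open>x\<close>, and after a full pass no starting vertex is left for the paths that have not
  grown.\<close>

lemma kernel_products_long:
  fixes L :: nat
  assumes vs: "set vs = verts G"
    and f: "f \<in> kernel_products (path_algebra G) (\<lambda>v f. lookup f (v, [])) (concat (replicate L vs))"
    and r: "r \<in> keys f"
  shows "L \<le> length (snd r)"
proof -
  let ?kp = "\<lambda>ws. kernel_products (path_algebra G) (\<lambda>v f. lookup f (v, [])) ws :: (('a, 'b) qpath \<Rightarrow>\<^sub>0 'c) set"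
  \<comment> \<open>Invariant within a pass: paths that have not grown yet do not start at a vertex
    already processed. The list is worked off from its end, since \<open>kernel_products\<close>
    multiplies on the left.\<close>
  have step: "\<forall>(u, es)\<in>keys f. m < length es \<or> m = length es \<and> u \<notin> set ws"
    if IH: "\<forall>f\<in>?kp ws'. \<forall>(u, es)\<in>keys f. m \<le> length es"
      and "f \<in> ?kp (ws @ ws')" for m ws ws' f using that(2)
  proof (induction ws arbitrary: f)
    case Nil
    then show ?case using IH by fastforce
  next
    case (Cons x ws)
    then obtain s t where st: "f = path_mult G s t" "keys s \<subseteq> quiver_paths G"
      "lookup s (x, []) = 0" "t \<in> ?kp (ws @ ws')" by auto
    show ?case
    proof (intro ballI case_prodI2)
      fix r u es assume "r \<in> keys f" "r = (u, es)"
      then obtain p q where pq: "es = p @ q" "(u, p) \<in> keys s" "(path_end u p, q) \<in> keys t"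
        unfolding st(1) using keys_path_mult[OF st(2)] by blast
      from pq(3) have q: "m < length q \<or> m = length q \<and> path_end u p \<notin> set ws" using Cons.IH[OF st(4)] by blast
      then show "m < length es \<or> m = length es \<and> u \<notin> set (x # ws)" using pq(1,2) st(3) by (cases p) (auto simp: in_keys_iff)
    qed
  qed
  have start: "u \<in> verts G" if "f \<in> ?kp ws" "(u, es) \<in> keys f" for f ws u es
  proof -
    have "keys f \<subseteq> quiver_paths G" using that(1)
    proof (induction ws arbitrary: f)
      case Nil
      then show ?case using path_scalar_closed by auto
    next
      case (Cons x ws)
      then show ?case using path_mult_closed by fastforce
    qed
    then show ?thesis using that(2) by (auto simp: quiver_paths_eq dest: is_path_start)
  qed
  have "\<forall>f\<in>?kp (concat (replicate m vs)). \<forall>(u, es)\<in>keys f. m \<le> length es" for m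
  proof (induction m)
    case (Suc m)
    show ?case
    proof (intro ballI, clarify)
      fix f u es assume f: "f \<in> ?kp (concat (replicate (Suc m) vs))" and k: "(u, es) \<in> keys f"
      have "m < length es \<or> m = length es \<and> u \<notin> set vs" using step[OF Suc, of f vs] f k by auto
      then show "Suc m \<le> length es" using start[OF f k] vs by auto
    qed
  qed simp
  from this[of L] f r show ?thesis by (cases r) auto
qed

text \<open>Only finitely many paths are shorter than \<open>L\<close>, which gives finite
  dimension; \<open>L\<close> passes through the vertices give the list of augmentations whose
  kernels multiply to zero.\<close>

lemma augmented_path_quotient:
  fixes I :: "(('a, 'b) qpath \<Rightarrow>\<^sub>0 'k::field) set"
  assumes I: "ideal I (path_algebra G)"
    and long: "!!p. p \<in> quiver_paths G ==> L \<le> length (snd p) ==> basis p \<in> I"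
    and triv: "I \<subseteq> no_trivial"
  shows "augmented_algebra (path_algebra G Quot I) (based_quotient.sc (path_algebra G) I) (verts G)
      (\<lambda>v r. lookup (based_quotient.rep (path_algebra G) I r) (v, []))"
    and "!!v f. v \<in> verts G ==> f \<in> carrier (path_algebra G) ==>
      lookup (based_quotient.rep (path_algebra G) I (I +>\<^bsub>path_algebra G\<^esub> f)) (v, []) = lookup f (v, [])"
proof -
  interpret based_quotient "path_algebra G :: (('a, 'b) qpath \<Rightarrow>\<^sub>0 'k) ring" "quiver_paths G" I
    by (intro based_quotient.intro based_path_algebra I)
  let ?Y = "{p \<in> quiver_paths G. length (snd p) < L}"
  have "?Y \<subseteq> verts G \<times> {p. set p \<subseteq> arcs G \<and> length p \<le> L}"
    using is_path_arcs by (auto simp: quiver_paths_eq dest: is_path_start)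
  moreover have "finite (verts G \<times> {p. set p \<subseteq> arcs G \<and> length p \<le> L})"
    by (intro finite_cartesian_product finite_lists_length_le) auto
  ultimately have fin: "finite ?Y" by (rule finite_subset)
  obtain vs where vs: "set vs = verts G" using finite_list[OF finite_verts] by blast
  have kp: "kernel_products (path_algebra G) (\<lambda>v f. lookup f (v, [])) (concat (replicate L vs)) \<subseteq> I"
  proof
    fix f :: "('a, 'b) qpath \<Rightarrow>\<^sub>0 'k"
    assume f: "f \<in> kernel_products (path_algebra G) (\<lambda>v f. lookup f (v, [])) (concat (replicate L vs))"
    have "f \<in> kernel_products (path_algebra G) (\<lambda>v f. lookup f (v, [])) ws ==> f \<in> carrier (path_algebra G)" for ws and f :: "('a, 'b) qpath \<Rightarrow>\<^sub>0 'k"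
    proof (induction ws arbitrary: f)
      case Nil
      then show ?case using path_scalar_closed by auto
    next
      case (Cons x ws)
      then show ?case using path_mult_closed by fastforce
    qed
    then have "keys f \<subseteq> {p \<in> quiver_paths G. L \<le> length (snd p)}" using kernel_products_long[OF vs f] f by auto
    then show "f \<in> I"
    proof (induction rule: poly_mapping_single_induct)
      case (single p c)
      then show ?case using I_scale[OF long, of p c] by simp
    qed (simp_all add: I_zero I_add)
  qed
  have one: "lookup (path_scalar G (1 :: 'k)) (v, []) = 1" if "v \<in> verts G" for v
    using that by (auto simp: path_scalar_def lookup_sum lookup_single when_def sum.delta)
  have "set (concat (replicate L vs)) \<subseteq> verts G" using vs by auto
  with kp have nil: "\<exists>xs. set xs \<subseteq> verts G \<and> kernel_products (path_algebra G) (\<lambda>v f. lookup f (v, [])) xs \<subseteq> I" by blast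
  note * = augmented_quotient[of ?Y "verts G" "\<lambda>v f. lookup f (v, [])", OF fin]
  show "augmented_algebra (path_algebra G Quot I) sc (verts G) (\<lambda>v r. lookup (rep r) (v, []))"
    by (rule *) (use long triv one nil in "auto simp: lookup_add eps_path_mult no_trivial_def")
  show "lookup (rep (qt f)) (v, []) = lookup f (v, [])"
    if "v \<in> verts G" "f \<in> carrier (path_algebra G)" for v f
    by (rule *) (use long triv one nil that in "auto simp: lookup_add eps_path_mult no_trivial_def")
qed

text \<open>Powers of ideals acquire their new factor on the right, so the last arrow is split
  off.\<close>

lemma basis_in_arrow_power:
  assumes "(u, p) \<in> quiver_paths G" "n \<le> length p"
  shows "basis (u, p) \<in> (arrow_ideal G :: (('a, 'b) qpath \<Rightarrow>\<^sub>0 'k::field) set) [^]\<^bsub>ideals_set (path_algebra G)\<^esub> n"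
  using assms
proof (induction n arbitrary: p)
  case 0
  then show ?case by (simp add: ideals_set_def nat_pow_def)
next
  case (Suc n)
  interpret P: based_algebra "path_algebra G :: (('a, 'b) qpath \<Rightarrow>\<^sub>0 'k) ring" "quiver_paths G" by (rule based_path_algebra)
  let ?arrows = "(\<lambda>e. basis (tail G e, [e])) ` arcs G :: (('a, 'b) qpath \<Rightarrow>\<^sub>0 'k) set"
  obtain p' e where p: "p = p' @ [e]" using Suc.prems(2) by (cases p rule: rev_cases) auto
  have path: "is_path u p'" "e \<in> arcs G" "tail G e = path_end u p'" using Suc.prems(1) unfolding p by (auto simp: quiver_paths_eq)
  have 1: "basis (u, p') \<in> (arrow_ideal G :: (('a, 'b) qpath \<Rightarrow>\<^sub>0 'k) set) [^]\<^bsub>ideals_set (path_algebra G)\<^esub> n"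
    using Suc path p by (auto simp: quiver_paths_eq)
  have "?arrows \<subseteq> carrier (path_algebra G)" by (auto simp: quiver_paths_eq)
  then have 2: "basis (tail G e, [e]) \<in> (arrow_ideal G :: (('a, 'b) qpath \<Rightarrow>\<^sub>0 'k) set)"
    unfolding arrow_ideal_def using P.genideal_self path(2) by blast
  have "basis (u, p') \<otimes>\<^bsub>path_algebra G\<^esub> basis (tail G e, [e]) \<in>
      ideal_prod (path_algebra G) ((arrow_ideal G :: (('a, 'b) qpath \<Rightarrow>\<^sub>0 'k) set) [^]\<^bsub>ideals_set (path_algebra G)\<^esub> n) (arrow_ideal G)"
    by (rule ideal_prod.prod[OF 1 2])
  then show ?case using path by (simp add: p path_mult_single ideals_set_def nat_pow_def)
qed

lemma arrow_square_no_trivial: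
  "(arrow_ideal G :: (('a, 'b) qpath \<Rightarrow>\<^sub>0 'k::field) set) [^]\<^bsub>ideals_set (path_algebra G)\<^esub> (2 :: nat) \<subseteq> no_trivial"
proof -
  interpret P: based_algebra "path_algebra G :: (('a, 'b) qpath \<Rightarrow>\<^sub>0 'k) ring" "quiver_paths G" by (rule based_path_algebra)
  interpret N: ideal no_trivial "path_algebra G :: (('a, 'b) qpath \<Rightarrow>\<^sub>0 'k) ring" by (rule ideal_no_trivial)
  let ?J = "arrow_ideal G :: (('a, 'b) qpath \<Rightarrow>\<^sub>0 'k) set"
  let ?P = "path_algebra G :: (('a, 'b) qpath \<Rightarrow>\<^sub>0 'k) ring"
  have J: "?J \<subseteq> no_trivial" unfolding arrow_ideal_def
    by (rule P.genideal_minimal[OF ideal_no_trivial]) (auto simp: no_trivial_def quiver_paths_eq lookup_single when_def)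
  have prod: "ideal_prod ?P K ?J \<subseteq> no_trivial" if "K \<subseteq> carrier ?P" for K
  proof
    fix f assume "f \<in> ideal_prod ?P K ?J"
    then show "f \<in> no_trivial"
    proof (induction rule: ideal_prod.induct)
      case (prod i j)
      then show ?case using that J by (intro N.I_l_closed) auto
    next
      case (sum f g)
      then show ?case using N.a_closed by blast
    qed
  qed
  \<comment> \<open>The zeroth power is the whole algebra, so the square unfolds to a double product
    that starts from the carrier.\<close>
  have "ideal_prod ?P (carrier ?P) ?J \<subseteq> carrier ?P" using prod[OF subset_refl] N.Icarr by blast
  from prod[OF this] show ?thesis by (simp add: ideals_set_def nat_pow_def numeral_2_eq_2 del: path_algebra_simps)
qed

end

text \<open>What is retained of admissibility: relations involve no trivial path, and long paths are
  relations. For the gluing, the second property has to be derived from finite dimension.\<close>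

lemma bound_quiverD:
  fixes I :: "(('v, 'e) qpath \<Rightarrow>\<^sub>0 'k::field) set"
  assumes "bound_quiver Q I"
  obtains L where "fin_digraph Q" "ideal I (path_algebra Q)" "I \<subseteq> fin_digraph.no_trivial Q"
    "!!p. p \<in> quiver_paths Q ==> L \<le> length (snd p) ==> basis p \<in> I"
proof -
  have Q: "fin_digraph Q" and adm: "admissible_ideal Q I" using assms by (auto simp: bound_quiver_def)
  then obtain m where m: "arrow_ideal Q [^]\<^bsub>ideals_set (path_algebra Q)\<^esub> (m :: nat) \<subseteq> I" by (auto simp: admissible_ideal_def)
  show ?thesis
  proof (rule that[of m, OF Q])
    show "I \<subseteq> fin_digraph.no_trivial Q" using adm fin_digraph.arrow_square_no_trivial[OF Q] by (auto simp: admissible_ideal_def)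
    show "basis p \<in> I" if "p \<in> quiver_paths Q" "m \<le> length (snd p)" for p
      using fin_digraph.basis_in_arrow_power[OF Q, of "fst p" "snd p" m] that m by auto
  qed (use adm in "auto simp: admissible_ideal_def")
qed

section \<open>Quivers glued at a vertex\<close>

lemma path_algebra_map_eq:
  "path_algebra_map \<phi> \<psi> = linear_extension (\<lambda>p. basis (\<phi> (fst p), map \<psi> (snd p)))"
  by (simp add: fun_eq_iff path_algebra_map_def linear_extension_def)

text \<open>Both halves enter through injections on vertices and arrows, which makes the situation
  symmetric; \<open>gluing_quiver\<close>, with \<open>Inl a\<close> as the glued vertex, is
  not.\<close>

locale glued_quivers = q: fin_digraph Q + q1: fin_digraph Q1 + q2: fin_digraph Q2
  for Q :: "('u, 'g) pre_digraph" and Q1 :: "('v, 'e) pre_digraph" and Q2 :: "('w, 'f) pre_digraph" +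
  fixes \<phi>1 :: "'v => 'u" and \<psi>1 :: "'e => 'g" and a1 :: 'v
    and \<phi>2 :: "'w => 'u" and \<psi>2 :: "'f => 'g" and a2 :: 'w
  assumes inj: "inj_on \<phi>1 (verts Q1)" "inj_on \<psi>1 (arcs Q1)" "inj_on \<phi>2 (verts Q2)" "inj_on \<psi>2 (arcs Q2)"
    and ends1: "e \<in> arcs Q1 ==> tail Q (\<psi>1 e) = \<phi>1 (tail Q1 e) \<and> head Q (\<psi>1 e) = \<phi>1 (head Q1 e)"
    and ends2: "f \<in> arcs Q2 ==> tail Q (\<psi>2 f) = \<phi>2 (tail Q2 f) \<and> head Q (\<psi>2 f) = \<phi>2 (head Q2 f)"
    and verts_Q: "verts Q = \<phi>1 ` verts Q1 \<union> \<phi>2 ` verts Q2"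
    and arcs_Q: "arcs Q = \<psi>1 ` arcs Q1 \<union> \<psi>2 ` arcs Q2"
    and verts_int: "\<phi>1 ` verts Q1 \<inter> \<phi>2 ` verts Q2 = {\<phi>1 a1}"
    and arcs_int: "\<psi>1 ` arcs Q1 \<inter> \<psi>2 ` arcs Q2 = {}"
    and a1: "a1 \<in> verts Q1" and a2: "a2 \<in> verts Q2" and a_eq: "\<phi>1 a1 = \<phi>2 a2"
begin

lemma swap: "glued_quivers Q Q2 Q1 \<phi>2 \<psi>2 a2 \<phi>1 \<psi>1 a1"
  using inj ends1 ends2 verts_Q arcs_Q verts_int arcs_int a1 a2 a_eq by unfold_locales (auto simp: Int_commute Un_commute)

abbreviation "inA e \<equiv> e \<in> \<psi>1 ` arcs Q1"

definition "emb p = (\<phi>1 (fst p), map \<psi>1 (snd p))"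
definition "inn p \<longleftrightarrow> fst p \<in> \<phi>1 ` verts Q1 \<and> set (snd p) \<subseteq> \<psi>1 ` arcs Q1"
definition "unemb p = (inv_into (verts Q1) \<phi>1 (fst p), map (inv_into (arcs Q1) \<psi>1) (snd p))"

abbreviation emb_map :: "(('v, 'e) qpath \<Rightarrow>\<^sub>0 'k::field) => (('u, 'g) qpath \<Rightarrow>\<^sub>0 'k)"
  where "emb_map \<equiv> path_algebra_map \<phi>1 \<psi>1"

text \<open>Kills all paths that leave the first quiver. It is multiplicative because, by
  \<open>inn_append\<close>, a path lies in the first quiver iff both factors do.\<close>

definition retr :: "(('u, 'g) qpath \<Rightarrow>\<^sub>0 'k::field) => (('v, 'e) qpath \<Rightarrow>\<^sub>0 'k)"
  where "retr = linear_extension (\<lambda>p. if inn p then basis (unemb p) else 0)"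

lemma emb_map_simps [simp]:
  "emb_map 0 = 0" "emb_map (f + g) = emb_map f + emb_map g" "emb_map (scale c f) = scale c (emb_map f)"
  "emb_map (single p c) = single (emb p) c" by (simp_all add: path_algebra_map_eq emb_def)

lemma retr_simps [simp]:
  "retr 0 = 0" "retr (f + g) = retr f + retr g" "retr (scale c f) = scale c (retr f)"
  "retr (single p c) = (if inn p then single (unemb p) c else 0)" by (simp_all add: retr_def)

lemma emb_path:
  assumes "q1.is_path u p"
  shows "q.is_path (\<phi>1 u) (map \<psi>1 p)" "q.path_end (\<phi>1 u) (map \<psi>1 p) = \<phi>1 (q1.path_end u p)"
proof -
  have "q.is_path (\<phi>1 u) (map \<psi>1 p) \<and> q.path_end (\<phi>1 u) (map \<psi>1 p) = \<phi>1 (q1.path_end u p)" using assms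
    by (induction p arbitrary: u) (auto simp: verts_Q arcs_Q ends1)
  then show "q.is_path (\<phi>1 u) (map \<psi>1 p)" "q.path_end (\<phi>1 u) (map \<psi>1 p) = \<phi>1 (q1.path_end u p)" by auto
qed

lemma unemb_emb: "q1.is_path u p ==> unemb (emb (u, p)) = (u, p)"
proof -
  assume p: "q1.is_path u p"
  have "map (inv_into (arcs Q1) \<psi>1) (map \<psi>1 p) = p" using q1.is_path_arcs[OF p] inj(2) by (induction p) auto
  then show ?thesis using inj(1) q1.is_path_start[OF p] by (simp add: unemb_def emb_def)
qed

lemma inn_emb: "q1.is_path u p ==> inn (emb (u, p))" using q1.is_path_arcs[of u p] q1.is_path_start[of u p] by (auto simp: inn_def emb_def)

text \<open>\<open>inn\<close> constrains only the start vertex and the arrows; the vertices in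
  between follow from \<open>ends1\<close>, and injectivity on vertices makes consecutive arrows
  match in the first quiver.\<close>

lemma path_inn:
  assumes "q.is_path u p" "inn (u, p)"
  shows "\<exists>w r. q1.is_path w r \<and> (u, p) = emb (w, r)" using assms
proof (induction p arbitrary: u)
  case Nil
  then show ?case by (auto simp: inn_def emb_def intro: exI[of _ "[]"])
next
  case (Cons e p)
  then obtain e' where e: "e' \<in> arcs Q1" "e = \<psi>1 e'" by (auto simp: inn_def)
  have "inn (head Q e, p)" using Cons.prems e ends1[OF e(1)] by (auto simp: inn_def)
  moreover have "q.is_path (head Q e) p" using Cons.prems by simp
  ultimately obtain w r where wr: "q1.is_path w r" "(head Q e, p) = emb (w, r)" using Cons.IH by blast
  have "\<phi>1 w = \<phi>1 (head Q1 e')" using wr(2) e ends1[OF e(1)] by (simp add: emb_def)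
  then have "w = head Q1 e'" using inj(1) e q1.is_path_start[OF wr(1)] by (auto dest: inj_onD)
  then show ?case using e wr Cons.prems ends1[OF e(1)] by (intro exI[of _ "tail Q1 e'"] exI[of _ "e' # r"]) (auto simp: emb_def)
qed

lemma path_inn': "r \<in> quiver_paths Q ==> inn r ==> \<exists>w s. q1.is_path w s \<and> r = emb (w, s)"
  using path_inn by (cases r) (simp add: q.quiver_paths_eq)

lemma emb_eq_iff:
  "q1.is_path u p ==> q1.is_path w r ==> emb (u, p) = emb (w, r) \<longleftrightarrow> u = w \<and> p = r"
  using unemb_emb by (metis prod.inject)

lemma phi_eq_iff: "u \<in> verts Q1 ==> w \<in> verts Q1 ==> \<phi>1 u = \<phi>1 w \<longleftrightarrow> u = w"
  using inj(1) by (auto dest: inj_onD)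

text \<open>The vertex in the middle is not mentioned on the left; it belongs to the first quiver
  because a path inside that quiver ends there.\<close>

lemma inn_append: "q.is_path u (p @ r) ==> inn (u, p @ r) \<longleftrightarrow> inn (u, p) \<and> inn (q.path_end u p, r)"
proof -
  assume path: "q.is_path u (p @ r)"
  have "q.path_end u p \<in> \<phi>1 ` verts Q1" if i: "inn (u, p)"
  proof -
    have "q.is_path u p" using path by simp
    then obtain w s where "q1.is_path w s" "(u, p) = emb (w, s)" using path_inn i by blast
    then show ?thesis using emb_path(2)[of w s] q1.is_path_end[of w s] by (auto simp: emb_def)
  qed
  then show ?thesis by (auto simp: inn_def)
qed

text \<open>The two vertex sets meet in the glued vertex alone. This fact locates the places where
  paths change from one quiver to the other.\<close>

lemma outer_ends:
  assumes "e \<in> arcs Q" "\<not> inA e"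
  shows "tail Q e \<in> \<phi>1 ` verts Q1 \<longleftrightarrow> tail Q e = \<phi>1 a1" "head Q e \<in> \<phi>1 ` verts Q1 \<longleftrightarrow> head Q e = \<phi>1 a1"
proof -
  obtain f where "f \<in> arcs Q2" "e = \<psi>2 f" using assms arcs_Q by auto
  then have "tail Q e \<in> \<phi>2 ` verts Q2" "head Q e \<in> \<phi>2 ` verts Q2" using ends2[of f] by auto
  then show "tail Q e \<in> \<phi>1 ` verts Q1 \<longleftrightarrow> tail Q e = \<phi>1 a1" "head Q e \<in> \<phi>1 ` verts Q1 \<longleftrightarrow> head Q e = \<phi>1 a1"
    using verts_int a1 by blast+
qed

text \<open>Cut behind the last arrow outside the first quiver: the head of that arrow lies in the
  first quiver, hence is the glued vertex.\<close>

lemma split_suffix: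
  assumes p: "q.is_path u es" and fin: "q.path_end u es \<in> \<phi>1 ` verts Q1" and n: "\<not> inn (u, es)"
  shows "\<exists>xs r. es = xs @ map \<psi>1 r \<and> q1.is_path a1 r \<and> q.is_path u xs \<and> xs \<noteq> [] \<and> \<not> inA (last xs) \<and> q.path_end u xs = \<phi>1 a1"
proof -
  have "\<exists>e\<in>set es. \<not> inA e"
  proof (rule ccontr)
    assume "\<not> ?thesis"
    moreover have "u \<in> \<phi>1 ` verts Q1" using calculation p fin ends1 by (cases es) auto
    ultimately show False using n by (auto simp: inn_def)
  qed
  from split_list_last_prop[OF this] obtain ys e zs
    where es: "es = ys @ e # zs" "\<not> inA e" "\<forall>z\<in>set zs. inA z" by blast
  have e: "e \<in> arcs Q" and zs: "q.is_path (head Q e) zs" using p es(1) by auto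
  have "head Q e \<in> \<phi>1 ` verts Q1"
  proof (cases zs)
    case Nil
    then show ?thesis using fin es(1) by simp
  next
    case (Cons x xs)
    then obtain y where "y \<in> arcs Q1" "x = \<psi>1 y" using es(3) by auto
    then show ?thesis using zs Cons ends1[of y] q1.tail_in_verts[of y] by (metis image_eqI q.is_path.simps(2))
  qed
  then have h: "head Q e = \<phi>1 a1" using outer_ends(2)[OF e es(2)] by simp
  have "inn (head Q e, zs)" using es(3) h a1 by (auto simp: inn_def)
  then obtain w r where wr: "q1.is_path w r" "(head Q e, zs) = emb (w, r)" using path_inn[OF zs] by blast
  then have "w = a1" using h a1 q1.is_path_start[OF wr(1)] phi_eq_iff by (auto simp: emb_def)
  then show ?thesis using es wr p h by (intro exI[of _ "ys @ [e]"] exI[of _ r]) (auto simp: emb_def verts_Q a1)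
qed

lemma split_prefix:
  assumes p: "q.is_path u es" and start: "u \<in> \<phi>1 ` verts Q1" and n: "\<not> inn (u, es)"
  shows "\<exists>w r xs. es = map \<psi>1 r @ xs \<and> q1.is_path w r \<and> u = \<phi>1 w \<and> q1.path_end w r = a1 \<and> q.is_path (\<phi>1 a1) xs \<and> xs \<noteq> [] \<and> \<not> inA (hd xs)"
proof -
  have "\<exists>e\<in>set es. \<not> inA e" using n start by (auto simp: inn_def)
  from split_list_first_prop[OF this] obtain ys e zs
    where es: "es = ys @ e # zs" "\<not> inA e" "\<forall>z\<in>set ys. inA z" by blast
  have e: "e \<in> arcs Q" "tail Q e = q.path_end u ys" and ys: "q.is_path u ys" and zs: "q.is_path (tail Q e) (e # zs)" using p es(1) by auto
  have "inn (u, ys)" using es(3) start by (auto simp: inn_def)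
  then obtain w r where wr: "q1.is_path w r" "(u, ys) = emb (w, r)" using path_inn[OF ys] by blast
  have fin: "tail Q e = \<phi>1 (q1.path_end w r)" using emb_path(2)[OF wr(1)] wr(2) e(2) by (simp add: emb_def)
  then have t: "tail Q e = \<phi>1 a1" using outer_ends(1)[OF e(1) es(2)] q1.is_path_end[OF wr(1)] by simp
  then have "q1.path_end w r = a1" using fin phi_eq_iff a1 q1.is_path_end[OF wr(1)] by auto
  then show ?thesis using es wr zs t by (intro exI[of _ w] exI[of _ r] exI[of _ "e # zs"]) (auto simp: emb_def)
qed

lemma emb_map_closed: "keys f \<subseteq> quiver_paths Q1 ==> keys (emb_map f) \<subseteq> quiver_paths Q" unfolding path_algebra_map_eq
  by (rule keys_linear_extension) (auto simp: q.quiver_paths_eq q1.quiver_paths_eq emb_path)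

lemma retr_closed: "keys f \<subseteq> quiver_paths Q ==> keys (retr f) \<subseteq> quiver_paths Q1" unfolding retr_def
proof (rule keys_linear_extension)
  fix p assume "p \<in> keys f" "keys f \<subseteq> quiver_paths Q"
  then have "q.is_path (fst p) (snd p)" by (auto simp: q.quiver_paths_eq)
  then show "keys (if inn p then basis (unemb p) else 0 :: ('v, 'e) qpath \<Rightarrow>\<^sub>0 'a) \<subseteq> quiver_paths Q1"
    using path_inn[of "fst p" "snd p"] unemb_emb by (auto simp: q1.quiver_paths_eq)
qed

lemma emb_map_mult:
  assumes "keys f \<subseteq> quiver_paths Q1" "keys g \<subseteq> quiver_paths Q1"
  shows "emb_map (path_mult Q1 f g) = path_mult Q (emb_map f) (emb_map g)" using assms(1)
proof (induction rule: poly_mapping_single_induct)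
  case (single p c)
  show ?case using assms(2)
  proof (induction rule: poly_mapping_single_induct)
    case (single r d)
    obtain u p' w r' where pr: "p = (u, p')" "r = (w, r')" "q1.is_path u p'" "q1.is_path w r'"
      using \<open>p \<in> quiver_paths Q1\<close> single by (auto simp: q1.quiver_paths_eq)
    then show ?case using phi_eq_iff[OF q1.is_path_end[OF pr(3)] q1.is_path_start[OF pr(4)]]
      by (simp add: q1.path_mult_single emb_def q.path_mult_single emb_path)
  qed simp_all
qed simp_all

lemma retr_mult:
  assumes "keys f \<subseteq> quiver_paths Q" "keys g \<subseteq> quiver_paths Q"
  shows "retr (path_mult Q f g) = path_mult Q1 (retr f) (retr g)" using assms(1)
proof (induction rule: poly_mapping_single_induct)
  case (single p c)
  show ?case using assms(2)
  proof (induction rule: poly_mapping_single_induct)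
    case (single r d)
    obtain u p' w r' where pr: "p = (u, p')" "r = (w, r')" "q.is_path u p'" "q.is_path w r'"
      using \<open>p \<in> quiver_paths Q\<close> single by (auto simp: q.quiver_paths_eq)
    show ?case
    proof (cases "inn p \<and> inn r")
      case False
      then show ?thesis using pr inn_append[of u p' r'] by (auto simp: q.path_mult_single)
    next
      case True
      then obtain x s y t where st: "p = emb (x, s)" "r = emb (y, t)" "q1.is_path x s" "q1.is_path y t" using path_inn pr by metis
      have "single p c = emb_map (single (x, s) c)" "single r d = emb_map (single (y, t) d)" using st by simp_all
      then have "path_mult Q (single p c) (single r d) = emb_map (path_mult Q1 (single (x, s) c) (single (y, t) d))"
        using st by (simp add: emb_map_mult q1.quiver_paths_eq)
      also have "retr \<dots> = path_mult Q1 (single (x, s) c) (single (y, t) d)"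
        using st unemb_emb[of x "s @ t"] inn_emb[of x "s @ t"] by (simp add: q1.path_mult_single)
      finally show ?thesis using True st unemb_emb by simp
    qed
  qed simp_all
qed simp_all

lemma retr_emb_map: "keys f \<subseteq> quiver_paths Q1 ==> retr (emb_map f) = f"
  by (induction rule: poly_mapping_single_induct) (auto simp: q1.quiver_paths_eq inn_emb unemb_emb)

lemma lookup_retr:
  assumes "keys f \<subseteq> quiver_paths Q" "q1.is_path u p"
  shows "lookup (retr f) (u, p) = lookup f (emb (u, p))" using assms(1)
proof (induction rule: poly_mapping_single_induct)
  case (single r c)
  show ?case
  proof (cases "inn r")
    case True
    then obtain w s where "q1.is_path w s" "r = emb (w, s)" using path_inn' single by blast
    then show ?thesis using emb_eq_iff assms(2) inn_emb unemb_emb by (auto simp: lookup_single when_def)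
  next
    case False
    then show ?thesis using inn_emb[OF assms(2)] by (auto simp: lookup_single when_def)
  qed
qed (simp_all add: lookup_add)

text \<open>\<open>retr\<close> is injective on paths inside the first quiver, so nothing can cancel
  in \<open>retr f\<close>.\<close>

lemma retr_keys:
  assumes "keys f \<subseteq> quiver_paths Q" "retr f = 0" "r \<in> keys f"
  shows "retr (basis r :: _ \<Rightarrow>\<^sub>0 'k::field) = 0"
proof (cases "inn r")
  case True
  then obtain w s where "q1.is_path w s" "r = emb (w, s)" using path_inn' assms by blast
  then show ?thesis using lookup_retr[OF assms(1), of w s] assms(2,3) by (simp add: in_keys_iff)
qed simp

section \<open>Longest final and initial segments in the first quiver\<close>

text \<open>For a path inside the first quiver the rest is the unit of that algebra and not the
  trivial path at its start, because \<open>suffix_map\<close> demands the same first factor for all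
  of \<open>A\<close>. Paths ending outside get 0, as right multiplication by the unit kills
  them.\<close>

definition suffix_rest :: "('u, 'g) qpath => (('u, 'g) qpath \<Rightarrow>\<^sub>0 'k::field)" where
  "suffix_rest p = (if q.path_end (fst p) (snd p) \<notin> \<phi>1 ` verts Q1 then 0
     else if dropWhile inA (rev (snd p)) = [] then emb_map (path_scalar Q1 1)
     else basis (fst p, rev (dropWhile inA (rev (snd p)))))"

definition suffix_part :: "('u, 'g) qpath => (('v, 'e) qpath \<Rightarrow>\<^sub>0 'k::field)" where
  "suffix_part p = (if q.path_end (fst p) (snd p) \<notin> \<phi>1 ` verts Q1 then 0
     else if dropWhile inA (rev (snd p)) = [] then basis (unemb p)
     else basis (a1, map (inv_into (arcs Q1) \<psi>1) (rev (takeWhile inA (rev (snd p))))))"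

definition prefix_rest :: "('u, 'g) qpath => (('u, 'g) qpath \<Rightarrow>\<^sub>0 'k::field)" where
  "prefix_rest p = (if fst p \<notin> \<phi>1 ` verts Q1 then 0
     else if dropWhile inA (snd p) = [] then emb_map (path_scalar Q1 1)
     else basis (\<phi>1 a1, dropWhile inA (snd p)))"

text \<open>An initial segment starts where the path starts, so paths inside the first quiver need
  no separate case here, unlike in \<open>suffix_part\<close>.\<close>

definition prefix_part :: "('u, 'g) qpath => (('v, 'e) qpath \<Rightarrow>\<^sub>0 'k::field)" where
  "prefix_part p = (if fst p \<notin> \<phi>1 ` verts Q1 then 0 else basis (unemb (fst p, takeWhile inA (snd p))))"

lemma inA_map: "q1.is_path u r ==> x \<in> set r ==> inA (\<psi>1 x)" using q1.is_path_arcs by auto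

lemma inv_map: "q1.is_path u r ==> map (inv_into (arcs Q1) \<psi>1 \<circ> \<psi>1) r = r"
  using unemb_emb[of u r] by (simp add: unemb_def emb_def)

lemma suffix_emb:
  assumes "q1.is_path u p"
  shows "suffix_rest (emb (u, p)) = emb_map (path_scalar Q1 1)" "suffix_part (emb (u, p)) = basis (u, p)"
proof -
  have "q.path_end (fst (emb (u, p))) (snd (emb (u, p))) \<in> \<phi>1 ` verts Q1"
    using emb_path(2)[OF assms] q1.is_path_end[OF assms] by (simp add: emb_def)
  moreover have "dropWhile inA (rev (snd (emb (u, p)))) = []" using inA_map[OF assms] by (auto simp: emb_def dropWhile_eq_Nil_conv)
  ultimately show "suffix_rest (emb (u, p)) = emb_map (path_scalar Q1 1)" "suffix_part (emb (u, p)) = basis (u, p)"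
    using unemb_emb[OF assms] by (simp_all add: suffix_rest_def suffix_part_def)
qed

lemma prefix_emb:
  assumes "q1.is_path u p"
  shows "prefix_rest (emb (u, p)) = emb_map (path_scalar Q1 1)" "prefix_part (emb (u, p)) = basis (u, p)"
proof -
  have "fst (emb (u, p)) \<in> \<phi>1 ` verts Q1" using q1.is_path_start[OF assms] by (simp add: emb_def)
  moreover have d: "dropWhile inA (snd (emb (u, p))) = []" "takeWhile inA (snd (emb (u, p))) = snd (emb (u, p))"
    using inA_map[OF assms] by (auto simp: emb_def dropWhile_eq_Nil_conv takeWhile_eq_all_conv)
  ultimately show "prefix_rest (emb (u, p)) = emb_map (path_scalar Q1 1)" "prefix_part (emb (u, p)) = basis (u, p)"
    using unemb_emb[OF assms] by (simp_all add: prefix_rest_def prefix_part_def d(2))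
qed

lemma suffix_append:
  assumes "q.is_path u xs" "xs \<noteq> []" "\<not> inA (last xs)" "q.path_end u xs = \<phi>1 a1" "q1.is_path a1 r"
  shows "suffix_rest (u, xs @ map \<psi>1 r) = basis (u, xs)" "suffix_part (u, xs @ map \<psi>1 r) = basis (a1, r)"
proof -
  have fin: "q.path_end u (xs @ map \<psi>1 r) \<in> \<phi>1 ` verts Q1"
    using emb_path(2)[OF assms(5)] q1.is_path_end[OF assms(5)] assms(4) by simp
  obtain ys e where xs: "xs = ys @ [e]" using assms(2) by (cases xs rule: rev_cases) auto
  have all: "inA x" if "x \<in> set (rev (map \<psi>1 r))" for x using that inA_map[OF assms(5)] by auto
  have "dropWhile inA (rev (xs @ map \<psi>1 r)) = rev xs"
    unfolding rev_append by (subst dropWhile_append2[OF all]) (use assms(3) xs in auto)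
  moreover have "takeWhile inA (rev (xs @ map \<psi>1 r)) = rev (map \<psi>1 r)"
    unfolding rev_append by (subst takeWhile_append2[OF all]) (use assms(3) xs in auto)
  ultimately show "suffix_rest (u, xs @ map \<psi>1 r) = basis (u, xs)" "suffix_part (u, xs @ map \<psi>1 r) = basis (a1, r)"
    using fin assms(2) inv_map[OF assms(5)] by (simp_all add: suffix_rest_def suffix_part_def)
qed

lemma prefix_append:
  assumes "q1.is_path w r" "xs \<noteq> []" "\<not> inA (hd xs)"
  shows "prefix_rest (\<phi>1 w, map \<psi>1 r @ xs) = basis (\<phi>1 a1, xs)" "prefix_part (\<phi>1 w, map \<psi>1 r @ xs) = basis (w, r)"
proof -
  have start: "\<phi>1 w \<in> \<phi>1 ` verts Q1" using q1.is_path_start[OF assms(1)] by simp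
  have all: "inA x" if "x \<in> set (map \<psi>1 r)" for x using that inA_map[OF assms(1)] by auto
  have "dropWhile inA (map \<psi>1 r @ xs) = xs" by (subst dropWhile_append2[OF all]) (use assms(2,3) in "auto simp: dropWhile_eq_self_iff")
  moreover have "takeWhile inA (map \<psi>1 r @ xs) = map \<psi>1 r"
    by (subst takeWhile_append2[OF all]) (use assms(2,3) in "auto simp: takeWhile_eq_Nil_iff")
  ultimately show "prefix_rest (\<phi>1 w, map \<psi>1 r @ xs) = basis (\<phi>1 a1, xs)" "prefix_part (\<phi>1 w, map \<psi>1 r @ xs) = basis (w, r)"
    using start assms(2) unemb_emb[OF assms(1)] by (simp_all add: prefix_rest_def prefix_part_def emb_def)
qed

text \<open>The paths of the other half, seen in \<open>Q\<close>.\<close>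

definition "outer = {(u, p). q.is_path u p \<and> (\<forall>e\<in>set p. \<not> inA e) \<and> (u \<in> \<phi>1 ` verts Q1 --> u = \<phi>1 a1)}"

lemma outer_nonempty:
  assumes "(u, p) \<in> outer" "p \<noteq> []"
  shows "q.is_path u p" "\<not> inn (u, p)" "\<not> inA (hd p)" "\<not> inA (last p)"
    "u \<in> \<phi>1 ` verts Q1 \<longleftrightarrow> u = \<phi>1 a1" "q.path_end u p \<in> \<phi>1 ` verts Q1 \<longleftrightarrow> q.path_end u p = \<phi>1 a1"
proof -
  show p: "q.is_path u p" and 1: "\<not> inA (hd p)" and 2: "\<not> inA (last p)" using assms by (auto simp: outer_def)
  show "\<not> inn (u, p)" using 1 hd_in_set[OF assms(2)] by (auto simp: inn_def)
  show "u \<in> \<phi>1 ` verts Q1 \<longleftrightarrow> u = \<phi>1 a1" using assms(1) a1 by (auto simp: outer_def)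
  have "last p \<in> arcs Q" using q.is_path_arcs[OF p] assms(2) by auto
  then show "q.path_end u p \<in> \<phi>1 ` verts Q1 \<longleftrightarrow> q.path_end u p = \<phi>1 a1"
    using outer_ends(2)[OF _ 2] by (simp add: q.path_end_last[OF assms(2)])
qed

lemma outer_suffix:
  assumes "(u, p) \<in> outer" "p \<noteq> []" "q.path_end u p = \<phi>1 a1"
  shows "suffix_rest (u, p) = basis (u, p)" "suffix_part (u, p) = basis (a1, [])"
  using suffix_append[of u p "[]"] outer_nonempty[OF assms(1,2)] assms(2,3) a1 by simp_all

lemma outer_prefix:
  assumes "(u, p) \<in> outer" "p \<noteq> []" "u = \<phi>1 a1"
  shows "prefix_rest (u, p) = basis (u, p)" "prefix_part (u, p) = basis (a1, [])"
  using prefix_append[of a1 "[]" p] outer_nonempty[OF assms(1,2)] assms(2,3) a1 by simp_all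

lemmas path_simps = q.path_mult_single q1.path_mult_single q.quiver_paths_eq q1.quiver_paths_eq

text \<open>In the decomposition \<open>XX\<close> contains the rests, which reach the glued vertex
  by an arrow outside the first quiver, \<open>TT\<close> the segments starting at that vertex, and
  \<open>Z\<close> the paths ending elsewhere. Products on the left act on \<open>XX\<close>,
  products with paths of the first quiver on the right act on \<open>TT\<close>.\<close>

lemma based_corner_suffix:
  fixes I :: "(('u, 'g) qpath \<Rightarrow>\<^sub>0 'k::field) set"
  assumes I: "ideal I (path_algebra Q)" and I1: "ideal I1 (path_algebra Q1)"
    and gen: "I = Idl\<^bsub>path_algebra Q\<^esub> (emb_map ` I1 \<union> G)"
    and C: "!!f. f \<in> C ==> keys f \<subseteq> outer"
    and G: "!!f. f \<in> G ==> keys f \<subseteq> {r \<in> outer. snd r \<noteq> []}"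
  shows "based_corner (path_algebra Q) (quiver_paths Q) I (path_algebra Q1) (quiver_paths Q1) I1
    emb_map retr (basis (a1, [])) suffix_rest suffix_part G C"
proof (rule split_corner.based_corner[where jj = emb
      and XX = "{(u, xs). q.is_path u xs \<and> xs \<noteq> [] \<and> \<not> inA (last xs) \<and> q.path_end u xs = \<phi>1 a1}"
      and TT = "{(u, r). q1.is_path u r \<and> u = a1}"
      and Z = "{(u, p). q.path_end u p \<notin> \<phi>1 ` verts Q1}"
      and cat = "\<lambda>x t. (fst x, snd x @ map \<psi>1 (snd t))"
      and UU = outer and UU' = "{r \<in> outer. snd r \<noteq> []}" and v = "basis (\<phi>1 a1, [])"],
    intro split_corner.intro split_corner_axioms.intro based_quotient.intro q.based_path_algebra q1.based_path_algebra I I1 gen)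
  show "(\<exists>t\<in>quiver_paths Q1. r = emb t) \<or>
      (\<exists>x\<in>{(u, xs). q.is_path u xs \<and> xs \<noteq> [] \<and> \<not> inA (last xs) \<and> q.path_end u xs = \<phi>1 a1}.
        \<exists>t\<in>{(u, r). q1.is_path u r \<and> u = a1}. r = (fst x, snd x @ map \<psi>1 (snd t))) \<or>
      r \<in> {(u, p). q.path_end u p \<notin> \<phi>1 ` verts Q1}" if "r \<in> quiver_paths Q" for r
  proof -
    obtain u p where r: "r = (u, p)" "q.is_path u p" using \<open>r \<in> quiver_paths Q\<close> by (auto simp: q.quiver_paths_eq)
    show ?thesis using path_inn[of u p] split_suffix[of u p] r by (fastforce simp: q1.quiver_paths_eq)
  qed
  show "suffix_part r = (0 :: _ \<Rightarrow>\<^sub>0 'k) \<or> suffix_part r = (basis (a1, []) :: _ \<Rightarrow>\<^sub>0 'k)" if "r \<in> outer" for r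
  proof -
    obtain u p where r: "r = (u, p)" by (cases r)
    show ?thesis
    proof (cases "p = []")
      case True
      show ?thesis
      proof (cases "u = \<phi>1 a1")
        case True
        then have "r = emb (a1, [])" using r \<open>p = []\<close> by (simp add: emb_def)
        then show ?thesis using a1 by (simp add: suffix_emb(2))
      qed (use that True r in "auto simp: outer_def suffix_part_def")
    next
      case False
      have o: "(u, p) \<in> outer" using that r by simp
      show ?thesis
      proof (cases "q.path_end u p = \<phi>1 a1")
        case True
        show ?thesis by (simp add: r outer_suffix(2)[OF o False True])
      next
        case F: False
        show ?thesis using outer_nonempty(6)[OF o False] F by (simp add: r suffix_part_def)
      qed
    qed
  qed
  show "basis r \<otimes>\<^bsub>path_algebra Q\<^esub> basis (\<phi>1 a1, []) = 0 \<and> suffix_part r = 0 \<or>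
      basis r \<otimes>\<^bsub>path_algebra Q\<^esub> basis (\<phi>1 a1, []) = suffix_rest r \<and> suffix_part r = basis (a1, [])"
    if "r \<in> {r \<in> outer. snd r \<noteq> []}" for r
  proof -
    obtain u p where r: "r = (u, p)" by (cases r)
    have o: "(u, p) \<in> outer" "p \<noteq> []" using that r by auto
    show ?thesis
    proof (cases "q.path_end u p = \<phi>1 a1")
      case True
      then show ?thesis using outer_nonempty(1)[OF o] a1 by (simp add: r outer_suffix[OF o True] q.path_mult_single verts_Q)
    next
      case False
      then show ?thesis using outer_nonempty(1,6)[OF o] a1 by (simp add: r q.path_mult_single suffix_part_def verts_Q)
    qed
  qed
  show "retr (basis r :: _ \<Rightarrow>\<^sub>0 'k) = 0" if "r \<in> {r \<in> outer. snd r \<noteq> []}" for r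
    using that outer_nonempty(2)[of "fst r" "snd r"] by simp
  let ?O = "path_algebra Q :: (('u, 'g) qpath \<Rightarrow>\<^sub>0 'k) ring" and ?O1 = "path_algebra Q1 :: (('v, 'e) qpath \<Rightarrow>\<^sub>0 'k) ring"
  let ?XX = "{(u, xs). q.is_path u xs \<and> xs \<noteq> [] \<and> \<not> inA (last xs) \<and> q.path_end u xs = \<phi>1 a1}"
    and ?TT = "{(u, r). q1.is_path u r \<and> u = a1}" and ?Z = "{(u, p). q.path_end u p \<notin> \<phi>1 ` verts Q1}"
  show "suffix_rest (fst w, snd w @ map \<psi>1 (snd t)) = (basis w :: _ \<Rightarrow>\<^sub>0 'k) \<and>
      suffix_part (fst w, snd w @ map \<psi>1 (snd t)) = (basis t :: _ \<Rightarrow>\<^sub>0 'k)" if "w \<in> ?XX" "t \<in> ?TT" for w t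
    using that by (auto simp: suffix_append)
  show "suffix_rest z = (0 :: _ \<Rightarrow>\<^sub>0 'k) \<and> suffix_part z = (0 :: _ \<Rightarrow>\<^sub>0 'k)" if "z \<in> ?Z" for z
    using that by (auto simp: suffix_rest_def suffix_part_def)
  show "basis (fst w, snd w @ map \<psi>1 (snd t)) = basis w \<otimes>\<^bsub>?O\<^esub> emb_map (basis t)" if "w \<in> ?XX" "t \<in> ?TT" for w t
    using that a1 by (auto simp: emb_path path_simps emb_def verts_Q)
  show "basis t \<otimes>\<^bsub>?O1\<^esub> basis s = 0 \<or> (\<exists>r\<in>quiver_paths Q1. basis t \<otimes>\<^bsub>?O1\<^esub> basis s = basis r)"
    if "t \<in> quiver_paths Q1" "s \<in> quiver_paths Q1" for t s
  proof (cases "q1.path_end (fst t) (snd t) = fst s")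
    case True
    then show ?thesis using that by (intro disjI2 bexI[of _ "(fst t, snd t @ snd s)"]) (auto simp: path_simps emb_def verts_Q)
  qed (use that in "auto simp: path_simps")
  show "basis t \<otimes>\<^bsub>?O1\<^esub> basis s = 0 \<or> (\<exists>r\<in>?TT. basis t \<otimes>\<^bsub>?O1\<^esub> basis s = basis r)"
    if "t \<in> ?TT" "s \<in> quiver_paths Q1" for t s
  proof (cases "q1.path_end (fst t) (snd t) = fst s")
    case True
    then show ?thesis using that by (intro disjI2 bexI[of _ "(fst t, snd t @ snd s)"]) (auto simp: path_simps emb_def verts_Q)
  qed (use that in "auto simp: path_simps")
  show "basis r \<otimes>\<^bsub>?O\<^esub> basis w = 0 \<or> (\<exists>y\<in>?XX. basis r \<otimes>\<^bsub>?O\<^esub> basis w = basis y)"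
    if "r \<in> quiver_paths Q" "w \<in> ?XX" for r w
  proof (cases "q.path_end (fst r) (snd r) = fst w")
    case True
    then show ?thesis using that by (intro disjI2 bexI[of _ "(fst r, snd r @ snd w)"]) (auto simp: path_simps emb_def verts_Q)
  qed (use that in "auto simp: path_simps")
  show "basis r \<otimes>\<^bsub>?O\<^esub> basis z = 0 \<or> (\<exists>y\<in>?Z. basis r \<otimes>\<^bsub>?O\<^esub> basis z = basis y)"
    if "r \<in> quiver_paths Q" "z \<in> ?Z" "z \<in> quiver_paths Q" for r z
  proof (cases "q.path_end (fst r) (snd r) = fst z")
    case True
    then show ?thesis using that by (intro disjI2 bexI[of _ "(fst r, snd r @ snd z)"]) (auto simp: path_simps emb_def verts_Q)
  qed (use that in "auto simp: path_simps")
  show "basis z \<otimes>\<^bsub>?O\<^esub> emb_map (basis t) = 0" if "z \<in> ?Z" "z \<in> quiver_paths Q" "t \<in> quiver_paths Q1" for z t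
    using that q1.is_path_start[of "fst t" "snd t"] q1.is_path_end[of "fst t" "snd t"]
    by (auto simp: q.path_mult_single q.quiver_paths_eq q1.quiver_paths_eq emb_def emb_path)
  show "basis (a1, []) \<in> carrier (path_algebra Q1)" using a1 by (simp add: q1.quiver_paths_eq)
  show "basis (\<phi>1 a1, []) \<in> carrier (path_algebra Q)" using a1 by (simp add: q.quiver_paths_eq verts_Q)
  show "?XX \<subseteq> quiver_paths Q" "?TT \<subseteq> quiver_paths Q1" "outer \<subseteq> quiver_paths Q"
    by (auto simp: q.quiver_paths_eq q1.quiver_paths_eq outer_def)
  show "suffix_rest (emb t) = emb_map \<one>\<^bsub>path_algebra Q1\<^esub> \<and> suffix_part (emb t) = (basis t :: _ \<Rightarrow>\<^sub>0 'k)"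
    if "t \<in> quiver_paths Q1" for t using that by (cases t) (simp add: q1.quiver_paths_eq suffix_emb)
  show "retr (basis r :: _ \<Rightarrow>\<^sub>0 'k) = 0"
    if "f \<in> carrier (path_algebra Q)" "retr f = 0" "r \<in> keys f" for f :: "_ \<Rightarrow>\<^sub>0 'k" and r
    by (rule retr_keys[OF _ that(2,3)]) (use that(1) in simp)
qed (use C G a1 in "auto simp: emb_map_mult retr_mult retr_emb_map dest: subsetD[OF emb_map_closed] subsetD[OF retr_closed]")

text \<open>The mirror image over the opposite algebra. Its products concatenate in reverse order,
  hence \<open>cat\<close> puts the segment of the first quiver in front.\<close>

lemma based_corner_prefix:
  fixes I :: "(('u, 'g) qpath \<Rightarrow>\<^sub>0 'k::field) set"
  assumes I: "ideal I (opposite_ring (path_algebra Q))" and I1: "ideal I1 (opposite_ring (path_algebra Q1))"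
    and gen: "I = Idl\<^bsub>opposite_ring (path_algebra Q)\<^esub> (emb_map ` I1 \<union> G)"
    and C: "!!f. f \<in> C ==> keys f \<subseteq> outer"
    and G: "!!f. f \<in> G ==> keys f \<subseteq> {r \<in> outer. snd r \<noteq> []}"
  shows "based_corner (opposite_ring (path_algebra Q)) (quiver_paths Q) I (opposite_ring (path_algebra Q1)) (quiver_paths Q1) I1
    emb_map retr (basis (a1, [])) prefix_rest prefix_part G C"
proof (rule split_corner.based_corner[where jj = emb
      and XX = "{(u, xs). q.is_path u xs \<and> xs \<noteq> [] \<and> \<not> inA (hd xs) \<and> u = \<phi>1 a1}"
      and TT = "{(u, r). q1.is_path u r \<and> q1.path_end u r = a1}"
      and Z = "{(u, p). u \<notin> \<phi>1 ` verts Q1}"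
      and cat = "\<lambda>x t. (\<phi>1 (fst t), map \<psi>1 (snd t) @ snd x)"
      and UU = outer and UU' = "{r \<in> outer. snd r \<noteq> []}" and v = "basis (\<phi>1 a1, [])"],
    intro split_corner.intro split_corner_axioms.intro based_quotient.intro based_algebra.based_algebra_opposite q.based_path_algebra q1.based_path_algebra I I1 gen)
  show "(\<exists>t\<in>quiver_paths Q1. r = emb t) \<or>
      (\<exists>x\<in>{(u, xs). q.is_path u xs \<and> xs \<noteq> [] \<and> \<not> inA (hd xs) \<and> u = \<phi>1 a1}.
        \<exists>t\<in>{(u, r). q1.is_path u r \<and> q1.path_end u r = a1}. r = (\<phi>1 (fst t), map \<psi>1 (snd t) @ snd x)) \<or>
      r \<in> {(u, p). u \<notin> \<phi>1 ` verts Q1}" if "r \<in> quiver_paths Q" for r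
  proof -
    obtain u p where r: "r = (u, p)" "q.is_path u p" using \<open>r \<in> quiver_paths Q\<close> by (auto simp: q.quiver_paths_eq)
    show ?thesis using path_inn[of u p] split_prefix[of u p] r by (fastforce simp: q1.quiver_paths_eq)
  qed
  show "prefix_part r = (0 :: _ \<Rightarrow>\<^sub>0 'k) \<or> prefix_part r = (basis (a1, []) :: _ \<Rightarrow>\<^sub>0 'k)" if "r \<in> outer" for r
  proof -
    obtain u p where r: "r = (u, p)" by (cases r)
    show ?thesis
    proof (cases "p = []")
      case True
      show ?thesis
      proof (cases "u = \<phi>1 a1")
        case True
        then have "r = emb (a1, [])" using r \<open>p = []\<close> by (simp add: emb_def)
        then show ?thesis using a1 by (simp add: prefix_emb(2))
      qed (use that True r in "auto simp: outer_def prefix_part_def")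
    next
      case False
      have o: "(u, p) \<in> outer" using that r by simp
      show ?thesis
      proof (cases "u = \<phi>1 a1")
        case True
        show ?thesis by (simp add: r outer_prefix(2)[OF o False True])
      next
        case F: False
        show ?thesis using outer_nonempty(5)[OF o False] F by (simp add: r prefix_part_def)
      qed
    qed
  qed
  show "basis r \<otimes>\<^bsub>opposite_ring (path_algebra Q)\<^esub> basis (\<phi>1 a1, []) = 0 \<and> prefix_part r = 0 \<or>
      basis r \<otimes>\<^bsub>opposite_ring (path_algebra Q)\<^esub> basis (\<phi>1 a1, []) = prefix_rest r \<and> prefix_part r = basis (a1, [])"
    if "r \<in> {r \<in> outer. snd r \<noteq> []}" for r
  proof -
    obtain u p where r: "r = (u, p)" by (cases r)
    have o: "(u, p) \<in> outer" "p \<noteq> []" using that r by auto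
    show ?thesis
    proof (cases "u = \<phi>1 a1")
      case True
      show ?thesis using a1 by (simp add: r True outer_prefix[OF o True, unfolded True] q.path_mult_single verts_Q)
    next
      case False
      then show ?thesis using outer_nonempty(1,5)[OF o] a1 by (simp add: r q.path_mult_single prefix_part_def verts_Q)
    qed
  qed
  show "retr (basis r :: _ \<Rightarrow>\<^sub>0 'k) = 0" if "r \<in> {r \<in> outer. snd r \<noteq> []}" for r
    using that outer_nonempty(2)[of "fst r" "snd r"] by simp
  let ?O = "opposite_ring (path_algebra Q) :: (('u, 'g) qpath \<Rightarrow>\<^sub>0 'k) ring" and ?O1 = "opposite_ring (path_algebra Q1) :: (('v, 'e) qpath \<Rightarrow>\<^sub>0 'k) ring"
  let ?XX = "{(u, xs). q.is_path u xs \<and> xs \<noteq> [] \<and> \<not> inA (hd xs) \<and> u = \<phi>1 a1}"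
    and ?TT = "{(u, r). q1.is_path u r \<and> q1.path_end u r = a1}" and ?Z = "{(u, p). u \<notin> \<phi>1 ` verts Q1}"
  show "prefix_rest (\<phi>1 (fst t), map \<psi>1 (snd t) @ snd w) = (basis w :: _ \<Rightarrow>\<^sub>0 'k) \<and>
      prefix_part (\<phi>1 (fst t), map \<psi>1 (snd t) @ snd w) = (basis t :: _ \<Rightarrow>\<^sub>0 'k)" if "w \<in> ?XX" "t \<in> ?TT" for w t
    using that by (cases w; cases t) (simp add: prefix_append)
  show "prefix_rest z = (0 :: _ \<Rightarrow>\<^sub>0 'k) \<and> prefix_part z = (0 :: _ \<Rightarrow>\<^sub>0 'k)" if "z \<in> ?Z" for z
    using that by (auto simp: prefix_rest_def prefix_part_def)
  show "basis (\<phi>1 (fst t), map \<psi>1 (snd t) @ snd w) = basis w \<otimes>\<^bsub>?O\<^esub> emb_map (basis t)" if "w \<in> ?XX" "t \<in> ?TT" for w t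
    using that a1 by (auto simp: emb_path path_simps emb_def verts_Q)
  show "basis t \<otimes>\<^bsub>?O1\<^esub> basis s = 0 \<or> (\<exists>r\<in>quiver_paths Q1. basis t \<otimes>\<^bsub>?O1\<^esub> basis s = basis r)"
    if "t \<in> quiver_paths Q1" "s \<in> quiver_paths Q1" for t s
  proof (cases "q1.path_end (fst s) (snd s) = fst t")
    case True
    then show ?thesis using that by (intro disjI2 bexI[of _ "(fst s, snd s @ snd t)"]) (auto simp: path_simps emb_def verts_Q)
  qed (use that in "auto simp: path_simps")
  show "basis t \<otimes>\<^bsub>?O1\<^esub> basis s = 0 \<or> (\<exists>r\<in>?TT. basis t \<otimes>\<^bsub>?O1\<^esub> basis s = basis r)"
    if "t \<in> ?TT" "s \<in> quiver_paths Q1" for t s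
  proof (cases "q1.path_end (fst s) (snd s) = fst t")
    case True
    then show ?thesis using that by (intro disjI2 bexI[of _ "(fst s, snd s @ snd t)"]) (auto simp: path_simps emb_def verts_Q)
  qed (use that in "auto simp: path_simps")
  show "basis r \<otimes>\<^bsub>?O\<^esub> basis w = 0 \<or> (\<exists>y\<in>?XX. basis r \<otimes>\<^bsub>?O\<^esub> basis w = basis y)"
    if "r \<in> quiver_paths Q" "w \<in> ?XX" for r w
  proof (cases "q.path_end (fst w) (snd w) = fst r")
    case True
    then show ?thesis using that by (intro disjI2 bexI[of _ "(fst w, snd w @ snd r)"]) (auto simp: path_simps emb_def verts_Q)
  qed (use that in "auto simp: path_simps")
  show "basis r \<otimes>\<^bsub>?O\<^esub> basis z = 0 \<or> (\<exists>y\<in>?Z. basis r \<otimes>\<^bsub>?O\<^esub> basis z = basis y)"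
    if "r \<in> quiver_paths Q" "z \<in> ?Z" "z \<in> quiver_paths Q" for r z
  proof (cases "q.path_end (fst z) (snd z) = fst r")
    case True
    then show ?thesis using that by (intro disjI2 bexI[of _ "(fst z, snd z @ snd r)"]) (auto simp: path_simps emb_def verts_Q)
  qed (use that in "auto simp: path_simps")
  show "basis z \<otimes>\<^bsub>?O\<^esub> emb_map (basis t) = 0" if "z \<in> ?Z" "z \<in> quiver_paths Q" "t \<in> quiver_paths Q1" for z t
    using that q1.is_path_start[of "fst t" "snd t"] q1.is_path_end[of "fst t" "snd t"]
    by (auto simp: q.path_mult_single q.quiver_paths_eq q1.quiver_paths_eq emb_def emb_path)
  show "basis (a1, []) \<in> carrier (?O1)" using a1 by (simp add: q1.quiver_paths_eq)
  show "basis (\<phi>1 a1, []) \<in> carrier (?O)" using a1 by (simp add: q.quiver_paths_eq verts_Q)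
  show "?XX \<subseteq> quiver_paths Q" "?TT \<subseteq> quiver_paths Q1" "outer \<subseteq> quiver_paths Q"
    by (auto simp: q.quiver_paths_eq q1.quiver_paths_eq outer_def)
  show "prefix_rest (emb t) = emb_map \<one>\<^bsub>?O1\<^esub> \<and> prefix_part (emb t) = (basis t :: _ \<Rightarrow>\<^sub>0 'k)"
    if "t \<in> quiver_paths Q1" for t using that by (cases t) (simp add: q1.quiver_paths_eq prefix_emb)
  show "retr (basis r :: _ \<Rightarrow>\<^sub>0 'k) = 0"
    if "f \<in> carrier (?O)" "retr f = 0" "r \<in> keys f" for f :: "_ \<Rightarrow>\<^sub>0 'k" and r
    by (rule retr_keys[OF _ that(2,3)]) (use that(1) in simp)
qed (use C G a1 in "auto simp: emb_map_mult retr_mult retr_emb_map dest: subsetD[OF emb_map_closed] subsetD[OF retr_closed]")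

end

section \<open>Long paths in a finite-dimensional gluing\<close>

lemma linear_on_sum:
  assumes "linear_on U \<theta>" "finite F" "!!i. i \<in> F ==> h i \<in> U" "0 \<in> U"
    "!!f g. f \<in> U ==> g \<in> U ==> f + g \<in> U" "!!c f. f \<in> U ==> scale c f \<in> U"
  shows "\<theta> (\<Sum>i\<in>F. scale (c i) (h i)) = (\<Sum>i\<in>F. c i * \<theta> (h i))"
proof -
  have z: "\<theta> 0 = 0" using assms(1,4) unfolding linear_on_def by (metis mult_zero_left scale_simps(6))
  have "(\<Sum>i\<in>F. scale (c i) (h i)) \<in> U \<and> \<theta> (\<Sum>i\<in>F. scale (c i) (h i)) = (\<Sum>i\<in>F. c i * \<theta> (h i))"
    using assms(2,3)
  proof (induction F)
    case (insert i F)
    then show ?case using assms(1,5,6) by (simp add: linear_on_def)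
  qed (simp add: assms(4) z)
  then show ?thesis by blast
qed

lemma tensor_map_sum:
  "tensor_map rr gg \<theta> (\<Sum>i\<in>F. scale (c i) (basis (h i))) = (\<Sum>i\<in>F. scale (c i * \<theta> (rr (h i))) (gg (h i)))"
  by (induction F rule: infinite_finite_induct) simp_all

lemma scale_sum_left: "scale (\<Sum>i\<in>F. c i) f = (\<Sum>i\<in>F. scale (c i) f)"
  by (rule poly_mapping_eqI) (simp add: lookup_sum sum_distrib_right)

context based_quotient
begin

text \<open>If \<open>g\<close> were outside \<open>I\<close>, a basis of \<open>I\<close> enlarged
  by \<open>g\<close> would be independent, and the functional that is 1 on \<open>g\<close> and 0
  on that basis would extend to the whole space. This recovers membership in the ideal from
  \<open>tensor_map\<close>, which only sees functionals.\<close>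

lemma ideal_separation:
  assumes g: "g \<in> carrier P"
    and "!!\<theta>. linear_on (carrier P) \<theta> ==> (!!f. f \<in> I ==> \<theta> f = 0) ==> \<theta> g = 0"
  shows "g \<in> I"
proof (rule ccontr)
  assume gI: "g \<notin> I"
  interpret v: vector_space_pair "scale :: 'k => ('p \<Rightarrow>\<^sub>0 'k) => _" "(*) :: 'k => 'k => 'k"
    by unfold_locales (simp_all add: algebra_simps)
  have sub: "v.vs1.subspace I" by (simp add: v.vs1.subspace_def I_zero I_add I_scale)
  obtain B where B: "B \<subseteq> I" "v.vs1.independent B" "I \<subseteq> v.vs1.span B" using v.vs1.maximal_independent_subset .
  have "g \<notin> v.vs1.span B" using v.vs1.span_minimal[OF B(1) sub] gI by blast
  then have "v.vs1.independent (insert g B)" using B(2) by (rule v.vs1.independent_insertI)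
  from v.linear_independent_extend[OF this, of "\<lambda>x. if x = g then 1 else 0"]
  obtain h where h: "Vector_Spaces.linear scale (*) h" "\<forall>x\<in>insert g B. h x = (if x = g then 1 else 0)" by blast
  have lin: "linear_on (carrier P) h" unfolding linear_on_def by (simp add: v.linear_add[OF h(1)] v.linear_scale[OF h(1)])
  have "h x = 0" if "x \<in> B" for x using h(2) that B(1) gI by auto
  then have "h f = 0" if "f \<in> I" for f using v.linear_eq_0_on_span[OF h(1)] B(3) that by blast
  from assms(2)[OF lin this] show False using h(2) by simp
qed

text \<open>Dimension is measured over the image of the ground field, which first has to be
  recognised as a subfield; since the unit is not in \<open>I\<close>, nonzero scalars stay
  nonzero.\<close>

lemma finite_dimension_relation:
  assumes fd: "ring.finite_dimension qr (range sc) (carrier qr)" and one: "\<one> \<notin> I"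
    and fs: "!!i::nat. fs i \<in> carrier P"
  shows "\<exists>n c. (\<exists>i<n. c i \<noteq> 0) \<and> (\<Sum>i<n. scale (c i) (fs i)) \<in> I"
proof -
  interpret R: ring "qr" by (rule quotient_is_ring)
  have mult: "sc c \<otimes>\<^bsub>qr\<^esub> sc d = sc (c * d)" for c d using sc_mult_qt[of "scale d \<one>" c] by (simp add: sc_def)
  have add: "sc c \<oplus>\<^bsub>qr\<^esub> sc d = sc (c + d)" for c d by (simp add: sc_def qt_add)
  have sc1: "\<one>\<^bsub>qr\<^esub> = sc 1" and sc0: "\<zero>\<^bsub>qr\<^esub> = sc 0"
    by (simp_all add: sc_def one_quotient zero_quotient)
  have neq: "sc c \<noteq> \<zero>\<^bsub>qr\<^esub>" if "c \<noteq> 0" for c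
  proof
    assume "sc c = \<zero>\<^bsub>qr\<^esub>"
    then have "scale (inverse c) (scale c \<one>) \<in> I" unfolding sc_def by (intro I_scale[where f = "scale c \<one>"]) (simp add: qt_eq_zero_iff)
    then show False using one that by simp
  qed
  have "subring (range sc) qr"
  proof (rule R.subringI)
    show "\<ominus>\<^bsub>qr\<^esub> h \<in> range sc" if "h \<in> range sc" for h
    proof -
      obtain c where h: "h = sc c" using \<open>h \<in> range sc\<close> by blast
      have "\<ominus>\<^bsub>qr\<^esub> sc c = sc (- c)" by (rule R.minus_equality) (simp_all add: add sc0)
      then show ?thesis using h by blast
    qed
  qed (auto simp: sc1 mult add)
  then have subcring: "subcring (range sc) qr" by (rule R.subcringI) (auto simp: mult mult.commute)
  have "subfield (range sc) qr"
  proof (rule R.subfieldI[OF subcring])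
    show "Units (qr\<lparr>carrier := range sc\<rparr>) = range sc - {\<zero>\<^bsub>qr\<^esub>}"
    proof (intro equalityI subsetI)
      fix u assume "u \<in> Units (qr\<lparr>carrier := range sc\<rparr>)"
      then obtain c d where u: "u = sc c" "sc c \<otimes>\<^bsub>qr\<^esub> sc d = \<one>\<^bsub>qr\<^esub>" by (auto simp: Units_def)
      then have "u \<noteq> \<zero>\<^bsub>qr\<^esub>" using neq[of 1] by (metis R.l_null sc1 sc_closed zero_neq_one)
      then show "u \<in> range sc - {\<zero>\<^bsub>qr\<^esub>}" using u by blast
    next
      fix u assume "u \<in> range sc - {\<zero>\<^bsub>qr\<^esub>}"
      then obtain c where "u = sc c" "c \<noteq> 0" using sc0 by auto
      then show "u \<in> Units (qr\<lparr>carrier := range sc\<rparr>)" by (auto simp: Units_def mult sc1 intro!: exI[of _ "inverse c"])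
    qed
  qed
  note K = this
  obtain n where n: "R.dimension n (range sc) (carrier qr)" using fd unfolding R.finite_dimension_def by blast
  \<comment> \<open>One element more than the dimension forces a dependence.\<close>
  let ?Us = "map (\<lambda>i. qt (fs i)) [0..<Suc n]"
  have Us: "set ?Us \<subseteq> carrier qr" using fs by auto
  have "\<not> R.independent (range sc) ?Us" using R.independent_length_le_dimension[OF K n _ Us] by auto
  then obtain Ks where Ks: "length Ks = length ?Us" "R.combine Ks ?Us = \<zero>\<^bsub>qr\<^esub>" "set Ks \<subseteq> range sc" "set Ks \<noteq> {\<zero>\<^bsub>qr\<^esub>}"
    using R.dependent_imp_non_trivial_combine[OF K Us] by blast
  have "\<forall>i<length Ks. \<exists>c. Ks ! i = sc c" using Ks(3) nth_mem by blast
  then obtain c where c: "!!i. i < length Ks ==> Ks ! i = sc (c i)" by metis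
  have comb: "R.combine (map (\<lambda>i. sc (c i)) js) (map (\<lambda>i. qt (fs i)) js) = qt (\<Sum>i\<leftarrow>js. scale (c i) (fs i))
      \<and> (\<Sum>i\<leftarrow>js. scale (c i) (fs i)) \<in> carrier P" for js
    by (induction js) (use fs in "simp_all add: zero_quotient sc_mult_qt qt_add")
  have Ks_eq: "Ks = map (\<lambda>i. sc (c i)) [0..<Suc n]" using Ks(1) c by (intro nth_equalityI) (auto simp del: upt_Suc)
  have "qt (\<Sum>i\<leftarrow>[0..<Suc n]. scale (c i) (fs i)) = \<zero>\<^bsub>qr\<^esub>"
    using Ks(2) comb[of "[0..<Suc n]"] by (simp only: Ks_eq)
  then have "(\<Sum>i\<leftarrow>[0..<Suc n]. scale (c i) (fs i)) \<in> I" using comb[of "[0..<Suc n]"] qt_eq_zero_iff by blast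
  moreover have "(\<Sum>i\<leftarrow>[0..<Suc n]. scale (c i) (fs i)) = (\<Sum>i<Suc n. scale (c i) (fs i))"
    by (simp only: interv_sum_list_conv_sum_set_nat set_upt atLeast0LessThan)
  ultimately have "(\<Sum>i<Suc n. scale (c i) (fs i)) \<in> I" by simp
  moreover have "\<exists>i<Suc n. c i \<noteq> 0"
  proof (rule ccontr)
    assume "\<not> ?thesis"
    then have "set Ks = {\<zero>\<^bsub>qr\<^esub>}" unfolding Ks_eq by (auto simp: sc0 simp del: upt_Suc)
    then show False using Ks(4) by blast
  qed
  ultimately show ?thesis by blast
qed

end

lemma (in fin_digraph) lookup_path_scalar: "v \<in> verts G ==> lookup (path_scalar G c) (v, []) = c"
  by (auto simp: path_scalar_def lookup_sum lookup_single when_def sum.delta)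

locale glued_bound_quivers = glued_quivers Q Q1 Q2 \<phi>1 \<psi>1 a1 \<phi>2 \<psi>2 a2
  for Q :: "('u, 'g) pre_digraph" and Q1 :: "('v, 'e) pre_digraph" and Q2 :: "('w, 'f) pre_digraph"
    and \<phi>1 \<psi>1 a1 \<phi>2 \<psi>2 a2 +
  fixes I :: "(('u, 'g) qpath \<Rightarrow>\<^sub>0 'k::field) set" and I1 :: "(('v, 'e) qpath \<Rightarrow>\<^sub>0 'k) set" and I2 :: "(('w, 'f) qpath \<Rightarrow>\<^sub>0 'k) set"
  assumes I1: "ideal I1 (path_algebra Q1)" and I2: "ideal I2 (path_algebra Q2)"
    and I1_triv: "I1 \<subseteq> q1.no_trivial" and I2_triv: "I2 \<subseteq> q2.no_trivial"
    and I1_long: "\<exists>L. \<forall>p\<in>quiver_paths Q1. L \<le> length (snd p) --> basis p \<in> I1"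
    and I2_long: "\<exists>L. \<forall>p\<in>quiver_paths Q2. L \<le> length (snd p) --> basis p \<in> I2"
    and I_eq: "I = Idl\<^bsub>path_algebra Q\<^esub> (path_algebra_map \<phi>1 \<psi>1 ` I1 \<union> path_algebra_map \<phi>2 \<psi>2 ` I2)"
begin

lemma swap_bound: "glued_bound_quivers Q Q2 Q1 \<phi>2 \<psi>2 a2 \<phi>1 \<psi>1 a1 I I2 I1"
  by (intro glued_bound_quivers.intro swap glued_bound_quivers_axioms.intro I1 I2 I1_triv I2_triv I1_long I2_long)
    (simp add: I_eq Un_commute)

sublocale other: glued_quivers Q Q2 Q1 \<phi>2 \<psi>2 a2 \<phi>1 \<psi>1 a1 by (rule swap)

lemma keys_emb_map: "r \<in> keys (emb_map f) ==> \<exists>p\<in>keys f. r = emb p"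
  using keys_linear_extension[of f "\<lambda>p. basis (emb p)" "emb ` keys f"] by (auto simp: path_algebra_map_eq emb_def)

lemma relations_closed: "emb_map ` I1 \<union> other.emb_map ` I2 \<subseteq> carrier (path_algebra Q)"
proof -
  have "keys (emb_map f) \<subseteq> quiver_paths Q" if "f \<in> I1" for f
    by (rule emb_map_closed) (use I1_triv that in "auto simp: q1.no_trivial_def")
  moreover have "keys (other.emb_map f) \<subseteq> quiver_paths Q" if "f \<in> I2" for f
    by (rule other.emb_map_closed) (use I2_triv that in "auto simp: q2.no_trivial_def")
  ultimately show ?thesis by auto
qed

lemma ideal_I: "ideal I (path_algebra Q)" unfolding I_eq by (rule ring.genideal_ideal[OF q.ring_path_algebra relations_closed])

sublocale p: based_quotient "path_algebra Q" "quiver_paths Q" I by (intro based_quotient.intro q.based_path_algebra ideal_I)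

sublocale p1: based_quotient "path_algebra Q1" "quiver_paths Q1" I1 by (intro based_quotient.intro q1.based_path_algebra I1)

lemma emb_map_no_trivial: "f \<in> q1.no_trivial ==> emb_map f \<in> q.no_trivial"
proof -
  assume f: "f \<in> q1.no_trivial"
  have "(v, []) \<notin> keys (emb_map f)" for v
  proof
    assume "(v, []) \<in> keys (emb_map f)"
    then obtain u where "(u, []) \<in> keys f" using keys_emb_map by (fastforce simp: emb_def)
    moreover from this have "(u, []) \<in> quiver_paths Q1" using f by (auto simp: q1.no_trivial_def)
    ultimately show False using f by (simp add: q1.no_trivial_def q1.quiver_paths_eq in_keys_iff)
  qed
  then show ?thesis using f emb_map_closed by (auto simp: q1.no_trivial_def q.no_trivial_def in_keys_iff)
qed

lemma emb_map_I: "f \<in> I1 ==> emb_map f \<in> I"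
  unfolding I_eq using ring.genideal_self[OF q.ring_path_algebra relations_closed] by blast

lemma outer_other:
  "keys f \<subseteq> quiver_paths Q2 ==> keys (other.emb_map f) \<subseteq> outer"
proof
  fix r assume f: "keys f \<subseteq> quiver_paths Q2" and r: "r \<in> keys (other.emb_map f)"
  obtain p where p: "p \<in> keys f" "r = other.emb p" using glued_bound_quivers.keys_emb_map[OF swap_bound r] by blast
  obtain u es where ues: "p = (u, es)" "q2.is_path u es" using p f by (auto simp: q2.quiver_paths_eq)
  have "\<phi>2 u \<in> \<phi>2 ` verts Q2" using q2.is_path_start[OF ues(2)] by blast
  then show "r \<in> outer" using p ues other.emb_path(1)[OF ues(2)] q2.is_path_arcs[OF ues(2)] arcs_int verts_int
    by (auto simp: outer_def other.emb_def)
qed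

text \<open>Relations contain no trivial path; this places them in the set \<open>UU'\<close> of
  \<open>split_corner\<close>, which the generators \<open>G\<close> must satisfy.\<close>

lemma outer_other_ideal: "f \<in> I2 ==> keys (other.emb_map f) \<subseteq> {r \<in> outer. snd r \<noteq> []}"
proof -
  assume f: "f \<in> I2"
  then have "f \<in> q2.no_trivial" using I2_triv by blast
  then have "keys f \<subseteq> quiver_paths Q2" "other.emb_map f \<in> q.no_trivial"
    using glued_bound_quivers.emb_map_no_trivial[OF swap_bound] by (auto simp: q2.no_trivial_def)
  moreover from this have "(v, []) \<notin> keys (other.emb_map f)" for v
    by (auto simp: q.no_trivial_def q.quiver_paths_eq in_keys_iff dest!: spec[of _ v] subsetD[of _ _ "(v, [])"])
  ultimately show ?thesis using outer_other[of f] by force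
qed

lemma I_triv: "I \<subseteq> q.no_trivial" unfolding I_eq
proof (rule ring.genideal_minimal[OF q.ring_path_algebra q.ideal_no_trivial])
  show "emb_map ` I1 \<union> other.emb_map ` I2 \<subseteq> q.no_trivial"
    using emb_map_no_trivial glued_bound_quivers.emb_map_no_trivial[OF swap_bound] I1_triv I2_triv by blast
qed

lemma suffix_corner: "based_corner (path_algebra Q) (quiver_paths Q) I (path_algebra Q1) (quiver_paths Q1) I1
    emb_map retr (basis (a1, [])) suffix_rest suffix_part (other.emb_map ` I2) (other.emb_map ` carrier (path_algebra Q2))"
  by (rule based_corner_suffix[OF ideal_I I1 I_eq]) (use outer_other outer_other_ideal in auto)

lemma suffix_ideal:
  assumes "f \<in> I" "linear_on (carrier (path_algebra Q)) \<theta>" "!!f. f \<in> I ==> \<theta> f = 0"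
  shows "tensor_map suffix_rest suffix_part \<theta> f \<in> I1" by (rule based_corner.pi_T_I(2)[OF suffix_corner assms])

text \<open>Cancels a loop of the first quiver from the right end of the terms of a relation.\<close>

lemma cancel_loop:
  fixes n :: nat
  assumes x: "q1.is_path a1 x" "basis (a1, x) \<notin> I1"
    and h: "!!i. i < n ==> h i \<in> quiver_paths Q \<and> suffix_part (h i) = (basis (a1, x) :: _ \<Rightarrow>\<^sub>0 'k)
      \<and> (suffix_rest (h i) :: _ \<Rightarrow>\<^sub>0 'k) \<in> carrier (path_algebra Q)"
    and rel: "(\<Sum>i<n. scale (c i) (basis (h i))) \<in> I"
  shows "(\<Sum>i<n. scale (c i) (suffix_rest (h i))) \<in> I"
proof (rule p.ideal_separation)
  have "finsum (path_algebra Q) (\<lambda>i. scale (c i) (suffix_rest (h i))) {..<n} \<in> carrier (path_algebra Q)"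
    by (rule p.finsum_closed) (use h p.scale_closed in blast)
  then show "(\<Sum>i<n. scale (c i) (suffix_rest (h i))) \<in> carrier (path_algebra Q)"
    by (subst (asm) p.finsum_eq_sum) (use h p.scale_closed in auto)
  fix \<theta> assume \<theta>: "linear_on (carrier (path_algebra Q)) \<theta>" "!!f. f \<in> I ==> \<theta> f = 0"
  have eq: "\<theta> (\<Sum>i<n. scale (c i) (suffix_rest (h i))) = (\<Sum>i<n. c i * \<theta> (suffix_rest (h i)))" (is "_ = ?s")
    by (rule linear_on_sum[OF \<theta>(1)]) (use h p.plus_closed p.scale_closed p.zero_in_carrier in auto)
  \<comment> \<open>All terms have the same final segment \<open>x\<close>, so the relation
    collapses to a multiple of \<open>x\<close>; since \<open>x\<close> is not a relation, the
    multiple is zero.\<close>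
  have "tensor_map suffix_rest suffix_part \<theta> (\<Sum>i<n. scale (c i) (basis (h i))) \<in> I1" by (rule suffix_ideal[OF rel \<theta>])
  then have "(\<Sum>i<n. scale (c i * \<theta> (suffix_rest (h i))) (suffix_part (h i))) \<in> I1" unfolding tensor_map_sum .
  also have "(\<Sum>i<n. scale (c i * \<theta> (suffix_rest (h i))) (suffix_part (h i))) = scale ?s (basis (a1, x))"
    unfolding scale_sum_left by (rule sum.cong[OF refl]) (use h in auto)
  finally have "scale ?s (basis (a1, x)) \<in> I1" .
  then have "scale (inverse ?s) (scale ?s (basis (a1, x))) \<in> I1" by (rule p1.I_scale)
  then show "\<theta> (\<Sum>i<n. scale (c i) (suffix_rest (h i))) = 0"
    unfolding eq using x(2) by (cases "?s = 0") (simp_all del: mult_eq_0_iff)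
qed

text \<open>In a relation among positive powers of the product of the two loops, cancelling
  \<open>y\<close> and then \<open>x\<close> from the right lowers all exponents by one. The lowest
  term then contains a trivial path, which no relation does, so its coefficient is zero and the rest
  is a shorter relation of the same kind.\<close>

lemma loops_in_ideal:
  assumes fd: "ring.finite_dimension p.qr (range p.sc) (carrier p.qr)"
    and x: "q1.is_path a1 x" "q1.path_end a1 x = a1" "x \<noteq> []"
    and y: "q2.is_path a2 y" "q2.path_end a2 y = a2" "y \<noteq> []"
  shows "basis (a1, x) \<in> I1 \<or> basis (a2, y) \<in> I2"
proof (rule ccontr)
  assume "\<not> ?thesis"
  then have xI: "basis (a1, x) \<notin> I1" and yI: "basis (a2, y) \<notin> I2" by auto
  let ?v = "\<phi>1 a1" and ?x = "map \<psi>1 x" and ?y = "map \<psi>2 y"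
  define z where "z n = concat (replicate n (?x @ ?y))" for n
  have z_Suc: "z (Suc n) = z n @ ?x @ ?y" for n by (simp add: z_def flip: concat_replicate_trivial) (induction n, simp_all)
  have px: "q.is_path ?v ?x" "q.path_end ?v ?x = ?v" using emb_path[OF x(1)] x(2) by simp_all
  have py: "q.is_path ?v ?y" "q.path_end ?v ?y = ?v" using other.emb_path[OF y(1)] y(2) a_eq by simp_all
  have pz: "q.is_path ?v (z n) \<and> q.path_end ?v (z n) = ?v" for n
    by (induction n) (use px py a1 in "simp_all add: z_Suc, simp add: z_def verts_Q")
  have last_x: "last ?x \<in> \<psi>1 ` arcs Q1" "last ?x \<notin> \<psi>2 ` arcs Q2"
  proof -
    have "last x \<in> arcs Q1" using q1.is_path_arcs[OF x(1)] last_in_set[OF x(3)] by blast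
    then show "last ?x \<in> \<psi>1 ` arcs Q1" "last ?x \<notin> \<psi>2 ` arcs Q2" using x(3) arcs_int by (auto simp: last_map)
  qed
  have last_y: "last ?y \<in> \<psi>2 ` arcs Q2" "last ?y \<notin> \<psi>1 ` arcs Q1"
  proof -
    have "last y \<in> arcs Q2" using q2.is_path_arcs[OF y(1)] last_in_set[OF y(3)] by blast
    then show "last ?y \<in> \<psi>2 ` arcs Q2" "last ?y \<notin> \<psi>1 ` arcs Q1" using y(3) arcs_int by (auto simp: last_map)
  qed
  let ?one = "emb_map (path_scalar Q1 1) :: ('u, 'g) qpath \<Rightarrow>\<^sub>0 'k"
  have one_closed: "keys ?one \<subseteq> quiver_paths Q" by (rule emb_map_closed[OF q1.path_scalar_closed])
  have one: "lookup ?one (?v, []) = 1"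
  proof -
    have "lookup (retr ?one) (a1, []) = lookup ?one (emb (a1, []))"
      by (rule lookup_retr[OF emb_map_closed[OF q1.path_scalar_closed]]) (use a1 in simp)
    moreover have "retr ?one = path_scalar Q1 1" by (rule retr_emb_map[OF q1.path_scalar_closed])
    ultimately show ?thesis using a1 by (simp add: emb_def q1.lookup_path_scalar)
  qed
  have zero: "\<forall>i<n. c i = 0" if "(\<Sum>i<n. scale (c i) (basis (?v, z (Suc i)))) \<in> I" for n c using that
  proof (induction n arbitrary: c)
    case (Suc n)
    \<comment> \<open>\<open>y\<close> belongs to the second quiver, so it is cancelled with the
      roles of the two halves exchanged.\<close>
    have 1: "(\<Sum>i<Suc n. scale (c i) (other.suffix_rest (?v, z (Suc i)))) \<in> I"
    proof (rule glued_bound_quivers.cancel_loop[OF swap_bound y(1) yI])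
      fix i
      have "z i @ ?x \<noteq> []" "\<not> other.inA (last (z i @ ?x))" "q.is_path ?v (z i @ ?x)" "q.path_end ?v (z i @ ?x) = \<phi>2 a2"
        using x(3) last_x pz[of i] px a_eq by simp_all
      note eqs = other.suffix_append[OF this(3,1,2,4) y(1), unfolded append_assoc]
      show "(?v, z (Suc i)) \<in> quiver_paths Q \<and> other.suffix_part (?v, z (Suc i)) = (basis (a2, y) :: _ \<Rightarrow>\<^sub>0 'k)
          \<and> (other.suffix_rest (?v, z (Suc i)) :: _ \<Rightarrow>\<^sub>0 'k) \<in> carrier (path_algebra Q)"
        using pz[of "Suc i"] pz[of i] px by (simp add: q.quiver_paths_eq z_Suc eqs)
    qed (rule Suc.prems)
    have rest: "other.suffix_rest (?v, z (Suc i)) = (basis (?v, z i @ ?x) :: _ \<Rightarrow>\<^sub>0 'k)" for i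
      using other.suffix_append(1)[of ?v "z i @ ?x" y] x(3) last_x pz[of i] px a_eq y(1) by (simp add: z_Suc)
    \<comment> \<open>For \<open>i = 0\<close> the whole path lies in the first quiver, so its rest
      is the unit of that half; the coefficient of this unit at the glued vertex is still 1.\<close>
    have part: "suffix_rest (?v, z i @ ?x) = (if i = 0 then ?one else basis (?v, z i)) \<and>
        suffix_part (?v, z i @ ?x) = (basis (a1, x) :: _ \<Rightarrow>\<^sub>0 'k)" for i
    proof (cases i)
      case 0
      have "(?v, z i @ ?x) = emb (a1, x)" by (simp add: 0 z_def emb_def)
      then show ?thesis using 0 suffix_emb[OF x(1)] by simp
    next
      case (Suc j)
      have "z i \<noteq> []" "\<not> inA (last (z i))" using y(3) last_y by (simp_all add: Suc z_Suc)
      then show ?thesis using Suc suffix_append[of ?v "z i" x] pz[of i] x(1) by simp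
    qed
    have 2: "(\<Sum>i<Suc n. scale (c i) (suffix_rest (?v, z i @ ?x))) \<in> I"
    proof (rule cancel_loop[OF x(1) xI])
      fix i
      show "(?v, z i @ ?x) \<in> quiver_paths Q \<and> suffix_part (?v, z i @ ?x) = (basis (a1, x) :: _ \<Rightarrow>\<^sub>0 'k)
          \<and> (suffix_rest (?v, z i @ ?x) :: _ \<Rightarrow>\<^sub>0 'k) \<in> carrier (path_algebra Q)"
        using part[of i] pz[of i] px one_closed by (simp add: q.quiver_paths_eq)
    qed (use 1 in "simp only: rest")
    have "(\<Sum>i<Suc n. scale (c i) (suffix_rest (?v, z i @ ?x))) =
        scale (c 0) ?one + (\<Sum>i<n. scale (c (Suc i)) (basis (?v, z (Suc i))))" unfolding sum.lessThan_Suc_shift by (simp add: part)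
    with 2 have rel: "scale (c 0) ?one + (\<Sum>i<n. scale (c (Suc i)) (basis (?v, z (Suc i)))) \<in> I" by simp
    have "z (Suc i) \<noteq> []" for i using x(3) by (simp add: z_Suc)
    then have "lookup (scale (c 0) ?one + (\<Sum>i<n. scale (c (Suc i)) (basis (?v, z (Suc i))))) (?v, []) = c 0"
      by (simp add: lookup_add lookup_sum one lookup_single when_def)
    then have c0: "c 0 = 0" using rel I_triv a1 by (auto simp: q.no_trivial_def verts_Q)
    then have "\<forall>i<n. c (Suc i) = 0" using rel Suc.IH[of "\<lambda>i. c (Suc i)"] by simp
    then show ?case using c0 less_Suc_eq_0_disj by auto
  qed simp
  have v: "?v \<in> verts Q" using a1 by (simp add: verts_Q)
  have "path_scalar Q 1 \<notin> I"
  proof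
    assume "path_scalar Q 1 \<in> I"
    then have "path_scalar Q (1 :: 'k) \<in> q.no_trivial" using I_triv by blast
    then show False using v q.lookup_path_scalar[OF v, of "1 :: 'k"] by (auto simp: q.no_trivial_def)
  qed
  moreover have "basis (?v, z (Suc i)) \<in> carrier (path_algebra Q)" for i using pz by (simp add: q.quiver_paths_eq)
  ultimately obtain n c where "\<exists>i<n. c i \<noteq> 0" "(\<Sum>i<n. scale (c i) (basis (?v, z (Suc i)))) \<in> I"
    using p.finite_dimension_relation[OF fd, of "\<lambda>i. basis (?v, z (Suc i))"] by auto
  then show False using zero by blast
qed

lemma factor_in_I:
  assumes "q.is_path u (p @ r @ s)" "basis (q.path_end u p, r) \<in> I"
  shows "basis (u, p @ r @ s) \<in> I"
proof -
  have "basis (u, p) \<otimes>\<^bsub>path_algebra Q\<^esub> (basis (q.path_end u p, r) \<otimes>\<^bsub>path_algebra Q\<^esub> basis (q.path_end u (p @ r), s)) \<in> I"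
    using assms by (intro p.I_l_closed p.I_r_closed) (auto simp: q.quiver_paths_eq)
  then show ?thesis using assms(1) by (simp add: q.path_mult_single)
qed

lemma run_in_I:
  assumes "\<forall>p\<in>quiver_paths Q1. L \<le> length (snd p) --> basis p \<in> I1"
    and "q.is_path u p" "\<forall>e\<in>set p. inA e" "p \<noteq> []" "L \<le> length p"
  shows "basis (u, p) \<in> I"
proof -
  have "inn (u, p)" using assms(2,3,4) ends1 by (cases p) (auto simp: inn_def)
  then obtain w r where wr: "q1.is_path w r" "(u, p) = emb (w, r)" using path_inn[OF assms(2)] by blast
  then have "basis (w, r) \<in> I1" using assms(1,5) by (auto simp: q1.quiver_paths_eq emb_def)
  from emb_map_I[OF this] show ?thesis using wr by simp
qed

text \<open>
  If all loops at the gluing vertex in the first quiver are relations, a nonzero path visits that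
  quiver only at its beginning and at its end.
\<close>

lemma long_paths_in_I:
  assumes loops: "!!x. q1.is_path a1 x ==> q1.path_end a1 x = a1 ==> x \<noteq> [] ==> basis (a1, x) \<in> I1"
  shows "\<exists>L. \<forall>p\<in>quiver_paths Q. L \<le> length (snd p) --> basis p \<in> I"
proof -
  obtain L1 L2 where L1: "\<forall>p\<in>quiver_paths Q1. L1 \<le> length (snd p) --> basis p \<in> I1"
    and L2: "\<forall>p\<in>quiver_paths Q2. L2 \<le> length (snd p) --> basis p \<in> I2" using I1_long I2_long by blast
  \<comment> \<open>Outside the ideal, successive runs in the first, second and again the first
    quiver have length at most \<open>L1\<close>, \<open>L2\<close> and \<open>L1\<close>; anything
    longer has a further run.\<close>
  have "basis (u, es) \<in> I" if es: "q.is_path u es" "L1 + L2 + L1 < length es" for u es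
  proof (rule ccontr)
    assume nI: "basis (u, es) \<notin> I"
    have notI: "basis (q.path_end u p, r) \<notin> I" if "es = p @ r @ s" for p r s using factor_in_I[of u p r s] nI es(1) that by blast
    \<comment> \<open>\<open>p1\<close>, \<open>p2\<close> and \<open>p3\<close> are the first runs,
      alternately inside and outside the first quiver; \<open>p1\<close> may be empty.\<close>
    define p1 where "p1 = takeWhile inA es"
    define r1 where "r1 = dropWhile inA es"
    define p2 where "p2 = takeWhile (\<lambda>e. \<not> inA e) r1"
    define r2 where "r2 = dropWhile (\<lambda>e. \<not> inA e) r1"
    define p3 where "p3 = takeWhile inA r2"
    define r3 where "r3 = dropWhile inA r2"
    have split: "es = p1 @ r1" "r1 = p2 @ r2" "r2 = p3 @ r3" by (simp_all add: p1_def r1_def p2_def r2_def p3_def r3_def)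
    have path: "q.is_path u p1" "q.is_path (q.path_end u p1) p2" "q.is_path (q.path_end u (p1 @ p2)) p3"
      "q.is_path (q.path_end u (p1 @ p2 @ p3)) r3" using es(1) by (simp_all add: split)
    have run: "\<forall>e\<in>set p1. inA e" "\<forall>e\<in>set p2. \<not> inA e" "\<forall>e\<in>set p3. inA e"
      by (auto simp: p1_def p2_def p3_def dest: set_takeWhileD)
    have len1: "length p1 \<le> L1"
      using run_in_I[OF L1 path(1) run(1)] notI[of "[]" p1 r1] split(1) by (cases "L1 \<le> length p1 \<and> p1 \<noteq> []") auto
    have len3: "length p3 \<le> L1"
      using run_in_I[OF L1 path(3) run(3)] notI[of "p1 @ p2" p3 r3] split by (cases "L1 \<le> length p3 \<and> p3 \<noteq> []") auto
    have "\<forall>e\<in>set p2. other.inA e" using run(2) q.is_path_arcs[OF path(2)] arcs_Q by auto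
    then have len2: "length p2 \<le> L2"
      using glued_bound_quivers.run_in_I[OF swap_bound L2 path(2)] notI[of p1 p2 r2] split by (cases "L2 \<le> length p2 \<and> p2 \<noteq> []") auto
    have r3: "r3 \<noteq> []" using es(2) len1 len2 len3 by (auto simp: split)
    have "r2 \<noteq> []" using r3 split(3) by auto
    then have hd2: "inA (hd r2)" using hd_dropWhile[of "\<lambda>e. \<not> inA e" r1] by (simp add: r2_def)
    then have p3: "p3 \<noteq> []" using \<open>r2 \<noteq> []\<close> by (cases r2) (auto simp: p3_def)
    have "r1 \<noteq> []" using \<open>r2 \<noteq> []\<close> split(2) by auto
    then have "\<not> inA (hd r1)" using hd_dropWhile[of inA es] by (simp add: r1_def)
    then have p2: "p2 \<noteq> []" using \<open>r1 \<noteq> []\<close> by (cases r1) (auto simp: p2_def)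
    have e2: "last p2 \<in> arcs Q" "\<not> inA (last p2)" using p2 run(2) q.is_path_arcs[OF path(2)] by auto
    have e3: "hd r3 \<in> arcs Q" "\<not> inA (hd r3)"
      using r3 q.is_path_arcs[OF path(4)] hd_in_set[OF r3] hd_dropWhile[of inA r2] by (blast, simp add: r3_def)
    let ?w = "q.path_end u (p1 @ p2)"
    have w: "?w = head Q (last p2)" using p2 by (simp add: q.path_end_last)
    obtain y where y: "y \<in> arcs Q1" "hd p3 = \<psi>1 y" using run(3) hd_in_set[OF p3] by blast
    have "tail Q (hd p3) = ?w" using path(3) p3 by (cases p3) auto
    then have "?w = \<phi>1 (tail Q1 y)" using y ends1 by simp
    then have "?w \<in> \<phi>1 ` verts Q1" using y(1) by simp
    \<comment> \<open>\<open>p3\<close> is enclosed by arrows outside the first quiver, so it starts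
      and ends at the glued vertex and is one of the loops assumed to be relations.\<close>
    then have w1: "?w = \<phi>1 a1" using outer_ends(2)[OF e2] w by simp
    have "inn (?w, p3)" using run(3) w1 a1 by (auto simp: inn_def)
    then obtain v x where vx: "q1.is_path v x" "(?w, p3) = emb (v, x)" using path_inn[OF path(3)] by blast
    have "\<phi>1 v = \<phi>1 a1" "p3 = map \<psi>1 x" using vx(2) w1 by (simp_all add: emb_def)
    then have v: "v = a1" using phi_eq_iff a1 q1.is_path_start[OF vx(1)] by blast
    have fin: "q.path_end u (p1 @ p2 @ p3) = \<phi>1 (q1.path_end a1 x)"
      using emb_path(2)[OF vx(1)] v w1 \<open>p3 = map \<psi>1 x\<close> by simp
    have t: "tail Q (hd r3) = q.path_end u (p1 @ p2 @ p3)" using path(4) r3 by (cases r3) auto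
    have "q1.path_end a1 x \<in> verts Q1" using q1.is_path_end[OF vx(1)] v by simp
    then have "\<phi>1 (q1.path_end a1 x) = \<phi>1 a1" using outer_ends(1)[OF e3] t fin by simp
    then have "q1.path_end a1 x = a1" using phi_eq_iff a1 \<open>q1.path_end a1 x \<in> verts Q1\<close> by blast
    moreover have "x \<noteq> []" using p3 \<open>p3 = map \<psi>1 x\<close> by auto
    ultimately have "basis (a1, x) \<in> I1" using loops vx(1) v by blast
    from emb_map_I[OF this] have "basis (?w, p3) \<in> I" using vx(2) v by simp
    then show False using notI[of "p1 @ p2" p3 r3] split by simp
  qed
  then have "\<forall>p\<in>quiver_paths Q. Suc (L1 + L2 + L1) \<le> length (snd p) --> basis p \<in> I" by (auto simp: q.quiver_paths_eq)
  then show ?thesis by blast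
qed

end

section \<open>Gluings of bound quiver algebras\<close>

lemma ideal_opposite_ring:
  assumes "ideal J R"
  shows "ideal J (opposite_ring R)"
proof -
  interpret J: ideal J R by fact
  have "subgroup J (add_monoid (opposite_ring R))" unfolding add_monoid_opposite_ring by (rule J.a_subgroup)
  then show ?thesis by (rule idealI[OF ring_opposite_ring[OF J.ring_axioms]]) (use J.I_l_closed J.I_r_closed in auto)
qed

lemma genideal_opposite_ring: "genideal (opposite_ring R) S = genideal R S"
  using ideal_opposite_ring[of _ R] ideal_opposite_ring[of _ "opposite_ring R"] by (auto simp: genideal_def)

lemma (in based_quotient) rep_opposite: "based_quotient.rep (opposite_ring P) I = rep"
  by (simp add: fun_eq_iff rep_def based_quotient.rep_def[OF based_quotient_opposite] a_r_coset_opposite)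

lemma (in based_quotient) sc_opposite: "based_quotient.sc (opposite_ring P) I = sc"
  by (simp add: fun_eq_iff sc_def based_quotient.sc_def[OF based_quotient_opposite] a_r_coset_opposite)

context fin_digraph
begin

lemma vertices_mult:
  assumes "U \<subseteq> verts G" "W \<subseteq> verts G"
  shows "path_mult G (\<Sum>u\<in>U. basis (u, [])) (\<Sum>w\<in>W. basis (w, [])) = (\<Sum>w\<in>U \<inter> W. basis (w, []) :: _ \<Rightarrow>\<^sub>0 'k::field)"
proof -
  have fin: "finite U" "finite W" using assms finite_subset[OF _ finite_verts] by auto
  have 1: "path_mult G (\<Sum>u\<in>U. basis (u, [])) (basis (w, []) :: _ \<Rightarrow>\<^sub>0 'k::field) = (if w \<in> U then basis (w, []) else 0)" for w
    using fin(1) assms(1) by (induction U) (auto simp: path_mult_single)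
  have "path_mult G (\<Sum>u\<in>U. basis (u, [])) (\<Sum>w\<in>W. basis (w, []) :: _ \<Rightarrow>\<^sub>0 'k::field) = (\<Sum>w\<in>W. if w \<in> U then basis (w, []) else 0)"
    using fin(2) by (induction W) (simp_all add: 1)
  then show ?thesis by (simp add: sum.inter_restrict[OF fin(2)] Int_commute[of U W])
qed

end

context glued_bound_quivers
begin

sublocale p2: based_quotient "path_algebra Q2" "quiver_paths Q2" I2 by (intro based_quotient.intro q2.based_path_algebra I2)

lemma prefix_corner: "based_corner (opposite_ring (path_algebra Q)) (quiver_paths Q) I (opposite_ring (path_algebra Q1)) (quiver_paths Q1) I1
    emb_map retr (basis (a1, [])) prefix_rest prefix_part (other.emb_map ` I2) (other.emb_map ` carrier (path_algebra Q2))"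
  by (rule based_corner_prefix[OF ideal_opposite_ring[OF ideal_I] ideal_opposite_ring[OF I1]])
    (use outer_other outer_other_ideal in "auto simp: genideal_opposite_ring I_eq")

definition "emb_quotient x = p.qt (emb_map (p1.rep x))"
definition "retr_quotient r = p1.qt (retr (p.rep r))"

lemma emb_quotient_qt: "f \<in> carrier (path_algebra Q1) ==> emb_quotient (p1.qt f) = p.qt (emb_map f)"
proof -
  interpret s: based_corner "path_algebra Q" "quiver_paths Q" I "path_algebra Q1" "quiver_paths Q1" I1
    emb_map retr "basis (a1, [])" suffix_rest suffix_part "other.emb_map ` I2" "other.emb_map ` carrier (path_algebra Q2)"
    by (rule suffix_corner)
  show "f \<in> carrier (path_algebra Q1) ==> emb_quotient (p1.qt f) = p.qt (emb_map f)"
    using s.iq_qt[of f] by (simp add: emb_quotient_def s.\<iota>q_def)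
qed

lemma emb_quotient_image: "emb_quotient ` carrier p1.qr = p.qt ` emb_map ` carrier (path_algebra Q1)"
  unfolding p1.carrier_quotient image_image by (rule image_cong[OF refl emb_quotient_qt])

abbreviation "eps v r \<equiv> lookup (p.rep r) (v, [])"
abbreviation "eps1 v r \<equiv> lookup (p1.rep r) (v, [])"

lemma augmented1: "augmented_algebra p1.qr p1.sc (verts Q1) eps1"
  and eps1_qt: "v \<in> verts Q1 ==> f \<in> carrier (path_algebra Q1) ==> eps1 v (p1.qt f) = lookup f (v, [])"
proof -
  obtain L where "!!p. p \<in> quiver_paths Q1 ==> L \<le> length (snd p) ==> basis p \<in> I1" using I1_long by blast
  note * = q1.augmented_path_quotient[OF I1 this I1_triv]
  show "augmented_algebra p1.qr p1.sc (verts Q1) eps1" by (rule *(1))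
  show "v \<in> verts Q1 ==> f \<in> carrier (path_algebra Q1) ==> eps1 v (p1.qt f) = lookup f (v, [])" by (rule *(2))
qed

text \<open>The two corners come from final and from initial segments. Classes, representatives and
  scalars agree for a quotient and its opposite, so both corners use the same maps.\<close>

lemma corners:
  assumes long: "!!p. p \<in> quiver_paths Q ==> L \<le> length (snd p) ==> basis p \<in> I"
  shows "corner p.qr p.sc (verts Q) eps p1.qr p1.sc (verts Q1) eps1
      emb_quotient retr_quotient \<phi>1 (p1.qt (basis (a1, []))) (p.qt ` other.emb_map ` carrier (path_algebra Q2))"
    and "corner (opposite_ring p.qr) p.sc (verts Q) eps (opposite_ring p1.qr) p1.sc (verts Q1) eps1
      emb_quotient retr_quotient \<phi>1 (p1.qt (basis (a1, []))) (p.qt ` other.emb_map ` carrier (path_algebra Q2))"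
proof -
  note aug = q.augmented_path_quotient[OF ideal_I long I_triv]
  have j: "\<phi>1 v \<in> verts Q" if "v \<in> verts Q1" for v using that by (simp add: verts_Q)
  have e: "lookup f (\<phi>1 v, []) = lookup (retr f) (v, [])"
    if "v \<in> verts Q1" "f \<in> carrier (path_algebra Q)" for v and f :: "('u, 'g) qpath \<Rightarrow>\<^sub>0 'k"
    using lookup_retr[of f v "[]"] that by (simp add: emb_def)
  interpret s: based_corner "path_algebra Q" "quiver_paths Q" I "path_algebra Q1" "quiver_paths Q1" I1
    emb_map retr "basis (a1, [])" suffix_rest suffix_part "other.emb_map ` I2" "other.emb_map ` carrier (path_algebra Q2)"
    by (rule suffix_corner)
  have eqs: "s.\<iota>q = emb_quotient" "s.\<pi>q = retr_quotient"
    by (simp_all add: fun_eq_iff s.\<iota>q_def s.\<pi>q_def emb_quotient_def retr_quotient_def)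
  show "corner p.qr p.sc (verts Q) eps p1.qr p1.sc (verts Q1) eps1
      emb_quotient retr_quotient \<phi>1 (p1.qt (basis (a1, []))) (p.qt ` other.emb_map ` carrier (path_algebra Q2))"
    using s.corner_quotient[OF aug(1) augmented1 aug(2) eps1_qt, where j = \<phi>1] j e by (simp only: eqs)
  interpret t: based_corner "opposite_ring (path_algebra Q)" "quiver_paths Q" I "opposite_ring (path_algebra Q1)" "quiver_paths Q1" I1
    emb_map retr "basis (a1, [])" prefix_rest prefix_part "other.emb_map ` I2" "other.emb_map ` carrier (path_algebra Q2)"
    by (rule prefix_corner)
  have eqt: "t.\<iota>q = emb_quotient" "t.\<pi>q = retr_quotient"
    by (simp_all add: fun_eq_iff t.\<iota>q_def t.\<pi>q_def emb_quotient_def retr_quotient_def p.rep_opposite p1.rep_opposite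
        p.a_r_coset_opposite p1.a_r_coset_opposite)
  note * = t.corner_quotient[where V = "verts Q" and eps = "\<lambda>v f. lookup f (v, [])"
      and VA = "verts Q1" and epsA = "\<lambda>v f. lookup f (v, [])" and j = \<phi>1,
      unfolded p.rep_opposite p1.rep_opposite p.sc_opposite p1.sc_opposite p.a_r_coset_opposite p1.a_r_coset_opposite
        p.opposite_quotient[symmetric] p1.opposite_quotient[symmetric] eqt opposite_ring_simps]
  show "corner (opposite_ring p.qr) p.sc (verts Q) eps (opposite_ring p1.qr) p1.sc (verts Q1) eps1
      emb_quotient retr_quotient \<phi>1 (p1.qt (basis (a1, []))) (p.qt ` other.emb_map ` carrier (path_algebra Q2))"
    by (rule *[OF augmented_algebra_opposite[OF aug(1)] augmented_algebra_opposite[OF augmented1] aug(2) eps1_qt j e])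
qed

lemma emb_map_sum: "emb_map (\<Sum>v\<in>F. basis (v, [])) = (\<Sum>v\<in>F. basis (\<phi>1 v, []))"
  by (induction F rule: infinite_finite_induct) (simp_all add: emb_def)

lemma emb_map_one: "emb_map (path_scalar Q1 1) = (\<Sum>w\<in>\<phi>1 ` verts Q1. basis (w, []))"
  by (simp add: path_scalar_def emb_map_sum sum.reindex[OF inj(1)])

lemma emb_quotient_one: "emb_quotient \<one>\<^bsub>p1.qr\<^esub> = p.qt (\<Sum>w\<in>\<phi>1 ` verts Q1. basis (w, []))"
  using emb_quotient_qt[OF p1.one_closed] by (simp add: p1.one_quotient emb_map_one)

lemma emb_quotient_vertex: "emb_quotient (p1.qt (basis (a1, []))) = p.qt (basis (\<phi>1 a1, []))"
  using emb_quotient_qt[of "basis (a1, [])"] a1 by (simp add: emb_def q1.quiver_paths_eq)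

lemma vertices_closed: "U \<subseteq> verts Q ==> (\<Sum>w\<in>U. basis (w, []) :: _ \<Rightarrow>\<^sub>0 'k) \<in> carrier (path_algebra Q)"
proof -
  assume U: "U \<subseteq> verts Q"
  have "keys (\<Sum>w\<in>U. basis (w, []) :: ('u, 'g) qpath \<Rightarrow>\<^sub>0 'k) \<subseteq> (\<Union>w\<in>U. {(w, [])})"
    using keys_sum[of "\<lambda>w. basis (w, []) :: ('u, 'g) qpath \<Rightarrow>\<^sub>0 'k" U] by simp
  also have "\<dots> \<subseteq> quiver_paths Q" using U by (auto simp: q.quiver_paths_eq)
  finally show ?thesis by simp
qed

lemma emb_quotient_one_mult:
  "p.qt (\<Sum>w\<in>\<phi>1 ` verts Q1. basis (w, [])) \<otimes>\<^bsub>p.qr\<^esub> p.qt (\<Sum>w\<in>\<phi>2 ` verts Q2. basis (w, [])) =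
   p.qt (basis (\<phi>1 a1, []))"
proof -
  have "\<phi>1 ` verts Q1 \<subseteq> verts Q" "\<phi>2 ` verts Q2 \<subseteq> verts Q" by (auto simp: verts_Q)
  then show ?thesis by (simp add: p.qt_mult[OF vertices_closed vertices_closed] q.vertices_mult verts_int)
qed

text \<open>Each trivial path and each arrow belongs to one of the halves, and a path is the product
  of its arrows.\<close>

lemma path_generated:
  assumes H: "!!f g. f \<in> H ==> g \<in> H ==> path_mult Q f g \<in> H"
    "!!f. keys f \<subseteq> quiver_paths Q1 ==> emb_map f \<in> H"
    "!!f. keys f \<subseteq> quiver_paths Q2 ==> other.emb_map f \<in> H"
    and p: "q.is_path u p"
  shows "single (u, p) (c :: 'k) \<in> H" using p
proof (induction p arbitrary: u c)
  case Nil
  then consider w where "w \<in> verts Q1" "u = \<phi>1 w" | w where "w \<in> verts Q2" "u = \<phi>2 w" by (auto simp: verts_Q)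
  then show ?case
  proof cases
    case 1
    then show ?thesis using H(2)[of "single (w, []) c"] by (simp add: emb_def q1.quiver_paths_eq)
  next
    case 2
    then show ?thesis using H(3)[of "single (w, []) c"] by (simp add: other.emb_def q2.quiver_paths_eq)
  qed
next
  case (Cons e p)
  then have e: "e \<in> arcs Q" "tail Q e = u" and p: "q.is_path (head Q e) p" by auto
  from e(1) consider f where "f \<in> arcs Q1" "e = \<psi>1 f" | f where "f \<in> arcs Q2" "e = \<psi>2 f" by (auto simp: arcs_Q)
  then have "single (u, [e]) c \<in> H"
  proof cases
    case 1
    then show ?thesis using H(2)[of "single (tail Q1 f, [f]) c"] ends1[OF 1(1)] e(2) by (simp add: emb_def q1.quiver_paths_eq)
  next
    case 2
    then show ?thesis using H(3)[of "single (tail Q2 f, [f]) c"] ends2[OF 2(1)] e(2) by (simp add: other.emb_def q2.quiver_paths_eq)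
  qed
  from H(1)[OF this Cons.IH[OF p, of 1]] show ?case using Cons.prems p q.is_path_start[OF p] by (simp add: q.path_mult_single)
qed

lemma glued_algebra_quotient:
  assumes long: "!!p. p \<in> quiver_paths Q ==> L \<le> length (snd p) ==> basis p \<in> I"
  shows "glued_algebra p.qr p.sc (verts Q) eps
    p1.qr p1.sc (verts Q1) eps1
      emb_quotient retr_quotient \<phi>1 (p1.qt (basis (a1, []))) (p.qt ` other.emb_map ` carrier (path_algebra Q2))
    p2.qr p2.sc (verts Q2) (\<lambda>v r. lookup (p2.rep r) (v, []))
      (\<lambda>x. p.qt (other.emb_map (p2.rep x))) (\<lambda>r. p2.qt (other.retr (p.rep r))) \<phi>2 (p2.qt (basis (a2, [])))
      (p.qt ` emb_map ` carrier (path_algebra Q1)) a1 a2"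
proof -
  interpret o: glued_bound_quivers Q Q2 Q1 \<phi>2 \<psi>2 a2 \<phi>1 \<psi>1 a1 I I2 I1 by (rule swap_bound)
  interpret R: ring "p.qr" by (rule p.quotient_is_ring)
  have oq: "o.emb_quotient = (\<lambda>x. p.qt (other.emb_map (p2.rep x)))" "o.retr_quotient = (\<lambda>r. p2.qt (other.retr (p.rep r)))"
    by (simp_all add: fun_eq_iff o.emb_quotient_def o.retr_quotient_def)
  note oc = o.corners[OF long]
  show ?thesis unfolding oq[symmetric]
  proof (intro glued_algebra.intro corners[OF long] oc glued_algebra_axioms.intro)
    show "p.qt ` other.emb_map ` carrier (path_algebra Q2) = o.emb_quotient ` carrier p2.qr" by (rule o.emb_quotient_image[symmetric])
    show "p.qt ` emb_map ` carrier (path_algebra Q1) = emb_quotient ` carrier p1.qr" by (rule emb_quotient_image[symmetric])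
    show "emb_quotient (p1.qt (basis (a1, []))) = o.emb_quotient (p2.qt (basis (a2, [])))"
      unfolding emb_quotient_vertex o.emb_quotient_vertex a_eq ..
    have sub: "\<phi>1 ` verts Q1 \<subseteq> verts Q" "\<phi>2 ` verts Q2 \<subseteq> verts Q" by (auto simp: verts_Q)
    \<comment> \<open>Inclusion and exclusion for the two vertex sets, which meet in the glued
      vertex.\<close>
    have "(\<Sum>w\<in>\<phi>1 ` verts Q1. basis (w, []) :: ('u, 'g) qpath \<Rightarrow>\<^sub>0 'k) + (\<Sum>w\<in>\<phi>2 ` verts Q2. basis (w, [])) = path_scalar Q 1 + basis (\<phi>1 a1, [])"
      using sum.union_inter[of "\<phi>1 ` verts Q1" "\<phi>2 ` verts Q2" "\<lambda>w. basis (w, []) :: ('u, 'g) qpath \<Rightarrow>\<^sub>0 'k"]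
      by (simp add: path_scalar_def verts_int flip: verts_Q)
    moreover have "basis (\<phi>1 a1, []) \<in> carrier (path_algebra Q)" using a1 by (simp add: q.quiver_paths_eq verts_Q)
    ultimately show "emb_quotient \<one>\<^bsub>p1.qr\<^esub> \<oplus>\<^bsub>p.qr\<^esub> o.emb_quotient \<one>\<^bsub>p2.qr\<^esub> =
        \<one>\<^bsub>p.qr\<^esub> \<oplus>\<^bsub>p.qr\<^esub> emb_quotient (p1.qt (basis (a1, [])))"
      unfolding emb_quotient_one o.emb_quotient_one emb_quotient_vertex p.one_quotient
      using p.qt_add[OF vertices_closed[OF sub(1)] vertices_closed[OF sub(2)]] p.qt_add[OF p.one_closed] by simp
    show "emb_quotient \<one>\<^bsub>p1.qr\<^esub> \<otimes>\<^bsub>p.qr\<^esub> o.emb_quotient \<one>\<^bsub>p2.qr\<^esub> =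
        emb_quotient (p1.qt (basis (a1, [])))"
      unfolding emb_quotient_one o.emb_quotient_one emb_quotient_vertex by (rule emb_quotient_one_mult)
    show "o.emb_quotient \<one>\<^bsub>p2.qr\<^esub> \<otimes>\<^bsub>p.qr\<^esub> emb_quotient \<one>\<^bsub>p1.qr\<^esub> =
        emb_quotient (p1.qt (basis (a1, [])))"
      unfolding emb_quotient_one o.emb_quotient_one emb_quotient_vertex a_eq by (rule o.emb_quotient_one_mult)
    fix H assume H: "H \<subseteq> carrier p.qr"
      "!!r s. r \<in> H ==> s \<in> H ==> r \<oplus>\<^bsub>p.qr\<^esub> s \<in> H"
      "!!r s. r \<in> H ==> s \<in> H ==> r \<otimes>\<^bsub>p.qr\<^esub> s \<in> H"
      "emb_quotient ` carrier p1.qr \<subseteq> H" "o.emb_quotient ` carrier p2.qr \<subseteq> H"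
    let ?H = "{f \<in> carrier (path_algebra Q). p.qt f \<in> H}"
    have e1: "emb_map f \<in> ?H" if f: "keys f \<subseteq> quiver_paths Q1" for f :: "('v, 'e) qpath \<Rightarrow>\<^sub>0 'k"
      using H(4) emb_map_closed[OF f] f unfolding emb_quotient_image by auto
    have e2: "other.emb_map f \<in> ?H" if f: "keys f \<subseteq> quiver_paths Q2" for f :: "('w, 'f) qpath \<Rightarrow>\<^sub>0 'k"
      using H(5) other.emb_map_closed[OF f] f unfolding o.emb_quotient_image by auto
    have m: "path_mult Q f g \<in> ?H" if "f \<in> ?H" "g \<in> ?H" for f g
      using that H(3)[of "p.qt f" "p.qt g"] p.qt_mult[of f g] q.path_mult_closed[of f g] by simp
    have "p.qt f \<in> H" if "f \<in> carrier (path_algebra Q)" for f using that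
    proof (induction rule: p.based_induct)
      case zero
      show ?case using e1[of 0] by simp
    next
      case (add f g)
      then show ?case using H(2)[of "p.qt f" "p.qt g"] p.qt_add[of f g] by simp
    next
      case (single r c)
      then show ?case using path_generated[OF m e1 e2, of "fst r" "snd r" c] by (auto simp: q.quiver_paths_eq)
    qed
    then show "H = carrier p.qr" using H(1) by (auto simp: p.carrier_quotient)
  next
    show "eps1 y (p1.qt (basis (a1, []))) = (if y = a1 then 1 else 0)" if "y \<in> verts Q1" for y
      using eps1_qt[OF that, of "basis (a1, [])"] a1 by (auto simp: q1.quiver_paths_eq lookup_single when_def)
    show "lookup (p2.rep (p2.qt (basis (a2, [])))) (z, []) = (if z = a2 then 1 else 0)" if "z \<in> verts Q2" for z
      using o.eps1_qt[OF that, of "basis (a2, [])"] a2 by (auto simp: q2.quiver_paths_eq lookup_single when_def)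
  qed (use a1 a2 a_eq verts_Q in auto)
qed

text \<open>By \<open>loops_in_ideal\<close>, in one of the halves all nontrivial loops at the glued
  vertex are relations. Whichever half it is, long paths of the glued quiver are relations, which
  supplies the length needed for the augmented structure.\<close>

lemma Gorenstein_gluing:
  assumes fd: "ring.finite_dimension p.qr (range p.sc) (carrier p.qr)"
  shows "(Gorenstein p.qr \<longleftrightarrow> Gorenstein p1.qr \<and> Gorenstein p2.qr) \<and>
    max (Gd p1.qr) (Gd p2.qr) \<le> Gd p.qr \<and>
    Gd p.qr \<le> max (max (Gd p1.qr) (Gd p2.qr)) 1"
proof -
  have "\<exists>L. \<forall>p\<in>quiver_paths Q. L \<le> length (snd p) --> basis p \<in> I"
  proof (cases "\<forall>x. q1.is_path a1 x \<and> q1.path_end a1 x = a1 \<and> x \<noteq> [] --> basis (a1, x) \<in> I1")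
    case True
    then show ?thesis using long_paths_in_I by blast
  next
    case False
    then have "!!y. q2.is_path a2 y ==> q2.path_end a2 y = a2 ==> y \<noteq> [] ==> basis (a2, y) \<in> I2"
      using loops_in_ideal[OF fd] by blast
    then show ?thesis by (rule glued_bound_quivers.long_paths_in_I[OF swap_bound])
  qed
  then obtain L where "!!p. p \<in> quiver_paths Q ==> L \<le> length (snd p) ==> basis p \<in> I" by blast
  from glued_algebra.Gorenstein_glued[OF glued_algebra_quotient[OF this]] show ?thesis .
qed

end

lemma glued_quivers_gluing_quiver:
  assumes "fin_digraph Q1" "fin_digraph Q2" "a \<in> verts Q1" "b \<in> verts Q2"
  shows "glued_quivers (gluing_quiver Q1 a Q2 b) Q1 Q2 Inl Inl a (glue_right a b) Inr b"
proof -
  interpret q1: fin_digraph Q1 by fact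
  interpret q2: fin_digraph Q2 by fact
  have "fin_digraph (gluing_quiver Q1 a Q2 b)" by unfold_locales (auto simp: gluing_quiver_def)
  then interpret q: fin_digraph "gluing_quiver Q1 a Q2 b" .
  show ?thesis by unfold_locales (use assms(3,4) in "auto simp: gluing_quiver_def glue_right_def inj_on_def split: if_splits")
qed

theorem proposition3p4:
  fixes Q\<^sub>A :: "('v, 'e) pre_digraph" and Q\<^sub>B :: "('w, 'f) pre_digraph"
    and I\<^sub>A :: "(('v, 'e) qpath \<Rightarrow>\<^sub>0 'k::alg_closed_field) set"
    and I\<^sub>B :: "(('w, 'f) qpath \<Rightarrow>\<^sub>0 'k) set"
    and a :: 'v and b :: 'w
  assumes "bound_quiver Q\<^sub>A I\<^sub>A" and "bound_quiver Q\<^sub>B I\<^sub>B"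
    and "a \<in> verts Q\<^sub>A" and "b \<in> verts Q\<^sub>B"
    and "finite_dim_quiver_algebra (gluing_quiver Q\<^sub>A a Q\<^sub>B b) (gluing_ideal Q\<^sub>A a I\<^sub>A Q\<^sub>B b I\<^sub>B)"
    and "A = quiver_algebra Q\<^sub>A I\<^sub>A" and "B = quiver_algebra Q\<^sub>B I\<^sub>B"
    and "\<Lambda> = quiver_algebra (gluing_quiver Q\<^sub>A a Q\<^sub>B b) (gluing_ideal Q\<^sub>A a I\<^sub>A Q\<^sub>B b I\<^sub>B)"
  shows "(Gorenstein \<Lambda> \<longleftrightarrow> Gorenstein A \<and> Gorenstein B) \<and>
         (Gorenstein \<Lambda> \<and> Gorenstein A \<and> Gorenstein B \<longrightarrow>
            max (Gd A) (Gd B) \<le> Gd \<Lambda> \<and> Gd \<Lambda> \<le> max (max (Gd A) (Gd B)) 1)"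
proof -
  obtain LA where A: "fin_digraph Q\<^sub>A" "ideal I\<^sub>A (path_algebra Q\<^sub>A)" "I\<^sub>A \<subseteq> fin_digraph.no_trivial Q\<^sub>A"
    "\<forall>p\<in>quiver_paths Q\<^sub>A. LA \<le> length (snd p) \<longrightarrow> basis p \<in> I\<^sub>A" using bound_quiverD[OF assms(1)] by metis
  obtain LB where B: "fin_digraph Q\<^sub>B" "ideal I\<^sub>B (path_algebra Q\<^sub>B)" "I\<^sub>B \<subseteq> fin_digraph.no_trivial Q\<^sub>B"
    "\<forall>p\<in>quiver_paths Q\<^sub>B. LB \<le> length (snd p) \<longrightarrow> basis p \<in> I\<^sub>B" using bound_quiverD[OF assms(2)] by metis
  interpret g: glued_bound_quivers "gluing_quiver Q\<^sub>A a Q\<^sub>B b" Q\<^sub>A Q\<^sub>B Inl Inl a "glue_right a b" Inr b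
    "gluing_ideal Q\<^sub>A a I\<^sub>A Q\<^sub>B b I\<^sub>B" I\<^sub>A I\<^sub>B
    by (intro glued_bound_quivers.intro glued_quivers_gluing_quiver glued_bound_quivers_axioms.intro)
      (use A B assms(3,4) in \<open>auto simp: gluing_ideal_def\<close>)
  \<comment> \<open>The scalar multiples of the unit are the elements \<open>path_scalar\<close>
    over which finite dimension is defined.\<close>
  have "g.p.sc = (\<lambda>c. gluing_ideal Q\<^sub>A a I\<^sub>A Q\<^sub>B b I\<^sub>B +>\<^bsub>path_algebra (gluing_quiver Q\<^sub>A a Q\<^sub>B b)\<^esub> path_scalar (gluing_quiver Q\<^sub>A a Q\<^sub>B b) c)"
    by (simp add: fun_eq_iff g.p.sc_def g.q.scale_path_scalar)
  then have "ring.finite_dimension \<Lambda> (range g.p.sc) (carrier \<Lambda>)"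
    using assms(5) by (simp add: finite_dim_quiver_algebra_def assms(8))
  from g.Gorenstein_gluing[OF this[unfolded assms(8)]] show ?thesis unfolding assms(6-8) by blast
qed

end
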